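(* Let $k\ge0$ be an integer and let data $f,\boldsymbol g,\phi_1$ be given for which the functional $F$ (see context) is well defined on $M_h\times\boldsymbol W_h$. Then the PDWG scheme (see context) has a solution $(\boldsymbol u_h,s_h,\lambda_h,\boldsymbol q_h)\in\boldsymbol V_h\times S_h\times M_h\times\boldsymbol W_h$; the components $s_h$, $\lambda_h$, $\boldsymbol q_h$ are uniquely determined, and the component $\boldsymbol u_h$ is unique up to the addition of a function $\boldsymbol\eta_h\in\mathbb H_{\varepsilon n,0}(\Omega)$ that is a piecewise polynomial of degree $k$ (i.e. $\boldsymbol\eta_h\in\boldsymbol V_h\cap\mathbb H_{\varepsilon n,0}(\Omega)$).
   Context: Domain and coefficient. $\Omega\subset\mathbb R^3$ is a bounded, open, connected polyhedral domain whose boundary $\Gamma=\partial\Omega=\bigcup_{i=0}^L\Gamma_i$ is a disjoint union of finitely many connected components, $\Gamma_0$ being the exterior boundary; $\boldsymbol n$ is the unit outward normal. $\varepsilon=\{\varepsilon_{ij}(\boldsymbol x)\}_{3\times3}$ is symmetric and uniformly positive definite with entries in $L^\infty(\Omega)$, and is assumed piecewise constant with respect to the partition $\mathcal T_h$ below. $(\cdot,\cdot)$ is the $L^2(\Omega)$ inner product. The space of normal $\varepsilon$-harmonic fields is $$\mathbb H_{\varepsilon n,0}(\Omega)=\{\boldsymbol v\in[L^2(\Omega)]^3:\nabla\times\boldsymbol v=0,\ \nabla\cdot(\varepsilon\boldsymbol v)=0,\ \varepsilon\boldsymbol v\cdot\boldsymbol n=0\text{ on }\Gamma\}.$$ Mesh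 and spaces. $\mathcal T_h$ is a shape-regular finite element partition of $\Omega$ into polyhedra; $h_T$ is the diameter of $T\in\mathcal T_h$. $P_k(T)$ denotes polynomials of total degree at most $k$; $P_k(\partial T)$ denotes functions that are polynomials of degree at most $k$ on each face $\sigma$ of $T$; $G_k(\partial T)$ denotes functions on $\partial T$ whose restriction to each face $\sigma$ lies in $[P_k(\sigma)]^3\times\boldsymbol n_\sigma$ (tangential vector polynomials). Boundary components (subscript $b$) are single-valued on each face of the partition. Define $\boldsymbol V_h=\{\boldsymbol v:\boldsymbol v|_T\in[P_k(T)]^3\ \forall T\}$; $S_h=\{\{s_0,s_b\}: s_0|_T\in P_k(T), s_b|_{\partial T}\in P_k(\partial T)\ \forall T,\ s_b|_{\Gamma_0}=0,\ s_b|_{\Gamma_i}=c_i\text{ an (arbitrary) constant},\ i=1,\dots,L\}$; $M_h=\{\{\varphi_0,\varphi_b\}:\varphi_0|_T\in P_k(T),\varphi_b|_{\partial T}\in P_k(\partial T)\ \forall T,\ \int_\Omega\varphi_0=0\}$; $\boldsymbol W_h=\{\{\boldsymbol\psi_0,\boldsymbol\psi_b\}:\boldsymbol\psi_0|_T\in[P_k(T)]^3,\boldsymbol\psi_b|_{\partial T}\in G_k(\partial T)\ \forall T,\ \boldsymbol\psi_b|_\Gamma=0\}$. Weak operators. On each $T$, for a weak function $v=\{v_0,v_b\}$, $\nabla_wv\in[P_k(T)]^3$ is defined by $(\nabla_wv,\boldsymbol\varphi)_T=-(v_0,\nabla\cdot\boldsymbol\varphi)_T+\langle v_b,\boldsymbol\varphi\cdot\boldsymbol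 n\rangle_{\partial T}$ for all $\boldsymbol\varphi\in[P_k(T)]^3$; for $\boldsymbol v=\{\boldsymbol v_0,\boldsymbol v_b\}$, $\nabla_w\times\boldsymbol v\in[P_k(T)]^3$ is defined by $(\nabla_w\times\boldsymbol v,\boldsymbol\varphi)_T=(\boldsymbol v_0,\nabla\times\boldsymbol\varphi)_T-\langle\boldsymbol v_b\times\boldsymbol n,\boldsymbol\varphi\rangle_{\partial T}$ for all $\boldsymbol\varphi\in[P_k(T)]^3$. PDWG scheme. With fixed parameters $\rho_1,\rho_2,\rho_3>0$ and $\gamma\ge-1$, set $B_h(\boldsymbol v,r;\varphi,\boldsymbol\psi)=(\boldsymbol v,\varepsilon\nabla_w\varphi+\nabla_w\times\boldsymbol\psi)+(\boldsymbol\psi_0,\varepsilon\nabla_wr)$, $s_1(\lambda,\boldsymbol q;\varphi,\boldsymbol\psi)=\rho_1\sum_Th_T^{-1}\langle\lambda_0-\lambda_b,\varphi_0-\varphi_b\rangle_{\partial T}+\rho_2\sum_Th_T^{-1}\langle\boldsymbol q_0\times\boldsymbol n-\boldsymbol q_b\times\boldsymbol n,\boldsymbol\psi_0\times\boldsymbol n-\boldsymbol\psi_b\times\boldsymbol n\rangle_{\partial T}$, $s_2(s,r)=\rho_3\sum_Th_T^{-\gamma}\langle s_0-s_b,r_0-r_b\rangle_{\partial T}$, $F(\varphi,\boldsymbol\psi)=(\boldsymbol g,\boldsymbol\psi_0)-(f,\varphi_0)+\langle\phi_1,\varphi_b\rangle_\Gamma$. The scheme: find $(\boldsymbol u_h,s_h,\lambda_h,\boldsymbol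 q_h)\in\boldsymbol V_h\times S_h\times M_h\times\boldsymbol W_h$ such that $s_1(\lambda_h,\boldsymbol q_h;\varphi,\boldsymbol\psi)+B_h(\boldsymbol u_h,s_h;\varphi,\boldsymbol\psi)=F(\varphi,\boldsymbol\psi)$ for all $\varphi\in M_h$, $\boldsymbol\psi\in\boldsymbol W_h$, and $-s_2(s_h,r)+B_h(\boldsymbol v,r;\lambda_h,\boldsymbol q_h)=0$ for all $\boldsymbol v\in\boldsymbol V_h$, $r\in S_h$. *)

theory Defs
  imports "HOL-Analysis.Analysis"
begin

type_synonym pt = "real^3"

text \<open>Polynomials of total degree at most \<open>k\<close>. A polynomial is determined by its restriction to a
  cell (a set with nonempty interior), so \<open>P\<^sub>k(T)\<close> is represented by polynomials on the whole space.\<close>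

definition poly_space :: "nat \<Rightarrow> (pt \<Rightarrow> real) set" where
  "poly_space k = {p. \<exists>c :: (3 \<Rightarrow> nat) \<Rightarrow> real.
     p = (\<lambda>x. \<Sum>a | (\<Sum>i\<in>UNIV. a i) \<le> k. c a * (\<Prod>i\<in>UNIV. (x $ i) ^ a i))}"

definition vpoly_space :: "nat \<Rightarrow> (pt \<Rightarrow> real^3) set" where
  "vpoly_space k = {p. \<forall>i. (\<lambda>x. p x $ i) \<in> poly_space k}"

definition partial :: "3 \<Rightarrow> (pt \<Rightarrow> 'a::real_normed_vector) \<Rightarrow> pt \<Rightarrow> 'a" where
  "partial i f x = frechet_derivative f (at x) (axis i 1)"

definition grad :: "(pt \<Rightarrow> real) \<Rightarrow> pt \<Rightarrow> real^3" where
  "grad f x = (\<chi> i. partial i f x)"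

definition divg :: "(pt \<Rightarrow> real^3) \<Rightarrow> pt \<Rightarrow> real" where
  "divg v x = (\<Sum>i\<in>UNIV. partial i v x $ i)"

definition curl :: "(pt \<Rightarrow> real^3) \<Rightarrow> pt \<Rightarrow> real^3" where
  "curl v x = vector
     [partial 2 v x $ 3 - partial 3 v x $ 2,
      partial 3 v x $ 1 - partial 1 v x $ 3,
      partial 1 v x $ 2 - partial 2 v x $ 1]"

definition smooth :: "(pt \<Rightarrow> 'a::real_normed_vector) \<Rightarrow> bool" where
  "smooth f \<longleftrightarrow> (\<forall>is x. foldr partial is f differentiable (at x))"

definition test_function :: "pt set \<Rightarrow> (pt \<Rightarrow> 'a::real_normed_vector) \<Rightarrow> bool" where
  "test_function \<Omega> \<phi> \<longleftrightarrow> smooth \<phi> \<and> compact (closure {x. \<phi> x \<noteq> 0}) \<and> closure {x. \<phi> x \<noteq> 0} \<subseteq> \<Omega>"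

definition inner_L2 :: "pt set \<Rightarrow> (pt \<Rightarrow> 'a::euclidean_space) \<Rightarrow> (pt \<Rightarrow> 'a) \<Rightarrow> real" where
  "inner_L2 S f g = (LINT x:S|lebesgue. f x \<bullet> g x)"

definition square_integrable :: "pt set \<Rightarrow> (pt \<Rightarrow> 'a::euclidean_space) \<Rightarrow> bool" where
  "square_integrable S f \<longleftrightarrow>
     f \<in> borel_measurable (lebesgue_on S) \<and> integrable (lebesgue_on S) (\<lambda>x. (norm (f x))\<^sup>2)"

definition has_weak_curl :: "pt set \<Rightarrow> (pt \<Rightarrow> real^3) \<Rightarrow> (pt \<Rightarrow> real^3) \<Rightarrow> bool" where
  "has_weak_curl \<Omega> v w \<longleftrightarrow> (\<forall>\<phi>. test_function \<Omega> \<phi> \<longrightarrow> inner_L2 \<Omega> v (curl \<phi>) = inner_L2 \<Omega> w \<phi>)"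

definition has_weak_div :: "pt set \<Rightarrow> (pt \<Rightarrow> real^3) \<Rightarrow> (pt \<Rightarrow> real) \<Rightarrow> bool" where
  "has_weak_div \<Omega> v d \<longleftrightarrow> (\<forall>\<phi>. test_function \<Omega> \<phi> \<longrightarrow> inner_L2 \<Omega> v (grad \<phi>) = - inner_L2 \<Omega> d \<phi>)"

text \<open>The normal trace of a field in \<open>H(div)\<close> is the functional
  \<open>\<phi> \<mapsto> (v, \<nabla>\<phi>) + (\<nabla>\<cdot>v, \<phi>)\<close>; here \<open>\<phi>\<close> ranges over the restrictions to \<open>\<Omega>\<close> of smooth functions on
  the whole space.\<close>

definition zero_normal_trace :: "pt set \<Rightarrow> (pt \<Rightarrow> real^3) \<Rightarrow> bool" where
  "zero_normal_trace \<Omega> v \<longleftrightarrow> (\<exists>d. square_integrable \<Omega> d \<and> has_weak_div \<Omega> v d \<and>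
     (\<forall>\<phi>. smooth \<phi> \<longrightarrow> inner_L2 \<Omega> v (grad \<phi>) + inner_L2 \<Omega> d \<phi> = 0))"

definition normal_harmonic :: "pt set \<Rightarrow> (pt \<Rightarrow> real^3^3) \<Rightarrow> (pt \<Rightarrow> real^3) set" where
  "normal_harmonic \<Omega> \<epsilon> = {v. square_integrable \<Omega> v
     \<and> has_weak_curl \<Omega> v (\<lambda>_. 0)
     \<and> has_weak_div \<Omega> (\<lambda>x. \<epsilon> x *v v x) (\<lambda>_. 0)
     \<and> zero_normal_trace \<Omega> (\<lambda>x. \<epsilon> x *v v x)}"

text \<open>Library polytopes are convex; general polyhedra are finite unions of them.\<close>

definition polytope_union :: "pt set \<Rightarrow> bool" where
  "polytope_union S \<longleftrightarrow> (\<exists>C. finite C \<and> (\<forall>P\<in>C. polytope P) \<and> S = \<Union>C)"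

text \<open>\<open>interior (closure \<Omega>) = \<Omega>\<close> says that \<open>\<Omega>\<close> lies on one side of its boundary (no cracks or
  punctures), so that an outward normal makes sense.\<close>

definition polyhedral_domain :: "pt set \<Rightarrow> bool" where
  "polyhedral_domain \<Omega> \<longleftrightarrow> \<Omega> \<noteq> {} \<and> bounded \<Omega> \<and> open \<Omega> \<and> connected \<Omega>
     \<and> polytope_union (closure \<Omega>) \<and> interior (closure \<Omega>) = \<Omega>"

text \<open>A closed, possibly nonconvex, polyhedron (\<open>d = 3\<close>) or flat polygon (\<open>d = 2\<close>).\<close>

definition polyhedral_cell :: "int \<Rightarrow> pt set \<Rightarrow> bool" where
  "polyhedral_cell d S \<longleftrightarrow> polytope_union S \<and> aff_dim S = d
     \<and> closure (rel_interior S) = S \<and> connected (rel_interior S)"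

definition unit_normal :: "pt set \<Rightarrow> real^3 \<Rightarrow> bool" where
  "unit_normal \<sigma> n \<longleftrightarrow> norm n = 1 \<and> (\<forall>x\<in>\<sigma>. \<forall>y\<in>\<sigma>. n \<bullet> (x - y) = 0)"

definition outward_unit_normal :: "pt set \<Rightarrow> pt set \<Rightarrow> real^3 \<Rightarrow> bool" where
  "outward_unit_normal T \<sigma> n \<longleftrightarrow> unit_normal \<sigma> n
     \<and> (\<forall>x\<in>rel_interior \<sigma>. \<exists>e>0. \<forall>t. 0 < t \<and> t < e \<longrightarrow> x - t *\<^sub>R n \<in> T \<and> x + t *\<^sub>R n \<notin> T)"

definition normal_of :: "pt set \<Rightarrow> pt set \<Rightarrow> real^3" where
  "normal_of T \<sigma> = (THE n. outward_unit_normal T \<sigma> n)"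

definition faces_of :: "pt set set \<Rightarrow> pt set \<Rightarrow> pt set set" where
  "faces_of Eh T = {\<sigma>\<in>Eh. \<sigma> \<subseteq> frontier T}"

text \<open>\<open>Th\<close> is the set of (closed) cells and \<open>Eh\<close> the set of (closed) faces of the partition.
  A planar facet of a cell may consist of several faces of the partition, as happens at hanging
  nodes.\<close>

definition polyhedral_partition :: "pt set \<Rightarrow> pt set set \<Rightarrow> pt set set \<Rightarrow> bool" where
  "polyhedral_partition \<Omega> Th Eh \<longleftrightarrow>
     finite Th \<and> (\<forall>T\<in>Th. polyhedral_cell 3 T) \<and> \<Union>Th = closure \<Omega>
     \<and> (\<forall>T\<in>Th. \<forall>T'\<in>Th. T \<noteq> T' \<longrightarrow> interior T \<inter> interior T' = {})
     \<and> finite Eh \<and> (\<forall>\<sigma>\<in>Eh. polyhedral_cell 2 \<sigma>)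
     \<and> (\<forall>\<sigma>\<in>Eh. \<forall>\<sigma>'\<in>Eh. \<sigma> \<noteq> \<sigma>' \<longrightarrow> rel_interior \<sigma> \<inter> rel_interior \<sigma>' = {})
     \<and> (\<forall>\<sigma>\<in>Eh. \<exists>T\<in>Th. \<sigma> \<in> faces_of Eh T)
     \<and> (\<forall>T\<in>Th. \<Union>(faces_of Eh T) = frontier T)
     \<and> (\<forall>T\<in>Th. \<forall>\<sigma>\<in>faces_of Eh T. \<exists>n. outward_unit_normal T \<sigma> n)"

text \<open>Surface integral over a flat face: the area measure on the plane of \<open>\<sigma>\<close> is the image of the
  volume measure on the slab of thickness 1 around that plane under orthogonal projection.\<close>

definition slab :: "pt set \<Rightarrow> pt set" where
  "slab \<sigma> = {x. closest_point (affine hull \<sigma>) x \<in> \<sigma> \<and> dist x (closest_point (affine hull \<sigma>) x) \<le> 1/2}"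

definition face_integrable :: "pt set \<Rightarrow> (pt \<Rightarrow> real) \<Rightarrow> bool" where
  "face_integrable \<sigma> f \<longleftrightarrow> set_integrable lebesgue (slab \<sigma>) (\<lambda>x. f (closest_point (affine hull \<sigma>) x))"

definition face_integral :: "pt set \<Rightarrow> (pt \<Rightarrow> real) \<Rightarrow> real" where
  "face_integral \<sigma> f = (LINT x:slab \<sigma>|lebesgue. f (closest_point (affine hull \<sigma>) x))"

text \<open>For a single partition shape regularity is a lower bound \<open>\<kappa>\<close> on the ratios below; the value of
  \<open>\<kappa>\<close> plays a role only for estimates that are uniform in a family of partitions.\<close>

definition shape_regular :: "real \<Rightarrow> pt set set \<Rightarrow> pt set set \<Rightarrow> bool" where
  "shape_regular \<kappa> Th Eh \<longleftrightarrow> (\<forall>T\<in>Th. \<kappa> * diameter T ^ 3 \<le> measure lebesgue T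
     \<and> (\<forall>\<sigma>\<in>faces_of Eh T. \<kappa> * diameter T \<le> diameter \<sigma>
          \<and> \<kappa> * (diameter \<sigma>)\<^sup>2 \<le> face_integral \<sigma> (\<lambda>_. 1)))"

definition coefficient :: "pt set \<Rightarrow> pt set set \<Rightarrow> (pt \<Rightarrow> real^3^3) \<Rightarrow> bool" where
  "coefficient \<Omega> Th \<epsilon> \<longleftrightarrow>
     (AE x in lebesgue_on \<Omega>. transpose (\<epsilon> x) = \<epsilon> x)
     \<and> (\<exists>\<alpha>>0. AE x in lebesgue_on \<Omega>. \<forall>\<xi>. \<alpha> * (norm \<xi>)\<^sup>2 \<le> \<xi> \<bullet> (\<epsilon> x *v \<xi>))
     \<and> (\<forall>i j. (\<lambda>x. \<epsilon> x $ i $ j) \<in> borel_measurable (lebesgue_on \<Omega>)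
          \<and> (\<exists>C. AE x in lebesgue_on \<Omega>. \<bar>\<epsilon> x $ i $ j\<bar> \<le> C))
     \<and> (\<forall>T\<in>Th. \<exists>E. AE x in lebesgue_on T. \<epsilon> x = E)"

text \<open>A piecewise function is a family indexed by the cells (or faces), hence multivalued where cells
  meet. Outside the partition, and for face functions also off the face, the family vanishes, so
  that equality of families is equality of the functions they represent.\<close>

type_synonym 'a pw = "pt set \<Rightarrow> pt \<Rightarrow> 'a"
type_synonym 'a weak = "'a pw \<times> 'a pw"

definition piecewise :: "pt set set \<Rightarrow> (pt set \<Rightarrow> (pt \<Rightarrow> 'a::zero) set) \<Rightarrow> 'a pw set" where
  "piecewise A P = {v. (\<forall>S\<in>A. v S \<in> P S) \<and> (\<forall>S. S \<notin> A \<longrightarrow> v S = (\<lambda>_. 0))}"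

text \<open>The function on \<open>\<Omega>\<close>, defined up to a null set, represented by a family indexed by cells.\<close>

definition glue :: "pt set set \<Rightarrow> 'a::real_vector pw \<Rightarrow> pt \<Rightarrow> 'a" where
  "glue Th v x = (\<Sum>T\<in>Th. indicator (interior T) x *\<^sub>R v T x)"

definition face_poly :: "nat \<Rightarrow> pt set \<Rightarrow> (pt \<Rightarrow> real) set" where
  "face_poly k \<sigma> = {w. \<exists>p\<in>poly_space k. w = (\<lambda>x. if x \<in> \<sigma> then p x else 0)}"

definition face_tangential :: "nat \<Rightarrow> pt set \<Rightarrow> (pt \<Rightarrow> real^3) set" where
  "face_tangential k \<sigma> = {w. \<exists>p\<in>vpoly_space k. \<exists>n. unit_normal \<sigma> n \<and>
     w = (\<lambda>x. if x \<in> \<sigma> then cross3 (p x) n else 0)}"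

definition V_h :: "pt set set \<Rightarrow> nat \<Rightarrow> (real^3) pw set" where
  "V_h Th k = piecewise Th (\<lambda>_. vpoly_space k)"

definition S_h :: "pt set set \<Rightarrow> pt set set \<Rightarrow> nat \<Rightarrow> (nat \<Rightarrow> pt set) \<Rightarrow> nat \<Rightarrow> real weak set" where
  "S_h Th Eh k \<Gamma> L = {(s0, sb). s0 \<in> piecewise Th (\<lambda>_. poly_space k)
     \<and> sb \<in> piecewise Eh (face_poly k)
     \<and> (\<forall>\<sigma>\<in>Eh. \<sigma> \<subseteq> \<Gamma> 0 \<longrightarrow> (\<forall>x\<in>\<sigma>. sb \<sigma> x = 0))
     \<and> (\<forall>i\<in>{1..L}. \<exists>c. \<forall>\<sigma>\<in>Eh. \<sigma> \<subseteq> \<Gamma> i \<longrightarrow> (\<forall>x\<in>\<sigma>. sb \<sigma> x = c))}"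

definition M_h :: "pt set \<Rightarrow> pt set set \<Rightarrow> pt set set \<Rightarrow> nat \<Rightarrow> real weak set" where
  "M_h \<Omega> Th Eh k = {(\<phi>0, \<phi>b). \<phi>0 \<in> piecewise Th (\<lambda>_. poly_space k)
     \<and> \<phi>b \<in> piecewise Eh (face_poly k)
     \<and> (LINT x:\<Omega>|lebesgue. glue Th \<phi>0 x) = 0}"

definition W_h :: "pt set \<Rightarrow> pt set set \<Rightarrow> pt set set \<Rightarrow> nat \<Rightarrow> (real^3) weak set" where
  "W_h \<Omega> Th Eh k = {(\<psi>0, \<psi>b). \<psi>0 \<in> piecewise Th (\<lambda>_. vpoly_space k)
     \<and> \<psi>b \<in> piecewise Eh (face_tangential k)
     \<and> (\<forall>\<sigma>\<in>Eh. \<sigma> \<subseteq> frontier \<Omega> \<longrightarrow> (\<forall>x\<in>\<sigma>. \<psi>b \<sigma> x = 0))}"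

definition grad_w :: "pt set set \<Rightarrow> nat \<Rightarrow> real weak \<Rightarrow> (real^3) pw" where
  "grad_w Eh k v T = (THE w. w \<in> vpoly_space k \<and> (\<forall>\<phi>\<in>vpoly_space k.
     inner_L2 T w \<phi> = - inner_L2 T (fst v T) (divg \<phi>)
       + (\<Sum>\<sigma>\<in>faces_of Eh T. face_integral \<sigma> (\<lambda>x. snd v \<sigma> x * (\<phi> x \<bullet> normal_of T \<sigma>)))))"

definition curl_w :: "pt set set \<Rightarrow> nat \<Rightarrow> (real^3) weak \<Rightarrow> (real^3) pw" where
  "curl_w Eh k v T = (THE w. w \<in> vpoly_space k \<and> (\<forall>\<phi>\<in>vpoly_space k.
     inner_L2 T w \<phi> = inner_L2 T (fst v T) (curl \<phi>)
       - (\<Sum>\<sigma>\<in>faces_of Eh T. face_integral \<sigma> (\<lambda>x. cross3 (snd v \<sigma> x) (normal_of T \<sigma>) \<bullet> \<phi> x))))"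

definition B_h :: "pt set \<Rightarrow> (pt \<Rightarrow> real^3^3) \<Rightarrow> pt set set \<Rightarrow> pt set set \<Rightarrow> nat \<Rightarrow>
    (real^3) pw \<Rightarrow> real weak \<Rightarrow> real weak \<Rightarrow> (real^3) weak \<Rightarrow> real" where
  "B_h \<Omega> \<epsilon> Th Eh k v r \<phi> \<psi> =
     inner_L2 \<Omega> (glue Th v)
       (\<lambda>x. \<epsilon> x *v glue Th (grad_w Eh k \<phi>) x + glue Th (curl_w Eh k \<psi>) x)
     + inner_L2 \<Omega> (glue Th (fst \<psi>)) (\<lambda>x. \<epsilon> x *v glue Th (grad_w Eh k r) x)"

definition s_1 :: "pt set set \<Rightarrow> pt set set \<Rightarrow> real \<Rightarrow> real \<Rightarrow>
    real weak \<Rightarrow> (real^3) weak \<Rightarrow> real weak \<Rightarrow> (real^3) weak \<Rightarrow> real" where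
  "s_1 Th Eh \<rho>1 \<rho>2 l q \<phi> \<psi> =
     \<rho>1 * (\<Sum>T\<in>Th. inverse (diameter T) * (\<Sum>\<sigma>\<in>faces_of Eh T.
        face_integral \<sigma> (\<lambda>x. (fst l T x - snd l \<sigma> x) * (fst \<phi> T x - snd \<phi> \<sigma> x))))
     + \<rho>2 * (\<Sum>T\<in>Th. inverse (diameter T) * (\<Sum>\<sigma>\<in>faces_of Eh T.
        face_integral \<sigma> (\<lambda>x.
          (cross3 (fst q T x) (normal_of T \<sigma>) - cross3 (snd q \<sigma> x) (normal_of T \<sigma>))
          \<bullet> (cross3 (fst \<psi> T x) (normal_of T \<sigma>) - cross3 (snd \<psi> \<sigma> x) (normal_of T \<sigma>)))))"

definition s_2 :: "pt set set \<Rightarrow> pt set set \<Rightarrow> real \<Rightarrow> real \<Rightarrow> real weak \<Rightarrow> real weak \<Rightarrow> real" where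
  "s_2 Th Eh \<rho>3 \<gamma> s r = \<rho>3 * (\<Sum>T\<in>Th. diameter T powr (- \<gamma>) * (\<Sum>\<sigma>\<in>faces_of Eh T.
     face_integral \<sigma> (\<lambda>x. (fst s T x - snd s \<sigma> x) * (fst r T x - snd r \<sigma> x))))"

definition boundary_faces :: "pt set \<Rightarrow> pt set set \<Rightarrow> pt set set" where
  "boundary_faces \<Omega> Eh = {\<sigma>\<in>Eh. \<sigma> \<subseteq> frontier \<Omega>}"

definition F_load :: "pt set \<Rightarrow> pt set set \<Rightarrow> pt set set \<Rightarrow>
    (pt \<Rightarrow> real) \<Rightarrow> (pt \<Rightarrow> real^3) \<Rightarrow> (pt \<Rightarrow> real) \<Rightarrow> real weak \<Rightarrow> (real^3) weak \<Rightarrow> real" where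
  "F_load \<Omega> Th Eh f g \<phi>1 \<phi> \<psi> =
     inner_L2 \<Omega> g (glue Th (fst \<psi>)) - inner_L2 \<Omega> f (glue Th (fst \<phi>))
     + (\<Sum>\<sigma>\<in>boundary_faces \<Omega> Eh. face_integral \<sigma> (\<lambda>x. \<phi>1 x * snd \<phi> \<sigma> x))"

definition F_well_defined :: "pt set \<Rightarrow> pt set set \<Rightarrow> pt set set \<Rightarrow> nat \<Rightarrow>
    (pt \<Rightarrow> real) \<Rightarrow> (pt \<Rightarrow> real^3) \<Rightarrow> (pt \<Rightarrow> real) \<Rightarrow> bool" where
  "F_well_defined \<Omega> Th Eh k f g \<phi>1 \<longleftrightarrow> (\<forall>\<phi>\<in>M_h \<Omega> Th Eh k. \<forall>\<psi>\<in>W_h \<Omega> Th Eh k.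
     set_integrable lebesgue \<Omega> (\<lambda>x. g x \<bullet> glue Th (fst \<psi>) x)
     \<and> set_integrable lebesgue \<Omega> (\<lambda>x. f x * glue Th (fst \<phi>) x)
     \<and> (\<forall>\<sigma>\<in>boundary_faces \<Omega> Eh. face_integrable \<sigma> (\<lambda>x. \<phi>1 x * snd \<phi> \<sigma> x)))"

definition pdwg_solution :: "pt set \<Rightarrow> (nat \<Rightarrow> pt set) \<Rightarrow> nat \<Rightarrow> (pt \<Rightarrow> real^3^3) \<Rightarrow>
    pt set set \<Rightarrow> pt set set \<Rightarrow> nat \<Rightarrow> real \<Rightarrow> real \<Rightarrow> real \<Rightarrow> real \<Rightarrow>
    (pt \<Rightarrow> real) \<Rightarrow> (pt \<Rightarrow> real^3) \<Rightarrow> (pt \<Rightarrow> real) \<Rightarrow>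
    (real^3) pw \<Rightarrow> real weak \<Rightarrow> real weak \<Rightarrow> (real^3) weak \<Rightarrow> bool" where
  "pdwg_solution \<Omega> \<Gamma> L \<epsilon> Th Eh k \<rho>1 \<rho>2 \<rho>3 \<gamma> f g \<phi>1 u s l q \<longleftrightarrow>
     u \<in> V_h Th k \<and> s \<in> S_h Th Eh k \<Gamma> L \<and> l \<in> M_h \<Omega> Th Eh k \<and> q \<in> W_h \<Omega> Th Eh k
     \<and> (\<forall>\<phi>\<in>M_h \<Omega> Th Eh k. \<forall>\<psi>\<in>W_h \<Omega> Th Eh k.
          s_1 Th Eh \<rho>1 \<rho>2 l q \<phi> \<psi> + B_h \<Omega> \<epsilon> Th Eh k u s \<phi> \<psi> = F_load \<Omega> Th Eh f g \<phi>1 \<phi> \<psi>)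
     \<and> (\<forall>v\<in>V_h Th k. \<forall>r\<in>S_h Th Eh k \<Gamma> L.
          - s_2 Th Eh \<rho>3 \<gamma> s r + B_h \<Omega> \<epsilon> Th Eh k v r l q = 0)"

end

theory Submission
  imports Defs "HOL-Library.Function_Algebras"
begin

text \<open>The scheme is a linear system given by a symmetric bilinear form on a finite-dimensional space, so it is
  solvable if and only if the load vanishes on the kernel of the form, and two solutions differ by a kernel element.

  For a kernel element \<open>(u, s, \<lambda>, q)\<close> testing with the element itself makes all stabilisation terms vanish, so
  \<open>\<lambda>\<close>, \<open>s\<close> and the tangential part of \<open>q\<close> are continuous across faces. Then \<open>\<nabla>\<lambda>\<close> and \<open>\<nabla>s\<close> are
  orthogonal to curls, which gives \<open>\<lambda> = 0\<close> and \<open>s = 0\<close>. The field \<open>q\<close> is curl free with zero tangential trace,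
  hence a gradient of a potential that is constant on each component of the boundary, while \<open>\<epsilon> q\<close> is
  divergence free with zero flux through each component; hence \<open>(\<epsilon> q, q) = 0\<close>. The potential is replaced by
  its mollifications, whose oscillation on a boundary component tends to zero. What remains is that \<open>u\<close> has
  vanishing broken curl and divergence and vanishing jumps, which is \<open>\<epsilon>\<close>-harmonicity by Green's formulas and
  localised test functions.\<close>

subsection \<open>Finite-dimensional spaces of functions\<close>

text \<open>A polyhedral domain in this sense need not be Lipschitz or simply connected, and its
  cells need not be convex, so neither trace theorems nor a potential on \<open>\<Omega>\<close> are
  at hand. Two devices replace them. The divergence theorem on a cell comes from translating the
  cell: along almost every line its indicator jumps only at isolated transversal crossings of single
  faces, because edges and points on several faces lie on finitely many lines. The field
  \<open>q\<close> is extended by zero: its tangential trace vanishes, so the extension is curl free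
  on the whole space, where a potential exists whatever the topology of \<open>\<Omega>\<close>. The
  potential is locally constant outside, and near each boundary point the complement of
  \<open>closure \<Omega>\<close> is a cone, so that exterior segments carry this information to the
  boundary. A separate constant on each component does no harm once every flux vanishes: test
  functions in \<open>S_h\<close> give this for \<open>\<Gamma> 1\<close> to
  \<open>\<Gamma> L\<close>, and the divergence theorem on the whole mesh gives it for
  \<open>\<Gamma> 0\<close>, where they are zero.\<close>

instantiation "fun" :: (type, real_vector) real_vector
begin
definition scaleR_fun :: "real \<Rightarrow> ('a \<Rightarrow> 'b) \<Rightarrow> 'a \<Rightarrow> 'b" where
  "scaleR_fun c f = (\<lambda>x. c *\<^sub>R f x)"
instance
  by standard (auto simp: scaleR_fun_def plus_fun_def scaleR_add_right scaleR_add_left)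
end

lemma scaleR_fun_apply [simp]: "(c *\<^sub>R f) x = c *\<^sub>R f x"
  by (simp add: scaleR_fun_def)

lemma sum_fun_apply: "(\<Sum>i\<in>A. f i) x = (\<Sum>i\<in>A. f i x)"
  by (induction A rule: infinite_finite_induct) auto

text \<open>Linearity is asked only on \<open>X\<close>: functionals built from integrals or from
  \<open>THE\<close> need not be linear outside a space of admissible functions. The single
  condition with a scalar covers sums and multiples.\<close>

definition lin_on :: "'a::real_vector set \<Rightarrow> ('a \<Rightarrow> real) \<Rightarrow> bool" where
  "lin_on X f \<longleftrightarrow> (\<forall>x\<in>X. \<forall>y\<in>X. \<forall>c. f (x + c *\<^sub>R y) = f x + c * f y)"

lemma lin_onI: "(\<And>x y c. x \<in> X \<Longrightarrow> y \<in> X \<Longrightarrow> f (x + c *\<^sub>R y) = f x + c * f y) \<Longrightarrow> lin_on X f"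
  by (auto simp: lin_on_def)

lemma lin_onD: "lin_on X f \<Longrightarrow> x \<in> X \<Longrightarrow> y \<in> X \<Longrightarrow> f (x + c *\<^sub>R y) = f x + c * f y"
  by (auto simp: lin_on_def)

lemma lin_on_0: "lin_on X f \<Longrightarrow> subspace X \<Longrightarrow> f 0 = 0"
  using lin_onD[of X f 0 0 1] by (simp add: subspace_0)

lemma lin_on_diff: "lin_on X f \<Longrightarrow> x \<in> X \<Longrightarrow> y \<in> X \<Longrightarrow> f (x - c *\<^sub>R y) = f x - c * f y"
  using lin_onD[of X f x y "-c"] by simp

lemma lin_on_sum:
  assumes "lin_on X f" "subspace X" "finite B" "B \<subseteq> X"
  shows "f (\<Sum>b\<in>B. c b *\<^sub>R b) = (\<Sum>b\<in>B. c b * f b)"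
  using assms(3,4)
proof (induction B rule: finite_induct)
  case empty
  then show ?case using lin_on_0[OF assms(1,2)] by simp
next
  case (insert b B)
  have "(\<Sum>b\<in>B. c b *\<^sub>R b) \<in> X"
    using insert assms(2) by (intro subspace_sum subspace_scale) auto
  then have "f ((\<Sum>b\<in>B. c b *\<^sub>R b) + c b *\<^sub>R b) = f (\<Sum>b\<in>B. c b *\<^sub>R b) + c b * f b"
    using insert by (intro lin_onD[OF assms(1)]) auto
  then show ?case using insert by (simp add: add.commute)
qed

text \<open>Induction on the number of functionals. On the kernel \<open>Y\<close> of one of them
  the remaining ones suffice; the missing coefficient is then fixed at a single vector
  \<open>z\<close> outside \<open>Y\<close>.\<close>

lemma functional_in_span:
  fixes F :: "'a::real_vector \<Rightarrow> real"
  assumes "finite J" "subspace X" "\<forall>j\<in>J. lin_on X (f j)" "lin_on X F"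
    and "\<forall>x\<in>X. (\<forall>j\<in>J. f j x = 0) \<longrightarrow> F x = 0"
  shows "\<exists>c. \<forall>x\<in>X. F x = (\<Sum>j\<in>J. c j * f j x)"
  using assms
proof (induction J arbitrary: X rule: finite_induct)
  case empty
  then show ?case by auto
next
  case (insert j J)
  define Y where "Y = {x\<in>X. f j x = 0}"
  have fj: "lin_on X (f j)" using insert by auto
  have Y: "subspace Y"
    unfolding subspace_def Y_def
    using insert.prems(1) fj lin_on_0[OF fj insert.prems(1)] lin_onD[OF fj, of 0]
      lin_onD[OF fj, of _ _ 1]
    by (auto simp: subspace_0 subspace_add subspace_scale)
  have "\<exists>c. \<forall>x\<in>Y. F x = (\<Sum>j\<in>J. c j * f j x)"
    using insert.prems by (intro insert.IH Y) (auto simp: Y_def lin_on_def)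
  then obtain c where c: "\<And>x. x \<in> Y \<Longrightarrow> F x = (\<Sum>j\<in>J. c j * f j x)" by blast
  have sum_upd: "(\<Sum>i\<in>J. (c(j := d)) i * f i x) = (\<Sum>i\<in>J. c i * f i x)" for d x
    using insert by (intro sum.cong) auto
  show ?case
  proof (cases "\<forall>x\<in>X. f j x = 0")
    case True
    then have "Y = X" by (auto simp: Y_def)
    then show ?thesis
      using c insert sum_upd True by (intro exI[of _ "c(j := 0)"]) auto
  next
    case False
    then obtain z where z: "z \<in> X" "f j z \<noteq> 0" by blast
    \<comment> \<open>Chosen so that both sides agree at \<open>z\<close>.\<close>
    define d where "d = (F z - (\<Sum>j\<in>J. c j * f j z)) / f j z"
    have "F x = (\<Sum>i\<in>insert j J. (c(j := d)) i * f i x)" if x: "x \<in> X" for x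
    proof -
      \<comment> \<open>The component of \<open>x\<close> along \<open>z\<close>, so that
        \<open>x - t *\<^sub>R z\<close> lies in \<open>Y\<close>.\<close>
      define t where "t = f j x / f j z"
      have diff: "g (x - t *\<^sub>R z) = g x - t * g z" if "lin_on X g" for g
        using lin_on_diff[OF that] x z by auto
      have "x - t *\<^sub>R z \<in> Y"
        using x z diff[OF fj] insert.prems(1)
        by (auto simp: Y_def t_def subspace_diff subspace_scale)
      from c[OF this] have "F x - t * F z = (\<Sum>i\<in>J. c i * (f i x - t * f i z))"
        using diff insert.prems by auto
      also have "\<dots> = (\<Sum>i\<in>J. c i * f i x) - t * (\<Sum>i\<in>J. c i * f i z)"
        by (simp add: algebra_simps sum_subtractf sum_distrib_left)
      finally have "F x = (\<Sum>i\<in>J. c i * f i x) + t * (F z - (\<Sum>i\<in>J. c i * f i z))"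
        by (simp add: algebra_simps)
      also have "F z - (\<Sum>i\<in>J. c i * f i z) = d * f j z" using z by (simp add: d_def)
      also have "t * (d * f j z) = d * f j x" using z by (simp add: t_def)
      finally show ?thesis using insert sum_upd by simp
    qed
    then show ?thesis by blast
  qed
qed

text \<open>Inclusion in the span of a finite set, rather than possession of a finite basis, passes
  to arbitrary subsets without any subspace argument.\<close>

definition fin_span :: "'a::real_vector set \<Rightarrow> bool" where
  "fin_span X \<longleftrightarrow> (\<exists>B. finite B \<and> X \<subseteq> span B)"

lemma fin_span_subset: "fin_span Y \<Longrightarrow> X \<subseteq> Y \<Longrightarrow> fin_span X"
  unfolding fin_span_def by blast

lemma fin_span_image:
  assumes "linear f" "fin_span X"
  shows "fin_span (f ` X)"
proof -
  obtain B where "finite B" "X \<subseteq> span B" using assms(2) by (auto simp: fin_span_def)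
  then have "finite (f ` B)" "f ` X \<subseteq> span (f ` B)"
    using linear_span_image[OF assms(1), of B] by auto
  then show ?thesis unfolding fin_span_def by blast
qed

text \<open>Finite dimension of products, of vector fields and of families over a mesh all reduce to
  this: each element is a finite sum of parts taken from the spaces \<open>X i\<close>.\<close>

lemma fin_span_sum:
  assumes "finite I" "\<And>i. i \<in> I \<Longrightarrow> fin_span (X i)"
    and "\<And>y. y \<in> Y \<Longrightarrow> \<exists>x. (\<forall>i\<in>I. x i \<in> X i) \<and> y = (\<Sum>i\<in>I. x i)"
  shows "fin_span Y"
proof -
  obtain B where B: "\<And>i. i \<in> I \<Longrightarrow> finite (B i)" "\<And>i. i \<in> I \<Longrightarrow> X i \<subseteq> span (B i)"
    using assms(2) unfolding fin_span_def by metis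
  have "Y \<subseteq> span (\<Union>i\<in>I. B i)"
  proof
    fix y assume "y \<in> Y"
    then obtain x where x: "\<forall>i\<in>I. x i \<in> X i" "y = (\<Sum>i\<in>I. x i)" using assms(3) by blast
    have "x i \<in> span (\<Union>i\<in>I. B i)" if "i \<in> I" for i
      using x B that span_mono[of "B i" "\<Union>i\<in>I. B i"] by blast
    then show "y \<in> span (\<Union>i\<in>I. B i)" using x by (simp add: span_sum)
  qed
  then show ?thesis unfolding fin_span_def using B assms(1) by blast
qed

lemma fin_span_Times:
  assumes "fin_span X" "fin_span Y"
  shows "fin_span (X \<times> Y)"
proof -
  have "linear (\<lambda>x::'a. (x, 0::'b))" "linear (\<lambda>y::'b. (0::'a, y))"
    by (auto intro!: linearI)
  then have fs: "fin_span ((\<lambda>x. (x, 0::'b)) ` X)" "fin_span ((\<lambda>y. (0::'a, y)) ` Y)"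
    using assms fin_span_image by blast+
  show ?thesis
  proof (rule fin_span_sum)
    show "finite (UNIV::bool set)" by simp
    show "fin_span (if i then (\<lambda>x. (x, 0::'b)) ` X else (\<lambda>y. (0::'a, y)) ` Y)" for i
      using fs by auto
    fix z assume "z \<in> X \<times> Y"
    then show "\<exists>x. (\<forall>i\<in>UNIV. x i \<in> (if i then (\<lambda>x. (x, 0::'b)) ` X else (\<lambda>y. (0::'a, y)) ` Y))
         \<and> z = (\<Sum>i\<in>UNIV. x i)"
      by (intro exI[of _ "\<lambda>i. if i then (fst z, 0) else (0, snd z)"]) (auto simp: UNIV_bool)
  qed
qed

text \<open>Fredholm alternative for a symmetric form. By symmetry the common zeros of the
  functionals \<open>a b\<close>, with \<open>b\<close> in a basis, are exactly the radical;
  \<open>F\<close> vanishes there and is therefore a combination of them.\<close>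

lemma symmetric_form_representation:
  assumes X: "subspace X" "fin_span X"
    and sym: "\<And>x y. x \<in> X \<Longrightarrow> y \<in> X \<Longrightarrow> a x y = a y x"
    and lin: "\<And>x. x \<in> X \<Longrightarrow> lin_on X (a x)" and F: "lin_on X F"
    and rad: "\<And>y. y \<in> X \<Longrightarrow> (\<And>x. x \<in> X \<Longrightarrow> a x y = 0) \<Longrightarrow> F y = 0"
  shows "\<exists>x\<in>X. \<forall>y\<in>X. a x y = F y"
proof -
  obtain B0 where B0: "finite B0" "X \<subseteq> span B0" using X(2) by (auto simp: fin_span_def)
  obtain B where B: "B \<subseteq> X" "independent B" "X \<subseteq> span B"
    by (rule maximal_independent_subset)
  have "finite B" using independent_span_bound[OF B0(1) B(2)] B B0 by auto
  have "\<exists>c. \<forall>y\<in>X. F y = (\<Sum>b\<in>B. c b * a b y)"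
  proof (rule functional_in_span[OF \<open>finite B\<close> X(1) _ F])
    show "\<forall>j\<in>B. lin_on X (a j)" using B lin by auto
    show "\<forall>y\<in>X. (\<forall>b\<in>B. a b y = 0) \<longrightarrow> F y = 0"
    proof (intro ballI impI)
      fix y assume y: "y \<in> X" "\<forall>b\<in>B. a b y = 0"
      have ly: "lin_on X (a y)" using lin y by auto
      have "subspace {x\<in>X. a y x = 0}"
        unfolding subspace_def
        using X(1) lin_on_0[OF ly X(1)] lin_onD[OF ly, of 0] lin_onD[OF ly, of _ _ 1]
        by (auto simp: subspace_0 subspace_add subspace_scale)
      then have "span B \<subseteq> {x\<in>X. a y x = 0}"
        using B y sym by (intro span_minimal) auto
      then show "F y = 0" using B y sym by (intro rad) auto
    qed
  qed
  then obtain c where c: "\<And>y. y \<in> X \<Longrightarrow> F y = (\<Sum>b\<in>B. c b * a b y)" by blast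
  \<comment> \<open>The coefficients of the combination of functionals, read as coordinates, give
    the solution.\<close>
  define x where "x = (\<Sum>b\<in>B. c b *\<^sub>R b)"
  have x: "x \<in> X" unfolding x_def using B X by (intro subspace_sum subspace_scale) auto
  have "a x y = F y" if y: "y \<in> X" for y
  proof -
    have "a x y = a y x" using sym x y by auto
    also have "\<dots> = (\<Sum>b\<in>B. c b * a y b)"
      unfolding x_def using lin_on_sum[OF lin[OF y] X(1) \<open>finite B\<close> B(1)] by auto
    also have "\<dots> = F y" using B y sym c[OF y] by (auto intro!: sum.cong)
    finally show ?thesis .
  qed
  then show ?thesis using x by blast
qed

subsection \<open>Polynomials\<close>

definition monomial :: "(3 \<Rightarrow> nat) \<Rightarrow> pt \<Rightarrow> real" where
  "monomial a x = (\<Prod>i\<in>UNIV. (x $ i) ^ a i)"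

lemma poly_space_alt: "poly_space k = {p. \<exists>c. p = (\<lambda>x. \<Sum>a | (\<Sum>i\<in>UNIV. a i) \<le> k. c a * monomial a x)}"
  by (simp add: poly_space_def monomial_def)

lemma finite_multi_indices: "finite {a :: 3 \<Rightarrow> nat. (\<Sum>i\<in>UNIV. a i) \<le> k}"
proof (rule finite_subset)
  show "{a :: 3 \<Rightarrow> nat. (\<Sum>i\<in>UNIV. a i) \<le> k} \<subseteq> PiE UNIV (\<lambda>_. {..k})"
  proof
    fix a :: "3 \<Rightarrow> nat" assume "a \<in> {a. (\<Sum>i\<in>UNIV. a i) \<le> k}"
    then have "a i \<le> k" for i using member_le_sum[of i UNIV a] by auto
    then show "a \<in> PiE UNIV (\<lambda>_. {..k})" by auto
  qed
qed (simp add: finite_PiE)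

lemma poly_space_subspace: "subspace (poly_space k)"
  unfolding subspace_def
proof (intro conjI ballI allI)
  show "0 \<in> poly_space k"
    unfolding poly_space_alt by (auto simp: fun_eq_iff intro!: exI[of _ "\<lambda>_. 0"])
next
  fix p q assume "p \<in> poly_space k" "q \<in> poly_space k"
  then obtain c d where "p = (\<lambda>x. \<Sum>a | (\<Sum>i\<in>UNIV. a i) \<le> k. c a * monomial a x)"
    "q = (\<lambda>x. \<Sum>a | (\<Sum>i\<in>UNIV. a i) \<le> k. d a * monomial a x)"
    unfolding poly_space_alt by blast
  then show "p + q \<in> poly_space k"
    unfolding poly_space_alt
    by (auto simp: fun_eq_iff sum.distrib[symmetric] distrib_right intro!: exI[of _ "\<lambda>a. c a + d a"])
next
  fix r p assume "p \<in> poly_space k"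
  then obtain c where "p = (\<lambda>x. \<Sum>a | (\<Sum>i\<in>UNIV. a i) \<le> k. c a * monomial a x)"
    unfolding poly_space_alt by blast
  then show "r *\<^sub>R p \<in> poly_space k"
    unfolding poly_space_alt
    by (auto simp: fun_eq_iff sum_distrib_left mult.assoc intro!: exI[of _ "\<lambda>a. r * c a"])
qed

lemma monomial_in_poly_space:
  assumes "(\<Sum>i\<in>UNIV. a i) \<le> k"
  shows "monomial a \<in> poly_space k"
proof -
  have "monomial a x = (\<Sum>b | (\<Sum>i\<in>UNIV. b i) \<le> k. (if b = a then 1 else 0) * monomial b x)" for x
  proof -
    have "(\<Sum>b | (\<Sum>i\<in>UNIV. b i) \<le> k. (if b = a then 1 else 0) * monomial b x)
      = (\<Sum>b | (\<Sum>i\<in>UNIV. b i) \<le> k. if b = a then monomial b x else 0)"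
      by (intro sum.cong) auto
    also have "\<dots> = monomial a x" using assms finite_multi_indices by (subst sum.delta) auto
    finally show ?thesis by simp
  qed
  then show ?thesis unfolding poly_space_alt by (auto intro!: exI[of _ "\<lambda>b. if b = a then 1 else 0"])
qed

lemma poly_space_eq_span: "poly_space k = span (monomial ` {a. (\<Sum>i\<in>UNIV. a i) \<le> k})"
proof
  show "span (monomial ` {a. (\<Sum>i\<in>UNIV. a i) \<le> k}) \<subseteq> poly_space k"
    using monomial_in_poly_space poly_space_subspace by (intro span_minimal) auto
  show "poly_space k \<subseteq> span (monomial ` {a. (\<Sum>i\<in>UNIV. a i) \<le> k})"
  proof
    fix p assume "p \<in> poly_space k"
    then obtain c where "p = (\<lambda>x. \<Sum>a | (\<Sum>i\<in>UNIV. a i) \<le> k. c a * monomial a x)"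
      unfolding poly_space_alt by blast
    then have "p = (\<Sum>a | (\<Sum>i\<in>UNIV. a i) \<le> k. c a *\<^sub>R monomial a)"
      by (auto simp: fun_eq_iff sum_fun_apply)
    moreover have "(\<Sum>a | (\<Sum>i\<in>UNIV. a i) \<le> k. c a *\<^sub>R monomial a)
        \<in> span (monomial ` {a. (\<Sum>i\<in>UNIV. a i) \<le> k})"
      by (intro span_sum span_scale span_base) auto
    ultimately show "p \<in> span (monomial ` {a. (\<Sum>i\<in>UNIV. a i) \<le> k})" by simp
  qed
qed

lemma fin_span_poly_space: "fin_span (poly_space k)"
  unfolding fin_span_def poly_space_eq_span using finite_multi_indices by blast

lemma poly_space_const: "(\<lambda>x. c) \<in> poly_space k"
proof -
  have "c *\<^sub>R monomial (\<lambda>_. 0) \<in> poly_space k"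
    by (intro subspace_scale poly_space_subspace monomial_in_poly_space) auto
  also have "c *\<^sub>R monomial (\<lambda>_. 0) = (\<lambda>x. c)" by (auto simp: monomial_def)
  finally show ?thesis .
qed

lemma poly_space_lincomb:
  assumes "\<And>i. i \<in> I \<Longrightarrow> p i \<in> poly_space k"
  shows "(\<lambda>x. \<Sum>i\<in>I. c i * p i x) \<in> poly_space k"
proof -
  have "(\<Sum>i\<in>I. c i *\<^sub>R p i) \<in> poly_space k"
    using assms by (intro subspace_sum subspace_scale poly_space_subspace) auto
  also have "(\<Sum>i\<in>I. c i *\<^sub>R p i) = (\<lambda>x. \<Sum>i\<in>I. c i * p i x)" by (auto simp: sum_fun_apply)
  finally show ?thesis .
qed

lemma poly_space_add: "p \<in> poly_space k \<Longrightarrow> q \<in> poly_space k \<Longrightarrow> (\<lambda>x. p x + q x) \<in> poly_space k"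
  using subspace_add[OF poly_space_subspace] by (auto simp: plus_fun_def)

lemma poly_space_scale: "p \<in> poly_space k \<Longrightarrow> (\<lambda>x. c * p x) \<in> poly_space k"
  using subspace_scale[OF poly_space_subspace, of p k c] by (auto simp: scaleR_fun_def)

lemma poly_space_diff: "p \<in> poly_space k \<Longrightarrow> q \<in> poly_space k \<Longrightarrow> (\<lambda>x. p x - q x) \<in> poly_space k"
  using poly_space_add[of p k "\<lambda>x. (-1) * q x"] poly_space_scale[of q k "-1"] by auto

lemma poly_space_sum: "(\<And>i. i \<in> I \<Longrightarrow> p i \<in> poly_space k) \<Longrightarrow> (\<lambda>x. \<Sum>i\<in>I. p i x) \<in> poly_space k"
  using poly_space_lincomb[of I p k "\<lambda>_. 1"] by simp

lemma poly_space_real_polynomial_function: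
  assumes "p \<in> poly_space k"
  shows "real_polynomial_function p"
proof -
  obtain c where p: "p = (\<lambda>x. \<Sum>a | (\<Sum>i\<in>UNIV. a i) \<le> k. c a * monomial a x)"
    using assms unfolding poly_space_alt by blast
  show ?thesis unfolding p monomial_def
    by (intro real_polynomial_function_sum finite_multi_indices real_polynomial_function.intros
        real_polynomial_function_prod real_polynomial_function_power bounded_linear_vec_nth) auto
qed

text \<open>On the line from \<open>u\<close> through \<open>x\<close> the polynomial is univariate
  and has infinitely many zeros close to \<open>u\<close>.\<close>

lemma real_polynomial_function_zero_on_open:
  fixes p :: "'a::euclidean_space \<Rightarrow> real"
  assumes "real_polynomial_function p" "open U" "u \<in> U" "\<And>x. x \<in> U \<Longrightarrow> p x = 0"
  shows "p x = 0"
proof -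
  define q where "q = (\<lambda>t::real. p (u + t *\<^sub>R (x - u)))"
  have "polynomial_function (\<lambda>t::real. u + t *\<^sub>R (x - u))"
    by (intro polynomial_function_add polynomial_function_const polynomial_function_bounded_linear
        bounded_linear_scaleR_left)
  then have "real_polynomial_function (p \<circ> (\<lambda>t::real. u + t *\<^sub>R (x - u)))"
    by (rule real_polynomial_function_compose) (rule assms(1))
  then obtain c n where q: "q = (\<lambda>t. \<Sum>i\<le>n. c i * t ^ i)"
    unfolding real_polynomial_function_iff_sum q_def o_def by blast
  have "((\<lambda>t::real. u + t *\<^sub>R (x - u)) \<longlongrightarrow> u) (at_right 0)"
    by (auto intro!: tendsto_eq_intros)
  then have "eventually (\<lambda>t::real. u + t *\<^sub>R (x - u) \<in> U) (at_right 0)"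
    using assms(2,3) by (rule topological_tendstoD)
  then obtain e where e: "e > 0" "\<And>t. 0 < t \<Longrightarrow> t < e \<Longrightarrow> u + t *\<^sub>R (x - u) \<in> U"
    by (auto simp: eventually_at_right[OF zero_less_one])
  have "{0<..<e} \<subseteq> {t. (\<Sum>i\<le>n. c i * t ^ i) = 0}"
    using e(2) assms(4) by (auto simp: q[unfolded q_def, THEN fun_cong, symmetric])
  moreover have "infinite {0<..<e}" using e(1) by (simp add: infinite_Ioo)
  ultimately have "\<not> finite {t. (\<Sum>i\<le>n. c i * t ^ i) = 0}" using finite_subset by blast
  then have "\<forall>i\<le>n. c i = 0" using polyfun_finite_roots[of c n] by auto
  then have "q 1 = 0" by (simp add: q)
  then show ?thesis by (simp add: q_def)
qed

subsection \<open>Partial derivatives\<close>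

text \<open>The common regularity class of polynomials, smooth test functions and mollified
  potentials; continuity of the partial derivatives is what the divergence theorem asks for.\<close>

definition C1 :: "(pt \<Rightarrow> 'a::real_normed_vector) \<Rightarrow> bool" where
  "C1 f \<longleftrightarrow> (\<forall>x. f differentiable (at x)) \<and> (\<forall>i. continuous_on UNIV (partial i f))"

lemma partial_eqI: "(f has_derivative f') (at x) \<Longrightarrow> partial i f x = f' (axis i 1)"
  by (simp add: partial_def frechet_derivative_at[symmetric])

lemma C1_has_derivative:
  assumes "f differentiable (at x)"
  shows "(f has_derivative (\<lambda>h. \<Sum>i\<in>UNIV. h $ i *\<^sub>R partial i f x)) (at x)"
proof -
  have D: "(f has_derivative frechet_derivative f (at x)) (at x)"
    using assms frechet_derivative_works by blast
  then have l: "linear (frechet_derivative f (at x))" by (simp add: has_derivative_linear)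
  have "frechet_derivative f (at x) h = (\<Sum>i\<in>UNIV. h $ i *\<^sub>R partial i f x)" for h
  proof -
    have "h = (\<Sum>i\<in>UNIV. h $ i *\<^sub>R axis i 1)"
      by (simp add: vec_eq_iff axis_def if_distrib cong: if_cong)
    then have "frechet_derivative f (at x) h = frechet_derivative f (at x) (\<Sum>i\<in>UNIV. h $ i *\<^sub>R axis i 1)"
      by simp
    also have "\<dots> = (\<Sum>i\<in>UNIV. h $ i *\<^sub>R partial i f x)"
      using l by (simp add: linear_sum linear_scale partial_def)
    finally show ?thesis .
  qed
  then have "frechet_derivative f (at x) = (\<lambda>h. \<Sum>i\<in>UNIV. h $ i *\<^sub>R partial i f x)" by blast
  then show ?thesis using D by simp
qed

lemma C1_differentiable: "C1 f \<Longrightarrow> f differentiable (at x)"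
  by (simp add: C1_def)

lemma C1_continuous_partial: "C1 f \<Longrightarrow> continuous_on S (partial i f)"
  unfolding C1_def by (meson continuous_on_subset subset_UNIV)

lemma C1_continuous_on: "C1 f \<Longrightarrow> continuous_on S f"
  by (simp add: C1_def continuous_at_imp_continuous_on differentiable_imp_continuous_within)

lemma partial_works: "f differentiable (at x) \<Longrightarrow> (f has_derivative frechet_derivative f (at x)) (at x)"
  using frechet_derivative_works by blast

lemma partial_add:
  assumes "f differentiable (at x)" "g differentiable (at x)"
  shows "partial i (\<lambda>x. f x + g x) x = partial i f x + partial i g x"
  unfolding partial_eqI[OF has_derivative_add[OF assms[THEN partial_works]]] by (simp add: partial_def)

lemma partial_minus:
  assumes "f differentiable (at x)" "g differentiable (at x)"
  shows "partial i (\<lambda>x. f x - g x) x = partial i f x - partial i g x"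
  unfolding partial_eqI[OF has_derivative_diff[OF assms[THEN partial_works]]] by (simp add: partial_def)

lemma partial_sum:
  assumes "\<And>j. j \<in> J \<Longrightarrow> f j differentiable (at x)"
  shows "partial i (\<lambda>x. \<Sum>j\<in>J. f j x) x = (\<Sum>j\<in>J. partial i (f j) x)"
  by (subst partial_eqI[OF has_derivative_sum]) (auto simp: partial_def intro!: partial_works assms)

lemma partial_mult:
  fixes f g :: "pt \<Rightarrow> real"
  assumes "f differentiable (at x)" "g differentiable (at x)"
  shows "partial i (\<lambda>x. f x * g x) x = f x * partial i g x + partial i f x * g x"
  unfolding partial_eqI[OF has_derivative_mult[OF assms[THEN partial_works]]] by (simp add: partial_def)

lemma partial_linear:
  assumes "bounded_linear L" "f differentiable (at x)"
  shows "partial i (\<lambda>x. L (f x)) x = L (partial i f x)"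
  unfolding partial_eqI[OF bounded_linear.has_derivative[OF assms(1) assms(2)[THEN partial_works]]]
  by (simp add: partial_def)

lemma partial_const [simp]: "partial i (\<lambda>x. c) = (\<lambda>x. 0)"
  by (rule ext, subst partial_eqI[OF has_derivative_const]) auto

lemma partial_coord: "partial i (\<lambda>x. x $ j) x = (if i = j then 1 else 0)"
proof -
  have "((\<lambda>x. x $ j) has_derivative (\<lambda>h. h $ j)) (at x)"
    by (intro bounded_linear_imp_has_derivative bounded_linear_vec_nth)
  from partial_eqI[OF this] show ?thesis by (simp add: axis_def)
qed

lemma C1_const: "C1 (\<lambda>x. c)" by (simp add: C1_def)

lemma C1_add: "C1 f \<Longrightarrow> C1 g \<Longrightarrow> C1 (\<lambda>x. f x + g x)"
  unfolding C1_def by (auto intro!: continuous_on_add simp: partial_add cong: continuous_on_cong)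

lemma C1_minus: "C1 f \<Longrightarrow> C1 g \<Longrightarrow> C1 (\<lambda>x. f x - g x)"
  unfolding C1_def by (auto intro!: continuous_on_diff simp: partial_minus cong: continuous_on_cong)

lemma C1_sum: "(\<And>j. j \<in> J \<Longrightarrow> C1 (f j)) \<Longrightarrow> C1 (\<lambda>x. \<Sum>j\<in>J. f j x)"
proof (induction J rule: infinite_finite_induct)
  case (insert j J)
  then show ?case using C1_add[of "f j" "\<lambda>x. \<Sum>j\<in>J. f j x"] by simp
qed (simp_all add: C1_const)

lemma C1_mult:
  fixes f g :: "pt \<Rightarrow> real"
  assumes "C1 f" "C1 g"
  shows "C1 (\<lambda>x. f x * g x)"
proof -
  have "continuous_on UNIV f" "continuous_on UNIV g" using assms C1_continuous_on by blast+
  then show ?thesis using assms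
    unfolding C1_def by (auto intro!: continuous_on_add continuous_on_mult simp: partial_mult cong: continuous_on_cong)
qed

lemma differentiable_bounded_linear:
  assumes "bounded_linear L" "f differentiable (at x)"
  shows "(\<lambda>x. L (f x)) differentiable (at x)"
  using bounded_linear.has_derivative[OF assms(1) assms(2)[THEN partial_works]] differentiable_def by blast

lemma C1_linear:
  assumes "bounded_linear L" "C1 f"
  shows "C1 (\<lambda>x. L (f x))"
  using assms(2) unfolding C1_def
  by (auto simp: partial_linear[OF assms(1)] cong: continuous_on_cong
      intro!: bounded_linear.continuous_on[OF assms(1)] differentiable_bounded_linear[OF assms(1)])

lemma C1_component: "C1 v \<Longrightarrow> C1 (\<lambda>x. v x $ j)"
  by (rule C1_linear[OF bounded_linear_vec_nth])

lemma partial_component: "v differentiable (at x) \<Longrightarrow> partial i (\<lambda>x. v x $ j) x = partial i v x $ j"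
  by (rule partial_linear[OF bounded_linear_vec_nth])

lemma C1_vec_iff:
  fixes v :: "pt \<Rightarrow> real^3"
  shows "C1 v \<longleftrightarrow> (\<forall>j. C1 (\<lambda>x. v x $ j))"
proof
  assume v: "\<forall>j. C1 (\<lambda>x. v x $ j)"
  have "C1 (\<lambda>x. \<Sum>j\<in>UNIV. v x $ j *\<^sub>R axis j (1::real))"
    using v by (intro C1_sum C1_linear[OF bounded_linear_scaleR_left]) auto
  also have "(\<lambda>x. \<Sum>j\<in>UNIV. v x $ j *\<^sub>R axis j (1::real)) = v"
    by (rule ext) (simp add: vec_eq_iff axis_def if_distrib cong: if_cong)
  finally show "C1 v" .
qed (use C1_component in blast)

text \<open>The exponent \<open>a i - 1\<close> is a truncated difference; for
  \<open>a i = 0\<close> the factor \<open>real (a i)\<close> makes its value irrelevant.\<close>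

lemma monomial_partial:
  "partial i (monomial a) x = real (a i) * monomial (a(i := a i - 1)) x"
  "monomial a differentiable (at x)"
proof -
  have D: "(monomial a has_derivative
     (\<lambda>h. \<Sum>j\<in>UNIV. of_nat (a j) * h $ j * x $ j ^ (a j - 1) * (\<Prod>l\<in>UNIV - {j}. x $ l ^ a l))) (at x)"
    unfolding monomial_def[abs_def]
    by (intro has_derivative_prod has_derivative_power bounded_linear_imp_has_derivative bounded_linear_vec_nth)
  then show "monomial a differentiable (at x)" using differentiable_def by blast
  have "partial i (monomial a) x
    = (\<Sum>j\<in>UNIV. if j = i then of_nat (a j) * x $ j ^ (a j - 1) * (\<Prod>l\<in>UNIV - {j}. x $ l ^ a l) else 0)"
    unfolding partial_eqI[OF D] by (intro sum.cong) (auto simp: axis_def)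
  also have "\<dots> = of_nat (a i) * (x $ i ^ (a i - 1) * (\<Prod>l\<in>UNIV - {i}. x $ l ^ a l))"
    by simp
  also have "x $ i ^ (a i - 1) * (\<Prod>l\<in>UNIV - {i}. x $ l ^ a l) = monomial (a(i := a i - 1)) x"
    unfolding monomial_def by (subst (2) prod.remove[of _ i]) auto
  finally show "partial i (monomial a) x = real (a i) * monomial (a(i := a i - 1)) x" .
qed

lemma poly_space_partial:
  assumes "p \<in> poly_space k"
  shows "partial i p \<in> poly_space k" "p differentiable (at x)"
proof -
  obtain c where p: "p = (\<lambda>x. \<Sum>a | (\<Sum>i\<in>UNIV. a i) \<le> k. c a * monomial a x)"
    using assms unfolding poly_space_alt by blast
  have d: "(\<lambda>x. c a * monomial a x) differentiable (at x)" for a x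
    by (intro differentiable_mult differentiable_const monomial_partial)
  then show "p differentiable (at x)" unfolding p using d by (intro differentiable_sum finite_multi_indices) blast
  have "partial i p = (\<lambda>x. \<Sum>a | (\<Sum>i\<in>UNIV. a i) \<le> k. (c a * real (a i)) * monomial (a(i := a i - 1)) x)"
  proof
    fix x
    have "partial i (\<lambda>x. c a * monomial a x) x = (c a * real (a i)) * monomial (a(i := a i - 1)) x" for a
      by (subst partial_mult) (auto simp: monomial_partial)
    then show "partial i p x = (\<Sum>a | (\<Sum>i\<in>UNIV. a i) \<le> k. (c a * real (a i)) * monomial (a(i := a i - 1)) x)"
      unfolding p by (subst partial_sum) (rule d, simp)
  qed
  also have "\<dots> \<in> poly_space k"
  proof (intro poly_space_lincomb monomial_in_poly_space)
    fix a :: "3 \<Rightarrow> nat" assume "a \<in> {a. (\<Sum>i\<in>UNIV. a i) \<le> k}"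
    moreover have "(\<Sum>j\<in>UNIV. (a(i := a i - 1)) j) \<le> (\<Sum>j\<in>UNIV. a j)" by (intro sum_mono) auto
    ultimately show "(\<Sum>j\<in>UNIV. (a(i := a i - 1)) j) \<le> k" by auto
  qed
  finally show "partial i p \<in> poly_space k" .
qed

lemma poly_continuous_on: "p \<in> poly_space k \<Longrightarrow> continuous_on S p"
  by (simp add: continuous_at_imp_continuous_on differentiable_imp_continuous_within poly_space_partial(2))

lemma poly_space_C1: "p \<in> poly_space k \<Longrightarrow> C1 p"
  unfolding C1_def using poly_space_partial poly_continuous_on by blast

lemma poly_space_zero_on_open:
  assumes "p \<in> poly_space k" "open U" "U \<noteq> {}" "\<And>x. x \<in> U \<Longrightarrow> p x = 0"
  shows "p = (\<lambda>x. 0)"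
proof -
  obtain u where "u \<in> U" using assms(3) by blast
  then have "p x = 0" for x
    by (rule real_polynomial_function_zero_on_open[OF poly_space_real_polynomial_function[OF assms(1)] assms(2)])
      (rule assms(4))
  then show ?thesis by blast
qed

lemma vpoly_space_subspace: "subspace (vpoly_space k)"
  unfolding subspace_def vpoly_space_def
  using subspace_0[OF poly_space_subspace] by (auto simp: poly_space_add poly_space_scale zero_fun_def)

lemma vpoly_space_C1: "p \<in> vpoly_space k \<Longrightarrow> C1 p"
  unfolding C1_vec_iff vpoly_space_def using poly_space_C1 by auto

lemma vpoly_continuous_on: "p \<in> vpoly_space k \<Longrightarrow> continuous_on S p"
  using vpoly_space_C1 C1_continuous_on by blast

lemma vpoly_space_zero_on_open:
  assumes "p \<in> vpoly_space k" "open U" "U \<noteq> {}" "\<And>x. x \<in> U \<Longrightarrow> p x = 0"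
  shows "p = (\<lambda>x. 0)"
proof
  fix x
  have "(\<lambda>x. p x $ i) = (\<lambda>x. 0)" for i
    using assms by (intro poly_space_zero_on_open[of _ k U]) (auto simp: vpoly_space_def)
  then show "p x = 0" by (simp add: vec_eq_iff fun_eq_iff)
qed

lemma fin_span_vpoly_space: "fin_span (vpoly_space k)"
proof (rule fin_span_sum)
  show "finite (UNIV::3 set)" by simp
  have "linear (\<lambda>q::pt \<Rightarrow> real. \<lambda>x. q x *\<^sub>R axis i (1::real))" for i :: 3
    by (intro linearI) (auto simp: fun_eq_iff scaleR_add_left)
  then show "fin_span ((\<lambda>q x. q x *\<^sub>R axis i (1::real)) ` poly_space k)" for i :: 3
    by (rule fin_span_image[OF _ fin_span_poly_space])
  fix p assume p: "p \<in> vpoly_space k"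
  show "\<exists>x. (\<forall>i\<in>UNIV. x i \<in> (\<lambda>q x. q x *\<^sub>R axis i (1::real)) ` poly_space k) \<and> p = (\<Sum>i\<in>UNIV. x i)"
    using p
    by (intro exI[of _ "\<lambda>i x. p x $ i *\<^sub>R axis i 1"])
      (auto simp: vpoly_space_def fun_eq_iff sum_fun_apply vec_eq_iff axis_def if_distrib cong: if_cong)
qed

lemma vpoly_space_component: "v \<in> vpoly_space k \<Longrightarrow> (\<lambda>x. v x $ i) \<in> poly_space k"
  by (simp add: vpoly_space_def)

lemma vpoly_space_partial:
  assumes "v \<in> vpoly_space k"
  shows "partial i v \<in> vpoly_space k"
proof -
  have "(\<lambda>x. partial i v x $ j) = partial i (\<lambda>x. v x $ j)" for j
    using partial_component[OF C1_differentiable[OF vpoly_space_C1[OF assms]]] by auto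
  then show ?thesis using assms poly_space_partial by (auto simp: vpoly_space_def)
qed

lemma grad_in_vpoly_space: "p \<in> poly_space k \<Longrightarrow> grad p \<in> vpoly_space k"
  by (auto simp: vpoly_space_def grad_def poly_space_partial(1))

lemma divg_in_poly_space: "v \<in> vpoly_space k \<Longrightarrow> divg v \<in> poly_space k"
  unfolding divg_def[abs_def] using vpoly_space_partial
  by (intro poly_space_sum) (auto simp: vpoly_space_def)

lemma curl_in_vpoly_space: "v \<in> vpoly_space k \<Longrightarrow> curl v \<in> vpoly_space k"
  by (subst vpoly_space_def)
    (auto simp: curl_def forall_3 intro!: poly_space_diff vpoly_space_component[of "partial _ v"] vpoly_space_partial)

lemma matrix_vpoly_space:
  assumes "v \<in> vpoly_space k"
  shows "(\<lambda>x. E *v v x) \<in> vpoly_space k"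
  using assms unfolding vpoly_space_def matrix_vector_mult_def
  by (auto intro!: poly_space_lincomb)

lemma linear_vpoly_space:
  assumes "v \<in> vpoly_space k" "linear f"
  shows "(\<lambda>x. f (v x)) \<in> vpoly_space k"
  using matrix_vpoly_space[OF assms(1), of "matrix f"] matrix_works[OF linear_matrix_vector_mul_eq[THEN iffD2, OF assms(2)]] by auto

lemma inner_vpoly_space:
  assumes "v \<in> vpoly_space k"
  shows "(\<lambda>x. v x \<bullet> n) \<in> poly_space k"
  using poly_space_lincomb[of UNIV "\<lambda>i x. v x $ i" k "\<lambda>i. n $ i"] assms
  by (simp add: inner_vec_def vpoly_space_def mult.commute)

subsection \<open>Smooth bump functions\<close>

text \<open>The extra power of \<open>1 / t\<close> makes the family closed under differentiation:
  the derivative of the member \<open>m\<close> involves only the members \<open>m + 1\<close> and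
  \<open>m + 2\<close>.\<close>

definition flat_exp :: "nat \<Rightarrow> real \<Rightarrow> real" where
  "flat_exp m t = (if t > 0 then exp (- (1 / t)) / t ^ m else 0)"

lemma flat_exp_deriv:
  "(flat_exp m has_real_derivative (flat_exp (m + 2) t - real m * flat_exp (m + 1) t)) (at t)"
proof -
  consider "t > 0" | "t < 0" | "t = 0" by linarith
  then show ?thesis
  proof cases
    case 1
    have "((\<lambda>t. exp (- (1 / t)) / t ^ m) has_real_derivative
        (flat_exp (m + 2) t - real m * flat_exp (m + 1) t)) (at t)"
    proof -
      have "((\<lambda>t. exp (- (1 / t)) * inverse t ^ m) has_real_derivative
        exp (- (1 / t)) * (1 / t\<^sup>2) * inverse t ^ m
          + exp (- (1 / t)) * (real m * inverse t ^ (m - 1) * (- (inverse t)\<^sup>2))) (at t)"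
      proof -
        have "((\<lambda>t. exp (- (1 / t))) has_real_derivative exp (- (1 / t)) * (1 / t\<^sup>2)) (at t)"
          using 1 by (auto intro!: derivative_eq_intros simp: power2_eq_square)
        moreover have "((\<lambda>t. inverse t ^ m) has_real_derivative
            real m * (- (inverse t ^ Suc (Suc 0)) * inverse t ^ (m - Suc 0))) (at t)"
          using 1 by (intro DERIV_power DERIV_inverse) auto
        ultimately show ?thesis
          by (rule DERIV_mult[THEN DERIV_cong]) (simp add: power2_eq_square algebra_simps)
      qed
      moreover have "exp (- (1 / t)) * (1 / t\<^sup>2) * inverse t ^ m
          + exp (- (1 / t)) * (real m * inverse t ^ (m - 1) * (- (inverse t)\<^sup>2))
          = flat_exp (m + 2) t - real m * flat_exp (m + 1) t"
        using 1 by (cases m) (auto simp: flat_exp_def field_simps power2_eq_square)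
      ultimately show ?thesis by (simp add: divide_inverse power_inverse)
    qed
    then show ?thesis
      by (rule DERIV_cong_ev[THEN iffD1, rotated 3])
        (use 1 eventually_nhds_in_open[of "{0<..}" t] in \<open>auto simp: flat_exp_def elim!: eventually_mono\<close>)
  next
    case 2
    have "((\<lambda>t. 0) has_real_derivative (flat_exp (m + 2) t - real m * flat_exp (m + 1) t)) (at t)"
      using 2 by (auto simp: flat_exp_def)
    then show ?thesis
      by (rule DERIV_cong_ev[THEN iffD1, rotated 3])
        (use 2 eventually_nhds_in_open[of "{..<0}" t] in \<open>auto simp: flat_exp_def elim!: eventually_mono\<close>)
  next
    case 3
    have "((\<lambda>h. flat_exp m h / h) \<longlongrightarrow> 0) (at 0)"
    proof (rule filterlim_split_at)
      show "((\<lambda>h. flat_exp m h / h) \<longlongrightarrow> 0) (at_left 0)"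
        by (rule tendsto_eventually) (auto simp: eventually_at_left_field flat_exp_def intro!: exI[of _ "-1"])
      \<comment> \<open>In the variable \<open>inverse h\<close> the difference quotient from the
        right is a power divided by an exponential.\<close>
      have "((\<lambda>h::real. inverse h ^ (m + 1) / exp (inverse h)) \<longlongrightarrow> 0) (at_right 0)"
        by (rule filterlim_compose[OF tendsto_power_div_exp_0 filterlim_inverse_at_top_right])
      moreover have "eventually (\<lambda>h. inverse h ^ (m + 1) / exp (inverse h) = flat_exp m h / h) (at_right 0)"
        by (auto simp: eventually_at_right_field flat_exp_def exp_minus field_simps intro!: exI[of _ 1])
      ultimately show "((\<lambda>h. flat_exp m h / h) \<longlongrightarrow> 0) (at_right 0)"
        by (rule Lim_transform_eventually)
    qed
    then show ?thesis using 3 by (simp add: DERIV_def flat_exp_def)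
  qed
qed

text \<open>A class of functions closed under partial derivatives, so that each member is smooth.\<close>

inductive smooth_gen :: "(pt \<Rightarrow> real) \<Rightarrow> bool" where
  const: "smooth_gen (\<lambda>x. c)"
| coord: "smooth_gen (\<lambda>x. x $ i)"
| add: "smooth_gen f \<Longrightarrow> smooth_gen g \<Longrightarrow> smooth_gen (\<lambda>x. f x + g x)"
| mult: "smooth_gen f \<Longrightarrow> smooth_gen g \<Longrightarrow> smooth_gen (\<lambda>x. f x * g x)"
| flat: "smooth_gen f \<Longrightarrow> smooth_gen (\<lambda>x. flat_exp m (f x))"
| exp: "smooth_gen f \<Longrightarrow> smooth_gen (\<lambda>x. exp (f x))"

lemma partial_compose:
  assumes "f differentiable (at x)" "(g has_real_derivative g') (at (f x))"
  shows "partial i (\<lambda>x. g (f x)) x = g' * partial i f x" "(\<lambda>x. g (f x)) differentiable (at x)"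
proof -
  have D: "((\<lambda>x. g (f x)) has_derivative (\<lambda>h. g' * frechet_derivative f (at x) h)) (at x)"
    using has_derivative_compose[OF partial_works[OF assms(1)]] assms(2)
    unfolding has_field_derivative_def by auto
  then show "(\<lambda>x. g (f x)) differentiable (at x)" using differentiable_def by blast
  show "partial i (\<lambda>x. g (f x)) x = g' * partial i f x"
    unfolding partial_eqI[OF D] by (simp add: partial_def)
qed

lemma smooth_gen_partial:
  "smooth_gen f \<Longrightarrow> (\<forall>x. f differentiable (at x)) \<and> (\<forall>i. smooth_gen (partial i f))"
proof (induction rule: smooth_gen.induct)
  case (const c)
  then show ?case by (auto intro: smooth_gen.const)
next
  case (coord j)
  have "(\<lambda>x::pt. x $ j) differentiable (at x)" for x
    by (rule bounded_linear_imp_differentiable[OF bounded_linear_vec_nth])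
  moreover have "smooth_gen (partial i (\<lambda>x. x $ j))" for i
    unfolding partial_coord[abs_def] by (auto intro: smooth_gen.const)
  ultimately show ?case by blast
next
  case (add f g)
  have "partial i (\<lambda>x. f x + g x) = (\<lambda>x. partial i f x + partial i g x)" for i
    using add by (auto simp: partial_add)
  then show ?case using add by (auto intro: smooth_gen.add)
next
  case (mult f g)
  have "partial i (\<lambda>x. f x * g x) = (\<lambda>x. f x * partial i g x + partial i f x * g x)" for i
    using mult by (auto simp: partial_mult)
  then show ?case using mult by (auto intro!: smooth_gen.add smooth_gen.mult)
next
  case (flat f m)
  have *: "partial i (\<lambda>x. flat_exp m (f x))
    = (\<lambda>x. (flat_exp (m + 2) (f x) + (- real m) * flat_exp (m + 1) (f x)) * partial i f x)" for i
    using flat partial_compose(1)[OF _ flat_exp_deriv] by auto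
  have "smooth_gen (\<lambda>x. (flat_exp (m + 2) (f x) + (- real m) * flat_exp (m + 1) (f x)) * partial i f x)" for i
    by (intro smooth_gen.add smooth_gen.mult smooth_gen.const smooth_gen.flat) (use flat in auto)
  then show ?case using flat partial_compose(2)[OF _ flat_exp_deriv] unfolding * by auto
next
  case (exp f)
  have "partial i (\<lambda>x. exp (f x)) = (\<lambda>x. exp (f x) * partial i f x)" for i
    using exp partial_compose(1)[OF _ DERIV_exp] by auto
  then show ?case using exp partial_compose(2)[OF _ DERIV_exp]
    by (auto intro!: smooth_gen.mult smooth_gen.exp)
qed

text \<open>All iterated partial derivatives keep the form of a generated function times the fixed
  vector \<open>v\<close>, so vector-valued test functions come from the scalar class.\<close>

lemma smooth_gen_scaleR:
  assumes "smooth_gen f"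
  shows "smooth (\<lambda>x. f x *\<^sub>R v)"
proof -
  have "smooth_gen (foldr partial is f) \<and>
    foldr partial is (\<lambda>x. f x *\<^sub>R v) = (\<lambda>x. foldr partial is f x *\<^sub>R v)" for "is"
  proof (induction "is")
    case Nil
    then show ?case using assms by simp
  next
    case (Cons i "is")
    then show ?case
      using smooth_gen_partial[of "foldr partial is f"]
      by (auto simp: partial_linear[OF bounded_linear_scaleR_left])
  qed
  then show ?thesis
    unfolding smooth_def using smooth_gen_partial
    by (auto intro!: differentiable_bounded_linear[OF bounded_linear_scaleR_left])
qed

lemma smooth_gen_smooth: "smooth_gen f \<Longrightarrow> smooth f"
  using smooth_gen_scaleR[of f "1::real"] by simp

lemma smooth_C1: "smooth f \<Longrightarrow> C1 f"
  unfolding smooth_def C1_def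
proof (intro conjI allI)
  assume *: "\<forall>is x. foldr partial is f differentiable at x"
  show "f differentiable at x" for x using *[rule_format, of "[]"] by simp
  show "continuous_on UNIV (partial i f)" for i
    using *[rule_format, of "[i]"]
    by (intro continuous_at_imp_continuous_on ballI differentiable_imp_continuous_within) simp
qed

text \<open>The squared distance keeps the argument of \<open>flat_exp 0\<close> polynomial, hence
  smooth also at the centre \<open>p\<close>.\<close>

definition bump :: "pt \<Rightarrow> real \<Rightarrow> pt \<Rightarrow> real" where
  "bump p r x = flat_exp 0 (r\<^sup>2 - (norm (x - p))\<^sup>2)"

lemma bump_nonneg: "0 \<le> bump p r x"
  by (simp add: bump_def flat_exp_def)

lemma bump_pos_iff: "0 < r \<Longrightarrow> 0 < bump p r x \<longleftrightarrow> x \<in> ball p r"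
  by (auto simp: bump_def flat_exp_def dist_norm norm_minus_commute
      intro: power2_less_imp_less power_strict_mono)

lemma bump_zero_iff: "0 < r \<Longrightarrow> bump p r x = 0 \<longleftrightarrow> x \<notin> ball p r"
  using bump_pos_iff[of r p x] bump_nonneg[of p r x] by linarith

lemma smooth_gen_sq_dist: "smooth_gen (\<lambda>x. a + b * (norm (x - p))\<^sup>2)"
proof -
  have "(norm (x - p))\<^sup>2 = (x$1 + - p$1) * (x$1 + - p$1) + (x$2 + - p$2) * (x$2 + - p$2) + (x$3 + - p$3) * (x$3 + - p$3)" for x :: pt
    unfolding power2_norm_eq_inner by (simp add: inner_vec_def sum_3)
  then show ?thesis by (simp only:) (intro smooth_gen.intros)
qed

lemma smooth_gen_inner: "smooth_gen (\<lambda>x. n \<bullet> (x - p))"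
proof -
  have "n \<bullet> (x - p) = n$1 * (x$1 + - p$1) + n$2 * (x$2 + - p$2) + n$3 * (x$3 + - p$3)" for x :: pt
    by (simp add: inner_vec_def sum_3)
  then show ?thesis by (simp only:) (intro smooth_gen.intros)
qed

lemma smooth_gen_bump: "smooth_gen (bump p r)"
  using smooth_gen.flat[OF smooth_gen_sq_dist[of "r\<^sup>2" "-1" p], of 0] by (simp add: bump_def[abs_def])

subsection \<open>Integrals of continuous functions\<close>

lemma set_integrable_lborel_imp_lebesgue:
  fixes f :: "'a::euclidean_space \<Rightarrow> 'b::{banach, second_countable_topology}"
  assumes "integrable lborel (\<lambda>x. indicator S x *\<^sub>R f x)"
  shows "set_integrable lebesgue S f"
  unfolding set_integrable_def
  using assms integrable_completion[of "\<lambda>x. indicator S x *\<^sub>R f x" lborel] borel_measurable_integrable[OF assms] by simp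

lemma integrable_on_compact:
  fixes f :: "'a::euclidean_space \<Rightarrow> 'b::euclidean_space"
  assumes "compact S" "continuous_on S f"
  shows "set_integrable lebesgue S f"
  using set_integrable_lborel_imp_lebesgue[OF borel_integrable_compact[OF assms]] .

lemma open_negligible_empty:
  fixes U :: "'a::euclidean_space set"
  assumes "open U" "negligible U"
  shows "U = {}"
  using assms open_not_negligible by blast

text \<open>The interior points at which \<open>f\<close> is nonzero form an open null set, hence
  the empty set.\<close>

lemma set_integral_zero_imp_zero:
  fixes f :: "'a::euclidean_space \<Rightarrow> real"
  assumes S: "compact S" "continuous_on S f" "\<And>x. x \<in> S \<Longrightarrow> 0 \<le> f x"
    and I: "(LINT x:S|lebesgue. f x) = 0" and x: "x \<in> interior S"
  shows "f x = 0"
proof -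
  have int: "integrable lebesgue (\<lambda>x. indicator S x *\<^sub>R f x)"
    using integrable_on_compact[OF S(1,2)] by (simp add: set_integrable_def)
  have "AE x in lebesgue. indicator S x *\<^sub>R f x = 0"
    using I S(3) by (subst (asm) set_lebesgue_integral_def,
        subst (asm) integral_nonneg_eq_0_iff_AE[OF int]) (auto simp: indicator_def)
  then have "{x. indicator S x *\<^sub>R f x \<noteq> 0} \<in> null_sets lebesgue"
    by (subst (asm) completion.AE_iff_null_sets)
      (use int[THEN borel_measurable_integrable] in measurable)
  then have "negligible {x. indicator S x *\<^sub>R f x \<noteq> 0}"
    by (simp add: negligible_iff_null_sets)
  then have neg: "negligible {x \<in> interior S. f x \<noteq> 0}"
    by (rule negligible_subset) (use interior_subset[of S] in \<open>auto simp: indicator_def\<close>)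
  have "continuous_on (interior S) f" using S(2) continuous_on_subset interior_subset by blast
  then have "open {x \<in> interior S. f x \<noteq> 0}"
    using continuous_open_preimage[OF _ open_interior, of S f "- {0}"]
    by (simp add: vimage_def Int_def conj_commute open_Compl)
  from open_negligible_empty[OF this neg] show ?thesis using x by auto
qed

subsection \<open>Polyhedra are locally conic\<close>

text \<open>Near \<open>x\<close> the set coincides with a cone with apex \<open>x\<close>. If a
  nearby point lies outside the set, the whole segment from \<open>x\<close> to it, apart from
  \<open>x\<close>, lies outside as well.\<close>

definition locally_conic :: "'a::real_normed_vector set \<Rightarrow> 'a \<Rightarrow> bool" where
  "locally_conic S x \<longleftrightarrow> (\<exists>e>0. \<forall>y\<in>ball x e. \<forall>t. 0 < t \<and> t \<le> 1 \<longrightarrow> (x + t *\<^sub>R (y - x) \<in> S \<longleftrightarrow> y \<in> S))"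

lemma locally_conic_Inter:
  assumes "finite C" "\<And>S. S \<in> C \<Longrightarrow> locally_conic S x"
  shows "locally_conic (\<Inter>C) x"
proof -
  obtain e where e: "\<And>S. S \<in> C \<Longrightarrow> 0 < e S"
    "\<And>S y t. S \<in> C \<Longrightarrow> y \<in> ball x (e S) \<Longrightarrow> 0 < t \<Longrightarrow> t \<le> 1 \<Longrightarrow> (x + t *\<^sub>R (y - x) \<in> S \<longleftrightarrow> y \<in> S)"
    using assms(2) unfolding locally_conic_def by metis
  have m: "0 < Min (insert 1 (e ` C))" "\<And>S. S \<in> C \<Longrightarrow> Min (insert 1 (e ` C)) \<le> e S"
    using assms(1) e(1) by auto
  have "x + t *\<^sub>R (y - x) \<in> S \<longleftrightarrow> y \<in> S"
    if "y \<in> ball x (Min (insert 1 (e ` C)))" "0 < t" "t \<le> 1" "S \<in> C" for y t S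
    using m(2)[OF that(4)] that by (intro e(2)) auto
  then show ?thesis unfolding locally_conic_def
    by (intro exI[of _ "Min (insert 1 (e ` C))"] conjI m ballI allI impI) blast
qed

lemma locally_conic_Union:
  assumes "finite C" "\<And>S. S \<in> C \<Longrightarrow> locally_conic S x"
  shows "locally_conic (\<Union>C) x"
proof -
  obtain e where e: "\<And>S. S \<in> C \<Longrightarrow> 0 < e S"
    "\<And>S y t. S \<in> C \<Longrightarrow> y \<in> ball x (e S) \<Longrightarrow> 0 < t \<Longrightarrow> t \<le> 1 \<Longrightarrow> (x + t *\<^sub>R (y - x) \<in> S \<longleftrightarrow> y \<in> S)"
    using assms(2) unfolding locally_conic_def by metis
  have m: "0 < Min (insert 1 (e ` C))" "\<And>S. S \<in> C \<Longrightarrow> Min (insert 1 (e ` C)) \<le> e S"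
    using assms(1) e(1) by auto
  have "x + t *\<^sub>R (y - x) \<in> S \<longleftrightarrow> y \<in> S"
    if "y \<in> ball x (Min (insert 1 (e ` C)))" "0 < t" "t \<le> 1" "S \<in> C" for y t S
    using m(2)[OF that(4)] that by (intro e(2)) auto
  then show ?thesis unfolding locally_conic_def
    by (intro exI[of _ "Min (insert 1 (e ` C))"] conjI m ballI allI impI) blast
qed

lemma locally_conic_halfspace:
  fixes a :: "'a::real_inner"
  assumes "a \<noteq> 0"
  shows "locally_conic {x. a \<bullet> x \<le> b} x"
proof (cases "a \<bullet> x = b")
  case True
  then have "a \<bullet> (x + t *\<^sub>R (y - x)) \<le> b \<longleftrightarrow> a \<bullet> y \<le> b" if "0 < t" for y t
  proof -
    have "a \<bullet> (x + t *\<^sub>R (y - x)) - b = t * (a \<bullet> y - b)"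
      using True by (simp add: inner_simps algebra_simps)
    then show ?thesis using that
      by (metis diff_le_0_iff_le linorder_not_le mult_le_0_iff order_less_imp_le)
  qed
  then show ?thesis unfolding locally_conic_def by (intro exI[of _ 1]) auto
next
  case False
  \<comment> \<open>The distance from \<open>x\<close> to the bounding plane; membership is constant
    in the ball of this radius.\<close>
  define e where "e = \<bar>a \<bullet> x - b\<bar> / norm a"
  have e: "0 < e" using False assms by (simp add: e_def)
  have *: "\<bar>a \<bullet> (z - x)\<bar> < \<bar>a \<bullet> x - b\<bar>" if "norm (z - x) < e" for z
  proof -
    have "\<bar>a \<bullet> (z - x)\<bar> \<le> norm a * norm (z - x)" by (rule Cauchy_Schwarz_ineq2)
    also have "\<dots> < norm a * e" using that assms by simp
    finally show ?thesis using assms by (simp add: e_def)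
  qed
  have iff: "a \<bullet> z \<le> b \<longleftrightarrow> a \<bullet> x \<le> b" if "norm (z - x) < e" for z
    using *[OF that] by (simp add: inner_simps) linarith
  have "norm (x + t *\<^sub>R (y - x) - x) < e" if "norm (y - x) < e" "0 < t" "t \<le> 1" for y t
    using that mult_left_le_one_le[of "norm (y - x)" t] by simp
  then have "x + t *\<^sub>R (y - x) \<in> {x. a \<bullet> x \<le> b} \<longleftrightarrow> y \<in> {x. a \<bullet> x \<le> b}"
    if "y \<in> ball x e" "0 < t" "t \<le> 1" for y t
    using that iff[of y] iff[of "x + t *\<^sub>R (y - x)"] by (simp add: dist_norm norm_minus_commute[of x])
  then show ?thesis unfolding locally_conic_def using e by blast
qed

text \<open>Polytopes are finite intersections of half spaces, and finite unions of them cover the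
  nonconvex polyhedra.\<close>

lemma locally_conic_polytope_union: "polytope_union S \<Longrightarrow> locally_conic S x"
  unfolding polytope_union_def
proof (elim exE conjE)
  fix C assume C: "finite C" "\<forall>P\<in>C. polytope P" "S = \<Union>C"
  have "locally_conic P x" if "P \<in> C" for P
  proof -
    have "polyhedron P" using C(2) that polytope_imp_polyhedron by blast
    then obtain F where F: "finite F" "P = \<Inter>F" "\<forall>h\<in>F. \<exists>a b. a \<noteq> 0 \<and> h = {x. a \<bullet> x \<le> b}"
      unfolding polyhedron_def by blast
    have "locally_conic h x" if "h \<in> F" for h using F(3)[rule_format, OF that] locally_conic_halfspace[of _ _ x] by auto
    with F(1,2) show ?thesis using locally_conic_Inter by blast
  qed
  with C show ?thesis using locally_conic_Union by blast
qed

lemma polytope_union_compact: "polytope_union S \<Longrightarrow> compact S"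
  unfolding polytope_union_def using polytope_imp_compact by (auto intro!: compact_Union)

subsection \<open>Planar faces and surface integrals\<close>

text \<open>For a unit vector \<open>n\<close> this is the orthogonal projection onto the plane
  through \<open>p\<close> with normal \<open>n\<close>. It makes the \<open>closest_point\<close>
  in the surface integral explicit.\<close>

definition proj :: "pt \<Rightarrow> pt \<Rightarrow> pt \<Rightarrow> pt" where
  "proj n p x = x - (n \<bullet> (x - p)) *\<^sub>R n"

lemma face_compact: "polyhedral_cell d \<sigma> \<Longrightarrow> compact \<sigma>"
  by (simp add: polyhedral_cell_def polytope_union_compact)

lemma face_rel_interior_nonempty: "polyhedral_cell 2 \<sigma> \<Longrightarrow> rel_interior \<sigma> \<noteq> {}"
  unfolding polyhedral_cell_def by (metis aff_dim_empty closure_empty neg_numeral_neq_numeral numeral_One)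

lemma face_nonempty: "polyhedral_cell 2 \<sigma> \<Longrightarrow> \<sigma> \<noteq> {}"
  using face_rel_interior_nonempty rel_interior_subset by blast

text \<open>One of the two affine sets contains the other and both have dimension two.\<close>

lemma face_affine_hull:
  assumes "polyhedral_cell 2 \<sigma>" "unit_normal \<sigma> n" "p \<in> \<sigma>"
  shows "affine hull \<sigma> = {x. n \<bullet> (x - p) = 0}"
proof -
  have n0: "n \<noteq> 0" using assms(2) by (auto simp: unit_normal_def)
  have H: "{x. n \<bullet> (x - p) = 0} = {x. n \<bullet> x = n \<bullet> p}" by (auto simp: inner_simps)
  have "affine hull \<sigma> = {x. n \<bullet> x = n \<bullet> p}"
  proof (rule affine_dim_equal)
    show "affine hull \<sigma> \<subseteq> {x. n \<bullet> x = n \<bullet> p}"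
    proof (rule hull_minimal)
      show "\<sigma> \<subseteq> {x. n \<bullet> x = n \<bullet> p}"
      proof
        fix x assume "x \<in> \<sigma>"
        then have "n \<bullet> (x - p) = 0" using assms(2,3) by (auto simp: unit_normal_def)
        then show "x \<in> {x. n \<bullet> x = n \<bullet> p}" by (simp add: inner_simps)
      qed
    qed (simp add: affine_hyperplane)
    show "aff_dim (affine hull \<sigma>) = aff_dim {x. n \<bullet> x = n \<bullet> p}"
      using assms(1) n0 by (simp add: polyhedral_cell_def)
    show "affine hull \<sigma> \<noteq> {}" using assms(3) by (auto simp: hull_inc)
  qed (auto simp: affine_hyperplane)
  then show ?thesis using H by simp
qed

lemma face_has_unit_normal:
  assumes "polyhedral_cell 2 \<sigma>"
  obtains n where "unit_normal \<sigma> n"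
proof -
  have "aff_dim \<sigma> < DIM(pt)" using assms by (simp add: polyhedral_cell_def)
  then obtain a b where ab: "a \<noteq> 0" "\<sigma> \<subseteq> {x. a \<bullet> x = b}" by (rule aff_lowdim_subset_hyperplane)
  have "unit_normal \<sigma> (a /\<^sub>R norm a)"
    unfolding unit_normal_def
  proof (intro conjI ballI)
    show "norm (a /\<^sub>R norm a) = 1" using ab(1) by simp
    fix x y assume "x \<in> \<sigma>" "y \<in> \<sigma>"
    then have "a \<bullet> x = a \<bullet> y" using ab(2) by auto
    then show "(a /\<^sub>R norm a) \<bullet> (x - y) = 0" by (simp add: inner_simps)
  qed
  then show ?thesis by (rule that)
qed

lemma proj_in_plane: "norm n = 1 \<Longrightarrow> n \<bullet> (proj n p x - p) = 0"
  by (simp add: proj_def inner_simps dot_square_norm)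

lemma proj_self: "n \<bullet> (x - p) = 0 \<Longrightarrow> proj n p x = x"
  by (simp add: proj_def)

lemma norm_proj_le:
  assumes "norm n = 1"
  shows "norm (v - (n \<bullet> v) *\<^sub>R n) \<le> norm v"
proof -
  have "n \<bullet> n = 1" using assms by (simp add: dot_square_norm)
  then have "(norm (v - (n \<bullet> v) *\<^sub>R n))\<^sup>2 = (norm v)\<^sup>2 - (n \<bullet> v)\<^sup>2"
    unfolding power2_norm_eq_inner by (simp add: inner_simps power2_eq_square inner_commute[of v n] algebra_simps)
  then have "(norm (v - (n \<bullet> v) *\<^sub>R n))\<^sup>2 \<le> (norm v)\<^sup>2" by simp
  then show ?thesis by (rule power2_le_imp_le) simp
qed

lemma dist_proj_le: "norm n = 1 \<Longrightarrow> dist (proj n p x) (proj n p y) \<le> dist x y"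
  using norm_proj_le[of n "x - y"] by (simp add: proj_def dist_norm inner_simps algebra_simps)

lemma continuous_on_proj: "continuous_on S (proj n p)"
  unfolding proj_def by (intro continuous_intros)

lemma closest_point_face:
  assumes "polyhedral_cell 2 \<sigma>" "unit_normal \<sigma> n" "p \<in> \<sigma>"
  shows "closest_point (affine hull \<sigma>) x = proj n p x"
proof -
  have nn: "norm n = 1" using assms(2) by (simp add: unit_normal_def)
  have "proj n p x = closest_point (affine hull \<sigma>) x"
  proof (rule closest_point_unique)
    show "convex (affine hull \<sigma>)" "closed (affine hull \<sigma>)"
      by (simp_all add: affine_imp_convex closed_affine_hull)
    show "proj n p x \<in> affine hull \<sigma>"
      using proj_in_plane[OF nn] by (simp add: face_affine_hull[OF assms])
    show "\<forall>z\<in>affine hull \<sigma>. dist x (proj n p x) \<le> dist x z"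
    proof
      fix z assume "z \<in> affine hull \<sigma>"
      then have z: "n \<bullet> (z - p) = 0" by (simp add: face_affine_hull[OF assms])
      have "dist x (proj n p x) = \<bar>n \<bullet> (x - p)\<bar>" using nn by (simp add: proj_def dist_norm)
      also have "n \<bullet> (x - p) = n \<bullet> (x - z)" using z by (simp add: inner_simps)
      also have "\<bar>n \<bullet> (x - z)\<bar> \<le> norm n * norm (x - z)" by (rule Cauchy_Schwarz_ineq2)
      finally show "dist x (proj n p x) \<le> dist x z" using nn by (simp add: dist_norm)
    qed
  qed
  then show ?thesis by simp
qed

lemma slab_eq:
  assumes "polyhedral_cell 2 \<sigma>" "unit_normal \<sigma> n" "p \<in> \<sigma>"
  shows "slab \<sigma> = {x. proj n p x \<in> \<sigma> \<and> \<bar>n \<bullet> (x - p)\<bar> \<le> 1/2}"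
proof -
  have "norm n = 1" using assms(2) by (simp add: unit_normal_def)
  then have "dist x (proj n p x) = \<bar>n \<bullet> (x - p)\<bar>" for x by (simp add: proj_def dist_norm)
  then show ?thesis unfolding slab_def by (simp add: closest_point_face[OF assms])
qed

lemma slab_compact:
  assumes "polyhedral_cell 2 \<sigma>"
  shows "compact (slab \<sigma>)"
proof -
  obtain n where n: "unit_normal \<sigma> n" using face_has_unit_normal[OF assms] .
  obtain p where p: "p \<in> \<sigma>" using face_nonempty[OF assms] by blast
  have nn: "norm n = 1" using n by (simp add: unit_normal_def)
  have "closed \<sigma>" "bounded \<sigma>" using face_compact[OF assms] by (auto simp: compact_eq_bounded_closed)
  have "closed (slab \<sigma>)"
  proof -
    have "slab \<sigma> = proj n p -` \<sigma> \<inter> (\<lambda>x. n \<bullet> (x - p)) -` {-1/2..1/2}"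
      unfolding slab_eq[OF assms n p] by auto
    moreover have "closed (proj n p -` \<sigma>)"
      using continuous_on_proj[of UNIV n p] \<open>closed \<sigma>\<close> continuous_on_closed_vimage[OF closed_UNIV] by auto
    moreover have "continuous_on UNIV (\<lambda>x. n \<bullet> (x - p))" by (intro continuous_intros)
    then have "closed ((\<lambda>x. n \<bullet> (x - p)) -` {-1/2..1/2})"
      using continuous_on_closed_vimage[OF closed_UNIV] by (metis Int_UNIV_right closed_atLeastAtMost)
    ultimately show ?thesis by auto
  qed
  moreover have "bounded (slab \<sigma>)"
  proof -
    obtain B where B: "\<And>x. x \<in> \<sigma> \<Longrightarrow> norm x \<le> B" using \<open>bounded \<sigma>\<close> by (auto simp: bounded_iff)
    have "norm x \<le> B + 1/2" if "x \<in> slab \<sigma>" for x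
    proof -
      have x: "proj n p x \<in> \<sigma>" "\<bar>n \<bullet> (x - p)\<bar> \<le> 1/2" using that unfolding slab_eq[OF assms n p] by auto
      have "norm x \<le> norm (proj n p x) + norm ((n \<bullet> (x - p)) *\<^sub>R n)"
        using norm_triangle_ineq[of "proj n p x" "(n \<bullet> (x - p)) *\<^sub>R n"] by (simp add: proj_def)
      then show ?thesis using B[OF x(1)] x(2) nn by simp
    qed
    then show ?thesis by (auto simp: bounded_iff)
  qed
  ultimately show ?thesis by (simp add: compact_eq_bounded_closed)
qed

lemma slab_closest_point_in: "x \<in> slab \<sigma> \<Longrightarrow> closest_point (affine hull \<sigma>) x \<in> \<sigma>"
  by (simp add: slab_def)

lemma continuous_on_slab:
  assumes "polyhedral_cell 2 \<sigma>" "continuous_on \<sigma> f"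
  shows "continuous_on (slab \<sigma>) (\<lambda>x. f (closest_point (affine hull \<sigma>) x))"
proof -
  obtain n where n: "unit_normal \<sigma> n" using face_has_unit_normal[OF assms(1)] .
  obtain p where p: "p \<in> \<sigma>" using face_nonempty[OF assms(1)] by blast
  have "continuous_on (slab \<sigma>) (closest_point (affine hull \<sigma>))"
    using continuous_on_proj[of "slab \<sigma>" n p]
    by (simp add: closest_point_face[OF assms(1) n p] cong: continuous_on_cong)
  then show ?thesis
    by (rule continuous_on_compose2[OF assms(2)]) (use slab_closest_point_in in auto)
qed

lemma continuous_face_integrable:
  assumes "polyhedral_cell 2 \<sigma>" "continuous_on \<sigma> f"
  shows "face_integrable \<sigma> f"
  unfolding face_integrable_def
  by (rule integrable_on_compact[OF slab_compact[OF assms(1)] continuous_on_slab[OF assms]])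

lemma face_integral_cong:
  assumes "\<And>x. x \<in> \<sigma> \<Longrightarrow> f x = g x"
  shows "face_integral \<sigma> f = face_integral \<sigma> g"
  unfolding face_integral_def set_lebesgue_integral_def
  using assms slab_closest_point_in[of _ \<sigma>]
  by (intro Bochner_Integration.integral_cong) (auto simp: indicator_def)

lemma face_integral_add:
  "face_integrable \<sigma> f \<Longrightarrow> face_integrable \<sigma> g \<Longrightarrow>
    face_integral \<sigma> (\<lambda>x. f x + g x) = face_integral \<sigma> f + face_integral \<sigma> g"
  unfolding face_integral_def face_integrable_def by (rule set_integral_add(2))

lemma face_integrable_scale: "face_integrable \<sigma> f \<Longrightarrow> face_integrable \<sigma> (\<lambda>x. c * f x)"
  unfolding face_integrable_def by (rule set_integrable_mult_right)

lemma face_integral_scale: "face_integral \<sigma> (\<lambda>x. c * f x) = c * face_integral \<sigma> f"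
  unfolding face_integral_def by simp

lemma face_integral_zero [simp]: "face_integral \<sigma> (\<lambda>x. 0) = 0"
  using face_integral_scale[of \<sigma> 0 "\<lambda>x. 0"] by simp

lemma face_integral_lin:
  "face_integrable \<sigma> f \<Longrightarrow> face_integrable \<sigma> g \<Longrightarrow>
    face_integral \<sigma> (\<lambda>x. f x + c * g x) = face_integral \<sigma> f + c * face_integral \<sigma> g"
  by (simp add: face_integral_add face_integrable_scale face_integral_scale)

lemma face_integral_sum:
  assumes "\<And>i. i \<in> I \<Longrightarrow> face_integrable \<sigma> (f i)"
  shows "face_integral \<sigma> (\<lambda>x. \<Sum>i\<in>I. f i x) = (\<Sum>i\<in>I. face_integral \<sigma> (f i))
    \<and> face_integrable \<sigma> (\<lambda>x. \<Sum>i\<in>I. f i x)"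
proof (cases "finite I")
  case True
  then show ?thesis
    using assms unfolding face_integral_def face_integrable_def set_integrable_def set_lebesgue_integral_def
    by (simp add: sum_distrib_left del: sum_mult_indicator sum_indicator_mult)
next
  case False
  then show ?thesis by (simp add: face_integrable_def set_integrable_def)
qed

lemma face_integral_nonneg:
  assumes "\<And>x. x \<in> \<sigma> \<Longrightarrow> 0 \<le> f x"
  shows "0 \<le> face_integral \<sigma> f"
  unfolding face_integral_def set_lebesgue_integral_def
  using assms slab_closest_point_in[of _ \<sigma>] by (intro integral_nonneg_AE) (auto simp: indicator_def)

lemma rel_interior_face_ball:
  assumes "polyhedral_cell 2 \<sigma>" "unit_normal \<sigma> n" "p \<in> \<sigma>" "x \<in> rel_interior \<sigma>"
  obtains e where "e > 0" "\<forall>y. dist y x < e \<longrightarrow> n \<bullet> (y - p) = 0 \<longrightarrow> y \<in> \<sigma>"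
proof -
  obtain e where "e > 0" "ball x e \<inter> affine hull \<sigma> \<subseteq> \<sigma>"
    using assms(4) unfolding rel_interior_ball by blast
  then show ?thesis
    by (intro that[of e]) (auto simp: face_affine_hull[OF assms(1-3)] dist_commute)
qed

text \<open>A vanishing volume integral gives information at interior points of the slab only; this
  makes it available at points of the face.\<close>

lemma rel_interior_in_slab_interior:
  assumes "polyhedral_cell 2 \<sigma>" "x \<in> rel_interior \<sigma>"
  shows "x \<in> interior (slab \<sigma>)"
proof -
  obtain n where n: "unit_normal \<sigma> n" using face_has_unit_normal[OF assms(1)] .
  have p: "x \<in> \<sigma>" using assms(2) rel_interior_subset by blast
  have nn: "norm n = 1" using n by (simp add: unit_normal_def)
  obtain e where e: "e > 0" "\<forall>y. dist y x < e \<longrightarrow> n \<bullet> (y - x) = 0 \<longrightarrow> y \<in> \<sigma>"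
    using rel_interior_face_ball[OF assms(1) n p assms(2)] .
  have "ball x (min e (1/2)) \<subseteq> slab \<sigma>"
  proof
    fix y assume y: "y \<in> ball x (min e (1/2))"
    have "dist (proj n x y) x < e"
      using dist_proj_le[OF nn, of x y x] y by (simp add: proj_self dist_commute)
    then have "proj n x y \<in> \<sigma>" using e(2) proj_in_plane[OF nn] by blast
    moreover have "\<bar>n \<bullet> (y - x)\<bar> \<le> 1/2"
      using Cauchy_Schwarz_ineq2[of n "y - x"] nn y by (simp add: dist_norm norm_minus_commute)
    ultimately show "y \<in> slab \<sigma>" by (simp add: slab_eq[OF assms(1) n p])
  qed
  then show ?thesis using e(1) by (meson centre_in_ball half_gt_zero_iff interior_maximal min_less_iff_conj open_ball subsetD zero_less_one)
qed

text \<open>A face is the closure of its relative interior, so continuity carries the value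
  over.\<close>

lemma zero_on_face:
  fixes f :: "pt \<Rightarrow> 'a::t1_space"
  assumes "polyhedral_cell 2 \<sigma>" "continuous_on \<sigma> f" "\<And>x. x \<in> rel_interior \<sigma> \<Longrightarrow> f x = a" "x \<in> \<sigma>"
  shows "f x = a"
proof -
  have "\<sigma> = closure (rel_interior \<sigma>)" using assms(1) by (simp add: polyhedral_cell_def)
  then show ?thesis using continuous_constant_on_closure[of "rel_interior \<sigma>" f a x] assms by metis
qed

lemma face_integral_zero_imp_zero:
  assumes "polyhedral_cell 2 \<sigma>" "continuous_on \<sigma> f" "\<And>x. x \<in> \<sigma> \<Longrightarrow> 0 \<le> f x"
    and "face_integral \<sigma> f = 0" "x \<in> \<sigma>"
  shows "f x = 0"
proof (rule zero_on_face[OF assms(1,2) _ assms(5)])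
  fix x assume x: "x \<in> rel_interior \<sigma>"
  then have "closest_point (affine hull \<sigma>) x = x"
    using rel_interior_subset hull_inc by (metis closest_point_self subsetD)
  moreover have "f (closest_point (affine hull \<sigma>) x) = 0"
    using set_integral_zero_imp_zero[OF slab_compact[OF assms(1)] continuous_on_slab[OF assms(1,2)] _ _
        rel_interior_in_slab_interior[OF assms(1) x]] assms(3,4) slab_closest_point_in
    unfolding face_integral_def by blast
  ultimately show "f x = 0" by simp
qed

text \<open>The part \<open>v\<close> of \<open>m\<close> orthogonal to \<open>n\<close> is a
  direction inside the plane of the face, hence orthogonal to \<open>m\<close>, hence zero.\<close>

lemma unit_normal_unique:
  assumes "polyhedral_cell 2 \<sigma>" "unit_normal \<sigma> n" "unit_normal \<sigma> m"
  shows "m = n \<or> m = - n"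
proof -
  obtain p where p: "p \<in> rel_interior \<sigma>" using face_rel_interior_nonempty[OF assms(1)] by blast
  then have ps: "p \<in> \<sigma>" using rel_interior_subset by blast
  have nn: "norm n = 1" "norm m = 1" using assms by (simp_all add: unit_normal_def)
  then have n1: "n \<bullet> n = 1" by (simp add: dot_square_norm)
  obtain e where e: "e > 0" "\<forall>y. dist y p < e \<longrightarrow> n \<bullet> (y - p) = 0 \<longrightarrow> y \<in> \<sigma>"
    using rel_interior_face_ball[OF assms(1,2) ps p] .
  define v where "v = m - (n \<bullet> m) *\<^sub>R n"
  have nv: "n \<bullet> v = 0" by (simp add: v_def inner_simps n1)
  \<comment> \<open>Small enough for \<open>p + c *\<^sub>R v\<close> to stay within distance
    \<open>e\<close> of \<open>p\<close>; the added \<open>1\<close> covers the case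
    \<open>v = 0\<close>.\<close>
  define c where "c = e / (2 * (norm v + 1))"
  have c: "c > 0" using e(1) by (simp add: c_def add_nonneg_pos)
  have "c * norm v < e"
  proof -
    have "c * norm v \<le> c * (norm v + 1)" using c by (intro mult_left_mono) auto
    also have "c * (norm v + 1) = e / 2"
      using norm_ge_zero[of v] by (simp add: c_def field_simps del: norm_ge_zero)
    also have "e / 2 < e" using e(1) by simp
    finally show ?thesis .
  qed
  then have "p + c *\<^sub>R v \<in> \<sigma>" using c nv by (intro e(2)[rule_format]) (auto simp: dist_norm)
  then have "m \<bullet> (p + c *\<^sub>R v - p) = 0" using assms(3) ps unfolding unit_normal_def by blast
  then have "m \<bullet> v = 0" using c by simp
  moreover have "v \<bullet> v = (m - (n \<bullet> m) *\<^sub>R n) \<bullet> v" by (simp add: v_def)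
  ultimately have "v \<bullet> v = 0" using nv by (simp add: inner_diff_left)
  then have m: "m = (n \<bullet> m) *\<^sub>R n" by (simp add: v_def)
  then have "\<bar>n \<bullet> m\<bar> = 1" using nn by (metis mult.right_neutral norm_scaleR)
  then show ?thesis using m by (metis abs_eq_iff' scaleR_minus1_left scaleR_one)
qed

text \<open>Two opposite outward normals would put the same point next to \<open>p\<close> both
  inside and outside \<open>T\<close>.\<close>

lemma outward_unit_normal_unique:
  assumes "polyhedral_cell 2 \<sigma>" "outward_unit_normal T \<sigma> n" "outward_unit_normal T \<sigma> m"
  shows "m = n"
proof (rule ccontr)
  assume "m \<noteq> n"
  then have m: "m = - n" using unit_normal_unique assms unfolding outward_unit_normal_def by blast
  obtain p where p: "p \<in> rel_interior \<sigma>" using face_rel_interior_nonempty[OF assms(1)] by blast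
  obtain e where e: "e > 0" "\<And>t. 0 < t \<Longrightarrow> t < e \<Longrightarrow> p - t *\<^sub>R n \<in> T"
    using assms(2) p unfolding outward_unit_normal_def by blast
  obtain d where d: "d > 0" "\<And>t. 0 < t \<Longrightarrow> t < d \<Longrightarrow> p + t *\<^sub>R m \<notin> T"
    using assms(3) p unfolding outward_unit_normal_def by blast
  have "0 < min e d / 2" "min e d / 2 < e" "min e d / 2 < d" using e(1) d(1) by auto
  then show False using e(2)[of "min e d / 2"] d(2)[of "min e d / 2"] m by auto
qed

lemma normal_of_eq:
  assumes "polyhedral_cell 2 \<sigma>" "outward_unit_normal T \<sigma> n"
  shows "normal_of T \<sigma> = n"
  unfolding normal_of_def using assms outward_unit_normal_unique by blast

subsection \<open>Sets of codimension two\<close>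

text \<open>Members may degenerate to points or to the empty set. Such a cover has codimension two,
  so it remains negligible after a sweep in one direction, and so does its join with one
  point.\<close>

definition line_cover :: "pt set set \<Rightarrow> bool" where
  "line_cover \<L> \<longleftrightarrow> finite \<L> \<and> (\<forall>l\<in>\<L>. affine l \<and> aff_dim l \<le> 1)"

lemma negligible_aff_dim_less:
  assumes "aff_dim (S :: pt set) < 3"
  shows "negligible S"
proof -
  have "aff_dim S < DIM(pt)" using assms by simp
  then obtain a b where "a \<noteq> 0" "S \<subseteq> {x. a \<bullet> x = b}" by (rule aff_lowdim_subset_hyperplane)
  then show ?thesis using negligible_hyperplane negligible_subset by blast
qed

lemma negligible_insert_line:
  assumes "aff_dim (l :: pt set) \<le> 1"
  shows "negligible (affine hull (insert x l))"
proof (rule negligible_aff_dim_less)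
  show "aff_dim (affine hull (insert x l)) < 3"
    using assms by (auto simp: aff_dim_insert)
qed

lemma negligible_sweep:
  assumes "line_cover \<L>"
  shows "negligible {x. \<exists>t. x + t *\<^sub>R e \<in> \<Union>\<L>}"
proof -
  have "negligible {x. \<exists>t. x + t *\<^sub>R e \<in> l}" if l: "l \<in> \<L>" for l
  proof (cases "l = {}")
    case False
    then obtain q where q: "q \<in> l" by blast
    have "{x. \<exists>t. x + t *\<^sub>R e \<in> l} \<subseteq> affine hull (insert (q + e) l)"
    proof
      fix x assume "x \<in> {x. \<exists>t. x + t *\<^sub>R e \<in> l}"
      then obtain t where t: "x + t *\<^sub>R e \<in> l" by blast
      \<comment> \<open>The coefficients sum to one and recover \<open>x\<close> from the three
        points \<open>x + t *\<^sub>R e\<close>, \<open>q + e\<close> and \<open>q\<close>.\<close>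
      have "1 *\<^sub>R (x + t *\<^sub>R e) + (- t) *\<^sub>R (q + e) + t *\<^sub>R q \<in> affine hull (insert (q + e) l)"
        using t q by (intro mem_affine_3[OF affine_affine_hull]) (auto simp: hull_inc)
      then show "x \<in> affine hull (insert (q + e) l)" by (simp add: algebra_simps)
    qed
    then show ?thesis using negligible_insert_line[of l] assms l negligible_subset
      unfolding line_cover_def by blast
  qed simp
  moreover have "{x. \<exists>t. x + t *\<^sub>R e \<in> \<Union>\<L>} = (\<Union>l\<in>\<L>. {x. \<exists>t. x + t *\<^sub>R e \<in> l})" by auto
  ultimately show ?thesis using assms unfolding line_cover_def
    by (metis (no_types, lifting) finite_imageI imageE negligible_Union)
qed

text \<open>Once \<open>x\<close> is off the lines, a segment from \<open>x\<close> can meet a line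
  of the cover only if its other end lies in the affine hull of \<open>x\<close> and that line, and
  these finitely many hulls are negligible.\<close>

lemma generic_segment:
  assumes "line_cover \<L>" "open U" "U \<noteq> {}" "open V" "V \<noteq> {}"
  obtains x y where "x \<in> U" "y \<in> V" "closed_segment x y \<inter> \<Union>\<L> = {}"
proof -
  have "negligible (\<Union>\<L>)"
    using negligible_sweep[OF assms(1), of 0] by (rule negligible_subset) auto
  then have "\<not> U \<subseteq> \<Union>\<L>" using open_negligible_empty[OF assms(2)] assms(3) negligible_subset by blast
  then obtain x where x: "x \<in> U" "x \<notin> \<Union>\<L>" by blast
  have "negligible (\<Union>l\<in>\<L>. affine hull (insert x l))"
    using assms(1) unfolding line_cover_def by (intro negligible_Union) (auto intro: negligible_insert_line)
  then have "\<not> V \<subseteq> (\<Union>l\<in>\<L>. affine hull (insert x l))"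
    using open_negligible_empty[OF assms(4)] assms(5) negligible_subset by blast
  then obtain y where y: "y \<in> V" "\<And>l. l \<in> \<L> \<Longrightarrow> y \<notin> affine hull (insert x l)" by blast
  have "p \<notin> l" if ps: "p \<in> closed_segment x y" and lL: "l \<in> \<L>" for p l
  proof
    assume pl: "p \<in> l"
    obtain u where u: "p = (1 - u) *\<^sub>R x + u *\<^sub>R y" using ps unfolding closed_segment_def by blast
    have "u \<noteq> 0" using u x(2) pl lL by auto
    then have "y = (1 - 1/u) *\<^sub>R x + (1/u) *\<^sub>R p"
      by (simp add: u algebra_simps)
    moreover have "(1 - 1/u) *\<^sub>R x + (1/u) *\<^sub>R p \<in> affine hull (insert x l)"
      using pl by (intro mem_affine[OF affine_affine_hull]) (auto simp: hull_inc)
    ultimately show False using y(2)[OF lL] by simp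
  qed
  then show ?thesis using that x y by blast
qed

text \<open>A point of the relative frontier lies in some convex piece \<open>P\<close>. If
  \<open>P\<close> is two-dimensional, it spans the plane of \<open>\<sigma>\<close>, so the point
  is on the relative frontier of \<open>P\<close> too and thus on a facet; otherwise
  \<open>P\<close> itself lies in a line.\<close>

lemma line_cover_rel_frontier:
  assumes "polyhedral_cell 2 \<sigma>"
  shows "\<exists>\<L>. line_cover \<L> \<and> rel_frontier \<sigma> \<subseteq> \<Union>\<L>"
proof -
  obtain C where C: "finite C" "\<And>P. P \<in> C \<Longrightarrow> polytope P" "\<sigma> = \<Union>C"
    using assms unfolding polyhedral_cell_def polytope_union_def by blast
  define \<L> where "\<L> = (\<Union>P\<in>{P\<in>C. aff_dim P = 2}. (hull) affine ` {F. F facet_of P})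
    \<union> (hull) affine ` {P\<in>C. aff_dim P \<le> 1}"
  have "finite {F. F facet_of P}" if "P \<in> C" for P
    using C(2)[OF that] by (simp add: finite_polytope_facets)
  then have "finite \<L>" unfolding \<L>_def using C(1) by auto
  moreover have "affine l \<and> aff_dim l \<le> 1" if "l \<in> \<L>" for l
    using that unfolding \<L>_def facet_of_def by auto
  ultimately have lc: "line_cover \<L>" by (simp add: line_cover_def)
  have "rel_frontier \<sigma> \<subseteq> \<Union>\<L>"
  proof
    fix x assume x: "x \<in> rel_frontier \<sigma>"
    have "closed \<sigma>" using face_compact[OF assms] compact_imp_closed by blast
    then have x1: "x \<in> \<sigma>" "x \<notin> rel_interior \<sigma>" using x by (auto simp: rel_frontier_def)
    then obtain P where P: "P \<in> C" "x \<in> P" using C(3) by blast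
    have sub: "P \<subseteq> \<sigma>" using P C(3) by blast
    then have "aff_dim P \<le> 2" using aff_dim_subset[OF sub] assms by (simp add: polyhedral_cell_def)
    then consider "aff_dim P \<le> 1" | "aff_dim P = 2" by linarith
    then show "x \<in> \<Union>\<L>"
    proof cases
      case 1
      then have "affine hull P \<in> \<L>" using P by (auto simp: \<L>_def)
      then show ?thesis using P hull_inc[of x P affine] by blast
    next
      case 2
      have "affine hull P = affine hull \<sigma>"
        using sub 2 P assms
        by (intro affine_dim_equal) (auto simp: polyhedral_cell_def hull_mono hull_inc)
      then have "rel_interior P \<subseteq> rel_interior \<sigma>" using rel_interior_mono sub by blast
      then have "x \<in> rel_frontier P" using x1 P closure_subset by (auto simp: rel_frontier_def)
      then obtain F where F: "F facet_of P" "x \<in> F"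
        using rel_frontier_of_polyhedron[OF polytope_imp_polyhedron[OF C(2)[OF P(1)]]] by auto
      then have "affine hull F \<in> \<L>" using P 2 by (auto simp: \<L>_def)
      then show ?thesis using F hull_inc[of x F affine] by blast
    qed
  qed
  then show ?thesis using lc by blast
qed

lemma line_cover_Union:
  assumes "finite I" "\<And>i. i \<in> I \<Longrightarrow> \<exists>\<L>. line_cover \<L> \<and> S i \<subseteq> \<Union>\<L>"
  shows "\<exists>\<L>. line_cover \<L> \<and> (\<Union>i\<in>I. S i) \<subseteq> \<Union>\<L>"
proof -
  obtain L where L: "\<And>i. i \<in> I \<Longrightarrow> line_cover (L i)" "\<And>i. i \<in> I \<Longrightarrow> S i \<subseteq> \<Union>(L i)"
    using assms(2) by metis
  then show ?thesis using assms(1)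
    by (intro exI[of _ "\<Union>i\<in>I. L i"]) (auto simp: line_cover_def, blast)
qed

text \<open>A point of a face that avoids this set lies in the relative interior of the face and in
  no other face.\<close>

definition skeleton :: "pt set set \<Rightarrow> pt set" where
  "skeleton Eh = (\<Union>\<sigma>\<in>Eh. rel_frontier \<sigma>) \<union> (\<Union>(\<sigma>, \<sigma>')\<in>{(\<sigma>, \<sigma>'). \<sigma> \<in> Eh \<and> \<sigma>' \<in> Eh \<and> \<sigma> \<noteq> \<sigma>'}. \<sigma> \<inter> \<sigma>')"

text \<open>Coplanar faces with disjoint relative interiors meet only in their relative frontiers;
  the planes of any other pair meet at most in a line.\<close>

lemma line_cover_skeleton:
  assumes "finite Eh" "\<And>\<sigma>. \<sigma> \<in> Eh \<Longrightarrow> polyhedral_cell 2 \<sigma>"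
    and "\<And>\<sigma> \<sigma>'. \<sigma> \<in> Eh \<Longrightarrow> \<sigma>' \<in> Eh \<Longrightarrow> \<sigma> \<noteq> \<sigma>' \<Longrightarrow> rel_interior \<sigma> \<inter> rel_interior \<sigma>' = {}"
  obtains \<L> where "line_cover \<L>" "skeleton Eh \<subseteq> \<Union>\<L>"
proof -
  have 1: "\<exists>\<L>. line_cover \<L> \<and> (\<Union>\<sigma>\<in>Eh. rel_frontier \<sigma>) \<subseteq> \<Union>\<L>"
    using assms(1,2) line_cover_rel_frontier by (intro line_cover_Union) auto
  have 2: "\<exists>\<L>. line_cover \<L> \<and> \<sigma> \<inter> \<sigma>' \<subseteq> \<Union>\<L>" if s: "\<sigma> \<in> Eh" "\<sigma>' \<in> Eh" "\<sigma> \<noteq> \<sigma>'" for \<sigma> \<sigma>'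
  proof (cases "affine hull \<sigma> = affine hull \<sigma>'")
    case True
    have cl: "closed \<sigma>" "closed \<sigma>'" using assms(2) s face_compact compact_imp_closed by blast+
    have "\<sigma> \<inter> \<sigma>' \<subseteq> rel_frontier \<sigma> \<union> rel_frontier \<sigma>'"
      using assms(3)[OF s] cl by (auto simp: rel_frontier_def)
    then have "\<sigma> \<inter> \<sigma>' \<subseteq> (\<Union>\<sigma>\<in>Eh. rel_frontier \<sigma>)" using s by blast
    then show ?thesis using 1 by blast
  next
    case False
    let ?A = "affine hull \<sigma>" let ?B = "affine hull \<sigma>'"
    have d: "aff_dim ?A = 2" "aff_dim ?B = 2" using assms(2) s by (auto simp: polyhedral_cell_def)
    have "aff_dim (?A \<inter> ?B) \<le> 1"
    proof (rule ccontr)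
      assume "\<not> aff_dim (?A \<inter> ?B) \<le> 1"
      then have "aff_dim (?A \<inter> ?B) = 2" using aff_dim_subset[of "?A \<inter> ?B" ?A] d by auto
      moreover have "?A \<inter> ?B \<noteq> {}" using calculation by auto
      ultimately have "?A \<inter> ?B = ?A" "?A \<inter> ?B = ?B"
        using d affine_dim_equal[of "?A \<inter> ?B" ?A] affine_dim_equal[of "?A \<inter> ?B" ?B]
        by (metis affine_Int affine_affine_hull Int_lower1 Int_lower2)+
      then show False using False by metis
    qed
    then have "line_cover {?A \<inter> ?B}" by (auto simp: line_cover_def affine_Int)
    moreover have "\<sigma> \<inter> \<sigma>' \<subseteq> ?A \<inter> ?B" by (intro Int_mono hull_subset)
    ultimately show ?thesis by (intro exI[of _ "{?A \<inter> ?B}"]) auto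
  qed
  have "finite {(\<sigma>, \<sigma>'). \<sigma> \<in> Eh \<and> \<sigma>' \<in> Eh \<and> \<sigma> \<noteq> \<sigma>'}"
    by (rule finite_subset[of _ "Eh \<times> Eh"]) (use assms(1) in auto)
  then have "\<exists>\<L>. line_cover \<L> \<and>
    (\<Union>x\<in>{(\<sigma>, \<sigma>'). \<sigma> \<in> Eh \<and> \<sigma>' \<in> Eh \<and> \<sigma> \<noteq> \<sigma>'}. (case x of (\<sigma>, \<sigma>') \<Rightarrow> \<sigma> \<inter> \<sigma>')) \<subseteq> \<Union>\<L>"
    using 2 by (intro line_cover_Union) auto
  then obtain L2 where L2: "line_cover L2"
    "(\<Union>x\<in>{(\<sigma>, \<sigma>'). \<sigma> \<in> Eh \<and> \<sigma>' \<in> Eh \<and> \<sigma> \<noteq> \<sigma>'}. (case x of (\<sigma>, \<sigma>') \<Rightarrow> \<sigma> \<inter> \<sigma>')) \<subseteq> \<Union>L2" by blast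
  obtain L1 where L1: "line_cover L1" "(\<Union>\<sigma>\<in>Eh. rel_frontier \<sigma>) \<subseteq> \<Union>L1" using 1 by blast
  show ?thesis
  proof (rule that[of "L1 \<union> L2"])
    show "line_cover (L1 \<union> L2)" using L1(1) L2(1) by (auto simp: line_cover_def)
    show "skeleton Eh \<subseteq> \<Union>(L1 \<union> L2)" unfolding skeleton_def using L1(2) L2(2) by blast
  qed
qed

subsection \<open>Geometry of a polyhedral mesh\<close>

lemma closed_avoid_ball:
  assumes "closed C" "p \<notin> C"
  shows "\<exists>r>0. ball p r \<subseteq> - C"
  using assms open_contains_ball[of "- C"] by (auto simp: open_Compl)

locale polyhedral_mesh =
  fixes \<Omega> :: "pt set" and Th Eh :: "pt set set"
  assumes domain: "polyhedral_domain \<Omega>" and partition: "polyhedral_partition \<Omega> Th Eh"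
begin

abbreviation F :: "pt set \<Rightarrow> pt set set" where "F T \<equiv> faces_of Eh T"

lemma finite_Th: "finite Th" and finite_Eh: "finite Eh" and Union_Th: "\<Union>Th = closure \<Omega>"
  using partition by (auto simp: polyhedral_partition_def)

lemma cell: "T \<in> Th \<Longrightarrow> polyhedral_cell 3 T"
  and interiors_disjoint: "T \<in> Th \<Longrightarrow> T' \<in> Th \<Longrightarrow> T \<noteq> T' \<Longrightarrow> interior T \<inter> interior T' = {}"
  and face: "\<sigma> \<in> Eh \<Longrightarrow> polyhedral_cell 2 \<sigma>"
  and rel_interiors_disjoint: "\<sigma> \<in> Eh \<Longrightarrow> \<sigma>' \<in> Eh \<Longrightarrow> \<sigma> \<noteq> \<sigma>' \<Longrightarrow> rel_interior \<sigma> \<inter> rel_interior \<sigma>' = {}"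
  and face_has_cell: "\<sigma> \<in> Eh \<Longrightarrow> \<exists>T\<in>Th. \<sigma> \<in> F T"
  and Union_faces: "T \<in> Th \<Longrightarrow> \<Union>(F T) = frontier T"
  using partition unfolding polyhedral_partition_def by (elim conjE, (simp; fail))+

lemma outward_normal:
  assumes "T \<in> Th" "\<sigma> \<in> F T"
  shows "outward_unit_normal T \<sigma> (normal_of T \<sigma>)"
proof -
  obtain n where "outward_unit_normal T \<sigma> n"
  proof -
    have "\<forall>T\<in>Th. \<forall>\<sigma>\<in>F T. \<exists>n. outward_unit_normal T \<sigma> n"
      using partition unfolding polyhedral_partition_def by (elim conjE)
    then show ?thesis using assms that by blast
  qed
  moreover have "polyhedral_cell 2 \<sigma>" using assms face by (auto simp: faces_of_def)
  ultimately show ?thesis using normal_of_eq by metis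
qed

lemma unit_normal_of: "T \<in> Th \<Longrightarrow> \<sigma> \<in> F T \<Longrightarrow> unit_normal \<sigma> (normal_of T \<sigma>)"
  using outward_normal by (auto simp: outward_unit_normal_def)

lemma faces_in_Eh: "\<sigma> \<in> F T \<Longrightarrow> \<sigma> \<in> Eh" and faces_in_frontier: "\<sigma> \<in> F T \<Longrightarrow> \<sigma> \<subseteq> frontier T"
  by (auto simp: faces_of_def)

lemma face_of_cell: "\<sigma> \<in> F T \<Longrightarrow> polyhedral_cell 2 \<sigma>"
  using face faces_in_Eh by blast

lemma finite_faces: "finite (F T)"
  using finite_Eh by (simp add: faces_of_def)

lemma open_domain: "open \<Omega>" and bounded_domain: "bounded \<Omega>" and connected_domain: "connected \<Omega>"
  and domain_nonempty: "\<Omega> \<noteq> {}" and interior_closure_domain: "interior (closure \<Omega>) = \<Omega>"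
  and polytope_union_closure: "polytope_union (closure \<Omega>)"
  using domain by (auto simp: polyhedral_domain_def)

lemma cell_compact: "T \<in> Th \<Longrightarrow> compact T" and cell_closed: "T \<in> Th \<Longrightarrow> closed T"
  using cell face_compact compact_imp_closed by blast+

lemma cell_closure_interior:
  assumes "T \<in> Th"
  shows "closure (interior T) = T" "interior T \<noteq> {}" "connected (interior T)"
proof -
  have c: "polyhedral_cell 3 T" using assms cell by blast
  then have "aff_dim T = DIM(pt)" by (simp add: polyhedral_cell_def)
  then have "rel_interior T = interior T"
    using aff_dim_eq_full[of T] rel_interior_interior[of T] by blast
  moreover have "T \<noteq> {}" using c by (auto simp: polyhedral_cell_def)
  ultimately show "closure (interior T) = T" "interior T \<noteq> {}" "connected (interior T)"
    using c unfolding polyhedral_cell_def by auto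
qed

lemma cell_subset: "T \<in> Th \<Longrightarrow> T \<subseteq> closure \<Omega>"
  using Union_Th by blast

lemma interior_cell_subset: "T \<in> Th \<Longrightarrow> interior T \<subseteq> \<Omega>"
  using interior_mono[OF cell_subset] interior_closure_domain by blast

lemma faces_subset_closure: "\<sigma> \<in> Eh \<Longrightarrow> \<sigma> \<subseteq> closure \<Omega>"
  using face_has_cell faces_in_frontier cell_subset cell_closed frontier_subset_closed by blast

lemma lmeasurable_domain: "\<Omega> \<in> lmeasurable"
  using bounded_domain open_domain by (simp add: lmeasurable_open)

lemma negligible_face:
  assumes "\<sigma> \<in> Eh"
  shows "negligible (affine hull \<sigma>)" "negligible \<sigma>"
proof -
  have "aff_dim \<sigma> = 2" using face[OF assms] by (simp add: polyhedral_cell_def)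
  then show "negligible (affine hull \<sigma>)" "negligible \<sigma>" by (auto intro!: negligible_aff_dim_less)
qed

lemma negligible_cell_frontier: "T \<in> Th \<Longrightarrow> negligible (frontier T)"
  using Union_faces[of T] negligible_Union[OF finite_faces, of T] negligible_face faces_in_Eh by metis

section \<open>Points and segments off the skeleton\<close>

abbreviation skel :: "pt set" where "skel \<equiv> skeleton Eh"

lemma skel_cover: obtains \<L> where "line_cover \<L>" "skel \<subseteq> \<Union>\<L>"
  using line_cover_skeleton[OF finite_Eh face rel_interiors_disjoint] by blast

lemma negligible_skel_sweep: "negligible {x. \<exists>t. x + t *\<^sub>R e \<in> skel}"
proof -
  obtain \<L> where "line_cover \<L>" "skel \<subseteq> \<Union>\<L>" by (rule skel_cover)
  then show ?thesis by (intro negligible_subset[OF negligible_sweep[of \<L> e]]) blast+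
qed

lemma segment_off_skel:
  assumes "open U" "U \<noteq> {}" "open V" "V \<noteq> {}"
  obtains x y where "x \<in> U" "y \<in> V" "closed_segment x y \<inter> skel = {}"
proof -
  obtain \<L> where L: "line_cover \<L>" "skel \<subseteq> \<Union>\<L>" by (rule skel_cover)
  obtain x y where "x \<in> U" "y \<in> V" "closed_segment x y \<inter> \<Union>\<L> = {}"
    by (rule generic_segment[OF L(1) assms])
  then show ?thesis using that L(2) by blast
qed

lemma not_skelD:
  assumes "p \<notin> skel" "\<sigma> \<in> Eh" "p \<in> \<sigma>"
  shows "p \<in> rel_interior \<sigma>" "\<And>\<sigma>'. \<sigma>' \<in> Eh \<Longrightarrow> p \<in> \<sigma>' \<Longrightarrow> \<sigma>' = \<sigma>"
proof -
  have "p \<notin> rel_frontier \<sigma>" using assms(1,2) by (auto simp: skeleton_def)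
  then show "p \<in> rel_interior \<sigma>" using assms(3) closure_subset by (auto simp: rel_frontier_def)
  show "\<sigma>' = \<sigma>" if "\<sigma>' \<in> Eh" "p \<in> \<sigma>'" for \<sigma>'
    using assms that by (auto simp: skeleton_def)
qed

text \<open>The skeleton swept in the normal direction is null, so some point near the face avoids
  the sweep. Its projection to the plane moves it only along the normal and therefore avoids the
  skeleton.\<close>

lemma generic_point:
  assumes "\<sigma> \<in> Eh" "open U" "U \<inter> \<sigma> \<noteq> {}"
  obtains p where "p \<in> U" "p \<in> \<sigma>" "p \<notin> skel"
proof -
  have c: "polyhedral_cell 2 \<sigma>" using assms face by blast
  obtain n where n: "unit_normal \<sigma> n" using face_has_unit_normal[OF c] .
  have nn: "norm n = 1" using n by (simp add: unit_normal_def)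
  have "U \<inter> closure (rel_interior \<sigma>) \<noteq> {}" using assms c by (simp add: polyhedral_cell_def)
  then have "U \<inter> rel_interior \<sigma> \<noteq> {}" using open_Int_closure_eq_empty[OF assms(2)] by blast
  then obtain x where x: "x \<in> U" "x \<in> rel_interior \<sigma>" by blast
  then have xs: "x \<in> \<sigma>" using rel_interior_subset by blast
  obtain e where e: "e > 0" "\<forall>y. dist y x < e \<longrightarrow> n \<bullet> (y - x) = 0 \<longrightarrow> y \<in> \<sigma>"
    by (rule rel_interior_face_ball[OF c n xs x(2)])
  obtain d where d: "d > 0" "ball x d \<subseteq> U" using assms(2) x(1) open_contains_ball by blast
  have "\<not> ball x (min d e) \<subseteq> {x. \<exists>t. x + t *\<^sub>R n \<in> skel}"
  proof
    assume "ball x (min d e) \<subseteq> {x. \<exists>t. x + t *\<^sub>R n \<in> skel}"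
    then have "ball x (min d e) = {}"
      using open_negligible_empty[OF open_ball] negligible_subset[OF negligible_skel_sweep] by blast
    then show False using d(1) e(1) by simp
  qed
  then obtain y where y: "y \<in> ball x (min d e)" "\<And>t. y + t *\<^sub>R n \<notin> skel" by blast
  have ds: "dist (proj n x y) x < min d e"
    using dist_proj_le[OF nn, of x y x] y(1) by (simp add: proj_self dist_commute)
  show ?thesis
  proof (rule that[of "proj n x y"])
    show "proj n x y \<in> U" using ds d(2) by (auto simp: dist_commute)
    show "proj n x y \<in> \<sigma>" using ds e(2) proj_in_plane[OF nn] by auto
    show "proj n x y \<notin> skel" using y(2)[of "- (n \<bullet> (y - x))"] by (simp add: proj_def)
  qed
qed

lemma frontier_in_face:
  assumes "T \<in> Th" "p \<in> frontier T"
  obtains \<sigma> where "\<sigma> \<in> F T" "p \<in> \<sigma>"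
  using Union_faces[OF assms(1)] assms(2) by blast

lemma isolated_face_point:
  assumes "\<sigma> \<in> Eh" "p \<in> \<sigma>" "p \<notin> skel"
  obtains r where "r > 0" "\<And>\<sigma>' x. \<sigma>' \<in> Eh \<Longrightarrow> \<sigma>' \<noteq> \<sigma> \<Longrightarrow> x \<in> \<sigma>' \<Longrightarrow> x \<notin> ball p r"
proof -
  have "closed (\<Union>(Eh - {\<sigma>}))"
    using finite_Eh face face_compact compact_imp_closed by (intro closed_Union) auto
  moreover have "p \<notin> \<Union>(Eh - {\<sigma>})" using not_skelD(2)[OF assms(3,1,2)] by blast
  ultimately obtain r where "r > 0" "ball p r \<inter> \<Union>(Eh - {\<sigma>}) = {}"
    using closed_avoid_ball[of "\<Union>(Eh - {\<sigma>})" p] by blast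
  then show ?thesis using that by blast
qed

text \<open>In a ball that meets no other face, each open half ball is connected and misses the
  frontier of \<open>T\<close>, so it lies entirely inside or entirely outside \<open>T\<close>. The
  outward normal decides which.\<close>

lemma local_face:
  assumes T: "T \<in> Th" "\<sigma> \<in> F T" and p: "p \<in> \<sigma>" "p \<notin> skel"
  obtains r where "r > 0"
    "\<And>y. y \<in> ball p r \<Longrightarrow> normal_of T \<sigma> \<bullet> (y - p) < 0 \<Longrightarrow> y \<in> interior T"
    "\<And>y. y \<in> ball p r \<Longrightarrow> normal_of T \<sigma> \<bullet> (y - p) > 0 \<Longrightarrow> y \<notin> T"
proof -
  define n where "n = normal_of T \<sigma>"
  have sE: "\<sigma> \<in> Eh" using T faces_in_Eh by blast
  have un: "unit_normal \<sigma> n" using unit_normal_of T n_def by blast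
  have nn: "norm n = 1" using un by (simp add: unit_normal_def)
  then have n1: "n \<bullet> n = 1" by (simp add: dot_square_norm)
  obtain r where r: "r > 0" "ball p r \<inter> \<Union>(Eh - {\<sigma>}) = {}"
    by (rule isolated_face_point[OF sE p]) blast
  obtain e where e: "e > 0" "\<And>t. 0 < t \<Longrightarrow> t < e \<Longrightarrow> p - t *\<^sub>R n \<in> T" "\<And>t. 0 < t \<Longrightarrow> t < e \<Longrightarrow> p + t *\<^sub>R n \<notin> T"
    using outward_normal[OF T] not_skelD(1)[OF p(2) sE p(1)] unfolding outward_unit_normal_def n_def by blast
  define t where "t = min e r / 2"
  have t: "0 < t" "t < e" "t < r" using e(1) r(1) by (auto simp: t_def)
  \<comment> \<open>\<open>H 1\<close> is the half ball behind the face, \<open>H (-1)\<close> the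
    half ball in front of it.\<close>
  define H where "H s = ball p r \<inter> {y. s * (n \<bullet> (y - p)) < 0}" for s :: real
  have Hconn: "connected (H s)" for s
  proof -
    have "{y. s * (n \<bullet> (y - p)) < 0} = {y. (s *\<^sub>R n) \<bullet> y < (s *\<^sub>R n) \<bullet> p}" by (auto simp: inner_simps algebra_simps)
    then have "convex (H s)" unfolding H_def by (simp only:) (intro convex_Int convex_ball convex_halfspace_lt)
    then show ?thesis by (rule convex_connected)
  qed
  have Hfr: "H s \<inter> frontier T = {}" for s
  proof (rule ccontr)
    assume "H s \<inter> frontier T \<noteq> {}"
    then obtain y where y: "y \<in> H s" "y \<in> frontier T" by blast
    obtain \<sigma>' where s': "\<sigma>' \<in> F T" "y \<in> \<sigma>'" using frontier_in_face[OF T(1) y(2)] .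
    then have "\<sigma>' = \<sigma>" using r(2) y(1) faces_in_Eh unfolding H_def by blast
    then have "n \<bullet> (y - p) = 0" using un s' p(1) by (simp add: unit_normal_def)
    then show False using y(1) by (simp add: H_def)
  qed
  have m: "p - t *\<^sub>R n \<in> H 1" "p + t *\<^sub>R n \<in> H (-1)"
    using t nn n1 by (auto simp: H_def dist_norm)
  have "H 1 \<subseteq> T"
    using connected_Int_frontier[OF Hconn, of 1 T] Hfr[of 1] m(1) e(2)[OF t(1,2)] by blast
  moreover have "open (H 1)"
    unfolding H_def by (intro open_Int open_ball open_Collect_less continuous_intros)
  ultimately have A: "H 1 \<subseteq> interior T" by (simp add: interior_maximal)
  have B: "H (-1) \<inter> T = {}"
    using connected_Int_frontier[OF Hconn, of "-1" T] Hfr[of "-1"] m(2) e(3)[OF t(1,2)] by blast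
  show ?thesis
  proof (rule that[OF r(1)])
    show "y \<in> interior T" if "y \<in> ball p r" "normal_of T \<sigma> \<bullet> (y - p) < 0" for y
      using A that unfolding H_def n_def by auto
    show "y \<notin> T" if "y \<in> ball p r" "normal_of T \<sigma> \<bullet> (y - p) > 0" for y
      using B that unfolding H_def n_def by auto
  qed
qed

text \<open>Otherwise both cells would contain the same points just behind a generic point of the
  face, although their interiors are disjoint.\<close>

lemma same_normal_same_cell:
  assumes "T \<in> Th" "T' \<in> Th" "\<sigma> \<in> F T" "\<sigma> \<in> F T'" "normal_of T' \<sigma> = normal_of T \<sigma>"
  shows "T' = T"
proof (rule ccontr)
  assume ne: "T' \<noteq> T"
  have sE: "\<sigma> \<in> Eh" using assms faces_in_Eh by blast
  define n where "n = normal_of T \<sigma>"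
  have nn: "norm n = 1" using unit_normal_of[OF assms(1,3)] by (simp add: unit_normal_def n_def)
  then have n1: "n \<bullet> n = 1" by (simp add: dot_square_norm)
  obtain p where p: "p \<in> \<sigma>" "p \<notin> skel"
    using generic_point[OF sE open_UNIV] face_nonempty[OF face[OF sE]] by (metis Int_UNIV_left)
  obtain r where r: "r > 0" "\<And>y. y \<in> ball p r \<Longrightarrow> normal_of T \<sigma> \<bullet> (y - p) < 0 \<Longrightarrow> y \<in> interior T"
    by (rule local_face[OF assms(1,3) p]) blast
  obtain r' where r': "r' > 0" "\<And>y. y \<in> ball p r' \<Longrightarrow> normal_of T' \<sigma> \<bullet> (y - p) < 0 \<Longrightarrow> y \<in> interior T'"
    by (rule local_face[OF assms(2,4) p]) blast
  define y where "y = p - (min r r' / 2) *\<^sub>R n"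
  have "0 < min r r' / 2" "min r r' / 2 < r" "min r r' / 2 < r'" using r(1) r'(1) by auto
  then have "y \<in> ball p r" "y \<in> ball p r'" "n \<bullet> (y - p) < 0"
    using nn n1 by (auto simp: y_def dist_norm)
  then have "y \<in> interior T \<inter> interior T'" using r(2) r'(2) assms(5) by (auto simp: n_def)
  then show False using interiors_disjoint[OF assms(1,2)] ne by auto
qed

abbreviation face_sum :: "pt set \<Rightarrow> (pt set \<Rightarrow> pt \<Rightarrow> real) \<Rightarrow> real" where
  "face_sum T h \<equiv> \<Sum>\<sigma>\<in>F T. face_integral \<sigma> (h \<sigma>)"

section \<open>The cells on the two sides of a face\<close>

abbreviation cells_at :: "pt set \<Rightarrow> pt set set" where
  "cells_at \<sigma> \<equiv> {T\<in>Th. \<sigma> \<in> F T}"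

text \<open>A generic point \<open>p\<close> of the face lies in \<open>\<Omega>\<close>. A short
  step along the normal leaves \<open>T1\<close> and reaches another cell \<open>T2\<close>, which
  also contains \<open>p\<close> and has it on its frontier, so \<open>T2\<close> has the same face.
  A third cell would repeat one of the two normals.\<close>

lemma interior_face_cells:
  assumes s: "\<sigma> \<in> Eh" "\<not> \<sigma> \<subseteq> frontier \<Omega>"
  obtains T1 T2 where "T1 \<noteq> T2" "T1 \<in> Th" "T2 \<in> Th" "cells_at \<sigma> = {T1, T2}"
    "normal_of T2 \<sigma> = - normal_of T1 \<sigma>"
proof -
  obtain T1 where T1: "T1 \<in> Th" "\<sigma> \<in> F T1" using face_has_cell[OF s(1)] by blast
  define n where "n = normal_of T1 \<sigma>"
  have un: "unit_normal \<sigma> n" using unit_normal_of[OF T1] by (simp add: n_def)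
  have nn: "norm n = 1" using un by (simp add: unit_normal_def)
  then have n1: "n \<bullet> n = 1" by (simp add: dot_square_norm)
  have "\<Omega> \<inter> \<sigma> \<noteq> {}"
    using s(2) faces_subset_closure[OF s(1)] open_domain by (auto simp: frontier_def interior_open)
  then obtain p where p: "p \<in> \<Omega>" "p \<in> \<sigma>" "p \<notin> skel" by (rule generic_point[OF s(1) open_domain])
  obtain r where r: "r > 0" "\<And>y. y \<in> ball p r \<Longrightarrow> n \<bullet> (y - p) < 0 \<Longrightarrow> y \<in> interior T1"
    "\<And>y. y \<in> ball p r \<Longrightarrow> n \<bullet> (y - p) > 0 \<Longrightarrow> y \<notin> T1"
    unfolding n_def by (rule local_face[OF T1 p(2,3)]) blast
  \<comment> \<open>Cells that do not contain \<open>p\<close> keep a positive distance from it, so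
    every cell reached by a short step contains \<open>p\<close>.\<close>
  have "closed (\<Union>{T\<in>Th. p \<notin> T})" using finite_Th cell_closed by (intro closed_Union) auto
  then obtain d where d: "d > 0" "ball p d \<subseteq> - \<Union>{T\<in>Th. p \<notin> T}"
    using closed_avoid_ball[of "\<Union>{T\<in>Th. p \<notin> T}" p] by auto
  obtain d' where d': "d' > 0" "ball p d' \<subseteq> \<Omega>" using p(1) open_domain open_contains_ball by blast
  define t where "t = min r (min d d') / 2"
  have t: "0 < t" "t < r" "t < d" "t < d'" using r(1) d(1) d'(1) by (auto simp: t_def)
  define y where "y = p + t *\<^sub>R n"
  have yb: "dist p y = t" using nn t by (simp add: y_def dist_norm)
  have "y \<in> closure \<Omega>" using yb t d'(2) closure_subset by (auto simp: subset_iff)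
  then obtain T2 where T2: "T2 \<in> Th" "y \<in> T2" using Union_Th by blast
  have pT2: "p \<in> T2" using T2 d(2) yb t by (auto simp: subset_iff)
  have "y \<notin> T1" using r(3)[of y] yb t n1 by (simp add: y_def)
  then have ne: "T1 \<noteq> T2" using T2 by blast
  have "p \<notin> interior T2"
  proof
    assume "p \<in> interior T2"
    then obtain c where c: "c > 0" "ball p c \<subseteq> interior T2" using open_contains_ball[of "interior T2"] by auto
    define z where "z = p - (min c r / 2) *\<^sub>R n"
    have "0 < min c r / 2" "min c r / 2 < c" "min c r / 2 < r" using c(1) r(1) by auto
    then have "z \<in> ball p c" "z \<in> ball p r" "n \<bullet> (z - p) < 0" using nn n1 by (auto simp: z_def dist_norm)
    then have "z \<in> interior T1 \<inter> interior T2" using c(2) r(2) by blast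
    then show False using interiors_disjoint[OF T1(1) T2(1) ne] by blast
  qed
  then have "p \<in> frontier T2" using pT2 closure_subset by (auto simp: frontier_def)
  then obtain \<sigma>' where "\<sigma>' \<in> F T2" "p \<in> \<sigma>'" using frontier_in_face[OF T2(1)] by blast
  then have sT2: "\<sigma> \<in> F T2" using not_skelD(2)[OF p(3) s(1) p(2)] faces_in_Eh by metis
  have normals: "normal_of T \<sigma> = n \<or> normal_of T \<sigma> = - n" if "T \<in> Th" "\<sigma> \<in> F T" for T
    using unit_normal_unique[OF face[OF s(1)] un unit_normal_of[OF that]] .
  have n2: "normal_of T2 \<sigma> = - n"
    using normals[OF T2(1) sT2] same_normal_same_cell[OF T1(1) T2(1) T1(2) sT2] ne by (auto simp: n_def)
  have "T = T1 \<or> T = T2" if "T \<in> Th" "\<sigma> \<in> F T" for T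
    using normals[OF that] same_normal_same_cell[OF T1(1) that(1) T1(2) that(2)]
      same_normal_same_cell[OF T2(1) that(1) sT2 that(2)] n2 by (auto simp: n_def)
  then have "cells_at \<sigma> = {T1, T2}" using T1 T2 sT2 by blast
  then show ?thesis using that ne T1 T2 n2 by (auto simp: n_def)
qed

lemma interior_face_normals:
  assumes "\<sigma> \<in> Eh" "\<not> \<sigma> \<subseteq> frontier \<Omega>"
  shows "(\<Sum>T\<in>cells_at \<sigma>. normal_of T \<sigma>) = 0"
proof -
  obtain T1 T2 where "T1 \<noteq> T2" "cells_at \<sigma> = {T1, T2}" "normal_of T2 \<sigma> = - normal_of T1 \<sigma>"
    by (rule interior_face_cells[OF assms]) blast
  then show ?thesis by simp
qed

text \<open>The two half balls at \<open>p\<close> lie in the two adjacent cells. What a small ball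
  has outside \<open>closure \<Omega>\<close> is thus an open set inside a plane, hence empty, and
  \<open>\<Omega>\<close> is the interior of its closure.\<close>

lemma interior_face_generic:
  assumes s: "\<sigma> \<in> Eh" "\<not> \<sigma> \<subseteq> frontier \<Omega>" and p: "p \<in> \<sigma>" "p \<notin> skel"
  shows "p \<in> \<Omega>"
proof -
  obtain T1 T2 where T: "T1 \<in> Th" "T2 \<in> Th" "cells_at \<sigma> = {T1, T2}"
    "normal_of T2 \<sigma> = - normal_of T1 \<sigma>" by (rule interior_face_cells[OF s]) blast
  then have sT: "\<sigma> \<in> F T1" "\<sigma> \<in> F T2" by blast+
  define n where "n = normal_of T1 \<sigma>"
  have nn: "norm n = 1" using unit_normal_of[OF T(1) sT(1)] by (simp add: unit_normal_def n_def)
  obtain r where r: "r > 0" "\<And>y. y \<in> ball p r \<Longrightarrow> n \<bullet> (y - p) < 0 \<Longrightarrow> y \<in> interior T1"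
    unfolding n_def by (rule local_face[OF T(1) sT(1) p]) blast
  obtain r' where r': "r' > 0" "\<And>y. y \<in> ball p r' \<Longrightarrow> (- n) \<bullet> (y - p) < 0 \<Longrightarrow> y \<in> interior T2"
    unfolding n_def T(4)[symmetric] by (rule local_face[OF T(2) sT(2) p]) blast
  let ?U = "ball p (min r r') - closure \<Omega>"
  have "?U \<subseteq> {y. n \<bullet> y = n \<bullet> p}"
  proof
    fix y assume y: "y \<in> ?U"
    then have "y \<notin> T1" "y \<notin> T2" using cell_subset T(1,2) by blast+
    then have "\<not> n \<bullet> (y - p) < 0" "\<not> (- n) \<bullet> (y - p) < 0"
      using r(2)[of y] r'(2)[of y] y interior_subset by auto
    then show "y \<in> {y. n \<bullet> y = n \<bullet> p}" by (simp add: inner_simps)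
  qed
  moreover have "n \<noteq> 0" using nn by auto
  ultimately have "negligible ?U" using negligible_hyperplane negligible_subset by blast
  then have "?U = {}" by (intro open_negligible_empty) auto
  then have "ball p (min r r') \<subseteq> closure \<Omega>" by blast
  then have "p \<in> interior (closure \<Omega>)" unfolding mem_interior using r(1) r'(1) by (intro exI[of _ "min r r'"]) auto
  then show ?thesis by (simp add: interior_closure_domain)
qed

section \<open>Connectivity of the cells through faces\<close>

lemma interior_avoids_cells:
  assumes "T \<in> Th" "T' \<in> Th" "T' \<noteq> T" "x \<in> T'"
  shows "x \<notin> interior T"
proof
  assume "x \<in> interior T"
  moreover have "x \<in> closure (interior T')" using assms cell_closure_interior(1) by auto
  ultimately have "interior T \<inter> interior T' \<noteq> {}"
    using open_Int_closure_eq_empty[OF open_interior, of T "interior T'"] by blast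
  then show False using interiors_disjoint assms by blast
qed

text \<open>A common point is on the frontier of both cells, hence on a face of each; off the
  skeleton the two faces coincide.\<close>

lemma shared_point_face:
  assumes "T \<in> Th" "T' \<in> Th" "T \<noteq> T'" "p \<in> T" "p \<in> T'" "p \<notin> skel"
  shows "\<exists>\<sigma>. \<sigma> \<in> F T \<and> \<sigma> \<in> F T'"
proof -
  have "p \<in> frontier T" "p \<in> frontier T'"
    using interior_avoids_cells[of T T'] interior_avoids_cells[of T' T] assms closure_subset by (auto simp: frontier_def)
  then obtain \<sigma> \<sigma>' where "\<sigma> \<in> F T" "p \<in> \<sigma>" "\<sigma>' \<in> F T'" "p \<in> \<sigma>'"
    using frontier_in_face[OF assms(1)] frontier_in_face[OF assms(2)] by metis
  then show ?thesis using not_skelD(2)[OF assms(6)] faces_in_Eh by metis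
qed

text \<open>If the value changed, two closed unions of cells would cover the segment and, by
  connectedness, meet on it. The common point is off the skeleton, so two cells with different
  values would share a face.\<close>

lemma face_connected_segment:
  assumes c: "\<And>T T' \<sigma>. T \<in> Th \<Longrightarrow> T' \<in> Th \<Longrightarrow> \<sigma> \<in> F T \<Longrightarrow> \<sigma> \<in> F T' \<Longrightarrow> c T = c T'"
    and seg: "closed_segment x y \<subseteq> closure \<Omega>" "closed_segment x y \<inter> skel = {}"
    and T: "T \<in> Th" "T' \<in> Th" "x \<in> T" "y \<in> T'"
  shows "c T = c T'"
proof (rule ccontr)
  assume ne: "c T \<noteq> c T'"
  define A where "A = \<Union>{S\<in>Th. c S = c T}"
  define B where "B = \<Union>{S\<in>Th. c S \<noteq> c T}"
  have "closed A" "closed B" unfolding A_def B_def using finite_Th cell_closed by (auto intro!: closed_Union)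
  moreover have "closed_segment x y \<subseteq> A \<union> B" using seg(1) Union_Th unfolding A_def B_def by blast
  moreover have "A \<inter> B \<inter> closed_segment x y = {}"
  proof (rule ccontr)
    assume "A \<inter> B \<inter> closed_segment x y \<noteq> {}"
    then obtain p S S' where p: "p \<in> closed_segment x y" "S \<in> Th" "c S = c T" "p \<in> S" "S' \<in> Th" "c S' \<noteq> c T" "p \<in> S'"
      unfolding A_def B_def by blast
    then have "S \<noteq> S'" "p \<notin> skel" using seg(2) by auto
    then obtain \<sigma> where "\<sigma> \<in> F S" "\<sigma> \<in> F S'" using shared_point_face p by metis
    then show False using c p by metis
  qed
  moreover have "A \<inter> closed_segment x y \<noteq> {}" "B \<inter> closed_segment x y \<noteq> {}"
    unfolding A_def B_def using T(1,3) ends_in_segment(1)[of x y] apply blast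
    unfolding B_def using T(2,4) ne ends_in_segment(2)[of x y] by force
  ultimately show False
    using connected_segment(1)[of x y] unfolding connected_closed by blast
qed

lemma interior_cells_dense:
  assumes "open U" "U \<inter> \<Omega> \<noteq> {}"
  shows "\<exists>T\<in>Th. U \<inter> interior T \<noteq> {}"
proof -
  obtain x where "x \<in> U" "x \<in> \<Omega>" using assms by blast
  then obtain T where T: "T \<in> Th" "x \<in> T" using Union_Th closure_subset by blast
  then have "U \<inter> closure (interior T) \<noteq> {}" using cell_closure_interior \<open>x \<in> U\<close> by auto
  then show ?thesis using open_Int_closure_eq_empty[OF assms(1)] T by blast
qed

text \<open>Contact along an edge or at a vertex does not transmit the value, so the paths between
  cells have to avoid the skeleton. Inside a ball in \<open>\<Omega>\<close> two cells are joined by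
  a segment off the skeleton; connectedness of \<open>\<Omega>\<close> makes this global.\<close>

lemma face_connected:
  assumes c: "\<And>T T' \<sigma>. T \<in> Th \<Longrightarrow> T' \<in> Th \<Longrightarrow> \<sigma> \<in> F T \<Longrightarrow> \<sigma> \<in> F T' \<Longrightarrow> c T = c T'"
    and T: "T0 \<in> Th" "T1 \<in> Th"
  shows "c T0 = c T1"
proof -
  define I where "I = (\<Union>T\<in>Th. interior T)"
  obtain x0 x1 where x: "x0 \<in> interior T0" "x1 \<in> interior T1" using cell_closure_interior(2) T by blast
  define R where "R x y \<longleftrightarrow> (\<forall>T\<in>Th. \<forall>T'\<in>Th. x \<in> interior T \<longrightarrow> y \<in> interior T' \<longrightarrow> c T = c T')" for x y
  define Q where "Q y \<longleftrightarrow> (\<forall>T'\<in>Th. y \<in> interior T' \<longrightarrow> c T' = c T0)" for y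
  have "Q x1"
  \<comment> \<open>The induction runs over points in cell interiors, which are dense, since a point
    on a face belongs to no definite cell.\<close>
  proof (rule connected_induction[OF connected_domain, where P = "\<lambda>x. x \<in> I" and a = x0])
    fix U a assume U: "openin (top_of_set \<Omega>) U" "a \<in> U"
    then have "open U" "U \<subseteq> \<Omega>" using openin_open_eq[OF open_domain] by auto
    then show "\<exists>z. z \<in> U \<and> z \<in> I" using interior_cells_dense[of U] U unfolding I_def by blast
  next
    fix a assume a: "a \<in> \<Omega>"
    then obtain r where r: "r > 0" "ball a r \<subseteq> \<Omega>" using open_domain open_contains_ball by blast
    have "Q y" if xy: "x \<in> ball a r" "y \<in> ball a r" "x \<in> I" "y \<in> I" "Q x" for x y
      unfolding Q_def
    proof (intro ballI impI)
      fix T' assume T': "T' \<in> Th" "y \<in> interior T'"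
      obtain T where T: "T \<in> Th" "x \<in> interior T" using xy by (auto simp: I_def)
      have "interior T \<inter> ball a r \<noteq> {}" "interior T' \<inter> ball a r \<noteq> {}" using T T' xy by auto
      then obtain u v where uv: "u \<in> interior T \<inter> ball a r" "v \<in> interior T' \<inter> ball a r" "closed_segment u v \<inter> skel = {}"
        by (metis segment_off_skel open_Int open_interior open_ball)
      have "closed_segment u v \<subseteq> ball a r"
        using uv by (intro closed_segment_subset convex_ball) auto
      then have "closed_segment u v \<subseteq> closure \<Omega>" using r(2) closure_subset by blast
      have "c T = c T'"
      proof (rule face_connected_segment[of c u v T T'])
        show "c S = c S'" if "S \<in> Th" "S' \<in> Th" "\<sigma> \<in> F S" "\<sigma> \<in> F S'" for S S' \<sigma>
          using that by (rule c)
        show "u \<in> T" "v \<in> T'" using uv interior_subset by blast+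
      qed (fact \<open>closed_segment u v \<subseteq> closure \<Omega>\<close> uv(3) T(1) T'(1))+
      then show "c T' = c T0" using xy(5) T unfolding Q_def by auto
    qed
    then show "\<exists>U. openin (top_of_set \<Omega>) U \<and> a \<in> U \<and> (\<forall>x\<in>U. \<forall>y\<in>U. x \<in> I \<and> y \<in> I \<and> Q x \<longrightarrow> Q y)"
      using r by (intro exI[of _ "ball a r"]) (auto simp: openin_open_eq[OF open_domain])
  next
    show "x0 \<in> \<Omega>" "x1 \<in> \<Omega>" using x T interior_cell_subset by blast+
    show "x0 \<in> I" "x1 \<in> I" using x T by (auto simp: I_def)
    show "Q x0" unfolding Q_def
    proof (intro ballI impI)
      fix T' assume "T' \<in> Th" "x0 \<in> interior T'"
      then have "T' = T0" using x(1) interiors_disjoint[OF _ T(1)] by blast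
      then show "c T' = c T0" by simp
    qed
  qed
  then show ?thesis using x T by (auto simp: Q_def)
qed

lemma connected_face:
  assumes "\<sigma> \<in> Eh"
  shows "connected \<sigma>"
proof -
  have "connected (rel_interior \<sigma>)" "closure (rel_interior \<sigma>) = \<sigma>"
    using face[OF assms] by (auto simp: polyhedral_cell_def)
  then show ?thesis using connected_imp_connected_closure by metis
qed

text \<open>Supplies a face on which functions in \<open>S_h\<close> are forced to be zero. A
  segment from far away into \<open>\<Omega>\<close>, off the skeleton, crosses the frontier of the
  outside at a point of a single face, and this connected face cannot leave the component.\<close>

lemma boundary_component_face:
  assumes "frontier (outside \<Omega>) \<subseteq> G" "G \<in> components (frontier \<Omega>)"
  obtains \<sigma> where "\<sigma> \<in> Eh" "\<sigma> \<subseteq> G"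
proof -
  obtain B where B: "\<Omega> \<subseteq> ball 0 B" using bounded_domain bounded_subset_ballD by blast
  have "- ball 0 B \<subseteq> outside \<Omega>" by (rule outside_subset_convex[OF convex_ball B])
  then have "- cball 0 B \<subseteq> outside \<Omega>" using ball_subset_cball by blast
  moreover have "- cball (0::pt) B \<noteq> {}" by (metis Compl_empty_eq bounded_cball compl_eq_compl_iff double_complement not_bounded_UNIV)
  ultimately obtain x y where xy: "x \<in> outside \<Omega>" "y \<in> \<Omega>" "closed_segment x y \<inter> skel = {}"
    using segment_off_skel[of "- cball 0 B" \<Omega>] open_domain domain_nonempty closed_cball
    by (metis open_Compl subsetD)
  have "y \<notin> outside \<Omega>" using xy(2) by (simp add: outside_def)
  then have "closed_segment x y \<inter> frontier (outside \<Omega>) \<noteq> {}"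
    using xy(1) by (intro connected_Int_frontier connected_segment) auto
  then obtain p where p: "p \<in> closed_segment x y" "p \<in> G" using assms(1) by blast
  have G: "G \<subseteq> frontier \<Omega>" using assms(2) in_components_subset by blast
  have ps: "p \<notin> skel" using p xy by blast
  have pO: "p \<notin> \<Omega>" "p \<in> closure \<Omega>" using p G open_domain by (auto simp: frontier_def interior_open)
  then obtain T where T: "T \<in> Th" "p \<in> T" using Union_Th by blast
  then have "p \<in> frontier T" using pO interior_cell_subset closure_subset by (fastforce simp: frontier_def)
  then obtain \<sigma> where s: "\<sigma> \<in> F T" "p \<in> \<sigma>" using frontier_in_face[OF T(1)] by blast
  then have sE: "\<sigma> \<in> Eh" using faces_in_Eh by blast
  then have "\<sigma> \<subseteq> frontier \<Omega>" using interior_face_generic[OF sE _ s(2) ps] pO by blast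
  then have "\<sigma> \<subseteq> G" using p(2) s(2) components_maximal[OF assms(2) _ ] connected_face[OF sE] by blast
  then show ?thesis using that sE by blast
qed

end

subsection \<open>The divergence theorem on a cell\<close>

text \<open>The derivative is the same map \<open>L\<close> at every point, so its determinant
  leaves the integral. Values pass through \<open>real^1\<close> to match the vector-valued change
  of variables theorem.\<close>

lemma change_of_variables_real:
  fixes f :: "pt \<Rightarrow> real" and g L :: "pt \<Rightarrow> pt"
  assumes S: "compact S" and f: "continuous_on (g ` S) f"
    and D: "\<And>x. x \<in> S \<Longrightarrow> (g has_derivative L) (at x within S)" and inj: "inj_on g S"
  shows "(LINT x:g ` S|lebesgue. f x) = \<bar>det (matrix L)\<bar> * (LINT x:S|lebesgue. f (g x))"
proof -
  have gc: "continuous_on S g"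
    using D by (meson continuous_on_eq_continuous_within has_derivative_continuous)
  have cg: "compact (g ` S)" using S gc by (rule compact_continuous_image[rotated])
  have fg: "continuous_on S (\<lambda>x. f (g x))"
    using continuous_on_compose2[OF f gc] by blast
  have aif: "f absolutely_integrable_on (g ` S)"
    using integrable_on_compact[OF cg f] .
  have aifg: "(\<lambda>x. f (g x)) absolutely_integrable_on S"
    using integrable_on_compact[OF S fg] .
  have Sm: "S \<in> sets lebesgue" using S by (simp add: lmeasurable_compact fmeasurableD)
  have "(\<lambda>x. \<bar>det (matrix L)\<bar> *\<^sub>R (vec (f (g x)) :: real^1)) absolutely_integrable_on S \<and>
    integral S (\<lambda>x. \<bar>det (matrix L)\<bar> *\<^sub>R (vec (f (g x)) :: real^1)) = vec (integral (g ` S) f)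
    \<longleftrightarrow> (\<lambda>x. vec (f x) :: real^1) absolutely_integrable_on (g ` S)
      \<and> integral (g ` S) (\<lambda>x. vec (f x) :: real^1) = vec (integral (g ` S) f)"
    using has_absolute_integral_change_of_variables[OF Sm D inj, of "\<lambda>x. vec (f x) :: real^1"] .
  moreover have "(\<lambda>x. vec (f x) :: real^1) absolutely_integrable_on (g ` S)"
    using aif by (simp add: absolutely_integrable_on_1_iff)
  moreover have "integral (g ` S) (\<lambda>x. vec (f x) :: real^1) = vec (integral (g ` S) f)"
    by (simp add: integral_on_1_eq)
  ultimately have "integral S (\<lambda>x. \<bar>det (matrix L)\<bar> *\<^sub>R (vec (f (g x)) :: real^1)) = vec (integral (g ` S) f)"
    by blast
  then have "integral S (\<lambda>x. \<bar>det (matrix L)\<bar> * f (g x)) = integral (g ` S) f"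
    by (simp add: integral_on_1_eq vec_eq_iff)
  then show ?thesis
    using set_lebesgue_integral_eq_integral(2)[OF aif] set_lebesgue_integral_eq_integral(2)[OF aifg] by simp
qed

text \<open>The matrix determinant lemma for the identity plus a rank-one map.\<close>

lemma det_rank_one_update:
  fixes n a :: "real^3"
  shows "det (matrix (\<lambda>v. v + (n \<bullet> v) *\<^sub>R a)) = 1 + n \<bullet> a"
  by (simp add: det_3 matrix_def inner_vec_def sum_3 axis_def algebra_simps)

text \<open>The region that the face sweeps when moved backwards along \<open>e\<close>. Translating
  a cell changes its indicator only on such prisms.\<close>

definition prism :: "pt \<Rightarrow> real \<Rightarrow> pt set \<Rightarrow> pt set" where
  "prism e t \<sigma> = {w. \<exists>s. 0 \<le> s \<and> s \<le> t \<and> w + s *\<^sub>R e \<in> \<sigma>}"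

lemma prism_compact:
  assumes "compact \<sigma>" shows "compact (prism e t \<sigma>)"
proof -
  have "prism e t \<sigma> = (\<lambda>(s, x). x - s *\<^sub>R e) ` ({0..t} \<times> \<sigma>)"
    unfolding prism_def by (force simp: image_iff)
  moreover have "continuous_on ({0..t} \<times> \<sigma>) (\<lambda>(s, x). x - s *\<^sub>R e)"
    unfolding case_prod_beta by (intro continuous_intros)
  ultimately show ?thesis using compact_continuous_image compact_Times[OF compact_Icc assms] by metis
qed

text \<open>The slanted prism is the image of the slab of unit thickness over \<open>\<sigma>\<close> under an affine map.\<close>

lemma prism_integral:
  assumes c: "polyhedral_cell 2 \<sigma>" "unit_normal \<sigma> n" "p \<in> \<sigma>" and ne: "n \<bullet> e \<noteq> 0" and t: "t > 0"
    and f: "continuous_on UNIV f"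
  shows "(LINT w:prism e t \<sigma>|lebesgue. f (w + t *\<^sub>R e))
    = t * \<bar>n \<bullet> e\<bar> * (LINT y:slab \<sigma>|lebesgue. f (proj n p y + (t * (1/2 - n \<bullet> (y - p))) *\<^sub>R e))"
proof -
  \<comment> \<open>The normal coordinate in the slab runs from \<open>-1/2\<close> to
    \<open>1/2\<close>; adding \<open>1/2\<close> and multiplying by \<open>t\<close> turns it into
    a travel time between \<open>0\<close> and \<open>t\<close>.\<close>
  define A where "A y = proj n p y - ((n \<bullet> (y - p) + 1/2) * t) *\<^sub>R e" for y
  define L where "L v = v + (n \<bullet> v) *\<^sub>R (- n - t *\<^sub>R e)" for v
  have nn: "norm n = 1" using c by (simp add: unit_normal_def)
  then have n1: "n \<bullet> n = 1" by (simp add: dot_square_norm)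
  have nproj: "n \<bullet> proj n p y = n \<bullet> p" for y
    using proj_in_plane[OF nn, of p y] by (simp add: inner_simps)
  have nA: "n \<bullet> A y = n \<bullet> p - ((n \<bullet> (y - p) + 1/2) * t) * (n \<bullet> e)" for y
    by (simp add: A_def inner_diff_right nproj)
  have yrep: "y = proj n p y + (n \<bullet> (y - p)) *\<^sub>R n" for y by (simp add: proj_def)
  have inj: "inj_on A S" for S
  proof (rule inj_onI)
    fix x y assume "A x = A y"
    then have "n \<bullet> A x = n \<bullet> A y" by simp
    then have "((n \<bullet> (x - p) + 1/2) * t) * (n \<bullet> e) = ((n \<bullet> (y - p) + 1/2) * t) * (n \<bullet> e)"
      using nA[of x] nA[of y] by linarith
    then have "(n \<bullet> (x - p) - n \<bullet> (y - p)) * (t * (n \<bullet> e)) = 0" by (simp add: algebra_simps)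
    then have eq: "n \<bullet> (x - p) = n \<bullet> (y - p)" using ne t by simp
    then have "proj n p x = proj n p y" using \<open>A x = A y\<close> by (simp add: A_def)
    then show "x = y" using yrep[of x] yrep[of y] eq by simp
  qed
  have D: "(A has_derivative L) (at x within S)" for x S
    unfolding A_def L_def proj_def
    by (auto intro!: derivative_eq_intros simp: inner_simps algebra_simps)
  have img: "A ` slab \<sigma> = prism e t \<sigma>"
  proof
    show "A ` slab \<sigma> \<subseteq> prism e t \<sigma>"
    proof
      fix w assume "w \<in> A ` slab \<sigma>"
      then obtain y where y: "w = A y" "proj n p y \<in> \<sigma>" "\<bar>n \<bullet> (y - p)\<bar> \<le> 1/2"
        unfolding slab_eq[OF c] by blast
      have "0 \<le> n \<bullet> (y - p) + 1/2" "n \<bullet> (y - p) + 1/2 \<le> 1" using y(3) by linarith+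
      then have "0 \<le> (n \<bullet> (y - p) + 1/2) * t" "(n \<bullet> (y - p) + 1/2) * t \<le> t"
        using t mult_right_mono[of "n \<bullet> (y - p) + 1/2" 1 t] by auto
      then show "w \<in> prism e t \<sigma>" unfolding prism_def
        using y(1,2) by (intro CollectI exI[of _ "(n \<bullet> (y - p) + 1/2) * t"]) (simp add: A_def)
    qed
    show "prism e t \<sigma> \<subseteq> A ` slab \<sigma>"
    proof
      fix w assume "w \<in> prism e t \<sigma>"
      then obtain s where s: "0 \<le> s" "s \<le> t" "w + s *\<^sub>R e \<in> \<sigma>" unfolding prism_def by blast
      define x where "x = w + s *\<^sub>R e"
      define y where "y = x + (s / t - 1/2) *\<^sub>R n"
      have nx: "n \<bullet> (x - p) = 0" using c s(3) by (simp add: unit_normal_def x_def)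
      have ny: "n \<bullet> (y - p) = s / t - 1/2" using nx n1 by (simp add: y_def inner_simps)
      have py: "proj n p y = x" by (simp add: proj_def ny) (simp add: y_def)
      have "s / t \<le> 1" "0 \<le> s / t" using s t by auto
      then have "\<bar>s / t - 1/2\<bar> \<le> 1/2" by linarith
      then have "y \<in> slab \<sigma>" unfolding slab_eq[OF c] using ny py s(3) by (simp add: x_def)
      moreover have "A y = w" using t by (simp add: A_def py ny) (simp add: x_def)
      ultimately show "w \<in> A ` slab \<sigma>" by blast
    qed
  qed
  \<comment> \<open>Here \<open>1 + n \<bullet> (- n - t *\<^sub>R e)\<close> equals
    \<open>- t * (n \<bullet> e)\<close>.\<close>
  have det: "\<bar>det (matrix L)\<bar> = t * \<bar>n \<bullet> e\<bar>"
    unfolding L_def det_rank_one_update using n1 t by (simp add: inner_diff_right abs_mult)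
  have "(LINT w:A ` slab \<sigma>|lebesgue. f (w + t *\<^sub>R e))
      = \<bar>det (matrix L)\<bar> * (LINT y:slab \<sigma>|lebesgue. f (A y + t *\<^sub>R e))"
    by (rule change_of_variables_real[OF slab_compact[OF c(1)] _ D inj])
      (intro continuous_on_compose2[OF f] continuous_intros, auto)
  moreover have "A y + t *\<^sub>R e = proj n p y + (t * (1/2 - n \<bullet> (y - p))) *\<^sub>R e" for y
    by (simp add: A_def algebra_simps flip: scaleR_add_left)
  ultimately show ?thesis unfolding img det by simp
qed

context polyhedral_mesh
begin

lemma face_line_hit:
  assumes "T \<in> Th" "\<sigma> \<in> F T" "normal_of T \<sigma> \<bullet> e \<noteq> 0" "w + s *\<^sub>R e \<in> \<sigma>" "w + s' *\<^sub>R e \<in> \<sigma>"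
  shows "s' = s"
proof -
  have "normal_of T \<sigma> \<bullet> ((w + s *\<^sub>R e) - (w + s' *\<^sub>R e)) = 0"
    using unit_normal_of[OF assms(1,2)] assms(4,5) unfolding unit_normal_def by blast
  then show ?thesis using assms(3) by (simp add: inner_simps flip: left_diff_distrib)
qed

text \<open>Along the line the indicator of the cell jumps exactly where a face is crossed transversally, by the sign of
  \<open>- n \<bullet> e\<close>.\<close>

lemma crossing_identity:
  assumes T: "T \<in> Th" and t: "t > 0"
    and w: "\<And>s. w + s *\<^sub>R e \<notin> skel" "w \<notin> frontier T" "w + t *\<^sub>R e \<notin> frontier T"
    and par: "\<And>\<sigma> s. \<sigma> \<in> F T \<Longrightarrow> normal_of T \<sigma> \<bullet> e = 0 \<Longrightarrow> w + s *\<^sub>R e \<notin> \<sigma>"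
  shows "indicator T w - indicator T (w + t *\<^sub>R e)
    = (\<Sum>\<sigma>\<in>F T. sgn (normal_of T \<sigma> \<bullet> e) * indicator (prism e t \<sigma>) w :: real)"
proof -
  define g where "g s = w + s *\<^sub>R e" for s
  define H where "H \<sigma> = {s. g s \<in> \<sigma>}" for \<sigma>
  define ch where "ch s = (if g s \<in> T then 1 else 0 :: real)" for s
  define c where "c \<sigma> = sgn (normal_of T \<sigma> \<bullet> e)" for \<sigma>
  \<comment> \<open>The signed count of crossings up to the parameter \<open>s\<close>; every face
    that the line meets is met only once.\<close>
  define N where "N s = (\<Sum>\<sigma>\<in>F T. c \<sigma> * (if \<exists>s'\<in>H \<sigma>. 0 \<le> s' \<and> s' \<le> s then 1 else 0))" for s
  have gcont: "continuous_on UNIV g" unfolding g_def by (intro continuous_intros)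
  have trans: "normal_of T \<sigma> \<bullet> e \<noteq> 0" if "\<sigma> \<in> F T" "s \<in> H \<sigma>" for \<sigma> s
    using par that by (auto simp: H_def g_def)
  have Huniq: "s' = s" if "\<sigma> \<in> F T" "s \<in> H \<sigma>" "s' \<in> H \<sigma>" for \<sigma> s s'
    using face_line_hit[OF T that(1) trans[OF that(1,2)]] that by (auto simp: H_def g_def)
  have Hfin: "finite (H \<sigma>)" if "\<sigma> \<in> F T" for \<sigma>
  proof (cases "H \<sigma> = {}")
    case False
    then obtain s where "s \<in> H \<sigma>" by blast
    then have "H \<sigma> \<subseteq> {s}" using Huniq[OF that] by blast
    then show ?thesis using finite_subset by blast
  qed simp
  then have finH: "finite (\<Union>\<sigma>\<in>F T. H \<sigma>)" using finite_faces by auto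
  have fr: "g s \<in> frontier T \<longleftrightarrow> s \<in> (\<Union>\<sigma>\<in>F T. H \<sigma>)" for s
    using Union_faces[OF T] by (auto simp: H_def)
  \<comment> \<open>Away from the frontier \<open>ch + N\<close> is locally constant in
    \<open>s\<close>. The induction skips the crossing parameters themselves, where the value of
    \<open>ch\<close> depends on which side the frontier is counted to.\<close>
  have "ch t + N t = ch 0 + N 0"
  proof (rule connected_induction[of "{0..t}" "\<lambda>s. g s \<notin> frontier T" "\<lambda>s. ch s + N s = ch 0 + N 0" 0 t])
    show "connected {0..t}" by simp
  next
    fix U a assume U: "openin (top_of_set {0..t}) U" "a \<in> U"
    then obtain d where d: "d > 0" "\<And>s. s \<in> {0..t} \<Longrightarrow> dist s a < d \<Longrightarrow> s \<in> U"
      unfolding openin_euclidean_subtopology_iff by blast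
    have a: "a \<in> {0..t}" using U openin_imp_subset by blast
    have "{max 0 (a - d)<..<min t (a + d)} \<subseteq> U" using d(2) by (auto simp: dist_real_def)
    moreover have "infinite {max 0 (a - d)<..<min t (a + d)}"
      using a d(1) t by (intro infinite_Ioo) auto
    ultimately have "infinite U" using finite_subset by blast
    then have "\<not> U \<subseteq> (\<Union>\<sigma>\<in>F T. H \<sigma>)" using finH finite_subset by blast
    then show "\<exists>z. z \<in> U \<and> g z \<notin> frontier T" using fr by blast
  next
    fix a assume a: "a \<in> {0..t}"
    obtain d where d: "d > 0" "\<And>s. s \<in> (\<Union>\<sigma>\<in>F T. H \<sigma>) \<Longrightarrow> s \<noteq> a \<Longrightarrow> d \<le> dist a s"
      using finite_set_avoid[OF finH, of a] by blast
    \<comment> \<open>Within distance \<open>d\<close> of \<open>a\<close> only a crossing at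
      \<open>a\<close> itself can change the count.\<close>
    have Nloc: "N s = (\<Sum>\<sigma>\<in>F T. c \<sigma> * (if \<exists>s'\<in>H \<sigma>. 0 \<le> s' \<and> s' < a then 1 else 0))
        + (\<Sum>\<sigma>\<in>F T. c \<sigma> * (if a \<in> H \<sigma> \<and> a \<le> s then 1 else 0))" if s: "\<bar>s - a\<bar> < d" for s
    proof -
      have "(if \<exists>s'\<in>H \<sigma>. 0 \<le> s' \<and> s' \<le> s then 1 else 0 :: real)
        = (if \<exists>s'\<in>H \<sigma>. 0 \<le> s' \<and> s' < a then 1 else 0) + (if a \<in> H \<sigma> \<and> a \<le> s then 1 else 0)"
        if f: "\<sigma> \<in> F T" for \<sigma>
      proof (cases "H \<sigma> = {}")
        case False
        then obtain h where h: "h \<in> H \<sigma>" by blast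
        then have Hh: "H \<sigma> = {h}" using Huniq[OF f] by blast
        have "h = a \<or> d \<le> \<bar>a - h\<bar>" using d(2)[of h] f h by (auto simp: dist_real_def)
        then show ?thesis
        proof
          assume "h = a"
          then show ?thesis using a by (simp add: Hh)
        next
          assume "d \<le> \<bar>a - h\<bar>"
          then have "h \<noteq> a" "h \<le> s \<longleftrightarrow> h < a" using s d(1) by linarith+
          then show ?thesis by (simp add: Hh)
        qed
      qed auto
      then show ?thesis unfolding N_def sum.distrib[symmetric] by (intro sum.cong) (auto simp: algebra_simps)
    qed
    have "\<exists>r>0. \<exists>C. \<forall>s. \<bar>s - a\<bar> < r \<longrightarrow> g s \<notin> frontier T \<longrightarrow> ch s + N s = C"
    proof (cases "g a \<in> frontier T")
      case False
      then have "a \<notin> H \<sigma>" if "\<sigma> \<in> F T" for \<sigma> using fr that by blast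
      then have z: "(\<Sum>\<sigma>\<in>F T. c \<sigma> * (if a \<in> H \<sigma> \<and> a \<le> s then 1 else 0)) = 0" for s
        by (intro sum.neutral) auto
      have "g a \<in> interior T \<or> g a \<in> - T"
        using False cell_closed[OF T] by (auto simp: frontier_def)
      then obtain r where r: "r > 0" "\<And>s. \<bar>s - a\<bar> < r \<Longrightarrow> ch s = ch a"
      proof
        assume "g a \<in> interior T"
        moreover have "open (g -` interior T)"
          using continuous_open_vimage[OF open_interior, of g] gcont by (simp add: continuous_on_eq_continuous_at)
        ultimately obtain r where r: "r > 0" "ball a r \<subseteq> g -` interior T" by (metis open_contains_ball vimageI)
        show ?thesis
        proof (rule that[OF r(1)])
          fix s assume "\<bar>s - a\<bar> < r"
          then have "s \<in> ball a r" "a \<in> ball a r" using r(1) by (auto simp: dist_real_def)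
          then have "g s \<in> T" "g a \<in> T" using r(2) interior_subset by blast+
          then show "ch s = ch a" by (simp add: ch_def)
        qed
      next
        assume "g a \<in> - T"
        moreover have "open (g -` (- T))"
          using continuous_open_vimage[of "- T" g] gcont cell_closed[OF T] by (simp add: continuous_on_eq_continuous_at open_Compl)
        ultimately obtain r where r: "r > 0" "ball a r \<subseteq> g -` (- T)" by (metis open_contains_ball vimageI)
        show ?thesis
        proof (rule that[OF r(1)])
          fix s assume "\<bar>s - a\<bar> < r"
          then have "s \<in> ball a r" "a \<in> ball a r" using r(1) by (auto simp: dist_real_def)
          then have "g s \<notin> T" "g a \<notin> T" using r(2) by blast+
          then show "ch s = ch a" by (simp add: ch_def)
        qed
      qed
      have "ch s + N s = ch a + (\<Sum>\<sigma>\<in>F T. c \<sigma> * (if \<exists>s'\<in>H \<sigma>. 0 \<le> s' \<and> s' < a then 1 else 0))"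
        if "\<bar>s - a\<bar> < min r d" for s
        using that r(2)[of s] Nloc[of s] z[of s] by simp
      then show ?thesis using r(1) d(1) by (meson min_less_iff_conj)
    next
      case True
      then obtain \<sigma> where s: "\<sigma> \<in> F T" "g a \<in> \<sigma>" using frontier_in_face[OF T] by blast
      define n where "n = normal_of T \<sigma>"
      have ga: "g a \<notin> skel" using w(1) by (simp add: g_def)
      have only: "a \<in> H \<sigma>' \<longleftrightarrow> \<sigma>' = \<sigma>" if "\<sigma>' \<in> F T" for \<sigma>'
        using not_skelD(2)[OF ga faces_in_Eh[OF s(1)] s(2)] faces_in_Eh that s(2) by (auto simp: H_def)
      have ne: "n \<bullet> e \<noteq> 0" using trans[OF s(1), of a] s(2) by (simp add: n_def H_def)
      have "(\<Sum>\<sigma>'\<in>F T. c \<sigma>' * (if a \<in> H \<sigma>' \<and> a \<le> s' then 1 else 0))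
          = (\<Sum>\<sigma>'\<in>F T. if \<sigma>' = \<sigma> then c \<sigma> * (if a \<le> s' then 1 else 0) else 0)" for s'
        using only by (intro sum.cong) auto
      then have z: "(\<Sum>\<sigma>'\<in>F T. c \<sigma>' * (if a \<in> H \<sigma>' \<and> a \<le> s' then 1 else 0)) = c \<sigma> * (if a \<le> s' then 1 else 0)" for s'
        using s(1) finite_faces by simp
      obtain r where r: "r > 0" "\<And>y. y \<in> ball (g a) r \<Longrightarrow> n \<bullet> (y - g a) < 0 \<Longrightarrow> y \<in> interior T"
        "\<And>y. y \<in> ball (g a) r \<Longrightarrow> n \<bullet> (y - g a) > 0 \<Longrightarrow> y \<notin> T"
        unfolding n_def by (rule local_face[OF T s ga]) blast
      define r' where "r' = r / (norm e + 1)"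
      have r': "r' > 0" using r(1) by (simp add: r'_def add_nonneg_pos)
      have gb: "g s' \<in> ball (g a) r" if "\<bar>s' - a\<bar> < r'" for s'
      proof -
        have "dist (g a) (g s') = \<bar>a - s'\<bar> * norm e" by (simp add: g_def dist_norm flip: scaleR_diff_left)
        also have "\<dots> \<le> \<bar>a - s'\<bar> * (norm e + 1)" by (intro mult_left_mono) auto
        also have "\<dots> < r' * (norm e + 1)" using that by (intro mult_strict_right_mono) (auto simp: abs_minus_commute add_nonneg_pos)
        also have "\<dots> = r" using norm_ge_zero[of e] by (simp add: r'_def del: norm_ge_zero)
        finally show ?thesis by simp
      qed
      have nga: "n \<bullet> (g s' - g a) = (s' - a) * (n \<bullet> e)" for s'
        by (simp add: g_def inner_simps algebra_simps)
      \<comment> \<open>Crossing outwards lowers \<open>ch\<close> by one while the positive sign of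
        \<open>n \<bullet> e\<close> raises the count by one; crossing inwards reverses
        both.\<close>
      have jump: "ch s' + c \<sigma> * (if a \<le> s' then 1 else 0) = (if n \<bullet> e > 0 then 1 else 0)"
        if s': "\<bar>s' - a\<bar> < r'" "g s' \<notin> frontier T" for s'
      proof -
        have "s' \<noteq> a" using s'(2) True by auto
        then consider "s' < a" "n \<bullet> e > 0" | "s' > a" "n \<bullet> e > 0" | "s' < a" "n \<bullet> e < 0" | "s' > a" "n \<bullet> e < 0"
          using ne by linarith
        then show ?thesis
        proof cases
          case 1
          then have "g s' \<in> T" using r(2)[OF gb[OF s'(1)]] interior_subset by (auto simp: nga mult_neg_pos)
          then show ?thesis using 1 by (simp add: ch_def)
        next
          case 2
          then have "g s' \<notin> T" using r(3)[OF gb[OF s'(1)]] by (auto simp: nga)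
          then show ?thesis using 2 by (simp add: ch_def c_def n_def)
        next
          case 3
          then have "g s' \<notin> T" using r(3)[OF gb[OF s'(1)]] by (auto simp: nga mult_neg_neg)
          then show ?thesis using 3 by (simp add: ch_def)
        next
          case 4
          then have "g s' \<in> T" using r(2)[OF gb[OF s'(1)]] interior_subset by (auto simp: nga mult_pos_neg)
          then show ?thesis using 4 by (simp add: ch_def c_def n_def)
        qed
      qed
      have "ch s + N s = (if n \<bullet> e > 0 then 1 else 0)
          + (\<Sum>\<sigma>\<in>F T. c \<sigma> * (if \<exists>s'\<in>H \<sigma>. 0 \<le> s' \<and> s' < a then 1 else 0))"
        if "\<bar>s - a\<bar> < min r' d" "g s \<notin> frontier T" for s
        using that jump[of s] Nloc[of s] z[of s] by simp
      then show ?thesis using r' d(1) by (meson min_less_iff_conj)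
    qed
    then obtain r C where r: "r > 0" "\<And>s. \<bar>s - a\<bar> < r \<Longrightarrow> g s \<notin> frontier T \<Longrightarrow> ch s + N s = C" by blast
    show "\<exists>U. openin (top_of_set {0..t}) U \<and> a \<in> U \<and> (\<forall>x\<in>U. \<forall>y\<in>U. g x \<notin> frontier T \<and> g y \<notin> frontier T
        \<and> ch x + N x = ch 0 + N 0 \<longrightarrow> ch y + N y = ch 0 + N 0)"
    proof (intro exI[of _ "{0..t} \<inter> ball a r"] conjI ballI impI)
      show "openin (top_of_set {0..t}) ({0..t} \<inter> ball a r)" by (simp add: openin_open_Int)
      show "a \<in> {0..t} \<inter> ball a r" using a r(1) by simp
      fix x y assume "x \<in> {0..t} \<inter> ball a r" "y \<in> {0..t} \<inter> ball a r"
        and xy: "g x \<notin> frontier T \<and> g y \<notin> frontier T \<and> ch x + N x = ch 0 + N 0"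
      then have "\<bar>x - a\<bar> < r" "\<bar>y - a\<bar> < r" by (auto simp: dist_real_def)
      then show "ch y + N y = ch 0 + N 0" using r(2)[of x] r(2)[of y] xy by simp
    qed
  next
    show "0 \<in> {0..t}" "t \<in> {0..t}" using t by auto
    show "g 0 \<notin> frontier T" "g t \<notin> frontier T" using w by (auto simp: g_def)
  qed simp
  moreover have "N 0 = 0"
  proof -
    have z: "0 \<notin> H \<sigma>" if "\<sigma> \<in> F T" for \<sigma> using fr[of 0] w(2) that by (auto simp: g_def)
    have "\<not> (\<exists>s'\<in>H \<sigma>. 0 \<le> s' \<and> s' \<le> 0)" if "\<sigma> \<in> F T" for \<sigma>
      using z[OF that] by (metis order_antisym)
    then show ?thesis unfolding N_def by (intro sum.neutral ballI) (simp only: if_False mult_zero_right)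
  qed
  moreover have "N t = (\<Sum>\<sigma>\<in>F T. sgn (normal_of T \<sigma> \<bullet> e) * indicator (prism e t \<sigma>) w)"
    unfolding N_def c_def by (intro sum.cong refl) (auto simp: prism_def indicator_def H_def g_def)
  ultimately show ?thesis by (auto simp: ch_def g_def indicator_def)
qed

text \<open>The crossing identity, integrated against \<open>f (w + t *\<^sub>R e)\<close>; the term
  with the shifted indicator is the integral over \<open>T\<close> by translation
  invariance.\<close>

lemma translated_cell_integral:
  assumes T: "T \<in> Th" and t: "t > 0" and f: "continuous_on UNIV f"
  shows "(LINT x:T|lebesgue. f (x + t *\<^sub>R e)) - (LINT x:T|lebesgue. f x)
    = (\<Sum>\<sigma>\<in>F T. sgn (normal_of T \<sigma> \<bullet> e) * (LINT w:prism e t \<sigma>|lebesgue. f (w + t *\<^sub>R e)))"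
proof -
  have fm: "f \<in> borel_measurable borel" using f by (simp add: borel_measurable_continuous_onI)
  have Tc: "compact T" using cell_compact T .
  have Tb: "T \<in> sets borel" using Tc by (simp add: compact_imp_closed borel_closed)
  have ft: "continuous_on S (\<lambda>w. f (w + t *\<^sub>R e))" for S
    by (intro continuous_on_compose2[OF f] continuous_intros) auto
  have i1: "integrable lebesgue (\<lambda>x. indicator T x * f (x + t *\<^sub>R e))"
    using integrable_on_compact[OF Tc ft] by (simp add: set_integrable_def)
  have i2: "integrable lborel (\<lambda>x. indicator T x *\<^sub>R f x)"
    by (rule borel_integrable_compact[OF Tc continuous_on_subset[OF f]]) simp
  have shift: "integral\<^sup>L lebesgue (\<lambda>w. indicator T (w + t *\<^sub>R e) * f (w + t *\<^sub>R e)) = (LINT x:T|lebesgue. f x)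
      \<and> integrable lebesgue (\<lambda>w. indicator T (w + t *\<^sub>R e) * f (w + t *\<^sub>R e))"
  proof -
    let ?h = "\<lambda>x. indicator T x * f x"
    have hm: "?h \<in> borel_measurable borel" using fm Tb by measurable
    have d: "distr lborel borel ((+) (t *\<^sub>R e)) = lborel" by (rule lborel_distr_plus)
    have "integrable (distr lborel borel ((+) (t *\<^sub>R e))) ?h" using i2 d by simp
    then have int: "integrable lborel (\<lambda>w. ?h (t *\<^sub>R e + w))"
      by (subst (asm) integrable_distr_eq) (use hm in auto)
    have "integral\<^sup>L lborel ?h = integral\<^sup>L (distr lborel borel ((+) (t *\<^sub>R e))) ?h" using d by simp
    also have "\<dots> = integral\<^sup>L lborel (\<lambda>w. ?h (t *\<^sub>R e + w))"
      by (rule integral_distr) (use hm in auto)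
    finally have "integral\<^sup>L lborel ?h = integral\<^sup>L lborel (\<lambda>w. ?h (t *\<^sub>R e + w))" .
    moreover have "integral\<^sup>L lebesgue ?h = integral\<^sup>L lborel ?h"
      by (rule integral_completion) (use hm in auto)
    moreover have "integral\<^sup>L lebesgue (\<lambda>w. ?h (t *\<^sub>R e + w)) = integral\<^sup>L lborel (\<lambda>w. ?h (t *\<^sub>R e + w))"
      by (rule integral_completion) (use int in auto)
    moreover have "integrable lebesgue (\<lambda>w. ?h (t *\<^sub>R e + w))"
      using int integrable_completion[of "\<lambda>w. ?h (t *\<^sub>R e + w)" lborel] borel_measurable_integrable[OF int] by simp
    ultimately show ?thesis by (simp add: set_lebesgue_integral_def add.commute)
  qed
  \<comment> \<open>A null set of starting points that contains every exception to the crossing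
    identity: lines through the skeleton, segments that start or end on the frontier, and points in
    the planes of faces. The last part excludes lines running inside a face.\<close>
  define Bad where "Bad = {w. \<exists>s. w + s *\<^sub>R e \<in> skel} \<union> frontier T \<union> ((+) (- (t *\<^sub>R e))) ` frontier T
    \<union> (\<Union>\<sigma>\<in>F T. affine hull \<sigma>)"
  have "negligible Bad"
    unfolding Bad_def using negligible_skel_sweep negligible_cell_frontier[OF T] finite_faces negligible_face(1) faces_in_Eh
    by (intro negligible_Un negligible_translation negligible_Union) auto
  then have "AE w in lebesgue. w \<notin> Bad"
    by (simp add: AE_not_in negligible_iff_null_sets)
  moreover have "indicator T w - indicator T (w + t *\<^sub>R e)
      = (\<Sum>\<sigma>\<in>F T. if normal_of T \<sigma> \<bullet> e = 0 then 0 else sgn (normal_of T \<sigma> \<bullet> e) * indicator (prism e t \<sigma>) w :: real)"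
    if w: "w \<notin> Bad" for w
  proof -
    have "w + s *\<^sub>R e \<notin> \<sigma>" if s: "\<sigma> \<in> F T" "normal_of T \<sigma> \<bullet> e = 0" for \<sigma> s
    proof
      assume m: "w + s *\<^sub>R e \<in> \<sigma>"
      have "w \<in> affine hull \<sigma>"
        unfolding face_affine_hull[OF face_of_cell[OF s(1)] unit_normal_of[OF T s(1)] m]
        using s(2) by (simp add: inner_simps)
      then show False using w s(1) unfolding Bad_def by blast
    qed
    moreover have "w + t *\<^sub>R e \<notin> frontier T"
    proof
      assume "w + t *\<^sub>R e \<in> frontier T"
      then have "- (t *\<^sub>R e) + (w + t *\<^sub>R e) \<in> ((+) (- (t *\<^sub>R e))) ` frontier T" by blast
      then show False using w unfolding Bad_def by simp
    qed
    ultimately have "indicator T w - indicator T (w + t *\<^sub>R e)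
      = (\<Sum>\<sigma>\<in>F T. sgn (normal_of T \<sigma> \<bullet> e) * indicator (prism e t \<sigma>) w :: real)"
      using w T t by (intro crossing_identity) (auto simp: Bad_def)
    also have "\<dots> = (\<Sum>\<sigma>\<in>F T. if normal_of T \<sigma> \<bullet> e = 0 then 0 else sgn (normal_of T \<sigma> \<bullet> e) * indicator (prism e t \<sigma>) w)"
      by (intro sum.cong) auto
    finally show ?thesis .
  qed
  ultimately have ae: "AE w in lebesgue. indicator T w * f (w + t *\<^sub>R e) - indicator T (w + t *\<^sub>R e) * f (w + t *\<^sub>R e)
      = (\<Sum>\<sigma>\<in>F T. (if normal_of T \<sigma> \<bullet> e = 0 then 0 else sgn (normal_of T \<sigma> \<bullet> e) * indicator (prism e t \<sigma>) w) * f (w + t *\<^sub>R e))"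
    by (auto simp: sum_distrib_right[symmetric] left_diff_distrib[symmetric] elim!: eventually_mono)
  have ip: "integrable lebesgue (\<lambda>w. (if normal_of T \<sigma> \<bullet> e = 0 then 0 else sgn (normal_of T \<sigma> \<bullet> e) * indicator (prism e t \<sigma>) w) * f (w + t *\<^sub>R e))"
    if "\<sigma> \<in> F T" for \<sigma>
  proof -
    have "set_integrable lebesgue (prism e t \<sigma>) (\<lambda>w. f (w + t *\<^sub>R e))"
      using integrable_on_compact[OF prism_compact ft] face_compact face_of_cell that by blast
    then show ?thesis unfolding set_integrable_def by (cases "normal_of T \<sigma> \<bullet> e = 0") (simp_all add: mult.assoc)
  qed
  have "(LINT x:T|lebesgue. f (x + t *\<^sub>R e)) - (LINT x:T|lebesgue. f x)
     = integral\<^sup>L lebesgue (\<lambda>w. indicator T w * f (w + t *\<^sub>R e) - indicator T (w + t *\<^sub>R e) * f (w + t *\<^sub>R e))"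
    using i1 shift by (simp add: set_lebesgue_integral_def)
  also have "\<dots> = integral\<^sup>L lebesgue (\<lambda>w. \<Sum>\<sigma>\<in>F T. (if normal_of T \<sigma> \<bullet> e = 0 then 0 else sgn (normal_of T \<sigma> \<bullet> e) * indicator (prism e t \<sigma>) w) * f (w + t *\<^sub>R e))"
    using ae i1 shift ip by (intro integral_cong_AE) auto
  also have "\<dots> = (\<Sum>\<sigma>\<in>F T. integral\<^sup>L lebesgue (\<lambda>w. (if normal_of T \<sigma> \<bullet> e = 0 then 0 else sgn (normal_of T \<sigma> \<bullet> e) * indicator (prism e t \<sigma>) w) * f (w + t *\<^sub>R e)))"
    by (intro Bochner_Integration.integral_sum ip)
  also have "\<dots> = (\<Sum>\<sigma>\<in>F T. sgn (normal_of T \<sigma> \<bullet> e) * (LINT w:prism e t \<sigma>|lebesgue. f (w + t *\<^sub>R e)))"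
  proof (intro sum.cong refl)
    fix \<sigma>
    show "integral\<^sup>L lebesgue (\<lambda>w. (if normal_of T \<sigma> \<bullet> e = 0 then 0 else sgn (normal_of T \<sigma> \<bullet> e) * indicator (prism e t \<sigma>) w) * f (w + t *\<^sub>R e))
      = sgn (normal_of T \<sigma> \<bullet> e) * (LINT w:prism e t \<sigma>|lebesgue. f (w + t *\<^sub>R e))"
      by (cases "normal_of T \<sigma> \<bullet> e = 0") (simp_all add: set_lebesgue_integral_def mult.assoc)
  qed
  finally show ?thesis .
qed

text \<open>The translation formula divided by the step, in the limit of small steps. The left side
  tends to the integral of the partial derivative. On the right the thickness of a prism is
  proportional to \<open>\<bar>n \<bullet> e\<bar>\<close>, which the sign of the crossing turns
  into \<open>n $ i\<close>.\<close>

theorem gauss_cell: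
  fixes f :: "pt \<Rightarrow> real"
  assumes T: "T \<in> Th" and f: "\<And>x. f differentiable (at x)" "continuous_on UNIV (partial i f)"
  shows "(LINT x:T|lebesgue. partial i f x) = (\<Sum>\<sigma>\<in>F T. normal_of T \<sigma> $ i * face_integral \<sigma> f)"
proof -
  define e where "e = axis i (1::real)"
  define \<tau> where "\<tau> m = 1 / real (Suc m)" for m
  have \<tau>: "\<tau> m > 0" "\<tau> m \<le> 1" for m by (auto simp: \<tau>_def)
  have \<tau>0: "\<tau> \<longlonglongrightarrow> 0" unfolding \<tau>_def by (rule LIMSEQ_inverse_real_of_nat[unfolded inverse_eq_divide])
  have fc: "continuous_on UNIV f"
    using f(1) by (simp add: continuous_at_imp_continuous_on differentiable_imp_continuous_within)
  have Tc: "compact T" using cell_compact T .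
  have ne: "normal_of T \<sigma> \<bullet> e = normal_of T \<sigma> $ i" for \<sigma> by (simp add: e_def inner_axis)
  have along: "((\<lambda>s. f (x + s *\<^sub>R e)) has_real_derivative partial i f (x + s *\<^sub>R e)) (at s)" for x s
  proof -
    have D: "(f has_derivative frechet_derivative f (at (x + s *\<^sub>R e))) (at (x + s *\<^sub>R e))"
      using f(1) frechet_derivative_works by blast
    have "((\<lambda>s. f (x + s *\<^sub>R e)) has_derivative (\<lambda>h. frechet_derivative f (at (x + s *\<^sub>R e)) (h *\<^sub>R e))) (at s)"
      by (rule has_derivative_compose[of "\<lambda>s. x + s *\<^sub>R e" "\<lambda>h. h *\<^sub>R e" s UNIV f, OF _ D]) (auto intro!: derivative_eq_intros)
    moreover have "frechet_derivative f (at (x + s *\<^sub>R e)) (h *\<^sub>R e) = h * partial i f (x + s *\<^sub>R e)" for h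
      using linear_scale[OF has_derivative_linear[OF D]] by (simp add: partial_def e_def)
    ultimately show ?thesis by (simp add: has_field_derivative_def mult.commute[of _ "partial i f (x + s *\<^sub>R e)"])
  qed
  obtain R where R: "T \<subseteq> cball 0 R" using compact_imp_bounded[OF Tc] unfolding bounded_iff by (metis mem_cball_0 subsetI)
  \<comment> \<open>The steps are at most one, so all shifted points stay in the enlarged ball and
    one bound serves every difference quotient.\<close>
  obtain C where C: "\<And>x. x \<in> cball 0 (R + 1) \<Longrightarrow> \<bar>partial i f x\<bar> \<le> C"
    by (rule continuous_on_compact_bound[OF compact_cball[of 0 "R + 1"] continuous_on_subset[OF f(2) subset_UNIV]]) auto
  have quot: "norm ((f (x + \<tau> m *\<^sub>R e) - f x) / \<tau> m) \<le> C" if "x \<in> T" for x m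
  proof -
    have "\<exists>z. 0 < z \<and> z < \<tau> m \<and> f (x + \<tau> m *\<^sub>R e) - f (x + 0 *\<^sub>R e) = (\<tau> m - 0) * partial i f (x + z *\<^sub>R e)"
      by (rule MVT2[OF \<tau>(1)]) (rule along)
    then obtain z where z: "0 < z" "z < \<tau> m" "f (x + \<tau> m *\<^sub>R e) - f x = \<tau> m * partial i f (x + z *\<^sub>R e)" by auto
    have "norm (x + z *\<^sub>R e) \<le> norm x + \<bar>z\<bar>"
      using norm_triangle_ineq[of x "z *\<^sub>R e"] by (simp add: e_def)
    also have "\<dots> \<le> R + 1" using R that z \<tau>(2)[of m] by (auto simp: subset_iff)
    finally have "\<bar>partial i f (x + z *\<^sub>R e)\<bar> \<le> C" by (intro C) auto
    then show ?thesis using z(3) \<tau>(1)[of m] by simp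
  qed
  have l1: "(\<lambda>m. LINT x:T|lebesgue. (f (x + \<tau> m *\<^sub>R e) - f x) / \<tau> m) \<longlonglongrightarrow> (LINT x:T|lebesgue. partial i f x)"
    unfolding set_lebesgue_integral_def
  proof (rule integral_dominated_convergence[where w = "\<lambda>x. indicator T x *\<^sub>R C"])
    show "(\<lambda>x. indicator T x *\<^sub>R partial i f x) \<in> borel_measurable lebesgue"
      using integrable_on_compact[OF Tc continuous_on_subset[OF f(2)]] by (auto simp: set_integrable_def)
    have q: "continuous_on T (\<lambda>x. (f (x + \<tau> m *\<^sub>R e) - f x) / \<tau> m)" for m
      using \<tau>(1)[of m] continuous_on_subset[OF fc]
      by (intro continuous_intros continuous_on_compose2[OF fc]) auto
    show "(\<lambda>x. indicator T x *\<^sub>R ((f (x + \<tau> m *\<^sub>R e) - f x) / \<tau> m)) \<in> borel_measurable lebesgue" for m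
      using borel_measurable_integrable[OF integrable_on_compact[OF Tc q, unfolded set_integrable_def]] .
    show "integrable lebesgue (\<lambda>x. indicator T x *\<^sub>R C)"
      using integrable_on_compact[OF Tc continuous_on_const, of C] unfolding set_integrable_def .
    show "AE x in lebesgue. (\<lambda>m. indicator T x *\<^sub>R ((f (x + \<tau> m *\<^sub>R e) - f x) / \<tau> m)) \<longlonglongrightarrow> indicator T x *\<^sub>R partial i f x"
    proof (intro AE_I2 tendsto_intros)
      fix x
      have "((\<lambda>h. (f (x + (0 + h) *\<^sub>R e) - f (x + 0 *\<^sub>R e)) / h) \<longlongrightarrow> partial i f (x + 0 *\<^sub>R e)) (at 0)"
        using along[of x 0] by (simp add: DERIV_def)
      moreover have "filterlim \<tau> (at 0) sequentially"
        using \<tau>0 \<tau>(1) by (intro filterlim_atI) (auto simp: less_imp_neq[symmetric] eventually_sequentially)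
      ultimately show "(\<lambda>m. (f (x + \<tau> m *\<^sub>R e) - f x) / \<tau> m) \<longlonglongrightarrow> partial i f x"
        using filterlim_compose by fastforce
    qed
    show "AE x in lebesgue. norm (indicator T x *\<^sub>R ((f (x + \<tau> m *\<^sub>R e) - f x) / \<tau> m)) \<le> indicator T x *\<^sub>R C" for m
      using quot[of _ m] by (intro AE_I2) (auto simp: indicator_def)
  qed
  have l2: "(\<lambda>m. sgn (normal_of T \<sigma> \<bullet> e) * (LINT w:prism e (\<tau> m) \<sigma>|lebesgue. f (w + \<tau> m *\<^sub>R e)) / \<tau> m)
      \<longlonglongrightarrow> normal_of T \<sigma> $ i * face_integral \<sigma> f" if s: "\<sigma> \<in> F T" for \<sigma>
  proof (cases "normal_of T \<sigma> \<bullet> e = 0")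
    case True
    then show ?thesis using ne[of \<sigma>] by simp
  next
    case False
    define n where "n = normal_of T \<sigma>"
    have c2: "polyhedral_cell 2 \<sigma>" using face_of_cell s .
    have un: "unit_normal \<sigma> n" using unit_normal_of[OF T s] by (simp add: n_def)
    obtain p where p: "p \<in> \<sigma>" using face_nonempty[OF c2] by blast
    have sc: "compact (slab \<sigma>)" by (rule slab_compact[OF c2])
    \<comment> \<open>The argument of \<open>f\<close> in \<open>prism_integral\<close>; it
      collapses to the projection onto the face as the step tends to zero.\<close>
    define P where "P m y = proj n p y + (\<tau> m * (1/2 - n \<bullet> (y - p))) *\<^sub>R e" for m y
    have Pc: "continuous_on S (P m)" for S m
      unfolding P_def by (intro continuous_intros continuous_on_proj)
    have P0: "(\<lambda>m. P m y) \<longlonglongrightarrow> proj n p y" for y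
      unfolding P_def using \<tau>0 by (auto intro!: tendsto_eq_intros)
    obtain R2 where R2: "\<And>x. x \<in> \<sigma> \<Longrightarrow> norm x \<le> R2"
      using compact_imp_bounded[OF face_compact[OF c2]] by (auto simp: bounded_iff)
    have Pb: "P m y \<in> cball 0 (R2 + 1)" if y: "y \<in> slab \<sigma>" for m y
    proof -
      have y': "proj n p y \<in> \<sigma>" "\<bar>n \<bullet> (y - p)\<bar> \<le> 1/2" using y unfolding slab_eq[OF c2 un p] by auto
      have "\<bar>1/2 - n \<bullet> (y - p)\<bar> \<le> 1" using y'(2) by linarith
      then have "\<bar>\<tau> m * (1/2 - n \<bullet> (y - p))\<bar> \<le> 1"
        using \<tau>[of m] mult_mono[of "\<tau> m" 1 "\<bar>1/2 - n \<bullet> (y - p)\<bar>" 1] by (simp add: abs_mult)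
      then have "norm (P m y) \<le> norm (proj n p y) + 1"
        unfolding P_def using norm_triangle_ineq[of "proj n p y" "(\<tau> m * (1/2 - n \<bullet> (y - p))) *\<^sub>R e"]
        by (simp add: e_def)
      then show ?thesis using R2[OF y'(1)] by simp
    qed
    obtain C2 where C2: "\<And>x. x \<in> cball 0 (R2 + 1) \<Longrightarrow> \<bar>f x\<bar> \<le> C2"
      by (rule continuous_on_compact_bound[OF compact_cball[of 0 "R2 + 1"] continuous_on_subset[OF fc subset_UNIV]]) auto
    have lim: "(\<lambda>m. LINT y:slab \<sigma>|lebesgue. f (P m y)) \<longlonglongrightarrow> (LINT y:slab \<sigma>|lebesgue. f (proj n p y))"
      unfolding set_lebesgue_integral_def
    proof (rule integral_dominated_convergence[where w = "\<lambda>x. indicator (slab \<sigma>) x *\<^sub>R C2"])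
      have c1: "continuous_on (slab \<sigma>) (\<lambda>x. f (proj n p x))"
        by (intro continuous_on_compose2[OF fc continuous_on_proj]) auto
      show "(\<lambda>x. indicator (slab \<sigma>) x *\<^sub>R f (proj n p x)) \<in> borel_measurable lebesgue"
        using borel_measurable_integrable[OF integrable_on_compact[OF sc c1, unfolded set_integrable_def]] .
      have c2: "continuous_on (slab \<sigma>) (\<lambda>x. f (P m x))" for m
        by (intro continuous_on_compose2[OF fc Pc]) auto
      show "(\<lambda>x. indicator (slab \<sigma>) x *\<^sub>R f (P m x)) \<in> borel_measurable lebesgue" for m
        using borel_measurable_integrable[OF integrable_on_compact[OF sc c2, unfolded set_integrable_def]] .
      show "integrable lebesgue (\<lambda>x. indicator (slab \<sigma>) x *\<^sub>R C2)"
        using integrable_on_compact[OF sc continuous_on_const, of C2] unfolding set_integrable_def .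
      show "AE x in lebesgue. (\<lambda>m. indicator (slab \<sigma>) x *\<^sub>R f (P m x)) \<longlonglongrightarrow> indicator (slab \<sigma>) x *\<^sub>R f (proj n p x)"
        using fc by (intro AE_I2 tendsto_intros continuous_on_tendsto_compose[OF fc P0]) auto
      show "AE x in lebesgue. norm (indicator (slab \<sigma>) x *\<^sub>R f (P m x)) \<le> indicator (slab \<sigma>) x *\<^sub>R C2" for m
        using C2[OF Pb] by (intro AE_I2) (auto simp: indicator_def)
    qed
    have "face_integral \<sigma> f = (LINT y:slab \<sigma>|lebesgue. f (proj n p y))"
      unfolding face_integral_def by (simp add: closest_point_face[OF c2 un p])
    moreover have "sgn (normal_of T \<sigma> \<bullet> e) * (LINT w:prism e (\<tau> m) \<sigma>|lebesgue. f (w + \<tau> m *\<^sub>R e)) / \<tau> m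
        = normal_of T \<sigma> $ i * (LINT y:slab \<sigma>|lebesgue. f (P m y))" for m
    proof -
      have "sgn (n \<bullet> e) * (LINT w:prism e (\<tau> m) \<sigma>|lebesgue. f (w + \<tau> m *\<^sub>R e)) / \<tau> m
        = (sgn (n \<bullet> e) * \<bar>n \<bullet> e\<bar>) * (LINT y:slab \<sigma>|lebesgue. f (P m y))"
        using prism_integral[OF c2 un p _ \<tau>(1) fc, of e m] False \<tau>(1)[of m] by (simp add: n_def P_def)
      also have "sgn (n \<bullet> e) * \<bar>n \<bullet> e\<bar> = n $ i" using ne[of \<sigma>] by (simp add: sgn_mult_abs n_def)
      finally show ?thesis by (simp add: n_def)
    qed
    ultimately show ?thesis using tendsto_mult_left[OF lim, of "normal_of T \<sigma> $ i"] by simp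
  qed
  have "(LINT x:T|lebesgue. (f (x + \<tau> m *\<^sub>R e) - f x) / \<tau> m)
      = (\<Sum>\<sigma>\<in>F T. sgn (normal_of T \<sigma> \<bullet> e) * (LINT w:prism e (\<tau> m) \<sigma>|lebesgue. f (w + \<tau> m *\<^sub>R e)) / \<tau> m)" for m
  proof -
    have c: "continuous_on T (\<lambda>x. f (x + \<tau> m *\<^sub>R e))" "continuous_on T f"
      by (intro continuous_on_compose2[OF fc] continuous_intros, auto intro: continuous_on_subset[OF fc])
    have "(LINT x:T|lebesgue. (f (x + \<tau> m *\<^sub>R e) - f x) / \<tau> m)
      = ((LINT x:T|lebesgue. f (x + \<tau> m *\<^sub>R e)) - (LINT x:T|lebesgue. f x)) / \<tau> m"
      using set_integral_diff(2)[OF integrable_on_compact[OF Tc c(1)] integrable_on_compact[OF Tc c(2)]]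
      by simp
    also have "\<dots> = (\<Sum>\<sigma>\<in>F T. sgn (normal_of T \<sigma> \<bullet> e) * (LINT w:prism e (\<tau> m) \<sigma>|lebesgue. f (w + \<tau> m *\<^sub>R e)) / \<tau> m)"
      unfolding translated_cell_integral[OF T \<tau>(1) fc] by (simp add: sum_divide_distrib)
    finally show ?thesis .
  qed
  then have "(\<lambda>m. LINT x:T|lebesgue. (f (x + \<tau> m *\<^sub>R e) - f x) / \<tau> m) \<longlonglongrightarrow> (\<Sum>\<sigma>\<in>F T. normal_of T \<sigma> $ i * face_integral \<sigma> f)"
    using tendsto_sum[OF l2] by simp
  with l1 show ?thesis using LIMSEQ_unique by blast
qed

end

subsection \<open>Green's formulas\<close>

lemma set_integrable_inner:
  fixes f g :: "pt \<Rightarrow> 'a::euclidean_space"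
  shows "compact S \<Longrightarrow> continuous_on S f \<Longrightarrow> continuous_on S g \<Longrightarrow> set_integrable lebesgue S (\<lambda>x. f x \<bullet> g x)"
  by (intro integrable_on_compact continuous_on_inner)

lemma inner_L2_commute: "inner_L2 S f g = inner_L2 S g f"
  by (simp add: inner_L2_def inner_commute)

lemma inner_L2_cong:
  assumes "\<And>x. x \<in> S \<Longrightarrow> f x = f' x" "\<And>x. x \<in> S \<Longrightarrow> g x = g' x"
  shows "inner_L2 S f g = inner_L2 S f' g'"
  unfolding inner_L2_def set_lebesgue_integral_def
  by (intro Bochner_Integration.integral_cong) (auto simp: indicator_def assms)

lemma inner_L2_zero [simp]: "inner_L2 S (\<lambda>x. 0) g = 0" "inner_L2 S f (\<lambda>x. 0) = 0"
  by (simp_all add: inner_L2_def)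

lemma inner_L2_scale: "inner_L2 S f (\<lambda>x. c *\<^sub>R g x) = c * inner_L2 S f g"
  by (simp add: inner_L2_def)

lemma inner_L2_add:
  assumes "compact S" "continuous_on S f" "continuous_on S g" "continuous_on S h"
  shows "inner_L2 S f (\<lambda>x. g x + h x) = inner_L2 S f g + inner_L2 S f h"
  using set_integral_add(2)[OF set_integrable_inner[OF assms(1-3)] set_integrable_inner[OF assms(1,2,4)]]
  by (simp add: inner_L2_def inner_add_right)

lemma inner_L2_lin:
  assumes "compact S" "continuous_on S f" "continuous_on S g" "continuous_on S h"
  shows "inner_L2 S f (\<lambda>x. g x + c *\<^sub>R h x) = inner_L2 S f g + c * inner_L2 S f h"
  using inner_L2_add[OF assms(1-3), of "\<lambda>x. c *\<^sub>R h x"] assms(4)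
  by (simp add: inner_L2_scale continuous_on_scaleR)

lemma inner_L2_minus: "inner_L2 S f (\<lambda>x. - g x) = - inner_L2 S f g"
  using inner_L2_scale[of S f "-1" g] by simp

lemma inner_L2_diff:
  assumes "compact S" "continuous_on S f" "continuous_on S g" "continuous_on S h"
  shows "inner_L2 S f (\<lambda>x. g x - h x) = inner_L2 S f g - inner_L2 S f h"
  using inner_L2_lin[OF assms, of "-1"] by simp

lemma inner_L2_sum:
  assumes "compact S" "continuous_on S f" "\<And>i. i \<in> I \<Longrightarrow> continuous_on S (g i)"
  shows "inner_L2 S f (\<lambda>x. \<Sum>i\<in>I. g i x) = (\<Sum>i\<in>I. inner_L2 S f (g i))"
  using assms(3)
proof (induction I rule: infinite_finite_induct)
  case (insert i I)
  then show ?case using assms(1,2) by (simp add: inner_L2_add continuous_on_sum)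
qed simp_all

lemma inner_L2_self_nonneg: "0 \<le> inner_L2 S f f"
  unfolding inner_L2_def set_lebesgue_integral_def by (intro integral_nonneg_AE) auto

lemma inner_L2_symmetric_matrix:
  assumes "transpose E = (E :: real^3^3)"
  shows "inner_L2 S v (\<lambda>x. E *v g x) = inner_L2 S (\<lambda>x. E *v v x) g"
proof -
  have "a \<bullet> (E *v b) = (E *v a) \<bullet> b" for a b
    using dot_lmul_matrix[of a E b] assms by (metis transpose_matrix_vector)
  then show ?thesis by (simp add: inner_L2_def)
qed

lemma linear_cross3: "linear (\<lambda>a. cross3 a n)" "linear (cross3 n)"
  by (intro linearI; simp add: cross3_simps)+

lemma continuous_on_cross3:
  assumes "continuous_on S f"
  shows "continuous_on S (\<lambda>x. cross3 (f x) n)" "continuous_on S (\<lambda>x. cross3 n (f x))"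
  using bounded_linear.continuous_on[OF linear_conv_bounded_linear[THEN iffD1, OF linear_cross3(1)] assms]
    bounded_linear.continuous_on[OF linear_conv_bounded_linear[THEN iffD1, OF linear_cross3(2)] assms] by auto

lemma partial_as_component: "C1 v \<Longrightarrow> partial i v x $ j = partial i (\<lambda>x. v x $ j) x"
  using partial_component[OF C1_differentiable] by metis

lemma C1_scaleR:
  fixes \<phi> :: "pt \<Rightarrow> real" and v :: "pt \<Rightarrow> real^3"
  shows "C1 \<phi> \<Longrightarrow> C1 v \<Longrightarrow> C1 (\<lambda>x. \<phi> x *\<^sub>R v x)"
  unfolding C1_vec_iff by (auto intro: C1_mult)

lemma C1_cross3: "C1 u \<Longrightarrow> C1 v \<Longrightarrow> C1 (\<lambda>x. cross3 (u x) (v x))"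
  unfolding C1_vec_iff forall_3 cross_components by (auto intro!: C1_minus C1_mult)

lemma divg_scaleR:
  assumes "C1 \<phi>" "C1 v"
  shows "divg (\<lambda>x. \<phi> x *\<^sub>R v x) x = \<phi> x * divg v x + v x \<bullet> grad \<phi> x"
proof -
  have "partial i (\<lambda>x. \<phi> x *\<^sub>R v x) x $ i = \<phi> x * (partial i v x $ i) + partial i \<phi> x * v x $ i" for i
    using assms C1_component[OF assms(2)] C1_scaleR[OF assms]
    by (simp add: partial_as_component partial_mult C1_differentiable)
  then show ?thesis
    by (simp add: divg_def inner_vec_def grad_def sum.distrib sum_distrib_left mult.commute)
qed

lemma divg_cross3:
  assumes "C1 \<phi>" "C1 u"
  shows "divg (\<lambda>x. cross3 (\<phi> x) (u x)) x = u x \<bullet> curl \<phi> x - \<phi> x \<bullet> curl u x"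
proof -
  have C: "C1 (\<lambda>x. \<phi> x $ i * u x $ j)" "C1 (\<lambda>x. u x $ i * \<phi> x $ j)" for i j
    using assms by (intro C1_mult C1_component; simp)+
  have *: "partial l (\<lambda>x. \<phi> x $ i * u x $ j - u x $ i * \<phi> x $ j) x
    = (\<phi> x $ i * (partial l u x $ j) + (partial l \<phi> x $ i) * u x $ j)
      - (u x $ i * (partial l \<phi> x $ j) + (partial l u x $ i) * \<phi> x $ j)" for i j l
    using assms C C1_component[OF assms(1)] C1_component[OF assms(2)]
    by (simp add: partial_as_component partial_minus partial_mult C1_differentiable)
  show ?thesis
    unfolding divg_def sum_3 partial_as_component[OF C1_cross3[OF assms]] cross_components *
    by (simp add: curl_def inner_vec_def sum_3 algebra_simps)
qed

lemma continuous_on_grad: "C1 \<phi> \<Longrightarrow> continuous_on S (grad \<phi>)"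
  unfolding grad_def[abs_def] by (intro continuous_on_vec_lambda C1_continuous_partial)

lemma continuous_on_divg: "C1 v \<Longrightarrow> continuous_on S (divg v)"
  unfolding divg_def[abs_def] by (intro continuous_on_sum continuous_intros C1_continuous_partial)

lemma continuous_on_curl:
  assumes "C1 v"
  shows "continuous_on S (curl v)"
proof -
  have "continuous_on S (\<lambda>x. partial i v x $ j)" for i j
    using assms by (intro continuous_intros C1_continuous_partial)
  then have "continuous_on S (\<lambda>x. curl v x $ i)" for i
    using exhaust_3[of i] by (auto simp: curl_def intro!: continuous_on_diff)
  then show ?thesis using continuous_on_vec_lambda[of S "\<lambda>i x. curl v x $ i"] by simp
qed

context polyhedral_mesh
begin

lemma divergence_theorem:
  assumes T: "T \<in> Th" and v: "C1 v"
  shows "(LINT x:T|lebesgue. divg v x) = (face_sum T (\<lambda>\<sigma> x. v x \<bullet> normal_of T \<sigma>))"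
proof -
  have Tc: "compact T" by (rule cell_compact[OF T])
  have vi: "C1 (\<lambda>x. v x $ i)" for i by (rule C1_component[OF v])
  have int: "set_integrable lebesgue T (\<lambda>x. partial i (\<lambda>x. v x $ i) x)" for i
    by (rule integrable_on_compact[OF Tc C1_continuous_partial[OF vi]])
  have fi: "face_integrable \<sigma> (\<lambda>x. normal_of T \<sigma> $ i * v x $ i)" if "\<sigma> \<in> F T" for \<sigma> i
    using face_of_cell[OF that] by (intro face_integrable_scale continuous_face_integrable C1_continuous_on[OF vi])
  have "(LINT x:T|lebesgue. divg v x) = (\<Sum>i\<in>UNIV. LINT x:T|lebesgue. partial i (\<lambda>x. v x $ i) x)"
    unfolding divg_def partial_as_component[OF v] set_lebesgue_integral_def scaleR_sum_right
    using int by (intro Bochner_Integration.integral_sum) (simp add: set_integrable_def)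
  also have "\<dots> = (\<Sum>i\<in>UNIV. \<Sum>\<sigma>\<in>F T. face_integral \<sigma> (\<lambda>x. normal_of T \<sigma> $ i * v x $ i))"
  proof (intro sum.cong refl)
    fix i
    show "(LINT x:T|lebesgue. partial i (\<lambda>x. v x $ i) x) = (face_sum T (\<lambda>\<sigma> x. normal_of T \<sigma> $ i * v x $ i))"
      unfolding face_integral_scale by (rule gauss_cell[OF T C1_differentiable[OF vi] C1_continuous_partial[OF vi]])
  qed
  also have "\<dots> = (\<Sum>\<sigma>\<in>F T. \<Sum>i\<in>UNIV. face_integral \<sigma> (\<lambda>x. normal_of T \<sigma> $ i * v x $ i))"
    by (rule sum.swap)
  also have "\<dots> = (face_sum T (\<lambda>\<sigma> x. v x \<bullet> normal_of T \<sigma>))"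
  proof (intro sum.cong refl)
    fix \<sigma> assume s: "\<sigma> \<in> F T"
    show "(\<Sum>i\<in>UNIV. face_integral \<sigma> (\<lambda>x. normal_of T \<sigma> $ i * v x $ i)) = face_integral \<sigma> (\<lambda>x. v x \<bullet> normal_of T \<sigma>)"
      using face_integral_sum[of UNIV \<sigma> "\<lambda>i x. normal_of T \<sigma> $ i * v x $ i"] fi[OF s]
      by (simp add: inner_vec_def mult.commute)
  qed
  finally show ?thesis .
qed

lemma green_grad:
  assumes T: "T \<in> Th" and v: "C1 v" and \<phi>: "C1 \<phi>"
  shows "inner_L2 T v (grad \<phi>) = - inner_L2 T (divg v) \<phi>
    + (face_sum T (\<lambda>\<sigma> x. \<phi> x * (v x \<bullet> normal_of T \<sigma>)))"
proof -
  have Tc: "compact T" by (rule cell_compact[OF T])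
  have i1: "set_integrable lebesgue T (\<lambda>x. divg v x \<bullet> \<phi> x)" "set_integrable lebesgue T (\<lambda>x. v x \<bullet> grad \<phi> x)"
    using v \<phi> by (intro set_integrable_inner Tc continuous_on_divg continuous_on_grad C1_continuous_on; simp)+
  have "(LINT x:T|lebesgue. divg (\<lambda>x. \<phi> x *\<^sub>R v x) x) = inner_L2 T (divg v) \<phi> + inner_L2 T v (grad \<phi>)"
    unfolding inner_L2_def set_integral_add(2)[OF i1, symmetric]
    by (simp add: divg_scaleR[OF \<phi> v] mult.commute)
  then show ?thesis
    using divergence_theorem[OF T C1_scaleR[OF \<phi> v]] by simp
qed

text \<open>The divergence theorem for \<open>cross3 (\<phi> x) (u x)\<close>, together with the
  cyclic symmetry of the triple product.\<close>

lemma green_curl: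
  assumes T: "T \<in> Th" and u: "C1 u" and \<phi>: "C1 \<phi>"
  shows "inner_L2 T u (curl \<phi>) = inner_L2 T (curl u) \<phi>
    + (face_sum T (\<lambda>\<sigma> x. cross3 (u x) (normal_of T \<sigma>) \<bullet> \<phi> x))"
proof -
  have Tc: "compact T" by (rule cell_compact[OF T])
  have i1: "set_integrable lebesgue T (\<lambda>x. u x \<bullet> curl \<phi> x)" "set_integrable lebesgue T (\<lambda>x. curl u x \<bullet> \<phi> x)"
    using u \<phi> by (intro set_integrable_inner Tc continuous_on_curl C1_continuous_on; simp)+
  have "(LINT x:T|lebesgue. divg (\<lambda>x. cross3 (\<phi> x) (u x)) x) = inner_L2 T u (curl \<phi>) - inner_L2 T (curl u) \<phi>"
    unfolding inner_L2_def set_integral_diff(2)[OF i1, symmetric]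
    by (simp add: divg_cross3[OF \<phi> u] inner_commute)
  moreover have "cross3 (\<phi> x) (u x) \<bullet> n = cross3 (u x) n \<bullet> \<phi> x" for x n
    by (simp add: cross3_simps)
  ultimately show ?thesis
    using divergence_theorem[OF T C1_cross3[OF \<phi> u]] by simp
qed

lemma inner_L2_vpoly_zero:
  assumes T: "T \<in> Th" and p: "p \<in> vpoly_space k" "inner_L2 T p p = 0"
  shows "p = (\<lambda>x. 0)"
proof (rule vpoly_space_zero_on_open[OF p(1) open_interior cell_closure_interior(2)[OF T]])
  fix x assume "x \<in> interior T"
  then have "p x \<bullet> p x = 0"
    using p by (intro set_integral_zero_imp_zero[OF cell_compact[OF T], of "\<lambda>x. p x \<bullet> p x"])
      (auto simp: inner_L2_def intro!: continuous_on_inner vpoly_continuous_on)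
  then show "p x = 0" by simp
qed

lemma inner_L2_poly_zero:
  assumes T: "T \<in> Th" and p: "p \<in> poly_space k" "inner_L2 T p p = 0"
  shows "p = (\<lambda>x. 0)"
proof (rule poly_space_zero_on_open[OF p(1) open_interior cell_closure_interior(2)[OF T]])
  fix x assume "x \<in> interior T"
  then have "p x \<bullet> p x = 0"
    using p poly_continuous_on[OF p(1), of T]
    by (intro set_integral_zero_imp_zero[OF cell_compact[OF T], of "\<lambda>x. p x \<bullet> p x"])
      (auto simp: inner_L2_def intro!: continuous_on_mult)
  then show "p x = 0" by simp
qed

subsection \<open>The weak gradient and the weak curl\<close>

text \<open>Gives meaning to the descriptions in \<open>grad_w\<close> and \<open>curl_w\<close>.
  The inner product on a cell is definite on polynomials because the cell has interior
  points.\<close>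

lemma riesz_vpoly:
  assumes T: "T \<in> Th" and G: "lin_on (vpoly_space k) G"
  shows "\<exists>!w. w \<in> vpoly_space k \<and> (\<forall>\<phi>\<in>vpoly_space k. inner_L2 T w \<phi> = G \<phi>)"
proof (rule ex_ex1I)
  have Tc: "compact T" by (rule cell_compact[OF T])
  have lin: "lin_on (vpoly_space k) (inner_L2 T x)" if "x \<in> vpoly_space k" for x
  proof (rule lin_onI)
    fix y z c assume "y \<in> vpoly_space k" "z \<in> vpoly_space k"
    then show "inner_L2 T x (y + c *\<^sub>R z) = inner_L2 T x y + c * inner_L2 T x z"
      using inner_L2_lin[OF Tc vpoly_continuous_on vpoly_continuous_on vpoly_continuous_on, of x k y k z k c] that
      by (simp add: plus_fun_def scaleR_fun_def)
  qed
  have "\<exists>x\<in>vpoly_space k. \<forall>y\<in>vpoly_space k. inner_L2 T x y = G y"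
  proof (rule symmetric_form_representation[OF vpoly_space_subspace fin_span_vpoly_space inner_L2_commute lin G])
    fix y assume y: "y \<in> vpoly_space k" "\<And>x. x \<in> vpoly_space k \<Longrightarrow> inner_L2 T x y = 0"
    then have "y = (\<lambda>x. 0)" using inner_L2_vpoly_zero[OF T] by blast
    then have "y = 0" by (simp add: zero_fun_def)
    then show "G y = 0" using lin_on_0[OF G vpoly_space_subspace] by simp
  qed
  then show "\<exists>w. w \<in> vpoly_space k \<and> (\<forall>\<phi>\<in>vpoly_space k. inner_L2 T w \<phi> = G \<phi>)" by blast
  fix w w' assume w: "w \<in> vpoly_space k \<and> (\<forall>\<phi>\<in>vpoly_space k. inner_L2 T w \<phi> = G \<phi>)"
    "w' \<in> vpoly_space k \<and> (\<forall>\<phi>\<in>vpoly_space k. inner_L2 T w' \<phi> = G \<phi>)"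
  define d where "d = (\<lambda>x. w x - w' x)"
  have d: "d \<in> vpoly_space k"
    using subspace_diff[OF vpoly_space_subspace, of w k w'] w by (auto simp: d_def fun_diff_def)
  have c: "continuous_on T w" "continuous_on T w'" "continuous_on T d"
    using w d vpoly_continuous_on by auto
  have "inner_L2 T d d = inner_L2 T w d - inner_L2 T w' d"
    using inner_L2_diff[OF Tc c(3,1,2), folded d_def] inner_L2_commute[of T w d] inner_L2_commute[of T w' d] by simp
  then have "inner_L2 T d d = 0" using w d by simp
  then have "d = (\<lambda>x. 0)" using inner_L2_vpoly_zero[OF T d] by blast
  then show "w = w'" by (auto simp: d_def fun_eq_iff)
qed

text \<open>Scalar weak functions without mean value or boundary conditions. Both \<open>M_h\<close>
  and \<open>S_h\<close> lie in this space, so weak gradients and their linearity are treated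
  once.\<close>

definition PW :: "nat \<Rightarrow> real weak set" where
  "PW k = piecewise Th (\<lambda>_. poly_space k) \<times> piecewise Eh (face_poly k)"

definition VW :: "nat \<Rightarrow> (real^3) weak set" where
  "VW k = piecewise Th (\<lambda>_. vpoly_space k) \<times> piecewise Eh (face_tangential k)"

lemma piecewiseD: "v \<in> piecewise A P \<Longrightarrow> S \<in> A \<Longrightarrow> v S \<in> P S"
  by (simp add: piecewise_def)

lemma PW_cell: "\<phi> \<in> PW k \<Longrightarrow> T \<in> Th \<Longrightarrow> fst \<phi> T \<in> poly_space k"
  by (auto simp: PW_def dest: piecewiseD)

lemma VW_cell: "\<psi> \<in> VW k \<Longrightarrow> T \<in> Th \<Longrightarrow> fst \<psi> T \<in> vpoly_space k"
  by (auto simp: VW_def dest: piecewiseD)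

lemma PW_face:
  assumes "\<phi> \<in> PW k" "\<sigma> \<in> Eh"
  obtains p where "p \<in> poly_space k" "snd \<phi> \<sigma> = (\<lambda>x. if x \<in> \<sigma> then p x else 0)"
proof -
  have "snd \<phi> \<sigma> \<in> face_poly k \<sigma>" using assms by (auto simp: PW_def dest: piecewiseD)
  then show ?thesis using that by (auto simp: face_poly_def)
qed

text \<open>The tangential face space admits either unit normal for each of its members; a sign
  change of the polynomial lets one fixed normal serve all.\<close>

lemma VW_face:
  assumes "\<psi> \<in> VW k" "\<sigma> \<in> Eh" "unit_normal \<sigma> n"
  obtains p where "p \<in> vpoly_space k" "snd \<psi> \<sigma> = (\<lambda>x. if x \<in> \<sigma> then cross3 (p x) n else 0)"
proof -
  have "snd \<psi> \<sigma> \<in> face_tangential k \<sigma>" using assms by (auto simp: VW_def dest: piecewiseD)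
  then obtain p m where p: "p \<in> vpoly_space k" "unit_normal \<sigma> m"
    "snd \<psi> \<sigma> = (\<lambda>x. if x \<in> \<sigma> then cross3 (p x) m else 0)" unfolding face_tangential_def by blast
  from unit_normal_unique[OF face[OF assms(2)] assms(3) p(2)] show ?thesis
  proof
    assume "m = n"
    then show ?thesis using that p by blast
  next
    assume m: "m = - n"
    have "(\<lambda>x. - p x) \<in> vpoly_space k"
      using linear_vpoly_space[OF p(1), of uminus] by (simp add: linear_uminus)
    then show ?thesis by (rule that) (simp add: p(3) m cross_minus_left cross_minus_right fun_eq_iff)
  qed
qed

lemma PW_face_continuous: "\<phi> \<in> PW k \<Longrightarrow> \<sigma> \<in> Eh \<Longrightarrow> continuous_on \<sigma> (snd \<phi> \<sigma>)"
  by (erule (1) PW_face) (auto intro: poly_continuous_on cong: continuous_on_cong)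

lemma VW_face_continuous: "\<psi> \<in> VW k \<Longrightarrow> \<sigma> \<in> Eh \<Longrightarrow> continuous_on \<sigma> (snd \<psi> \<sigma>)"
proof -
  assume a: "\<psi> \<in> VW k" "\<sigma> \<in> Eh"
  obtain n where n: "unit_normal \<sigma> n" using face_has_unit_normal[OF face[OF a(2)]] .
  obtain p where p: "p \<in> vpoly_space k" "snd \<psi> \<sigma> = (\<lambda>x. if x \<in> \<sigma> then cross3 (p x) n else 0)"
    by (rule VW_face[OF a n])
  have "continuous_on \<sigma> (\<lambda>x. cross3 (p x) n)"
    using linear_vpoly_space[OF p(1) linear_cross3(1)] by (rule vpoly_continuous_on)
  then show ?thesis unfolding p(2) by (simp cong: continuous_on_cong)
qed

lemma face_integrable_inner:
  fixes f g :: "pt \<Rightarrow> 'a::real_inner"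
  shows "\<sigma> \<in> Eh \<Longrightarrow> continuous_on \<sigma> f \<Longrightarrow> continuous_on \<sigma> g \<Longrightarrow> face_integrable \<sigma> (\<lambda>x. f x \<bullet> g x)"
  by (intro continuous_face_integrable face continuous_on_inner)

lemma divg_lin:
  assumes "C1 v" "C1 w"
  shows "divg (\<lambda>x. v x + c *\<^sub>R w x) = (\<lambda>x. divg v x + c * divg w x)"
proof
  fix x
  have cw: "C1 (\<lambda>x. c *\<^sub>R w x)" using assms(2) by (intro C1_linear[OF bounded_linear_scaleR_right])
  have "partial i (\<lambda>x. v x + c *\<^sub>R w x) x = partial i v x + c *\<^sub>R partial i w x" for i
    using partial_add[OF C1_differentiable[OF assms(1)] C1_differentiable[OF cw]]
      partial_linear[OF bounded_linear_scaleR_right C1_differentiable[OF assms(2)]] by auto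
  then show "divg (\<lambda>x. v x + c *\<^sub>R w x) x = divg v x + c * divg w x"
    by (simp add: divg_def sum.distrib sum_distrib_left)
qed

lemma curl_lin:
  assumes "C1 v" "C1 w"
  shows "curl (\<lambda>x. v x + c *\<^sub>R w x) = (\<lambda>x. curl v x + c *\<^sub>R curl w x)"
proof
  fix x
  have cw: "C1 (\<lambda>x. c *\<^sub>R w x)" using assms(2) by (intro C1_linear[OF bounded_linear_scaleR_right])
  have "partial i (\<lambda>x. v x + c *\<^sub>R w x) x = partial i v x + c *\<^sub>R partial i w x" for i
    using partial_add[OF C1_differentiable[OF assms(1)] C1_differentiable[OF cw]]
      partial_linear[OF bounded_linear_scaleR_right C1_differentiable[OF assms(2)]] by auto
  then show "curl (\<lambda>x. v x + c *\<^sub>R w x) x = curl v x + c *\<^sub>R curl w x"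
    by (simp add: curl_def vec_eq_iff forall_3 algebra_simps)
qed

definition grad_rhs :: "pt set \<Rightarrow> real weak \<Rightarrow> (pt \<Rightarrow> real^3) \<Rightarrow> real" where
  "grad_rhs T \<phi> w = - inner_L2 T (fst \<phi> T) (divg w)
    + (face_sum T (\<lambda>\<sigma> x. snd \<phi> \<sigma> x * (w x \<bullet> normal_of T \<sigma>)))"

definition curl_rhs :: "pt set \<Rightarrow> (real^3) weak \<Rightarrow> (pt \<Rightarrow> real^3) \<Rightarrow> real" where
  "curl_rhs T \<psi> w = inner_L2 T (fst \<psi> T) (curl w)
    - (face_sum T (\<lambda>\<sigma> x. cross3 (snd \<psi> \<sigma> x) (normal_of T \<sigma>) \<bullet> w x))"

text \<open>Membership, defining identity and uniqueness: later arguments use these three facts in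
  place of the description \<open>THE\<close>.\<close>

lemma grad_w_spec:
  assumes T: "T \<in> Th" and \<phi>: "\<phi> \<in> PW k"
  shows "grad_w Eh k \<phi> T \<in> vpoly_space k"
    and "w \<in> vpoly_space k \<Longrightarrow> inner_L2 T (grad_w Eh k \<phi> T) w = grad_rhs T \<phi> w"
    and "\<lbrakk>w \<in> vpoly_space k; \<And>\<xi>. \<xi> \<in> vpoly_space k \<Longrightarrow> inner_L2 T w \<xi> = grad_rhs T \<phi> \<xi>\<rbrakk> \<Longrightarrow> grad_w Eh k \<phi> T = w"
proof -
  have Tc: "compact T" by (rule cell_compact[OF T])
  have "lin_on (vpoly_space k) (grad_rhs T \<phi>)"
  proof (rule lin_onI)
    fix v w c assume vw: "v \<in> vpoly_space k" "w \<in> vpoly_space k"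
    have C: "C1 v" "C1 w" using vw vpoly_space_C1 by auto
    have f0: "continuous_on T (fst \<phi> T)" using poly_continuous_on[OF PW_cell[OF \<phi> T]] .
    have "inner_L2 T (fst \<phi> T) (divg (v + c *\<^sub>R w)) = inner_L2 T (fst \<phi> T) (divg v) + c * inner_L2 T (fst \<phi> T) (divg w)"
      using inner_L2_lin[OF Tc f0 continuous_on_divg[OF C(1)] continuous_on_divg[OF C(2)], of c] divg_lin[OF C, of c]
      by (simp add: plus_fun_def scaleR_fun_def)
    moreover have "face_integral \<sigma> (\<lambda>x. snd \<phi> \<sigma> x * ((v + c *\<^sub>R w) x \<bullet> normal_of T \<sigma>))
        = face_integral \<sigma> (\<lambda>x. snd \<phi> \<sigma> x * (v x \<bullet> normal_of T \<sigma>)) + c * face_integral \<sigma> (\<lambda>x. snd \<phi> \<sigma> x * (w x \<bullet> normal_of T \<sigma>))"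
      if s: "\<sigma> \<in> F T" for \<sigma>
    proof -
      have sE: "\<sigma> \<in> Eh" using faces_in_Eh s .
      have fi: "face_integrable \<sigma> (\<lambda>x. snd \<phi> \<sigma> x * (v x \<bullet> normal_of T \<sigma>))" if "C1 v" for v
        using PW_face_continuous[OF \<phi> sE] C1_continuous_on[OF that]
        by (intro continuous_face_integrable face sE continuous_intros)
      show ?thesis using face_integral_lin[OF fi[OF C(1)] fi[OF C(2)], of c] by (simp add: algebra_simps inner_add_left)
    qed
    ultimately show "grad_rhs T \<phi> (v + c *\<^sub>R w) = grad_rhs T \<phi> v + c * grad_rhs T \<phi> w"
      by (simp add: grad_rhs_def sum.distrib sum_distrib_left algebra_simps)
  qed
  note ex = riesz_vpoly[OF T this]
  have eq: "grad_w Eh k \<phi> T = (THE w. w \<in> vpoly_space k \<and> (\<forall>\<xi>\<in>vpoly_space k. inner_L2 T w \<xi> = grad_rhs T \<phi> \<xi>))"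
    unfolding grad_w_def grad_rhs_def ..
  note the = theI'[OF ex, folded eq]
  show "grad_w Eh k \<phi> T \<in> vpoly_space k" using the by blast
  show "w \<in> vpoly_space k \<Longrightarrow> inner_L2 T (grad_w Eh k \<phi> T) w = grad_rhs T \<phi> w" using the by blast
  show "grad_w Eh k \<phi> T = w" if "w \<in> vpoly_space k" "\<And>\<xi>. \<xi> \<in> vpoly_space k \<Longrightarrow> inner_L2 T w \<xi> = grad_rhs T \<phi> \<xi>"
    using the1_equality[OF ex, of w, folded eq] that by blast
qed

lemma curl_w_spec:
  assumes T: "T \<in> Th" and \<psi>: "\<psi> \<in> VW k"
  shows "curl_w Eh k \<psi> T \<in> vpoly_space k"
    and "w \<in> vpoly_space k \<Longrightarrow> inner_L2 T (curl_w Eh k \<psi> T) w = curl_rhs T \<psi> w"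
    and "\<lbrakk>w \<in> vpoly_space k; \<And>\<xi>. \<xi> \<in> vpoly_space k \<Longrightarrow> inner_L2 T w \<xi> = curl_rhs T \<psi> \<xi>\<rbrakk> \<Longrightarrow> curl_w Eh k \<psi> T = w"
proof -
  have Tc: "compact T" by (rule cell_compact[OF T])
  have "lin_on (vpoly_space k) (curl_rhs T \<psi>)"
  proof (rule lin_onI)
    fix v w c assume vw: "v \<in> vpoly_space k" "w \<in> vpoly_space k"
    have C: "C1 v" "C1 w" using vw vpoly_space_C1 by auto
    have f0: "continuous_on T (fst \<psi> T)" using vpoly_continuous_on[OF VW_cell[OF \<psi> T]] .
    have "inner_L2 T (fst \<psi> T) (curl (v + c *\<^sub>R w)) = inner_L2 T (fst \<psi> T) (curl v) + c * inner_L2 T (fst \<psi> T) (curl w)"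
      using inner_L2_lin[OF Tc f0 continuous_on_curl[OF C(1)] continuous_on_curl[OF C(2)], of c] curl_lin[OF C, of c]
      by (simp add: plus_fun_def scaleR_fun_def)
    moreover have "face_integral \<sigma> (\<lambda>x. cross3 (snd \<psi> \<sigma> x) (normal_of T \<sigma>) \<bullet> (v + c *\<^sub>R w) x)
        = face_integral \<sigma> (\<lambda>x. cross3 (snd \<psi> \<sigma> x) (normal_of T \<sigma>) \<bullet> v x)
          + c * face_integral \<sigma> (\<lambda>x. cross3 (snd \<psi> \<sigma> x) (normal_of T \<sigma>) \<bullet> w x)"
      if s: "\<sigma> \<in> F T" for \<sigma>
    proof -
      have sE: "\<sigma> \<in> Eh" using faces_in_Eh s .
      have fi: "face_integrable \<sigma> (\<lambda>x. cross3 (snd \<psi> \<sigma> x) (normal_of T \<sigma>) \<bullet> v x)" if "C1 v" for v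
        using VW_face_continuous[OF \<psi> sE] C1_continuous_on[OF that]
        by (intro face_integrable_inner sE continuous_on_cross3)
      show ?thesis using face_integral_lin[OF fi[OF C(1)] fi[OF C(2)], of c] by (simp add: algebra_simps inner_add_right)
    qed
    ultimately show "curl_rhs T \<psi> (v + c *\<^sub>R w) = curl_rhs T \<psi> v + c * curl_rhs T \<psi> w"
      by (simp add: curl_rhs_def sum.distrib sum_distrib_left algebra_simps)
  qed
  note ex = riesz_vpoly[OF T this]
  have eq: "curl_w Eh k \<psi> T = (THE w. w \<in> vpoly_space k \<and> (\<forall>\<xi>\<in>vpoly_space k. inner_L2 T w \<xi> = curl_rhs T \<psi> \<xi>))"
    unfolding curl_w_def curl_rhs_def ..
  note the = theI'[OF ex, folded eq]
  show "curl_w Eh k \<psi> T \<in> vpoly_space k" using the by blast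
  show "w \<in> vpoly_space k \<Longrightarrow> inner_L2 T (curl_w Eh k \<psi> T) w = curl_rhs T \<psi> w" using the by blast
  show "curl_w Eh k \<psi> T = w" if "w \<in> vpoly_space k" "\<And>\<xi>. \<xi> \<in> vpoly_space k \<Longrightarrow> inner_L2 T w \<xi> = curl_rhs T \<psi> \<xi>"
    using the1_equality[OF ex, of w, folded eq] that by blast
qed

text \<open>When the face part is the trace of the cell part, Green's formula shows that the
  classical gradient satisfies the identity defining the weak one.\<close>

lemma grad_w_conforming:
  assumes T: "T \<in> Th" and \<phi>: "\<phi> \<in> PW k" and tr: "\<And>\<sigma> x. \<sigma> \<in> F T \<Longrightarrow> x \<in> \<sigma> \<Longrightarrow> snd \<phi> \<sigma> x = fst \<phi> T x"
  shows "grad_w Eh k \<phi> T = grad (fst \<phi> T)"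
proof (rule grad_w_spec(3)[OF T \<phi>])
  have p: "fst \<phi> T \<in> poly_space k" by (rule PW_cell[OF \<phi> T])
  then show "grad (fst \<phi> T) \<in> vpoly_space k" by (rule grad_in_vpoly_space)
  fix \<xi> assume c: "\<xi> \<in> vpoly_space k"
  have "(face_sum T (\<lambda>\<sigma> x. snd \<phi> \<sigma> x * (\<xi> x \<bullet> normal_of T \<sigma>)))
    = (face_sum T (\<lambda>\<sigma> x. fst \<phi> T x * (\<xi> x \<bullet> normal_of T \<sigma>)))"
    using tr by (intro sum.cong face_integral_cong) auto
  then show "inner_L2 T (grad (fst \<phi> T)) \<xi> = grad_rhs T \<phi> \<xi>"
    using green_grad[OF T vpoly_space_C1[OF c] poly_space_C1[OF p]]
    by (simp add: grad_rhs_def inner_L2_commute)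
qed

text \<open>Only the cross product with the normal enters the defining identity, so agreement of
  tangential traces is enough.\<close>

lemma curl_w_conforming:
  assumes T: "T \<in> Th" and \<psi>: "\<psi> \<in> VW k"
    and tr: "\<And>\<sigma> x. \<sigma> \<in> F T \<Longrightarrow> x \<in> \<sigma> \<Longrightarrow>
      cross3 (snd \<psi> \<sigma> x) (normal_of T \<sigma>) = cross3 (fst \<psi> T x) (normal_of T \<sigma>)"
  shows "curl_w Eh k \<psi> T = curl (fst \<psi> T)"
proof (rule curl_w_spec(3)[OF T \<psi>])
  have p: "fst \<psi> T \<in> vpoly_space k" by (rule VW_cell[OF \<psi> T])
  then show "curl (fst \<psi> T) \<in> vpoly_space k" by (rule curl_in_vpoly_space)
  fix \<xi> assume c: "\<xi> \<in> vpoly_space k"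
  have "(face_sum T (\<lambda>\<sigma> x. cross3 (snd \<psi> \<sigma> x) (normal_of T \<sigma>) \<bullet> \<xi> x))
    = (face_sum T (\<lambda>\<sigma> x. cross3 (fst \<psi> T x) (normal_of T \<sigma>) \<bullet> \<xi> x))"
    using tr by (intro sum.cong face_integral_cong) auto
  then show "inner_L2 T (curl (fst \<psi> T)) \<xi> = curl_rhs T \<psi> \<xi>"
    using green_curl[OF T vpoly_space_C1[OF p] vpoly_space_C1[OF c]]
    by (simp add: curl_rhs_def)
qed

lemma grad_w_lin:
  assumes T: "T \<in> Th" and p: "\<phi> \<in> PW k" "\<phi>' \<in> PW k" "\<phi> + c *\<^sub>R \<phi>' \<in> PW k"
  shows "grad_w Eh k (\<phi> + c *\<^sub>R \<phi>') T = (\<lambda>x. grad_w Eh k \<phi> T x + c *\<^sub>R grad_w Eh k \<phi>' T x)"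
proof (rule grad_w_spec(3)[OF T p(3)])
  have Tc: "compact T" by (rule cell_compact[OF T])
  have g: "grad_w Eh k \<phi> T \<in> vpoly_space k" "grad_w Eh k \<phi>' T \<in> vpoly_space k" using grad_w_spec(1)[OF T] p by auto
  show "(\<lambda>x. grad_w Eh k \<phi> T x + c *\<^sub>R grad_w Eh k \<phi>' T x) \<in> vpoly_space k"
    using subspace_add[OF vpoly_space_subspace g(1) subspace_scale[OF vpoly_space_subspace g(2)], of c]
    by (simp add: plus_fun_def scaleR_fun_def)
  fix w assume w: "w \<in> vpoly_space k"
  have c: "continuous_on T (fst \<phi> T)" "continuous_on T (fst \<phi>' T)" "continuous_on T (divg w)" "continuous_on T w"
    "continuous_on T (grad_w Eh k \<phi> T)" "continuous_on T (grad_w Eh k \<phi>' T)"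
    using PW_cell[OF p(1) T] PW_cell[OF p(2) T] w g continuous_on_divg[OF vpoly_space_C1[OF w]]
      poly_continuous_on vpoly_continuous_on by auto
  have S: "(face_sum T (\<lambda>\<sigma> x. snd (\<phi> + c *\<^sub>R \<phi>') \<sigma> x * (w x \<bullet> normal_of T \<sigma>)))
      = (face_sum T (\<lambda>\<sigma> x. snd \<phi> \<sigma> x * (w x \<bullet> normal_of T \<sigma>)))
        + c * (face_sum T (\<lambda>\<sigma> x. snd \<phi>' \<sigma> x * (w x \<bullet> normal_of T \<sigma>)))"
    unfolding sum_distrib_left sum.distrib[symmetric]
  proof (intro sum.cong refl)
    fix \<sigma> assume "\<sigma> \<in> F T"
    then have sE: "\<sigma> \<in> Eh" using faces_in_Eh by blast
    have fi: "face_integrable \<sigma> (\<lambda>x. snd \<phi> \<sigma> x * (w x \<bullet> normal_of T \<sigma>))" if "\<phi> \<in> PW k" for \<phi>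
      using PW_face_continuous[OF that sE] vpoly_continuous_on[OF w]
      by (intro continuous_face_integrable face sE continuous_intros)
    show "face_integral \<sigma> (\<lambda>x. snd (\<phi> + c *\<^sub>R \<phi>') \<sigma> x * (w x \<bullet> normal_of T \<sigma>))
      = face_integral \<sigma> (\<lambda>x. snd \<phi> \<sigma> x * (w x \<bullet> normal_of T \<sigma>)) + c * face_integral \<sigma> (\<lambda>x. snd \<phi>' \<sigma> x * (w x \<bullet> normal_of T \<sigma>))"
      using face_integral_lin[OF fi[OF p(1)] fi[OF p(2)], of c] by (simp add: plus_fun_def algebra_simps)
  qed
  have D: "inner_L2 T (fst (\<phi> + c *\<^sub>R \<phi>') T) (divg w) = inner_L2 T (fst \<phi> T) (divg w) + c * inner_L2 T (fst \<phi>' T) (divg w)"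
    using inner_L2_lin[OF Tc c(3,1,2), of c] by (simp add: inner_L2_commute[of T _ "divg w"] plus_fun_def)
  have "inner_L2 T (\<lambda>x. grad_w Eh k \<phi> T x + c *\<^sub>R grad_w Eh k \<phi>' T x) w = grad_rhs T \<phi> w + c * grad_rhs T \<phi>' w"
    using inner_L2_lin[OF Tc c(4,5,6), of c] grad_w_spec(2)[OF T p(1) w] grad_w_spec(2)[OF T p(2) w]
    by (simp add: inner_L2_commute[of T _ w])
  then show "inner_L2 T (\<lambda>x. grad_w Eh k \<phi> T x + c *\<^sub>R grad_w Eh k \<phi>' T x) w = grad_rhs T (\<phi> + c *\<^sub>R \<phi>') w"
    unfolding grad_rhs_def S D by (simp add: algebra_simps)
qed

lemma curl_w_lin:
  assumes T: "T \<in> Th" and p: "\<psi> \<in> VW k" "\<psi>' \<in> VW k" "\<psi> + c *\<^sub>R \<psi>' \<in> VW k"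
  shows "curl_w Eh k (\<psi> + c *\<^sub>R \<psi>') T = (\<lambda>x. curl_w Eh k \<psi> T x + c *\<^sub>R curl_w Eh k \<psi>' T x)"
proof (rule curl_w_spec(3)[OF T p(3)])
  have Tc: "compact T" by (rule cell_compact[OF T])
  have g: "curl_w Eh k \<psi> T \<in> vpoly_space k" "curl_w Eh k \<psi>' T \<in> vpoly_space k" using curl_w_spec(1)[OF T] p by auto
  show "(\<lambda>x. curl_w Eh k \<psi> T x + c *\<^sub>R curl_w Eh k \<psi>' T x) \<in> vpoly_space k"
    using subspace_add[OF vpoly_space_subspace g(1) subspace_scale[OF vpoly_space_subspace g(2)], of c]
    by (simp add: plus_fun_def scaleR_fun_def)
  fix w assume w: "w \<in> vpoly_space k"
  have c: "continuous_on T (fst \<psi> T)" "continuous_on T (fst \<psi>' T)" "continuous_on T (curl w)" "continuous_on T w"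
    "continuous_on T (curl_w Eh k \<psi> T)" "continuous_on T (curl_w Eh k \<psi>' T)"
    using VW_cell[OF p(1) T] VW_cell[OF p(2) T] w g continuous_on_curl[OF vpoly_space_C1[OF w]]
      vpoly_continuous_on by auto
  have S: "(face_sum T (\<lambda>\<sigma> x. cross3 (snd (\<psi> + c *\<^sub>R \<psi>') \<sigma> x) (normal_of T \<sigma>) \<bullet> w x))
      = (face_sum T (\<lambda>\<sigma> x. cross3 (snd \<psi> \<sigma> x) (normal_of T \<sigma>) \<bullet> w x))
        + c * (face_sum T (\<lambda>\<sigma> x. cross3 (snd \<psi>' \<sigma> x) (normal_of T \<sigma>) \<bullet> w x))"
    unfolding sum_distrib_left sum.distrib[symmetric]
  proof (intro sum.cong refl)
    fix \<sigma> assume "\<sigma> \<in> F T"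
    then have sE: "\<sigma> \<in> Eh" using faces_in_Eh by blast
    have fi: "face_integrable \<sigma> (\<lambda>x. cross3 (snd \<psi> \<sigma> x) (normal_of T \<sigma>) \<bullet> w x)" if "\<psi> \<in> VW k" for \<psi>
      using VW_face_continuous[OF that sE] vpoly_continuous_on[OF w]
      by (intro face_integrable_inner sE continuous_on_cross3)
    show "face_integral \<sigma> (\<lambda>x. cross3 (snd (\<psi> + c *\<^sub>R \<psi>') \<sigma> x) (normal_of T \<sigma>) \<bullet> w x)
      = face_integral \<sigma> (\<lambda>x. cross3 (snd \<psi> \<sigma> x) (normal_of T \<sigma>) \<bullet> w x)
        + c * face_integral \<sigma> (\<lambda>x. cross3 (snd \<psi>' \<sigma> x) (normal_of T \<sigma>) \<bullet> w x)"
      using face_integral_lin[OF fi[OF p(1)] fi[OF p(2)], of c]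
      by (simp add: plus_fun_def linear_add[OF linear_cross3(1)] linear_scale[OF linear_cross3(1)] inner_add_left)
  qed
  have D: "inner_L2 T (fst (\<psi> + c *\<^sub>R \<psi>') T) (curl w) = inner_L2 T (fst \<psi> T) (curl w) + c * inner_L2 T (fst \<psi>' T) (curl w)"
    using inner_L2_lin[OF Tc c(3,1,2), of c] by (simp add: inner_L2_commute[of T _ "curl w"] plus_fun_def)
  have "inner_L2 T (\<lambda>x. curl_w Eh k \<psi> T x + c *\<^sub>R curl_w Eh k \<psi>' T x) w = curl_rhs T \<psi> w + c * curl_rhs T \<psi>' w"
    using inner_L2_lin[OF Tc c(4,5,6), of c] curl_w_spec(2)[OF T p(1) w] curl_w_spec(2)[OF T p(2) w]
    by (simp add: inner_L2_commute[of T _ w])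
  then show "inner_L2 T (\<lambda>x. curl_w Eh k \<psi> T x + c *\<^sub>R curl_w Eh k \<psi>' T x) w = curl_rhs T (\<psi> + c *\<^sub>R \<psi>') w"
    unfolding curl_rhs_def S D by (simp add: algebra_simps)
qed

end

subsection \<open>Gradients and tangential derivatives\<close>

text \<open>Mixed partial derivatives of monomials commute because each lowers its own
  exponent.\<close>

lemma curl_grad_poly:
  assumes "p \<in> poly_space k"
  shows "curl (grad p) = (\<lambda>x. 0)"
proof -
  have comm: "partial i (partial j p) x = partial j (partial i p) x" for i j x
  proof -
    obtain c where p: "p = (\<lambda>x. \<Sum>a | (\<Sum>i\<in>UNIV. a i) \<le> k. c a * monomial a x)"
      using assms unfolding poly_space_alt by blast
    have d: "(\<lambda>x. r * monomial a x) differentiable (at x)" for a x r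
      by (intro differentiable_mult differentiable_const monomial_partial)
    have pm: "partial j (\<lambda>x. r * monomial a x) x = (r * real (a j)) * monomial (a(j := a j - 1)) x" for a j r x
      by (subst partial_mult) (auto simp: monomial_partial)
    have 1: "partial j p = (\<lambda>x. \<Sum>a | (\<Sum>i\<in>UNIV. a i) \<le> k. (c a * real (a j)) * monomial (a(j := a j - 1)) x)" for j
      unfolding p by (rule ext, subst partial_sum, rule d, simp only: pm)
    have 2: "partial i (partial j p) x = (\<Sum>a | (\<Sum>i\<in>UNIV. a i) \<le> k.
        (c a * real (a j) * real ((a(j := a j - 1)) i)) * monomial ((a(j := a j - 1))(i := (a(j := a j - 1)) i - 1)) x)" for i j x
      unfolding 1 by (subst partial_sum, rule d, simp only: pm)
    show ?thesis
    proof (cases "i = j")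
      case False
      then show ?thesis unfolding 2 by (intro sum.cong refl) (simp add: fun_upd_twist mult.commute mult.left_commute)
    qed simp
  qed
  have "partial i (grad p) x $ j = partial i (partial j p) x" for i j x
    using partial_as_component[OF vpoly_space_C1[OF grad_in_vpoly_space[OF assms]]] by (simp add: grad_def)
  then show ?thesis by (simp add: fun_eq_iff curl_def vec_eq_iff forall_3 comm)
qed

lemma C1_has_grad:
  fixes p :: "pt \<Rightarrow> real"
  assumes "C1 p"
  shows "(p has_derivative (\<lambda>h. grad p x \<bullet> h)) (at x)"
  using C1_has_derivative[OF C1_differentiable[OF assms]]
  by (simp add: inner_vec_def grad_def mult.commute)

lemma grad_zero_imp_const:
  fixes p :: "pt \<Rightarrow> real"
  assumes "C1 p" "\<And>x. grad p x = 0"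
  shows "p = (\<lambda>x. p 0)"
proof -
  have "(p has_derivative (\<lambda>h. 0)) (at x within UNIV)" for x
    using C1_has_grad[OF assms(1), of x] assms(2) by simp
  then obtain c where "\<And>x. x \<in> UNIV \<Longrightarrow> p x = c"
    using has_derivative_zero_constant[of UNIV p] by auto
  then show ?thesis by (simp add: fun_eq_iff)
qed

text \<open>In the relative interior all derivatives along the plane of the face vanish, so the
  gradient is a multiple of \<open>n\<close> there; continuity reaches the rest of the face.\<close>

lemma tangential_gradient_zero:
  fixes p :: "pt \<Rightarrow> real"
  assumes c: "polyhedral_cell 2 \<sigma>" "unit_normal \<sigma> n" and p: "C1 p" "\<And>x. x \<in> \<sigma> \<Longrightarrow> p x = 0" and x: "x \<in> \<sigma>"
  shows "cross3 n (grad p x) = 0"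
proof (rule zero_on_face[OF c(1) _ _ x])
  show "continuous_on \<sigma> (\<lambda>x. cross3 n (grad p x))"
    by (rule continuous_on_cross3(2)[OF continuous_on_grad[OF p(1)]])
  fix x assume x: "x \<in> rel_interior \<sigma>"
  then have xs: "x \<in> \<sigma>" using rel_interior_subset by blast
  have n1: "n \<bullet> n = 1" using c(2) by (simp add: unit_normal_def dot_square_norm)
  obtain e where e: "e > 0" "\<forall>y. dist y x < e \<longrightarrow> n \<bullet> (y - x) = 0 \<longrightarrow> y \<in> \<sigma>"
    by (rule rel_interior_face_ball[OF c xs x])
  have tan: "grad p x \<bullet> v = 0" if v: "n \<bullet> v = 0" for v
  proof -
    have "((\<lambda>t. p (x + t *\<^sub>R v)) has_derivative (\<lambda>h. grad p (x + 0 *\<^sub>R v) \<bullet> (h *\<^sub>R v))) (at 0)"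
      by (rule has_derivative_compose[of "\<lambda>t. x + t *\<^sub>R v" "\<lambda>h. h *\<^sub>R v" 0 UNIV p, OF _ C1_has_grad[OF p(1)]])
        (auto intro!: derivative_eq_intros)
    then have "((\<lambda>t. p (x + t *\<^sub>R v)) has_real_derivative grad p x \<bullet> v) (at 0)"
      by (simp add: has_field_derivative_def mult_commute_abs)
    moreover have "((\<lambda>t. p (x + t *\<^sub>R v)) has_real_derivative 0) (at 0)"
    proof -
      have "eventually (\<lambda>t::real. dist (x + t *\<^sub>R v) x < e) (nhds 0)"
      proof (rule order_tendstoD(2)[OF _ e(1)])
        have "((\<lambda>t. dist (x + t *\<^sub>R v) x) \<longlongrightarrow> dist (x + 0 *\<^sub>R v) x) (nhds 0)"
          by (intro tendsto_intros) (simp add: filterlim_ident)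
        then show "((\<lambda>t. dist (x + t *\<^sub>R v) x) \<longlongrightarrow> 0) (nhds 0)" by simp
      qed
      then have "eventually (\<lambda>t. p (x + t *\<^sub>R v) = 0) (nhds 0)"
        by (rule eventually_mono) (use e(2) v p(2) in auto)
      then show ?thesis using DERIV_cong_ev[of 0 0 "\<lambda>t. p (x + t *\<^sub>R v)" "\<lambda>t. 0" 0 0] by simp
    qed
    ultimately show ?thesis by (rule DERIV_unique)
  qed
  define v where "v = grad p x - (n \<bullet> grad p x) *\<^sub>R n"
  have nv: "n \<bullet> v = 0" by (simp add: v_def inner_diff_right n1)
  have "v \<bullet> v = (grad p x - (n \<bullet> grad p x) *\<^sub>R n) \<bullet> v" by (simp add: v_def)
  then have "v \<bullet> v = 0" using tan[OF nv] nv by (simp add: inner_diff_left)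
  then have "grad p x = (n \<bullet> grad p x) *\<^sub>R n" by (simp add: v_def)
  then show "cross3 n (grad p x) = 0" by (metis cross_mult_right cross_refl scaleR_zero_right)
qed

subsection \<open>Reduction to sums over cells and faces\<close>

lemma AE_lebesgue_on_negligible:
  assumes "S \<in> sets lebesgue" "AE x in lebesgue_on S. P x"
  obtains N where "negligible N" "\<And>x. x \<in> S \<Longrightarrow> x \<notin> N \<Longrightarrow> P x"
proof -
  have "AE x in lebesgue. x \<in> S \<longrightarrow> P x"
    using assms(2) AE_restrict_space_iff[of S lebesgue P] assms(1) by simp
  then obtain N where "{x \<in> space lebesgue. \<not> (x \<in> S \<longrightarrow> P x)} \<subseteq> N" "N \<in> null_sets lebesgue"
    by (auto elim!: AE_E simp: null_sets_def)
  then show ?thesis using that[of N] by (auto simp: negligible_iff_null_sets)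
qed

context polyhedral_mesh
begin

text \<open>\<open>\<Omega>\<close> differs from the disjoint union of the cell interiors by a null
  set. The set \<open>N\<close> leaves room for a coefficient that is known only almost
  everywhere.\<close>

lemma domain_integral:
  fixes h :: "pt set \<Rightarrow> pt \<Rightarrow> real"
  assumes h: "\<And>T. T \<in> Th \<Longrightarrow> continuous_on T (h T)" and N: "negligible N"
    and H: "\<And>T x. T \<in> Th \<Longrightarrow> x \<in> interior T \<Longrightarrow> x \<notin> N \<Longrightarrow> H x = h T x"
  shows "set_integrable lebesgue \<Omega> H" "(LINT x:\<Omega>|lebesgue. H x) = (\<Sum>T\<in>Th. LINT x:T|lebesgue. h T x)"
proof -
  define G where "G x = (\<Sum>T\<in>Th. indicator T x *\<^sub>R h T x)" for x
  have int: "integrable lebesgue (\<lambda>x. indicator T x *\<^sub>R h T x)" if "T \<in> Th" for T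
    using integrable_on_compact[OF cell_compact[OF that] h[OF that]] by (simp only: set_integrable_def)
  have iG: "integrable lebesgue G" unfolding G_def using int by (intro Bochner_Integration.integrable_sum) auto
  have sG: "integral\<^sup>L lebesgue G = (\<Sum>T\<in>Th. LINT x:T|lebesgue. h T x)"
    unfolding G_def set_lebesgue_integral_def using int by (intro Bochner_Integration.integral_sum) auto
  define N' where "N' = N \<union> (\<Union>T\<in>Th. frontier T)"
  have N': "negligible N'"
    unfolding N'_def using N finite_Th negligible_cell_frontier by (intro negligible_Un negligible_Union) auto
  have eq: "(if x \<in> \<Omega> then H x else 0) = G x" if x: "x \<in> UNIV - N'" for x
  proof -
    have inT: "x \<in> interior T" if "T \<in> Th" "x \<in> T" for T
      using x that cell_closed[OF that(1)] unfolding N'_def frontier_def by auto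
    show ?thesis
    proof (cases "x \<in> \<Omega>")
      case True
      then obtain T where T: "T \<in> Th" "x \<in> T" using Union_Th closure_subset by blast
      have "x \<notin> T'" if "T' \<in> Th" "T' \<noteq> T" for T'
        using inT[OF T] inT[of T'] interiors_disjoint[OF that(1) T(1) that(2)] that by blast
      then have "G x = (\<Sum>T'\<in>Th. if T' = T then h T x else 0)"
        unfolding G_def using T by (intro sum.cong) (auto simp: indicator_def)
      also have "\<dots> = h T x" using T finite_Th by simp
      finally show ?thesis using H[OF T(1) inT[OF T]] x True by (simp add: N'_def)
    next
      case False
      then have "x \<notin> T" if "T \<in> Th" for T using inT[OF that] interior_cell_subset[OF that] by blast
      then show ?thesis using False by (simp add: G_def)
    qed
  qed
  have aG: "G absolutely_integrable_on UNIV" using iG by (simp add: set_integrable_def)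
  have aH: "(\<lambda>x. if x \<in> \<Omega> then H x else 0) absolutely_integrable_on UNIV"
    by (rule absolutely_integrable_spike[OF aG N' eq])
  show sH: "set_integrable lebesgue \<Omega> H" using aH by (simp only: absolutely_integrable_restrict_UNIV)
  have "(LINT x:\<Omega>|lebesgue. H x) = integral \<Omega> H" using set_lebesgue_integral_eq_integral(2)[OF sH] .
  also have "\<dots> = integral UNIV (\<lambda>x. if x \<in> \<Omega> then H x else 0)" by (simp add: integral_restrict_UNIV)
  also have "\<dots> = integral UNIV G" by (rule integral_spike[OF N']) (use eq in auto)
  also have "\<dots> = integral\<^sup>L lebesgue G" using set_lebesgue_integral_eq_integral(2)[OF aG] by (simp add: set_lebesgue_integral_def)
  finally show "(LINT x:\<Omega>|lebesgue. H x) = (\<Sum>T\<in>Th. LINT x:T|lebesgue. h T x)" using sG by simp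
qed

lemma glue_interior:
  fixes v :: "'a::real_vector pw"
  assumes "T \<in> Th" "x \<in> interior T"
  shows "glue Th v x = v T x"
proof -
  have "glue Th v x = (\<Sum>S\<in>Th. if S = T then v T x else 0)"
    unfolding glue_def
  proof (intro sum.cong refl)
    fix S assume "S \<in> Th"
    then show "indicator (interior S) x *\<^sub>R v S x = (if S = T then v T x else 0)"
      using assms interiors_disjoint[of S T] by (auto simp: indicator_def)
  qed
  then show ?thesis using assms finite_Th by simp
qed

lemma inner_L2_domain:
  fixes f g :: "pt \<Rightarrow> 'a::euclidean_space"
  assumes "\<And>T. T \<in> Th \<Longrightarrow> continuous_on T (f' T)" "\<And>T. T \<in> Th \<Longrightarrow> continuous_on T (g' T)" "negligible N"
    and "\<And>T x. T \<in> Th \<Longrightarrow> x \<in> interior T \<Longrightarrow> x \<notin> N \<Longrightarrow> f x = f' T x \<and> g x = g' T x"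
  shows "inner_L2 \<Omega> f g = (\<Sum>T\<in>Th. inner_L2 T (f' T) (g' T))"
  unfolding inner_L2_def using assms(1,2,4)
  by (intro domain_integral(2)[OF _ assms(3)] continuous_on_inner) auto

lemma sum_cells_faces:
  "(\<Sum>T\<in>Th. \<Sum>\<sigma>\<in>F T. A T \<sigma>) = (\<Sum>\<sigma>\<in>Eh. \<Sum>T\<in>cells_at \<sigma>. A T \<sigma>)" for A :: "pt set \<Rightarrow> pt set \<Rightarrow> 'a::comm_monoid_add"
proof -
  have "F T = {\<sigma>\<in>Eh. \<sigma> \<in> F T}" for T using faces_in_Eh by blast
  then have "(\<Sum>T\<in>Th. \<Sum>\<sigma>\<in>F T. A T \<sigma>) = (\<Sum>T\<in>Th. \<Sum>\<sigma>\<in>{\<sigma>\<in>Eh. \<sigma> \<in> F T}. A T \<sigma>)" by simp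
  also have "\<dots> = (\<Sum>\<sigma>\<in>Eh. \<Sum>T\<in>cells_at \<sigma>. A T \<sigma>)" by (rule sum.swap_restrict[OF finite_Th finite_Eh])
  finally show ?thesis .
qed

text \<open>The default value zero outside the mesh is the normal form that \<open>piecewise\<close>
  prescribes; for face functions it also applies off the face.\<close>

definition on_cells :: "(pt set \<Rightarrow> pt \<Rightarrow> 'a) \<Rightarrow> pt set \<Rightarrow> pt \<Rightarrow> 'a::zero" where
  "on_cells p T = (if T \<in> Th then p T else (\<lambda>_. 0))"

definition on_faces :: "(pt set \<Rightarrow> pt \<Rightarrow> 'a) \<Rightarrow> pt set \<Rightarrow> pt \<Rightarrow> 'a::zero" where
  "on_faces p \<sigma> = (if \<sigma> \<in> Eh then (\<lambda>x. if x \<in> \<sigma> then p \<sigma> x else 0) else (\<lambda>_. 0))"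

lemma on_cells_apply [simp]: "T \<in> Th \<Longrightarrow> on_cells p T = p T"
  by (simp add: on_cells_def)

lemma on_faces_apply [simp]: "\<sigma> \<in> Eh \<Longrightarrow> x \<in> \<sigma> \<Longrightarrow> on_faces p \<sigma> x = p \<sigma> x"
  by (simp add: on_faces_def)

lemma on_cells_piecewise: "(\<And>T. T \<in> Th \<Longrightarrow> p T \<in> P T) \<Longrightarrow> on_cells p \<in> piecewise Th P"
  by (simp add: piecewise_def on_cells_def)

lemma on_faces_poly: "(\<And>\<sigma>. \<sigma> \<in> Eh \<Longrightarrow> p \<sigma> \<in> poly_space k) \<Longrightarrow> on_faces p \<in> piecewise Eh (face_poly k)"
  by (auto simp: piecewise_def on_faces_def face_poly_def)

lemma on_faces_tangential:
  assumes "\<And>\<sigma>. \<sigma> \<in> Eh \<Longrightarrow> p \<sigma> \<in> vpoly_space k" "\<And>\<sigma>. \<sigma> \<in> Eh \<Longrightarrow> unit_normal \<sigma> (n \<sigma>)"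
  shows "on_faces (\<lambda>\<sigma> x. cross3 (p \<sigma> x) (n \<sigma>)) \<in> piecewise Eh (face_tangential k)"
  using assms unfolding piecewise_def face_tangential_def on_faces_def
  by (auto intro!: bexI[of _ "p _"] exI[of _ "n _"])

lemma piecewise_outside: "v \<in> piecewise A P \<Longrightarrow> S \<notin> A \<Longrightarrow> v S = (\<lambda>_. 0)"
  by (simp add: piecewise_def)

lemma V_h_cell: "v \<in> V_h Th k \<Longrightarrow> T \<in> Th \<Longrightarrow> v T \<in> vpoly_space k"
  by (auto simp: V_h_def dest: piecewiseD)

lemma M_h_PW: "M_h \<Omega> Th Eh k \<subseteq> PW k" and S_h_PW: "S_h Th Eh k \<Gamma> L \<subseteq> PW k"
  and W_h_VW: "W_h \<Omega> Th Eh k \<subseteq> VW k"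
  by (auto simp: M_h_def S_h_def W_h_def PW_def VW_def)

definition conforming :: "real weak \<Rightarrow> bool" where
  "conforming \<phi> \<longleftrightarrow> (\<forall>T\<in>Th. \<forall>\<sigma>\<in>F T. \<forall>x\<in>\<sigma>. snd \<phi> \<sigma> x = fst \<phi> T x)"

definition tangentially_conforming :: "(real^3) weak \<Rightarrow> bool" where
  "tangentially_conforming \<psi> \<longleftrightarrow> (\<forall>T\<in>Th. \<forall>\<sigma>\<in>F T. \<forall>x\<in>\<sigma>.
    cross3 (snd \<psi> \<sigma> x) (normal_of T \<sigma>) = cross3 (fst \<psi> T x) (normal_of T \<sigma>))"

text \<open>Such a function is constant on each cell and agrees across common faces, and the cells
  are connected through faces.\<close>

lemma conforming_constant:
  assumes \<phi>: "\<phi> \<in> PW k" "conforming \<phi>" and g: "\<And>T. T \<in> Th \<Longrightarrow> grad (fst \<phi> T) = (\<lambda>x. 0)"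
  obtains c where "\<And>T. T \<in> Th \<Longrightarrow> fst \<phi> T = (\<lambda>x. c)" "\<And>\<sigma> x. \<sigma> \<in> Eh \<Longrightarrow> x \<in> \<sigma> \<Longrightarrow> snd \<phi> \<sigma> x = c"
proof -
  have const: "fst \<phi> T = (\<lambda>x. fst \<phi> T 0)" if "T \<in> Th" for T
    using grad_zero_imp_const[OF poly_space_C1[OF PW_cell[OF \<phi>(1) that]]] g[OF that] by auto
  have step: "fst \<phi> T 0 = fst \<phi> T' 0" if TT: "T \<in> Th" "T' \<in> Th" "\<sigma> \<in> F T" "\<sigma> \<in> F T'" for T T' \<sigma>
  proof -
    obtain x where x: "x \<in> \<sigma>" using face_nonempty[OF face_of_cell[OF TT(3)]] by blast
    then have "fst \<phi> T x = fst \<phi> T' x" using \<phi>(2) TT unfolding conforming_def by metis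
    then show ?thesis using const[OF TT(1)] const[OF TT(2)] by metis
  qed
  obtain T0 where T0: "T0 \<in> Th" using Union_Th domain_nonempty closure_subset by blast
  have all: "fst \<phi> T = (\<lambda>x. fst \<phi> T0 0)" if "T \<in> Th" for T
  proof -
    have "fst \<phi> T 0 = fst \<phi> T0 0"
      by (rule face_connected[of "\<lambda>T. fst \<phi> T 0", OF step that T0])
    then show ?thesis using const[OF that] by simp
  qed
  show ?thesis
  proof (rule that[of "fst \<phi> T0 0"])
    show "T \<in> Th \<Longrightarrow> fst \<phi> T = (\<lambda>x. fst \<phi> T0 0)" for T by (rule all)
    fix \<sigma> x assume s: "\<sigma> \<in> Eh" "x \<in> \<sigma>"
    then obtain T where "T \<in> Th" "\<sigma> \<in> F T" using face_has_cell by blast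
    then show "snd \<phi> \<sigma> x = fst \<phi> T0 0" using \<phi>(2) s all[of T] unfolding conforming_def by (metis (mono_tags))
  qed
qed

lemma measure_domain_pos: "measure lebesgue \<Omega> > 0"
proof -
  have "\<Omega> \<in> lmeasurable" using bounded_domain open_domain by (simp add: lmeasurable_open)
  moreover have "\<not> negligible \<Omega>" using open_negligible_empty[OF open_domain] domain_nonempty by blast
  ultimately show ?thesis using negligible_iff_measure by (metis less_eq_real_def measure_nonneg)
qed

lemma domain_integral_const: "(LINT x:\<Omega>|lebesgue. c) = c * measure lebesgue \<Omega>"
proof -
  from lmeasurable_domain show ?thesis by (simp add: set_lebesgue_integral_def fmeasurable_def)
qed

lemma zero_pair:
  assumes "\<phi> \<in> piecewise Th P \<times> piecewise Eh Q"
    and "\<And>T. T \<in> Th \<Longrightarrow> fst \<phi> T = (\<lambda>x. 0)" "\<And>\<sigma>. \<sigma> \<in> Eh \<Longrightarrow> snd \<phi> \<sigma> = (\<lambda>x. 0)"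
  shows "\<phi> = 0"
proof -
  have "fst \<phi> T = (\<lambda>x. 0)" for T using assms(1,2) by (cases "T \<in> Th") (auto dest: piecewise_outside)
  moreover have "snd \<phi> \<sigma> = (\<lambda>x. 0)" for \<sigma> using assms(1,3) by (cases "\<sigma> \<in> Eh") (auto dest: piecewise_outside)
  ultimately show ?thesis by (simp add: prod_eq_iff fun_eq_iff)
qed

lemma PW_zeroI:
  assumes \<phi>: "\<phi> \<in> PW k" and "\<And>T. T \<in> Th \<Longrightarrow> fst \<phi> T = (\<lambda>x. 0)" "\<And>\<sigma> x. \<sigma> \<in> Eh \<Longrightarrow> x \<in> \<sigma> \<Longrightarrow> snd \<phi> \<sigma> x = 0"
  shows "\<phi> = 0"
proof (rule zero_pair[OF \<phi>[unfolded PW_def] assms(2)])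
  fix \<sigma> assume s: "\<sigma> \<in> Eh"
  obtain p where "snd \<phi> \<sigma> = (\<lambda>x. if x \<in> \<sigma> then p x else 0)" by (rule PW_face[OF \<phi> s])
  then show "snd \<phi> \<sigma> = (\<lambda>x. 0)" using assms(3)[OF s] by (auto simp: fun_eq_iff)
qed

text \<open>A face value is orthogonal to the normal by its tangential form and parallel to the
  normal because the cross product with it vanishes.\<close>

lemma VW_zeroI:
  assumes \<psi>: "\<psi> \<in> VW k" and "\<And>T. T \<in> Th \<Longrightarrow> fst \<psi> T = (\<lambda>x. 0)" "tangentially_conforming \<psi>"
  shows "\<psi> = 0"
proof (rule zero_pair[OF \<psi>[unfolded VW_def] assms(2)])
  fix \<sigma> assume s: "\<sigma> \<in> Eh"
  then obtain T where T: "T \<in> Th" "\<sigma> \<in> F T" using face_has_cell by blast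
  define n where "n = normal_of T \<sigma>"
  have un: "unit_normal \<sigma> n" using unit_normal_of[OF T] by (simp add: n_def)
  obtain p where p: "snd \<psi> \<sigma> = (\<lambda>x. if x \<in> \<sigma> then cross3 (p x) n else 0)" by (rule VW_face[OF \<psi> s un])
  have "snd \<psi> \<sigma> x = 0" for x
  proof (cases "x \<in> \<sigma>")
    case True
    have z: "cross3 (snd \<psi> \<sigma> x) n = 0"
      using assms(3) T True assms(2)[OF T(1)] unfolding tangentially_conforming_def n_def by simp
    have o: "n \<bullet> snd \<psi> \<sigma> x = 0" using True by (simp add: p dot_cross_self)
    have "norm n = 1" using un by (simp add: unit_normal_def)
    then show ?thesis using z o norm_cross_dot[of "snd \<psi> \<sigma> x" n] by (simp add: inner_commute)
  qed (simp add: p)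
  then show "snd \<psi> \<sigma> = (\<lambda>x. 0)" by blast
qed

end

section \<open>The coefficient on cells and the broken bilinear forms\<close>

locale pdwg_setting = polyhedral_mesh +
  fixes \<Gamma> :: "nat \<Rightarrow> pt set" and L :: nat and \<epsilon> :: "pt \<Rightarrow> real^3^3" and k :: nat
  assumes boundary: "components (frontier \<Omega>) = \<Gamma> ` {0..L}" "inj_on \<Gamma> {0..L}" "frontier (outside \<Omega>) \<subseteq> \<Gamma> 0"
    and coefficient: "coefficient \<Omega> Th \<epsilon>"
begin

text \<open>The constant value of \<open>\<epsilon>\<close> on a cell. The coefficient attains it
  only almost everywhere, whereas \<open>E T\<close> can be used at every point.\<close>

definition E :: "pt set \<Rightarrow> real^3^3" where
  "E T = (SOME A. \<exists>N. negligible N \<and> (\<forall>x\<in>interior T. x \<notin> N \<longrightarrow> \<epsilon> x = A))"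

lemma domain_sets: "\<Omega> \<in> sets lebesgue"
  using open_domain by (simp add: borel_open)

lemma E_cell: "T \<in> Th \<Longrightarrow> \<exists>N. negligible N \<and> (\<forall>x\<in>interior T. x \<notin> N \<longrightarrow> \<epsilon> x = E T)"
proof -
  assume T: "T \<in> Th"
  have "\<exists>A. AE x in lebesgue_on T. \<epsilon> x = A" using coefficient T unfolding coefficient_def by (elim conjE) blast
  then obtain A where A: "AE x in lebesgue_on T. \<epsilon> x = A" by blast
  have "T \<in> sets lebesgue" using cell_compact[OF T] by (simp add: lmeasurable_compact fmeasurableD)
  from AE_lebesgue_on_negligible[OF this A] obtain N where "negligible N" "\<And>x. x \<in> T \<Longrightarrow> x \<notin> N \<Longrightarrow> \<epsilon> x = A" by blast
  then have "\<exists>N. negligible N \<and> (\<forall>x\<in>interior T. x \<notin> N \<longrightarrow> \<epsilon> x = A)" using interior_subset by blast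
  then show ?thesis unfolding E_def by (rule someI)
qed

lemma E_ae: obtains N where "negligible N" "\<And>T x. T \<in> Th \<Longrightarrow> x \<in> interior T \<Longrightarrow> x \<notin> N \<Longrightarrow> \<epsilon> x = E T"
proof -
  obtain N where N: "\<And>T. T \<in> Th \<Longrightarrow> negligible (N T)" "\<And>T x. T \<in> Th \<Longrightarrow> x \<in> interior T \<Longrightarrow> x \<notin> N T \<Longrightarrow> \<epsilon> x = E T"
    using E_cell by metis
  show ?thesis
  proof (rule that[of "\<Union>T\<in>Th. N T"])
    show "negligible (\<Union>T\<in>Th. N T)" using N(1) finite_Th by (intro negligible_Union) auto
    show "\<epsilon> x = E T" if "T \<in> Th" "x \<in> interior T" "x \<notin> (\<Union>T\<in>Th. N T)" for T x
      using N(2)[OF that(1,2)] that by blast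
  qed
qed

text \<open>The interior of a cell is not null, so it contains a point at which both the property
  and the value \<open>E T\<close> hold.\<close>

lemma E_holds:
  assumes "AE x in lebesgue_on \<Omega>. P (\<epsilon> x)" "T \<in> Th"
  shows "P (E T)"
proof -
  obtain N where N: "negligible N" "\<And>T x. T \<in> Th \<Longrightarrow> x \<in> interior T \<Longrightarrow> x \<notin> N \<Longrightarrow> \<epsilon> x = E T" by (rule E_ae) blast
  obtain N' where N': "negligible N'" "\<And>x. x \<in> \<Omega> \<Longrightarrow> x \<notin> N' \<Longrightarrow> P (\<epsilon> x)"
    by (rule AE_lebesgue_on_negligible[OF domain_sets assms(1)]) blast
  have "\<not> interior T \<subseteq> N \<union> N'"
    using open_negligible_empty[OF open_interior] negligible_subset[OF negligible_Un[OF N(1) N'(1)]]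
      cell_closure_interior(2)[OF assms(2)] by blast
  then obtain x where "x \<in> interior T" "x \<notin> N" "x \<notin> N'" by blast
  then show ?thesis using N(2)[OF assms(2)] N'(2) interior_cell_subset[OF assms(2)] by force
qed

lemma E_symmetric: "T \<in> Th \<Longrightarrow> transpose (E T) = E T"
  using E_holds[of "\<lambda>A. transpose A = A" T] coefficient unfolding coefficient_def by (elim conjE)

lemma E_pos: "\<exists>\<alpha>>0. \<forall>T\<in>Th. \<forall>\<xi>. \<alpha> * (norm \<xi>)\<^sup>2 \<le> \<xi> \<bullet> (E T *v \<xi>)"
proof -
  have "\<exists>\<alpha>>0. AE x in lebesgue_on \<Omega>. \<forall>\<xi>. \<alpha> * (norm \<xi>)\<^sup>2 \<le> \<xi> \<bullet> (\<epsilon> x *v \<xi>)"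
    using coefficient unfolding coefficient_def by (elim conjE)
  then obtain \<alpha> where a: "\<alpha> > 0" "AE x in lebesgue_on \<Omega>. \<forall>\<xi>. \<alpha> * (norm \<xi>)\<^sup>2 \<le> \<xi> \<bullet> (\<epsilon> x *v \<xi>)" by blast
  then show ?thesis using E_holds[of "\<lambda>A. \<forall>\<xi>. \<alpha> * (norm \<xi>)\<^sup>2 \<le> \<xi> \<bullet> (A *v \<xi>)"] by blast
qed

lemma E_form_nonneg: "T \<in> Th \<Longrightarrow> 0 \<le> inner_L2 T v (\<lambda>x. E T *v v x)"
proof -
  assume T: "T \<in> Th"
  obtain \<alpha> where a: "\<alpha> > 0" "\<forall>T\<in>Th. \<forall>\<xi>. \<alpha> * (norm \<xi>)\<^sup>2 \<le> \<xi> \<bullet> (E T *v \<xi>)" using E_pos by blast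
  have "0 \<le> \<xi> \<bullet> (E T *v \<xi>)" for \<xi>
    using a T by (meson mult_nonneg_nonneg order_less_imp_le order_trans zero_le_power2)
  then show ?thesis unfolding inner_L2_def set_lebesgue_integral_def by (intro integral_nonneg_AE) auto
qed

lemma continuous_on_matrix: "continuous_on S v \<Longrightarrow> continuous_on S (\<lambda>x. A *v v x)" for A :: "real^3^3"
  by (rule bounded_linear.continuous_on[OF matrix_vector_mul_bounded_linear])

text \<open>The integrand is continuous and nonnegative, so it vanishes in the interior of the cell,
  and coercivity bounds \<open>v\<close> by it.\<close>

lemma E_form_zero:
  assumes T: "T \<in> Th" and v: "v \<in> vpoly_space m" "inner_L2 T v (\<lambda>x. E T *v v x) = 0"
  shows "v = (\<lambda>x. 0)"
proof (rule vpoly_space_zero_on_open[OF v(1) open_interior cell_closure_interior(2)[OF T]])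
  obtain \<alpha> where a: "\<alpha> > 0" "\<forall>T\<in>Th. \<forall>\<xi>. \<alpha> * (norm \<xi>)\<^sup>2 \<le> \<xi> \<bullet> (E T *v \<xi>)" using E_pos by blast
  fix x assume x: "x \<in> interior T"
  have nn: "0 \<le> \<xi> \<bullet> (E T *v \<xi>)" for \<xi>
    using a T by (meson mult_nonneg_nonneg order_less_imp_le order_trans zero_le_power2)
  have vc: "continuous_on T v" by (rule vpoly_continuous_on[OF v(1)])
  have "v x \<bullet> (E T *v v x) = 0"
    using v(2) nn x
    by (intro set_integral_zero_imp_zero[OF cell_compact[OF T], of "\<lambda>x. v x \<bullet> (E T *v v x)"]
        continuous_on_inner continuous_on_matrix vc) (auto simp: inner_L2_def)
  then have "\<alpha> * (norm (v x))\<^sup>2 \<le> 0" using a T by metis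
  then show "v x = 0" using a(1) by (simp add: mult_le_0_iff)
qed

text \<open>The pairing with \<open>\<epsilon>\<close> times a weak gradient occurs twice in
  \<open>B_h\<close>: once with its first argument as \<open>w\<close>, and once with the cell part
  of \<open>\<psi>\<close> as \<open>w\<close> and \<open>r\<close> as weak function.\<close>

definition div_form :: "(real^3) pw \<Rightarrow> real weak \<Rightarrow> real" where
  "div_form w \<phi> = (\<Sum>T\<in>Th. inner_L2 T (w T) (\<lambda>x. E T *v grad_w Eh k \<phi> T x))"

definition curl_form :: "(real^3) pw \<Rightarrow> (real^3) weak \<Rightarrow> real" where
  "curl_form w \<psi> = (\<Sum>T\<in>Th. inner_L2 T (w T) (curl_w Eh k \<psi> T))"

lemma B_h_forms:
  assumes v: "v \<in> V_h Th k" and r: "r \<in> PW k" and p: "\<phi> \<in> PW k" "\<psi> \<in> VW k"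
  shows "B_h \<Omega> \<epsilon> Th Eh k v r \<phi> \<psi> = div_form v \<phi> + curl_form v \<psi> + div_form (fst \<psi>) r"
proof -
  obtain N where N: "negligible N" "\<And>T x. T \<in> Th \<Longrightarrow> x \<in> interior T \<Longrightarrow> x \<notin> N \<Longrightarrow> \<epsilon> x = E T" by (rule E_ae) blast
  have c: "continuous_on T (v T)" "continuous_on T (fst \<psi> T)" "continuous_on T (\<lambda>x. E T *v grad_w Eh k \<phi> T x)"
    "continuous_on T (curl_w Eh k \<psi> T)" "continuous_on T (\<lambda>x. E T *v grad_w Eh k r T x)" if "T \<in> Th" for T
    using vpoly_continuous_on V_h_cell[OF v that] VW_cell[OF p(2) that] grad_w_spec(1)[OF that r]
      grad_w_spec(1)[OF that p(1)] curl_w_spec(1)[OF that p(2)] continuous_on_matrix by blast+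
  have "inner_L2 \<Omega> (glue Th v) (\<lambda>x. \<epsilon> x *v glue Th (grad_w Eh k \<phi>) x + glue Th (curl_w Eh k \<psi>) x)
      = (\<Sum>T\<in>Th. inner_L2 T (v T) (\<lambda>x. E T *v grad_w Eh k \<phi> T x + curl_w Eh k \<psi> T x))"
    using c N(2) by (intro inner_L2_domain[OF _ _ N(1)]) (auto simp: glue_interior intro!: continuous_on_add)
  also have "\<dots> = (\<Sum>T\<in>Th. inner_L2 T (v T) (\<lambda>x. E T *v grad_w Eh k \<phi> T x) + inner_L2 T (v T) (curl_w Eh k \<psi> T))"
    using c by (intro sum.cong refl inner_L2_add cell_compact) auto
  also have "\<dots> = div_form v \<phi> + curl_form v \<psi>" by (simp add: sum.distrib div_form_def curl_form_def)
  finally have 1: "inner_L2 \<Omega> (glue Th v) (\<lambda>x. \<epsilon> x *v glue Th (grad_w Eh k \<phi>) x + glue Th (curl_w Eh k \<psi>) x)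
      = div_form v \<phi> + curl_form v \<psi>" .
  have "inner_L2 \<Omega> (glue Th (fst \<psi>)) (\<lambda>x. \<epsilon> x *v glue Th (grad_w Eh k r) x) = div_form (fst \<psi>) r"
    unfolding div_form_def
    using c N(2) by (intro inner_L2_domain[OF _ _ N(1)]) (auto simp: glue_interior)
  then show ?thesis unfolding B_h_def 1 by simp
qed

text \<open>On an interior face the sum has two terms with opposite normals; on a boundary face it
  is the normal trace itself.\<close>

definition normal_jump :: "(real^3) pw \<Rightarrow> pt set \<Rightarrow> pt \<Rightarrow> real" where
  "normal_jump w \<sigma> x = (\<Sum>T\<in>cells_at \<sigma>. (E T *v w T x) \<bullet> normal_of T \<sigma>)"

definition tangential_jump :: "(real^3) pw \<Rightarrow> pt set \<Rightarrow> pt \<Rightarrow> real^3" where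
  "tangential_jump w \<sigma> x = (\<Sum>T\<in>cells_at \<sigma>. cross3 (normal_of T \<sigma>) (w T x))"

lemma normal_jump_poly:
  assumes "\<forall>T\<in>Th. w T \<in> vpoly_space m"
  shows "normal_jump w \<sigma> \<in> poly_space m"
  unfolding normal_jump_def[abs_def]
  using assms by (intro poly_space_sum inner_vpoly_space matrix_vpoly_space) auto

text \<open>Exchanging the summations collects at each face the contributions of the adjacent cells.
  This works because \<open>g\<close> is single-valued on the face.\<close>

lemma normal_jump_face_sum:
  assumes w0: "\<forall>T\<in>Th. w T \<in> vpoly_space m" and g: "\<And>\<sigma>. \<sigma> \<in> Eh \<Longrightarrow> continuous_on \<sigma> (g \<sigma>)"
  shows "(\<Sum>T\<in>Th. \<Sum>\<sigma>\<in>F T. face_integral \<sigma> (\<lambda>x. g \<sigma> x * ((E T *v w T x) \<bullet> normal_of T \<sigma>)))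
    = (\<Sum>\<sigma>\<in>Eh. face_integral \<sigma> (\<lambda>x. g \<sigma> x * normal_jump w \<sigma> x))"
  unfolding sum_cells_faces
proof (intro sum.cong refl)
  note w = w0[rule_format]
  fix \<sigma> assume s: "\<sigma> \<in> Eh"
  have "face_integrable \<sigma> (\<lambda>x. g \<sigma> x * ((E T *v w T x) \<bullet> normal_of T \<sigma>))" if "T \<in> cells_at \<sigma>" for T
    using that w g[OF s] by (intro continuous_face_integrable face s continuous_intros
        vpoly_continuous_on[OF matrix_vpoly_space[of _ m]]) auto
  then have "face_integral \<sigma> (\<lambda>x. \<Sum>T\<in>cells_at \<sigma>. g \<sigma> x * ((E T *v w T x) \<bullet> normal_of T \<sigma>))
    = (\<Sum>T\<in>cells_at \<sigma>. face_integral \<sigma> (\<lambda>x. g \<sigma> x * ((E T *v w T x) \<bullet> normal_of T \<sigma>)))"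
    by (rule face_integral_sum[THEN conjunct1])
  then show "(\<Sum>T\<in>cells_at \<sigma>. face_integral \<sigma> (\<lambda>x. g \<sigma> x * ((E T *v w T x) \<bullet> normal_of T \<sigma>)))
      = face_integral \<sigma> (\<lambda>x. g \<sigma> x * normal_jump w \<sigma> x)"
    by (simp only: normal_jump_def sum_distrib_left)
qed

lemma tangential_jump_face_sum:
  assumes w0: "\<forall>T\<in>Th. w T \<in> vpoly_space m" and g: "\<And>\<sigma>. \<sigma> \<in> Eh \<Longrightarrow> continuous_on \<sigma> (g \<sigma>)"
  shows "(\<Sum>T\<in>Th. \<Sum>\<sigma>\<in>F T. face_integral \<sigma> (\<lambda>x. cross3 (g \<sigma> x) (normal_of T \<sigma>) \<bullet> w T x))
    = (\<Sum>\<sigma>\<in>Eh. face_integral \<sigma> (\<lambda>x. g \<sigma> x \<bullet> tangential_jump w \<sigma> x))"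
  unfolding sum_cells_faces
proof (intro sum.cong refl)
  note w = w0[rule_format]
  fix \<sigma> assume s: "\<sigma> \<in> Eh"
  have "face_integrable \<sigma> (\<lambda>x. cross3 (g \<sigma> x) (normal_of T \<sigma>) \<bullet> w T x)" if "T \<in> cells_at \<sigma>" for T
    using that vpoly_continuous_on[OF w[of T], of \<sigma>]
    by (intro face_integrable_inner s continuous_on_cross3(1)[OF g[OF s]]) auto
  then have "face_integral \<sigma> (\<lambda>x. \<Sum>T\<in>cells_at \<sigma>. cross3 (g \<sigma> x) (normal_of T \<sigma>) \<bullet> w T x)
      = (\<Sum>T\<in>cells_at \<sigma>. face_integral \<sigma> (\<lambda>x. cross3 (g \<sigma> x) (normal_of T \<sigma>) \<bullet> w T x))"
    by (rule face_integral_sum[THEN conjunct1])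
  moreover have "cross3 a n \<bullet> b = a \<bullet> cross3 n b" for a b n by (simp add: cross3_simps)
  ultimately show "(\<Sum>T\<in>cells_at \<sigma>. face_integral \<sigma> (\<lambda>x. cross3 (g \<sigma> x) (normal_of T \<sigma>) \<bullet> w T x))
      = face_integral \<sigma> (\<lambda>x. g \<sigma> x \<bullet> tangential_jump w \<sigma> x)"
    by (simp only: tangential_jump_def inner_sum_right)
qed

text \<open>Integration by parts puts all derivatives on \<open>w\<close>, so the broken divergence
  and the normal jump appear paired with the independent cell and face parts of
  \<open>\<phi>\<close>. Symmetry of \<open>E T\<close> moves the coefficient to
  \<open>w\<close>.\<close>

lemma div_form_eq:
  assumes w0: "\<forall>T\<in>Th. w T \<in> vpoly_space k" and p: "\<phi> \<in> PW k"
  shows "div_form w \<phi> = - (\<Sum>T\<in>Th. inner_L2 T (divg (\<lambda>x. E T *v w T x)) (fst \<phi> T))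
    + (\<Sum>\<sigma>\<in>Eh. face_integral \<sigma> (\<lambda>x. snd \<phi> \<sigma> x * normal_jump w \<sigma> x))"
proof -
  note w = w0[rule_format]
  have "inner_L2 T (w T) (\<lambda>x. E T *v grad_w Eh k \<phi> T x) = grad_rhs T \<phi> (\<lambda>x. E T *v w T x)" if T: "T \<in> Th" for T
    using grad_w_spec(2)[OF T p matrix_vpoly_space[OF w[OF T], of "E T"]]
      inner_L2_symmetric_matrix[OF E_symmetric[OF T], of T "w T" "grad_w Eh k \<phi> T"]
      inner_L2_commute[of T "grad_w Eh k \<phi> T" "\<lambda>x. E T *v w T x"] by simp
  then have "div_form w \<phi> = (\<Sum>T\<in>Th. grad_rhs T \<phi> (\<lambda>x. E T *v w T x))" by (simp add: div_form_def)
  also have "\<dots> = - (\<Sum>T\<in>Th. inner_L2 T (divg (\<lambda>x. E T *v w T x)) (fst \<phi> T))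
    + (\<Sum>T\<in>Th. \<Sum>\<sigma>\<in>F T. face_integral \<sigma> (\<lambda>x. snd \<phi> \<sigma> x * ((E T *v w T x) \<bullet> normal_of T \<sigma>)))"
    unfolding grad_rhs_def sum.distrib sum_negf inner_L2_commute[of _ "fst \<phi> _"] ..
  finally show ?thesis using normal_jump_face_sum[of w k "snd \<phi>", OF w0 PW_face_continuous[OF p]] by simp
qed

lemma curl_form_eq:
  assumes w0: "\<forall>T\<in>Th. w T \<in> vpoly_space k" and p: "\<psi> \<in> VW k"
  shows "curl_form w \<psi> = (\<Sum>T\<in>Th. inner_L2 T (curl (w T)) (fst \<psi> T))
    - (\<Sum>\<sigma>\<in>Eh. face_integral \<sigma> (\<lambda>x. snd \<psi> \<sigma> x \<bullet> tangential_jump w \<sigma> x))"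
proof -
  note w = w0[rule_format]
  have "inner_L2 T (w T) (curl_w Eh k \<psi> T) = curl_rhs T \<psi> (w T)" if T: "T \<in> Th" for T
    using curl_w_spec(2)[OF T p w[OF T]] by (simp add: inner_L2_commute)
  then have "curl_form w \<psi> = (\<Sum>T\<in>Th. curl_rhs T \<psi> (w T))" by (simp add: curl_form_def)
  also have "\<dots> = (\<Sum>T\<in>Th. inner_L2 T (curl (w T)) (fst \<psi> T))
    - (\<Sum>T\<in>Th. \<Sum>\<sigma>\<in>F T. face_integral \<sigma> (\<lambda>x. cross3 (snd \<psi> \<sigma> x) (normal_of T \<sigma>) \<bullet> w T x))"
    unfolding curl_rhs_def sum_subtractf inner_L2_commute[of _ "fst \<psi> _"] ..
  finally show ?thesis using tangential_jump_face_sum[of w k "snd \<psi>", OF w0 VW_face_continuous[OF p]] by simp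
qed

text \<open>The identity of \<open>div_form_eq\<close> for a single classical function. It is the
  bridge between the discrete conditions on \<open>w\<close> and conditions tested with smooth
  functions.\<close>

lemma sum_green_grad:
  assumes w0: "\<forall>T\<in>Th. w T \<in> vpoly_space k" and p: "C1 \<phi>"
  shows "(\<Sum>T\<in>Th. inner_L2 T (\<lambda>x. E T *v w T x) (grad \<phi>))
    = - (\<Sum>T\<in>Th. inner_L2 T (divg (\<lambda>x. E T *v w T x)) \<phi>)
      + (\<Sum>\<sigma>\<in>Eh. face_integral \<sigma> (\<lambda>x. \<phi> x * normal_jump w \<sigma> x))"
proof -
  note w = w0[rule_format]
  have "(\<Sum>T\<in>Th. \<Sum>\<sigma>\<in>F T. face_integral \<sigma> (\<lambda>x. \<phi> x * ((E T *v w T x) \<bullet> normal_of T \<sigma>)))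
    = (\<Sum>\<sigma>\<in>Eh. face_integral \<sigma> (\<lambda>x. \<phi> x * normal_jump w \<sigma> x))"
    by (rule normal_jump_face_sum[of w k "\<lambda>_. \<phi>"]) (auto intro: w C1_continuous_on[OF p])
  moreover have "inner_L2 T (\<lambda>x. E T *v w T x) (grad \<phi>) = - inner_L2 T (divg (\<lambda>x. E T *v w T x)) \<phi>
      + (face_sum T (\<lambda>\<sigma> x. \<phi> x * ((E T *v w T x) \<bullet> normal_of T \<sigma>)))" if "T \<in> Th" for T
    by (rule green_grad[OF that vpoly_space_C1[OF matrix_vpoly_space[OF w[OF that]]] p])
  ultimately show ?thesis by (simp add: sum_subtractf)
qed

lemma sum_green_curl:
  assumes w0: "\<forall>T\<in>Th. w T \<in> vpoly_space k" and p: "C1 \<phi>"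
  shows "(\<Sum>T\<in>Th. inner_L2 T (w T) (curl \<phi>))
    = (\<Sum>T\<in>Th. inner_L2 T (curl (w T)) \<phi>) - (\<Sum>\<sigma>\<in>Eh. face_integral \<sigma> (\<lambda>x. \<phi> x \<bullet> tangential_jump w \<sigma> x))"
proof -
  note w = w0[rule_format]
  have J: "(\<Sum>T\<in>Th. \<Sum>\<sigma>\<in>F T. face_integral \<sigma> (\<lambda>x. cross3 (\<phi> x) (normal_of T \<sigma>) \<bullet> w T x))
    = (\<Sum>\<sigma>\<in>Eh. face_integral \<sigma> (\<lambda>x. \<phi> x \<bullet> tangential_jump w \<sigma> x))"
    by (rule tangential_jump_face_sum[of w k "\<lambda>_. \<phi>"]) (auto intro: w C1_continuous_on[OF p])
  have "inner_L2 T (w T) (curl \<phi>) = inner_L2 T (curl (w T)) \<phi>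
      - (face_sum T (\<lambda>\<sigma> x. cross3 (\<phi> x) (normal_of T \<sigma>) \<bullet> w T x))" if T: "T \<in> Th" for T
  proof -
  have anti: "cross3 (w T x) n \<bullet> \<phi> x = (-1) * (cross3 (\<phi> x) n \<bullet> w T x)" for x n by (simp add: cross3_simps)
  have "face_integral \<sigma> (\<lambda>x. cross3 (w T x) n \<bullet> \<phi> x) = - face_integral \<sigma> (\<lambda>x. cross3 (\<phi> x) n \<bullet> w T x)" for \<sigma> n
    unfolding anti face_integral_scale by simp
  then have "(face_sum T (\<lambda>\<sigma> x. cross3 (w T x) (normal_of T \<sigma>) \<bullet> \<phi> x))
    = - (face_sum T (\<lambda>\<sigma> x. cross3 (\<phi> x) (normal_of T \<sigma>) \<bullet> w T x))"
    by (simp add: sum_negf)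
  then show ?thesis
    using green_curl[OF T vpoly_space_C1[OF w[OF T]] p] by simp
  qed
  then show ?thesis using J by (simp add: sum_subtractf)
qed

end

context polyhedral_mesh
begin

subsection \<open>The discrete spaces\<close>

lemma piecewise_subspace:
  fixes P :: "pt set \<Rightarrow> (pt \<Rightarrow> 'a::real_vector) set"
  assumes "\<And>S. S \<in> A \<Longrightarrow> subspace (P S)"
  shows "subspace (piecewise A P)"
  unfolding subspace_def piecewise_def
  using assms by (auto simp: subspace_def plus_fun_def scaleR_fun_def zero_fun_def)

lemma linear_face_restrict: "linear (\<lambda>(p::pt \<Rightarrow> real) x. if x \<in> \<sigma> then p x else 0)"
  by (intro linearI) (auto simp: fun_eq_iff)

lemma face_poly_subspace: "subspace (face_poly k \<sigma>)"
proof -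
  have eq: "face_poly k \<sigma> = (\<lambda>p x. if x \<in> \<sigma> then p x else 0) ` poly_space k" by (auto simp: face_poly_def)
  show ?thesis unfolding eq by (rule linear_subspace_image[OF linear_face_restrict poly_space_subspace])
qed

text \<open>With the normal fixed the set is the image of a linear map, which gives both the
  subspace property and finite dimension.\<close>

lemma face_tangential_eq:
  assumes "polyhedral_cell 2 \<sigma>" "unit_normal \<sigma> n"
  shows "face_tangential k \<sigma> = (\<lambda>p x. if x \<in> \<sigma> then cross3 (p x) n else 0) ` vpoly_space k"
proof
  show "(\<lambda>p x. if x \<in> \<sigma> then cross3 (p x) n else 0) ` vpoly_space k \<subseteq> face_tangential k \<sigma>"
    unfolding face_tangential_def using assms(2) by blast
  show "face_tangential k \<sigma> \<subseteq> (\<lambda>p x. if x \<in> \<sigma> then cross3 (p x) n else 0) ` vpoly_space k"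
  proof
    fix w assume "w \<in> face_tangential k \<sigma>"
    then obtain p m where p: "p \<in> vpoly_space k" "unit_normal \<sigma> m" "w = (\<lambda>x. if x \<in> \<sigma> then cross3 (p x) m else 0)"
      unfolding face_tangential_def by blast
    from unit_normal_unique[OF assms p(2)] show "w \<in> (\<lambda>p x. if x \<in> \<sigma> then cross3 (p x) n else 0) ` vpoly_space k"
    proof
      assume "m = n"
      then show ?thesis using p by blast
    next
      assume m: "m = - n"
      have "(\<lambda>x. - p x) \<in> vpoly_space k"
        using linear_vpoly_space[OF p(1), of uminus] by (simp add: linear_uminus)
      moreover have "w = (\<lambda>x. if x \<in> \<sigma> then cross3 (- p x) n else 0)" by (simp add: p(3) m fun_eq_iff)
      ultimately show ?thesis by (intro image_eqI)
    qed
  qed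
qed

lemma linear_face_cross: "linear (\<lambda>(p::pt \<Rightarrow> real^3) x. if x \<in> \<sigma> then cross3 (p x) n else 0)"
  by (intro linearI) (auto simp: fun_eq_iff linear_add[OF linear_cross3(1)] linear_scale[OF linear_cross3(1)])

lemma face_tangential_subspace:
  assumes "\<sigma> \<in> Eh"
  shows "subspace (face_tangential k \<sigma>)"
proof -
  obtain n where n: "unit_normal \<sigma> n" using face_has_unit_normal[OF face[OF assms]] .
  show ?thesis unfolding face_tangential_eq[OF face[OF assms] n]
    by (rule linear_subspace_image[OF linear_face_cross vpoly_space_subspace])
qed

lemma fin_span_piecewise:
  fixes P :: "pt set \<Rightarrow> (pt \<Rightarrow> 'a::real_vector) set"
  assumes "finite A" "\<And>S. S \<in> A \<Longrightarrow> fin_span (P S)"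
  shows "fin_span (piecewise A P)"
proof (rule fin_span_sum[OF assms(1)])
  have "linear (\<lambda>(p::pt \<Rightarrow> 'a) S'. if S' = S then p else 0)" for S :: "pt set"
    by (intro linearI) (auto simp: fun_eq_iff)
  then show "fin_span ((\<lambda>p S'. if S' = S then p else 0) ` P S)" if "S \<in> A" for S
    using fin_span_image assms(2)[OF that] by blast
  fix v assume v: "v \<in> piecewise A P"
  show "\<exists>x. (\<forall>S\<in>A. x S \<in> (\<lambda>p S'. if S' = S then p else 0) ` P S) \<and> v = (\<Sum>S\<in>A. x S)"
  proof (intro exI conjI ballI)
    show "(\<lambda>S'. if S' = S then v S else 0) \<in> (\<lambda>p S'. if S' = S then p else 0) ` P S" if "S \<in> A" for S
      using piecewiseD[OF v that] by blast
    have "v S' = (\<Sum>S\<in>A. if S' = S then v S else 0)" for S'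
      using assms(1) piecewise_outside[OF v, of S'] by (cases "S' \<in> A") (auto simp: zero_fun_def)
    then show "v = (\<Sum>S\<in>A. (\<lambda>S'. if S' = S then v S else 0))"
      by (intro ext) (simp add: sum_fun_apply)
  qed
qed

lemma fin_span_face_poly: "fin_span (face_poly k \<sigma>)"
proof -
  have eq: "face_poly k \<sigma> = (\<lambda>p x. if x \<in> \<sigma> then p x else 0) ` poly_space k" by (auto simp: face_poly_def)
  show ?thesis unfolding eq by (rule fin_span_image[OF linear_face_restrict fin_span_poly_space])
qed

lemma fin_span_face_tangential:
  assumes "\<sigma> \<in> Eh"
  shows "fin_span (face_tangential k \<sigma>)"
proof -
  obtain n where n: "unit_normal \<sigma> n" using face_has_unit_normal[OF face[OF assms]] .
  show ?thesis unfolding face_tangential_eq[OF face[OF assms] n]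
    by (rule fin_span_image[OF linear_face_cross fin_span_vpoly_space])
qed

lemma PW_subspace: "subspace (PW k)"
  unfolding PW_def by (intro subspace_Times piecewise_subspace poly_space_subspace face_poly_subspace)

lemma VW_subspace: "subspace (VW k)"
  unfolding VW_def by (intro subspace_Times piecewise_subspace vpoly_space_subspace face_tangential_subspace)

lemma V_h_subspace: "subspace (V_h Th k)"
  unfolding V_h_def by (intro piecewise_subspace vpoly_space_subspace)

lemma fin_span_PW: "fin_span (PW k)"
  unfolding PW_def by (intro fin_span_Times fin_span_piecewise finite_Th finite_Eh fin_span_poly_space fin_span_face_poly)

lemma fin_span_VW: "fin_span (VW k)"
  unfolding VW_def by (intro fin_span_Times fin_span_piecewise finite_Th finite_Eh fin_span_vpoly_space fin_span_face_tangential)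

lemma fin_span_V_h: "fin_span (V_h Th k)"
  unfolding V_h_def by (intro fin_span_piecewise finite_Th fin_span_vpoly_space)

lemma mean_eq:
  assumes "\<phi> \<in> PW k"
  shows "(LINT x:\<Omega>|lebesgue. glue Th (fst \<phi>) x) = (\<Sum>T\<in>Th. inner_L2 T (\<lambda>x. 1) (fst \<phi> T))"
  unfolding inner_L2_def
  using poly_continuous_on[OF PW_cell[OF assms]]
  by (intro domain_integral(2)[OF _ negligible_empty]) (auto simp: glue_interior)

lemma mean_lin: "lin_on (PW k) (\<lambda>\<phi>. LINT x:\<Omega>|lebesgue. glue Th (fst \<phi>) x)"
proof (rule lin_onI)
  fix \<phi> \<phi>' c assume p: "\<phi> \<in> PW k" "\<phi>' \<in> PW k"
  then have s: "\<phi> + c *\<^sub>R \<phi>' \<in> PW k" by (intro subspace_add subspace_scale PW_subspace)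
  have "inner_L2 T (\<lambda>x. 1) (fst (\<phi> + c *\<^sub>R \<phi>') T) = inner_L2 T (\<lambda>x. 1) (fst \<phi> T) + c * inner_L2 T (\<lambda>x. 1) (fst \<phi>' T)"
    if T: "T \<in> Th" for T
    using inner_L2_lin[OF cell_compact[OF T] continuous_on_const poly_continuous_on[OF PW_cell[OF p(1) T]]
        poly_continuous_on[OF PW_cell[OF p(2) T]], of 1 c]
    by (simp add: plus_fun_def)
  then show "(LINT x:\<Omega>|lebesgue. glue Th (fst (\<phi> + c *\<^sub>R \<phi>')) x)
      = (LINT x:\<Omega>|lebesgue. glue Th (fst \<phi>) x) + c * (LINT x:\<Omega>|lebesgue. glue Th (fst \<phi>') x)"
    unfolding mean_eq[OF p(1)] mean_eq[OF p(2)] mean_eq[OF s] by (simp add: sum.distrib sum_distrib_left)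
qed

lemma M_h_iff: "\<phi> \<in> M_h \<Omega> Th Eh k \<longleftrightarrow> \<phi> \<in> PW k \<and> (LINT x:\<Omega>|lebesgue. glue Th (fst \<phi>) x) = 0"
  by (auto simp: M_h_def PW_def)

lemma subspace_closedI:
  assumes "subspace X" "0 \<in> Y" "Y \<subseteq> X" "\<And>x y c. x \<in> Y \<Longrightarrow> y \<in> Y \<Longrightarrow> x + c *\<^sub>R y \<in> Y"
  shows "subspace Y"
  unfolding subspace_def
proof (intro conjI ballI allI assms(2))
  show "x + y \<in> Y" if "x \<in> Y" "y \<in> Y" for x y using assms(4)[OF that, of 1] by simp
  show "c *\<^sub>R x \<in> Y" if "x \<in> Y" for c x using assms(4)[OF assms(2) that, of c] by simp
qed

lemma M_h_subspace: "subspace (M_h \<Omega> Th Eh k)"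
proof (rule subspace_closedI[OF PW_subspace _ M_h_PW])
  show "0 \<in> M_h \<Omega> Th Eh k"
    unfolding M_h_iff using lin_on_0[OF mean_lin PW_subspace] subspace_0[OF PW_subspace] by blast
  fix \<phi> \<phi>' c assume "\<phi> \<in> M_h \<Omega> Th Eh k" "\<phi>' \<in> M_h \<Omega> Th Eh k"
  then show "\<phi> + c *\<^sub>R \<phi>' \<in> M_h \<Omega> Th Eh k"
    unfolding M_h_iff using lin_onD[OF mean_lin, of \<phi> k \<phi>' c] subspace_add[OF PW_subspace, of \<phi> k "c *\<^sub>R \<phi>'"]
      subspace_scale[OF PW_subspace, of \<phi>' k c] by simp
qed

lemma S_h_iff: "\<phi> \<in> S_h Th Eh k \<Gamma> L \<longleftrightarrow> \<phi> \<in> PW k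
    \<and> (\<forall>\<sigma>\<in>Eh. \<sigma> \<subseteq> \<Gamma> 0 \<longrightarrow> (\<forall>x\<in>\<sigma>. snd \<phi> \<sigma> x = 0))
    \<and> (\<forall>i\<in>{1..L}. \<exists>c. \<forall>\<sigma>\<in>Eh. \<sigma> \<subseteq> \<Gamma> i \<longrightarrow> (\<forall>x\<in>\<sigma>. snd \<phi> \<sigma> x = c))"
  by (auto simp: S_h_def PW_def)

lemma S_h_subspace: "subspace (S_h Th Eh k \<Gamma> L)"
proof (rule subspace_closedI[OF PW_subspace _ S_h_PW])
  show "0 \<in> S_h Th Eh k \<Gamma> L"
    unfolding S_h_iff using subspace_0[OF PW_subspace] by auto
  fix \<phi> \<phi>' r assume s: "\<phi> \<in> S_h Th Eh k \<Gamma> L" "\<phi>' \<in> S_h Th Eh k \<Gamma> L"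
  have "\<exists>c. \<forall>\<sigma>\<in>Eh. \<sigma> \<subseteq> \<Gamma> i \<longrightarrow> (\<forall>x\<in>\<sigma>. snd (\<phi> + r *\<^sub>R \<phi>') \<sigma> x = c)" if "i \<in> {1..L}" for i
  proof -
    have "\<forall>i\<in>{1..L}. \<exists>c. \<forall>\<sigma>\<in>Eh. \<sigma> \<subseteq> \<Gamma> i \<longrightarrow> (\<forall>x\<in>\<sigma>. snd \<phi> \<sigma> x = c)" if "\<phi> \<in> S_h Th Eh k \<Gamma> L" for \<phi> :: "real weak"
      using that unfolding S_h_iff by (elim conjE)
    from bspec[OF this[OF s(1)] that] bspec[OF this[OF s(2)] that]
    obtain c c' where "\<forall>\<sigma>\<in>Eh. \<sigma> \<subseteq> \<Gamma> i \<longrightarrow> (\<forall>x\<in>\<sigma>. snd \<phi> \<sigma> x = c)"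
      "\<forall>\<sigma>\<in>Eh. \<sigma> \<subseteq> \<Gamma> i \<longrightarrow> (\<forall>x\<in>\<sigma>. snd \<phi>' \<sigma> x = c')" by (elim exE) blast
    then show ?thesis by (intro exI[of _ "c + r * c'"]) auto
  qed
  then show "\<phi> + r *\<^sub>R \<phi>' \<in> S_h Th Eh k \<Gamma> L"
    using s subspace_add[OF PW_subspace, of \<phi> k "r *\<^sub>R \<phi>'"] subspace_scale[OF PW_subspace, of \<phi>' k r]
    unfolding S_h_iff by auto
qed

lemma W_h_iff: "\<psi> \<in> W_h \<Omega> Th Eh k \<longleftrightarrow> \<psi> \<in> VW k \<and> (\<forall>\<sigma>\<in>Eh. \<sigma> \<subseteq> frontier \<Omega> \<longrightarrow> (\<forall>x\<in>\<sigma>. snd \<psi> \<sigma> x = 0))"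
  by (auto simp: W_h_def VW_def)

lemma W_h_subspace: "subspace (W_h \<Omega> Th Eh k)"
proof (rule subspace_closedI[OF VW_subspace _ W_h_VW])
  show "0 \<in> W_h \<Omega> Th Eh k" unfolding W_h_iff using subspace_0[OF VW_subspace] by auto
  fix \<phi> \<phi>' c assume "\<phi> \<in> W_h \<Omega> Th Eh k" "\<phi>' \<in> W_h \<Omega> Th Eh k"
  then show "\<phi> + c *\<^sub>R \<phi>' \<in> W_h \<Omega> Th Eh k"
    unfolding W_h_iff using subspace_add[OF VW_subspace, of \<phi> k "c *\<^sub>R \<phi>'"]
      subspace_scale[OF VW_subspace, of \<phi>' k c] by auto
qed

lemma sum_nonneg_zero:
  fixes f :: "pt set \<Rightarrow> real"
  assumes "finite A" "\<And>S. S \<in> A \<Longrightarrow> 0 \<le> f S" "(\<Sum>S\<in>A. f S) = 0" "S \<in> A"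
  shows "f S = 0"
  using sum_nonneg_eq_0_iff[of A f] assms by auto

end

context pdwg_setting
begin

lemma div_form_lin_right:
  assumes w0: "\<forall>T\<in>Th. w T \<in> vpoly_space k" and p: "\<phi> \<in> PW k" "\<phi>' \<in> PW k"
  shows "div_form w (\<phi> + c *\<^sub>R \<phi>') = div_form w \<phi> + c * div_form w \<phi>'"
proof -
  note w = w0[rule_format]
  have s: "\<phi> + c *\<^sub>R \<phi>' \<in> PW k" using p by (intro subspace_add subspace_scale PW_subspace)
  have "inner_L2 T (w T) (\<lambda>x. E T *v grad_w Eh k (\<phi> + c *\<^sub>R \<phi>') T x)
      = inner_L2 T (w T) (\<lambda>x. E T *v grad_w Eh k \<phi> T x) + c * inner_L2 T (w T) (\<lambda>x. E T *v grad_w Eh k \<phi>' T x)"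
    if T: "T \<in> Th" for T
    using inner_L2_lin[OF cell_compact[OF T] vpoly_continuous_on[OF w[OF T]]
        continuous_on_matrix[OF vpoly_continuous_on[OF grad_w_spec(1)[OF T p(1)]], where A = "E T"]
        continuous_on_matrix[OF vpoly_continuous_on[OF grad_w_spec(1)[OF T p(2)]], where A = "E T"], of c]
    by (simp add: grad_w_lin[OF T p s] matrix_vector_right_distrib matrix_vector_mult_scaleR)
  then show ?thesis by (simp add: div_form_def sum.distrib sum_distrib_left)
qed

lemma curl_form_lin_right:
  assumes w0: "\<forall>T\<in>Th. w T \<in> vpoly_space k" and p: "\<psi> \<in> VW k" "\<psi>' \<in> VW k"
  shows "curl_form w (\<psi> + c *\<^sub>R \<psi>') = curl_form w \<psi> + c * curl_form w \<psi>'"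
proof -
  note w = w0[rule_format]
  have s: "\<psi> + c *\<^sub>R \<psi>' \<in> VW k" using p by (intro subspace_add subspace_scale VW_subspace)
  have "inner_L2 T (w T) (curl_w Eh k (\<psi> + c *\<^sub>R \<psi>') T)
      = inner_L2 T (w T) (curl_w Eh k \<psi> T) + c * inner_L2 T (w T) (curl_w Eh k \<psi>' T)"
    if T: "T \<in> Th" for T
    using inner_L2_lin[OF cell_compact[OF T] vpoly_continuous_on[OF w[OF T]]
        vpoly_continuous_on[OF curl_w_spec(1)[OF T p(1)]]
        vpoly_continuous_on[OF curl_w_spec(1)[OF T p(2)]], of c]
    by (simp add: curl_w_lin[OF T p s])
  then show ?thesis by (simp add: curl_form_def sum.distrib sum_distrib_left)
qed

lemma inner_L2_lin_left:
  assumes T: "T \<in> Th" and w: "w \<in> vpoly_space k" "w' \<in> vpoly_space k" and g: "continuous_on T g"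
  shows "inner_L2 T (\<lambda>x. w x + c *\<^sub>R w' x) g = inner_L2 T w g + c * inner_L2 T w' g"
  using inner_L2_lin[OF cell_compact[OF T] g vpoly_continuous_on[OF w(1)] vpoly_continuous_on[OF w(2)], of c]
  by (simp add: inner_L2_commute[of T _ g])

lemma div_form_lin_left:
  assumes w0: "\<forall>T\<in>Th. w T \<in> vpoly_space k" "\<forall>T\<in>Th. w' T \<in> vpoly_space k" and p: "\<phi> \<in> PW k"
  shows "div_form (w + c *\<^sub>R w') \<phi> = div_form w \<phi> + c * div_form w' \<phi>"
proof -
  note w = w0[rule_format]
  have "inner_L2 T ((w + c *\<^sub>R w') T) (\<lambda>x. E T *v grad_w Eh k \<phi> T x)
      = inner_L2 T (w T) (\<lambda>x. E T *v grad_w Eh k \<phi> T x) + c * inner_L2 T (w' T) (\<lambda>x. E T *v grad_w Eh k \<phi> T x)"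
    if T: "T \<in> Th" for T
    using inner_L2_lin_left[OF T w(1)[OF T] w(2)[OF T]
        continuous_on_matrix[OF vpoly_continuous_on[OF grad_w_spec(1)[OF T p]], where A = "E T"], of c]
    by (simp add: plus_fun_def scaleR_fun_def)
  then show ?thesis by (simp add: div_form_def sum.distrib sum_distrib_left)
qed

lemma curl_form_lin_left:
  assumes w0: "\<forall>T\<in>Th. w T \<in> vpoly_space k" "\<forall>T\<in>Th. w' T \<in> vpoly_space k" and p: "\<psi> \<in> VW k"
  shows "curl_form (w + c *\<^sub>R w') \<psi> = curl_form w \<psi> + c * curl_form w' \<psi>"
proof -
  note w = w0[rule_format]
  have "inner_L2 T ((w + c *\<^sub>R w') T) (curl_w Eh k \<psi> T)
      = inner_L2 T (w T) (curl_w Eh k \<psi> T) + c * inner_L2 T (w' T) (curl_w Eh k \<psi> T)"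
    if T: "T \<in> Th" for T
    using inner_L2_lin_left[OF T w(1)[OF T] w(2)[OF T] vpoly_continuous_on[OF curl_w_spec(1)[OF T p]], of c]
    by (simp add: plus_fun_def scaleR_fun_def)
  then show ?thesis by (simp add: curl_form_def sum.distrib sum_distrib_left)
qed

subsection \<open>The kernel of the scheme\<close>

text \<open>The cell polynomial minus the trace polynomial vanishes on the face and so has no
  tangential gradient there. Hence all adjacent cells see the same tangential gradient.\<close>

lemma cross_grad_trace:
  assumes \<phi>: "\<phi> \<in> PW k" "conforming \<phi>" and T: "T \<in> Th" "\<sigma> \<in> F T" and n: "unit_normal \<sigma> n"
    and p: "p \<in> poly_space k" "snd \<phi> \<sigma> = (\<lambda>x. if x \<in> \<sigma> then p x else 0)" and x: "x \<in> \<sigma>"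
  shows "cross3 n (grad (fst \<phi> T) x) = cross3 n (grad p x)"
proof -
  have C: "C1 (fst \<phi> T)" "C1 p" using poly_space_C1 PW_cell[OF \<phi>(1) T(1)] p(1) by auto
  have z: "fst \<phi> T x - p x = 0" if "x \<in> \<sigma>" for x using \<phi>(2) T p(2) that unfolding conforming_def by force
  have "cross3 n (grad (\<lambda>x. fst \<phi> T x - p x) x) = 0"
    by (rule tangential_gradient_zero[OF face_of_cell[OF T(2)] n C1_minus[OF C] z x])
  moreover have "grad (\<lambda>x. fst \<phi> T x - p x) x = grad (fst \<phi> T) x - grad p x"
    using C by (simp add: grad_def partial_minus C1_differentiable vec_eq_iff)
  ultimately show ?thesis by (simp add: linear_diff[OF linear_cross3(2)])
qed

text \<open>The common tangential gradient factors out of the sum, and the normals at an interior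
  face cancel.\<close>

lemma tangential_jump_grad:
  assumes \<phi>: "\<phi> \<in> PW k" "conforming \<phi>" and s: "\<sigma> \<in> Eh" "\<not> \<sigma> \<subseteq> frontier \<Omega>" "x \<in> \<sigma>"
  shows "tangential_jump (\<lambda>T. grad (fst \<phi> T)) \<sigma> x = 0"
proof -
  obtain p where p: "p \<in> poly_space k" "snd \<phi> \<sigma> = (\<lambda>x. if x \<in> \<sigma> then p x else 0)" by (rule PW_face[OF \<phi>(1) s(1)])
  have "tangential_jump (\<lambda>T. grad (fst \<phi> T)) \<sigma> x = (\<Sum>T\<in>cells_at \<sigma>. cross3 (normal_of T \<sigma>) (grad p x))"
    unfolding tangential_jump_def
    using cross_grad_trace[OF \<phi> _ _ unit_normal_of p s(3)] by (intro sum.cong) auto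
  also have "\<dots> = cross3 (\<Sum>T\<in>cells_at \<sigma>. normal_of T \<sigma>) (grad p x)"
    by (simp add: linear_sum[OF linear_cross3(1)])
  finally show ?thesis using interior_face_normals[OF s(1,2)] by simp
qed

lemma div_form_conforming:
  assumes "\<phi> \<in> PW k" "conforming \<phi>"
  shows "div_form w \<phi> = (\<Sum>T\<in>Th. inner_L2 T (w T) (\<lambda>x. E T *v grad (fst \<phi> T) x))"
  unfolding div_form_def
  using assms grad_w_conforming[OF _ assms(1)] by (intro sum.cong) (auto simp: conforming_def)

lemma curl_form_conforming:
  assumes "\<psi> \<in> VW k" "tangentially_conforming \<psi>"
  shows "curl_form w \<psi> = (\<Sum>T\<in>Th. inner_L2 T (w T) (curl (fst \<psi> T)))"
  unfolding curl_form_def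
  using assms curl_w_conforming[OF _ assms(1)] by (intro sum.cong) (auto simp: tangentially_conforming_def)

lemma grad_form_zero:
  assumes \<phi>: "\<phi> \<in> PW k" and z: "(\<Sum>T\<in>Th. inner_L2 T (grad (fst \<phi> T)) (\<lambda>x. E T *v grad (fst \<phi> T) x)) = 0" and T: "T \<in> Th"
  shows "grad (fst \<phi> T) = (\<lambda>x. 0)"
  by (rule E_form_zero[OF T grad_in_vpoly_space[OF PW_cell[OF \<phi> T]]],
      rule sum_nonneg_zero[of Th "\<lambda>T. inner_L2 T (grad (fst \<phi> T)) (\<lambda>x. E T *v grad (fst \<phi> T) x)", OF finite_Th E_form_nonneg z T])

text \<open>Testing with the field \<epsilon> grad l + curl q itself shows that it vanishes.
  Gradients of conforming functions are orthogonal to curl q, so pairing with grad l leaves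
  (\<epsilon> grad l, grad l) = 0; then curl q vanishes as well.\<close>

lemma multiplier_zero:
  assumes l: "l \<in> M_h \<Omega> Th Eh k" "conforming l" and q: "q \<in> W_h \<Omega> Th Eh k" "tangentially_conforming q"
    and eq: "\<And>v. v \<in> V_h Th k \<Longrightarrow> div_form v l + curl_form v q = 0"
  shows "l = 0" "\<And>T. T \<in> Th \<Longrightarrow> curl (fst q T) = (\<lambda>x. 0)"
proof -
  have lP: "l \<in> PW k" and qV: "q \<in> VW k" using l q M_h_PW W_h_VW by blast+
  define g where "g T = grad (fst l T)" for T
  define c where "c T = curl (fst q T)" for T
  have g: "g T \<in> vpoly_space k" if "T \<in> Th" for T
    unfolding g_def by (rule grad_in_vpoly_space[OF PW_cell[OF lP that]])
  have c: "c T \<in> vpoly_space k" if "T \<in> Th" for T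
    unfolding c_def by (rule curl_in_vpoly_space[OF VW_cell[OF qV that]])
  define r where "r T x = E T *v g T x + c T x" for T x
  have r: "r T \<in> vpoly_space k" if "T \<in> Th" for T
    using subspace_add[OF vpoly_space_subspace matrix_vpoly_space[OF g[OF that], of "E T"] c[OF that]]
    by (simp add: plus_fun_def r_def[abs_def])
  have "on_cells r \<in> V_h Th k" unfolding V_h_def using r by (rule on_cells_piecewise)
  from eq[OF this] have "(\<Sum>T\<in>Th. inner_L2 T (r T) (\<lambda>x. E T *v g T x) + inner_L2 T (r T) (c T)) = 0"
    unfolding div_form_conforming[OF lP l(2)] curl_form_conforming[OF qV q(2)] by (simp add: sum.distrib g_def c_def)
  moreover have "inner_L2 T (r T) (\<lambda>x. E T *v g T x) + inner_L2 T (r T) (c T) = inner_L2 T (r T) (r T)" if T: "T \<in> Th" for T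
    using inner_L2_add[OF cell_compact[OF T] vpoly_continuous_on[OF r[OF T]]
        continuous_on_matrix[OF vpoly_continuous_on[OF g[OF T]], where A = "E T"] vpoly_continuous_on[OF c[OF T]]]
    by (simp add: r_def[abs_def])
  ultimately have "(\<Sum>T\<in>Th. inner_L2 T (r T) (r T)) = 0" by simp
  note rr = sum_nonneg_zero[of Th "\<lambda>T. inner_L2 T (r T) (r T)", OF finite_Th inner_L2_self_nonneg this]
  have "r T = (\<lambda>x. 0)" if "T \<in> Th" for T
    by (rule inner_L2_vpoly_zero[OF that r[OF that] rr[OF that]])
  then have cE: "c T x = - (E T *v g T x)" if "T \<in> Th" for T x
    using that by (simp add: r_def fun_eq_iff add_eq_0_iff2)
  have gb: "\<forall>T\<in>Th. g T \<in> vpoly_space k" using g by blast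
  have cg: "curl (g T) = (\<lambda>x. 0)" if "T \<in> Th" for T
    unfolding g_def by (rule curl_grad_poly[OF PW_cell[OF lP that]])
  \<comment> \<open>The gradient has no curl in the cells and no tangential jump at interior faces,
    and the face part of \<open>q\<close> is zero on boundary faces.\<close>
  have "curl_form g q = 0"
  proof -
    have "snd q \<sigma> x \<bullet> tangential_jump g \<sigma> x = 0" if "\<sigma> \<in> Eh" "x \<in> \<sigma>" for \<sigma> x
      using q(1) that tangential_jump_grad[OF lP l(2) that(1) _ that(2)] unfolding W_h_iff g_def by fastforce
    then have "face_integral \<sigma> (\<lambda>x. snd q \<sigma> x \<bullet> tangential_jump g \<sigma> x) = 0" if "\<sigma> \<in> Eh" for \<sigma>
      using face_integral_cong[of \<sigma> "\<lambda>x. snd q \<sigma> x \<bullet> tangential_jump g \<sigma> x" "\<lambda>x. 0"] that by simp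
    then show ?thesis
      unfolding curl_form_eq[of g, OF gb qV] using cg by simp
  qed
  then have "(\<Sum>T\<in>Th. inner_L2 T (g T) (c T)) = 0"
    unfolding curl_form_conforming[OF qV q(2)] by (simp add: c_def)
  moreover have "inner_L2 T (g T) (c T) = - inner_L2 T (g T) (\<lambda>x. E T *v g T x)" if "T \<in> Th" for T
    unfolding inner_L2_minus[of T "g T" "\<lambda>x. E T *v g T x", symmetric] by (intro inner_L2_cong refl cE that)
  ultimately have "(\<Sum>T\<in>Th. inner_L2 T (g T) (\<lambda>x. E T *v g T x)) = 0" by (simp add: sum_negf)
  then have g0: "g T = (\<lambda>x. 0)" if "T \<in> Th" for T
    unfolding g_def using grad_form_zero[OF lP _ that] by blast
  then show "curl (fst q T) = (\<lambda>x. 0)" if "T \<in> Th" for T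
    using cE[OF that] that by (auto simp: c_def fun_eq_iff)
  obtain a where a: "\<And>T. T \<in> Th \<Longrightarrow> fst l T = (\<lambda>x. a)" "\<And>\<sigma> x. \<sigma> \<in> Eh \<Longrightarrow> x \<in> \<sigma> \<Longrightarrow> snd l \<sigma> x = a"
    by (rule conforming_constant[OF lP l(2)]) (use g0 in \<open>auto simp: g_def\<close>)
  have "(LINT x:\<Omega>|lebesgue. glue Th (fst l) x) = (\<Sum>T\<in>Th. LINT x:T|lebesgue. a)"
    by (rule domain_integral(2)[OF _ negligible_empty]) (auto simp: glue_interior a)
  moreover have "(LINT x:\<Omega>|lebesgue. a) = (\<Sum>T\<in>Th. LINT x:T|lebesgue. a)"
    by (rule domain_integral(2)[OF _ negligible_empty]) auto
  \<comment> \<open>The mean value condition in \<open>M_h\<close> removes the constant.\<close>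
  ultimately have "a = 0" using l(1) measure_domain_pos unfolding M_h_iff by (simp add: domain_integral_const)
  then show "l = 0" using PW_zeroI[OF lP] a by simp
qed

section \<open>Boundary components and the vanishing of the potential\<close>

abbreviation faces_on :: "nat \<Rightarrow> pt set set" where
  "faces_on i \<equiv> {\<sigma>\<in>Eh. \<sigma> \<subseteq> \<Gamma> i}"

lemma boundary_face_component:
  assumes "\<sigma> \<in> Eh" "\<sigma> \<subseteq> frontier \<Omega>"
  obtains i where "i \<in> {0..L}" "\<sigma> \<subseteq> \<Gamma> i"
proof -
  have "frontier \<Omega> \<noteq> {}" using assms face_nonempty[OF face] by blast
  then obtain C where C: "C \<in> components (frontier \<Omega>)" "\<sigma> \<subseteq> C"
    using exists_component_superset[OF assms(2) _ connected_face[OF assms(1)]] by blast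
  then have "C \<in> \<Gamma> ` {0..L}" using boundary(1) by simp
  then obtain i where "i \<in> {0..L}" "C = \<Gamma> i" by blast
  then show ?thesis using that[of i] C(2) by simp
qed

lemma component_of: "i \<in> {0..L} \<Longrightarrow> \<Gamma> i \<in> components (frontier \<Omega>)"
  using boundary(1) by simp

lemma component_subset_frontier: "i \<in> {0..L} \<Longrightarrow> \<Gamma> i \<subseteq> frontier \<Omega>"
  using component_of in_components_subset by blast

lemma boundary_component_unique:
  assumes "\<sigma> \<in> Eh" "i \<in> {0..L}" "j \<in> {0..L}" "\<sigma> \<subseteq> \<Gamma> i" "\<sigma> \<subseteq> \<Gamma> j"
  shows "i = j"
proof (rule ccontr)
  assume "i \<noteq> j"
  then have "\<Gamma> i \<noteq> \<Gamma> j" using boundary(2) assms by (auto dest: inj_onD)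
  then have "\<Gamma> i \<inter> \<Gamma> j = {}"
    using components_nonoverlap[OF component_of[OF assms(2)] component_of[OF assms(3)]] by simp
  then show False using assms(4,5) face_nonempty[OF face[OF assms(1)]] by blast
qed

text \<open>For a unit vector \<open>n\<close>, passing from \<open>g\<close> to its tangential part
  does not change the cross product with \<open>n\<close>.\<close>

lemma triple_cross: "cross3 (cross3 (cross3 n g) n) n = (n \<bullet> n) *\<^sub>R cross3 g n"
  by (simp add: cross3_def vec_eq_iff forall_3 inner_vec_def sum_3 algebra_simps)

text \<open>The test function is the gradient of \<open>s\<close> with its tangential part on the
  faces. It is admissible in \<open>W_h\<close> because \<open>s\<close> is constant on each
  boundary component, and it is curl free, so only the energy of the gradient of \<open>s\<close>
  remains.\<close>

lemma potential_zero:
  assumes s: "s \<in> S_h Th Eh k \<Gamma> L" "conforming s" and u: "u \<in> V_h Th k"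
    and eq: "\<And>\<psi>. \<psi> \<in> W_h \<Omega> Th Eh k \<Longrightarrow> curl_form u \<psi> + div_form (fst \<psi>) s = 0"
  shows "s = 0"
proof -
  have sP: "s \<in> PW k" using s S_h_PW by blast
  have s0: "\<forall>\<sigma>\<in>Eh. \<sigma> \<subseteq> \<Gamma> 0 \<longrightarrow> (\<forall>x\<in>\<sigma>. snd s \<sigma> x = 0)"
    and si: "\<forall>i\<in>{1..L}. \<exists>c. \<forall>\<sigma>\<in>Eh. \<sigma> \<subseteq> \<Gamma> i \<longrightarrow> (\<forall>x\<in>\<sigma>. snd s \<sigma> x = c)"
    using s(1)[unfolded S_h_iff] by blast+
  have "\<forall>\<sigma>\<in>Eh. \<exists>p. p \<in> poly_space k \<and> snd s \<sigma> = (\<lambda>x. if x \<in> \<sigma> then p x else 0)"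
    using PW_face[OF sP] by blast
  from bchoice[OF this] obtain p where p: "\<And>\<sigma>. \<sigma> \<in> Eh \<Longrightarrow> p \<sigma> \<in> poly_space k"
    "\<And>\<sigma>. \<sigma> \<in> Eh \<Longrightarrow> snd s \<sigma> = (\<lambda>x. if x \<in> \<sigma> then p \<sigma> x else 0)" by blast
  have "\<forall>\<sigma>\<in>Eh. \<exists>n. unit_normal \<sigma> n" using face_has_unit_normal[OF face] by blast
  from bchoice[OF this] obtain n where n: "\<And>\<sigma>. \<sigma> \<in> Eh \<Longrightarrow> unit_normal \<sigma> (n \<sigma>)" by blast
  \<comment> \<open>The double cross product is the tangential part of the gradient of the trace
    polynomial, written in the form that \<open>face_tangential\<close> demands.\<close>
  define \<psi> where "\<psi> = (on_cells (\<lambda>T. grad (fst s T)),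
    on_faces (\<lambda>\<sigma> x. cross3 (cross3 (n \<sigma>) (grad (p \<sigma>) x)) (n \<sigma>)))"
  have V: "\<psi> \<in> VW k"
    unfolding VW_def \<psi>_def
    using on_cells_piecewise[of "\<lambda>T. grad (fst s T)" "\<lambda>_. vpoly_space k"] grad_in_vpoly_space[OF PW_cell[OF sP]]
      on_faces_tangential[of "\<lambda>\<sigma> x. cross3 (n \<sigma>) (grad (p \<sigma>) x)" k n]
      linear_vpoly_space[OF grad_in_vpoly_space[OF p(1)] linear_cross3(2)] n by auto
  have bd: "snd \<psi> \<sigma> x = 0" if sg: "\<sigma> \<in> Eh" "\<sigma> \<subseteq> frontier \<Omega>" "x \<in> \<sigma>" for \<sigma> x
  proof -
    obtain i where i: "i \<in> {0..L}" "\<sigma> \<subseteq> \<Gamma> i" by (rule boundary_face_component[OF sg(1,2)])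
    have "\<exists>c. \<forall>x\<in>\<sigma>. snd s \<sigma> x = c"
    proof (cases "i = 0")
      case True
      then show ?thesis using s0 sg(1) i(2) by blast
    next
      case False
      then have "i \<in> {1..L}" using i(1) by auto
      from bspec[OF si this] show ?thesis using sg(1) i(2) by blast
    qed
    then obtain c where c: "\<And>x. x \<in> \<sigma> \<Longrightarrow> p \<sigma> x - c = 0" using p(2)[OF sg(1)] by auto
    have C: "C1 (p \<sigma>)" using poly_space_C1[OF p(1)[OF sg(1)]] .
    have "cross3 (n \<sigma>) (grad (\<lambda>x. p \<sigma> x - c) x) = 0"
      by (rule tangential_gradient_zero[OF face[OF sg(1)] n[OF sg(1)] C1_minus[OF C C1_const] c sg(3)])
    moreover have "grad (\<lambda>x. p \<sigma> x - c) x = grad (p \<sigma>) x"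
      using C C1_const by (simp add: grad_def partial_minus C1_differentiable vec_eq_iff)
    ultimately show ?thesis using sg by (simp add: \<psi>_def)
  qed
  have W: "\<psi> \<in> W_h \<Omega> Th Eh k" unfolding W_h_iff using V bd by blast
  have tc: "tangentially_conforming \<psi>"
    unfolding tangentially_conforming_def
  proof (intro ballI)
    fix T \<sigma> x assume T: "T \<in> Th" "\<sigma> \<in> F T" "x \<in> \<sigma>"
    have sE: "\<sigma> \<in> Eh" using faces_in_Eh[OF T(2)] .
    have nn: "n \<sigma> \<bullet> n \<sigma> = 1" using n[OF sE] by (simp add: unit_normal_def dot_square_norm)
    have "cross3 (snd \<psi> \<sigma> x) (n \<sigma>) = cross3 (cross3 (cross3 (n \<sigma>) (grad (fst s T) x)) (n \<sigma>)) (n \<sigma>)"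
      using cross_grad_trace[OF sP s(2) T(1,2) n[OF sE] p[OF sE] T(3)] sE T(3) by (simp add: \<psi>_def)
    also have "\<dots> = cross3 (fst \<psi> T x) (n \<sigma>)" unfolding triple_cross nn using T(1) by (simp add: \<psi>_def)
    finally have e: "cross3 (snd \<psi> \<sigma> x) (n \<sigma>) = cross3 (fst \<psi> T x) (n \<sigma>)" .
    show "cross3 (snd \<psi> \<sigma> x) (normal_of T \<sigma>) = cross3 (fst \<psi> T x) (normal_of T \<sigma>)"
      using unit_normal_unique[OF face[OF sE] n[OF sE] unit_normal_of[OF T(1,2)]] e by auto
  qed
  have "curl_form u \<psi> = 0"
    unfolding curl_form_conforming[OF V tc] using curl_grad_poly[OF PW_cell[OF sP]] by (simp add: \<psi>_def)
  then have "(\<Sum>T\<in>Th. inner_L2 T (grad (fst s T)) (\<lambda>x. E T *v grad (fst s T) x)) = 0"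
    using eq[OF W] unfolding div_form_conforming[OF sP s(2)] by (simp add: \<psi>_def)
  then have "grad (fst s T) = (\<lambda>x. 0)" if "T \<in> Th" for T using grad_form_zero[OF sP _ that] by blast
  then obtain a where a: "\<And>T. T \<in> Th \<Longrightarrow> fst s T = (\<lambda>x. a)" "\<And>\<sigma> x. \<sigma> \<in> Eh \<Longrightarrow> x \<in> \<sigma> \<Longrightarrow> snd s \<sigma> x = a"
    using conforming_constant[OF sP s(2)] by metis
  \<comment> \<open>The remaining constant is zero because at least one face lies on
    \<open>\<Gamma> 0\<close>, where the face values are prescribed.\<close>
  obtain \<sigma> where sg: "\<sigma> \<in> Eh" "\<sigma> \<subseteq> \<Gamma> 0"
    by (rule boundary_component_face[OF boundary(3) component_of]) auto
  obtain x where "x \<in> \<sigma>" using face_nonempty[OF face[OF sg(1)]] by blast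
  then have "a = 0" using a(2)[OF sg(1)] s0 sg by force
  then show ?thesis using PW_zeroI[OF sP] a by simp
qed

lemma boundary_sum:
  fixes A :: "pt set \<Rightarrow> real"
  assumes "\<And>\<sigma>. \<sigma> \<in> Eh \<Longrightarrow> \<not> \<sigma> \<subseteq> frontier \<Omega> \<Longrightarrow> A \<sigma> = 0"
  shows "(\<Sum>\<sigma>\<in>Eh. A \<sigma>) = (\<Sum>i\<in>{0..L}. \<Sum>\<sigma>\<in>faces_on i. A \<sigma>)"
proof -
  have "(\<Sum>\<sigma>\<in>Eh. A \<sigma>) = (\<Sum>\<sigma>\<in>(\<Union>i\<in>{0..L}. faces_on i). A \<sigma>)"
  proof (rule sum.mono_neutral_right[OF finite_Eh])
    show "\<forall>\<sigma>\<in>Eh - (\<Union>i\<in>{0..L}. faces_on i). A \<sigma> = 0"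
      using assms boundary_face_component by (metis (mono_tags, lifting) DiffE UN_I mem_Collect_eq)
  qed blast
  also have "\<dots> = (\<Sum>i\<in>{0..L}. \<Sum>\<sigma>\<in>faces_on i. A \<sigma>)"
    using finite_Eh boundary_component_unique by (intro sum.UNION_disjoint) auto
  finally show ?thesis .
qed

lemma PW_pairI:
  assumes "\<And>T. T \<in> Th \<Longrightarrow> p T \<in> poly_space k" "\<And>\<sigma>. \<sigma> \<in> Eh \<Longrightarrow> r \<sigma> \<in> poly_space k"
  shows "(on_cells p, on_faces r) \<in> PW k"
  unfolding PW_def using on_cells_piecewise[of p "\<lambda>_. poly_space k"] on_faces_poly[of r k] assms by auto

text \<open>For the broken divergence on the cells and zero on the faces, the form equals minus the
  sum of the squared norms of the divergence.\<close>

lemma div_form_cells: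
  assumes w0: "\<forall>T\<in>Th. w T \<in> vpoly_space k" and z: "div_form w (on_cells (\<lambda>T. divg (\<lambda>x. E T *v w T x)), on_faces (\<lambda>_ _. 0)) = 0"
    and T: "T \<in> Th"
  shows "divg (\<lambda>x. E T *v w T x) = (\<lambda>x. 0)"
proof -
  note w = w0[rule_format]
  have d: "divg (\<lambda>x. E T *v w T x) \<in> poly_space k" if "T \<in> Th" for T
    by (rule divg_in_poly_space[OF matrix_vpoly_space[OF w[OF that]]])
  have P: "(on_cells (\<lambda>T. divg (\<lambda>x. E T *v w T x)), on_faces (\<lambda>_ _. 0)) \<in> PW k"
    using d by (intro PW_pairI poly_space_const)
  have "on_faces (\<lambda>_ _. 0 :: real) \<sigma> x = 0" for \<sigma> x by (simp add: on_faces_def)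
  then have "(\<Sum>T\<in>Th. inner_L2 T (divg (\<lambda>x. E T *v w T x)) (divg (\<lambda>x. E T *v w T x))) = 0"
    using z unfolding div_form_eq[of w, OF w0 P] by simp
  then have "inner_L2 T (divg (\<lambda>x. E T *v w T x)) (divg (\<lambda>x. E T *v w T x)) = 0"
    by (rule sum_nonneg_zero[of Th "\<lambda>T. inner_L2 T (divg (\<lambda>x. E T *v w T x)) (divg (\<lambda>x. E T *v w T x))", OF finite_Th inner_L2_self_nonneg _ T])
  then show ?thesis by (rule inner_L2_poly_zero[OF T d[OF T]])
qed

text \<open>The predicate \<open>P\<close> selects the faces on which the test space leaves the face
  part free: the interior faces for \<open>S_h\<close>, all faces for unconstrained weak
  functions.\<close>

lemma div_form_faces:
  assumes w0: "\<forall>T\<in>Th. w T \<in> vpoly_space k"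
    and z: "div_form w (on_cells (\<lambda>_ _. 0), on_faces (\<lambda>\<sigma>. if P \<sigma> then normal_jump w \<sigma> else (\<lambda>_. 0))) = 0"
    and s: "\<sigma> \<in> Eh" "P \<sigma>" "x \<in> \<sigma>"
  shows "normal_jump w \<sigma> x = 0"
proof -
  note w = w0[rule_format]
  have PW: "(on_cells (\<lambda>_ _. 0), on_faces (\<lambda>\<sigma>. if P \<sigma> then normal_jump w \<sigma> else (\<lambda>_. 0))) \<in> PW k"
    using normal_jump_poly[of w, OF w0] poly_space_const by (intro PW_pairI) auto
  have Jc: "continuous_on S (normal_jump w \<sigma>)" for S \<sigma>
    by (rule poly_continuous_on[OF normal_jump_poly[of w, OF w0]])
  have "(\<Sum>\<sigma>\<in>Eh. face_integral \<sigma> (\<lambda>x. (if P \<sigma> then normal_jump w \<sigma> x else 0) * normal_jump w \<sigma> x)) = 0"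
  proof -
    have "face_integral \<sigma> (\<lambda>x. on_faces (\<lambda>\<sigma>. if P \<sigma> then normal_jump w \<sigma> else (\<lambda>_. 0)) \<sigma> x * normal_jump w \<sigma> x)
      = face_integral \<sigma> (\<lambda>x. (if P \<sigma> then normal_jump w \<sigma> x else 0) * normal_jump w \<sigma> x)" if "\<sigma> \<in> Eh" for \<sigma>
      using that by (intro face_integral_cong) simp
    then show ?thesis using z unfolding div_form_eq[of w, OF w0 PW] by simp
  qed
  then have "face_integral \<sigma> (\<lambda>x. (if P \<sigma> then normal_jump w \<sigma> x else 0) * normal_jump w \<sigma> x) = 0"
    by (intro sum_nonneg_zero[of Eh "\<lambda>\<sigma>. face_integral \<sigma> (\<lambda>x. (if P \<sigma> then normal_jump w \<sigma> x else 0) * normal_jump w \<sigma> x)", OF finite_Eh _ _ s(1)]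
        face_integral_nonneg) auto
  then have "normal_jump w \<sigma> x * normal_jump w \<sigma> x = 0"
    using s Jc by (intro face_integral_zero_imp_zero[OF face[OF s(1)], of "\<lambda>x. normal_jump w \<sigma> x * normal_jump w \<sigma> x"])
      (auto intro: continuous_on_mult)
  then show ?thesis by simp
qed

text \<open>Functions in \<open>S_h\<close> are free on cells and interior faces but only constant
  on each boundary component, so on the boundary they control fluxes and not pointwise values. They
  vanish on \<open>\<Gamma> 0\<close>, and the flux there is recovered from the total flux.\<close>

lemma multiplier_divergence_free:
  assumes q: "q \<in> VW k" and eq: "\<And>r. r \<in> S_h Th Eh k \<Gamma> L \<Longrightarrow> div_form (fst q) r = 0"
  shows "\<And>T. T \<in> Th \<Longrightarrow> divg (\<lambda>x. E T *v fst q T x) = (\<lambda>x. 0)"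
    and "\<And>\<sigma> x. \<sigma> \<in> Eh \<Longrightarrow> \<not> \<sigma> \<subseteq> frontier \<Omega> \<Longrightarrow> x \<in> \<sigma> \<Longrightarrow> normal_jump (fst q) \<sigma> x = 0"
    and "\<And>i. i \<in> {0..L} \<Longrightarrow> (\<Sum>\<sigma>\<in>faces_on i. face_integral \<sigma> (normal_jump (fst q) \<sigma>)) = 0"
proof -
  note w = VW_cell[OF q]
  have w0: "\<forall>T\<in>Th. fst q T \<in> vpoly_space k" using w by blast
  have d: "divg (\<lambda>x. E T *v fst q T x) \<in> poly_space k" if "T \<in> Th" for T
    by (rule divg_in_poly_space[OF matrix_vpoly_space[OF w[OF that]]])
  have "(on_cells (\<lambda>T. divg (\<lambda>x. E T *v fst q T x)), on_faces (\<lambda>_ _. 0)) \<in> S_h Th Eh k \<Gamma> L"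
    unfolding S_h_iff using d by (auto intro!: PW_pairI poly_space_const)
  then show div: "divg (\<lambda>x. E T *v fst q T x) = (\<lambda>x. 0)" if "T \<in> Th" for T
    using eq by (intro div_form_cells[of "fst q", OF w0 _ that]) auto
  have "(on_cells (\<lambda>_ _. 0), on_faces (\<lambda>\<sigma>. if \<not> \<sigma> \<subseteq> frontier \<Omega> then normal_jump (fst q) \<sigma> else (\<lambda>_. 0))) \<in> S_h Th Eh k \<Gamma> L"
    unfolding S_h_iff
  proof (intro conjI)
    show "(on_cells (\<lambda>_ _. 0), on_faces (\<lambda>\<sigma>. if \<not> \<sigma> \<subseteq> frontier \<Omega> then normal_jump (fst q) \<sigma> else (\<lambda>_. 0))) \<in> PW k"
      using normal_jump_poly[of "fst q", OF w0] poly_space_const by (intro PW_pairI) auto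
  qed (use component_subset_frontier in \<open>force+\<close>)
  then show J0: "normal_jump (fst q) \<sigma> x = 0" if "\<sigma> \<in> Eh" "\<not> \<sigma> \<subseteq> frontier \<Omega>" "x \<in> \<sigma>" for \<sigma> x
    using eq by (intro div_form_faces[where w = "fst q", OF w0 _ that(1) _ that(3), where P = "\<lambda>\<sigma>. \<not> \<sigma> \<subseteq> frontier \<Omega>"]) (auto simp: that)
  have i1: "(\<Sum>\<sigma>\<in>faces_on i. face_integral \<sigma> (normal_jump (fst q) \<sigma>)) = 0" if i: "i \<in> {1..L}" for i
  proof -
    \<comment> \<open>The face part is the indicator of the component \<open>\<Gamma> i\<close>, so
      pairing with it gives the flux through that component.\<close>
    define r where "r = (on_cells (\<lambda>_ _. 0 :: real), on_faces (\<lambda>\<sigma> _. if \<sigma> \<subseteq> \<Gamma> i then 1 else 0 :: real))"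
    have P: "r \<in> PW k" unfolding r_def using poly_space_const by (intro PW_pairI) auto
    have val: "snd r \<sigma> x = (if j = i then 1 else 0)" if "j \<in> {0..L}" "\<sigma> \<in> Eh" "\<sigma> \<subseteq> \<Gamma> j" "x \<in> \<sigma>" for j \<sigma> x
      using boundary_component_unique[OF that(2,1) _ that(3), of i] i that by (auto simp: r_def)
    have "r \<in> S_h Th Eh k \<Gamma> L"
      unfolding S_h_iff
    proof (intro conjI P ballI impI)
      show "snd r \<sigma> x = 0" if "\<sigma> \<in> Eh" "\<sigma> \<subseteq> \<Gamma> 0" "x \<in> \<sigma>" for \<sigma> x
        using val[of 0 \<sigma> x] that i by auto
      show "\<exists>c. \<forall>\<sigma>\<in>Eh. \<sigma> \<subseteq> \<Gamma> j \<longrightarrow> (\<forall>x\<in>\<sigma>. snd r \<sigma> x = c)" if "j \<in> {1..L}" for j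
        using val[of j] that by (intro exI[of _ "if j = i then 1 else 0"]) auto
    qed
    from eq[OF this] have "(\<Sum>\<sigma>\<in>Eh. face_integral \<sigma> (\<lambda>x. snd r \<sigma> x * normal_jump (fst q) \<sigma> x)) = 0"
      unfolding div_form_eq[of "fst q", OF w0 P] by (simp add: r_def)
    moreover have "face_integral \<sigma> (\<lambda>x. snd r \<sigma> x * normal_jump (fst q) \<sigma> x)
        = (if \<sigma> \<subseteq> \<Gamma> i then face_integral \<sigma> (normal_jump (fst q) \<sigma>) else 0)" if "\<sigma> \<in> Eh" for \<sigma>
    proof -
      have "face_integral \<sigma> (\<lambda>x. snd r \<sigma> x * normal_jump (fst q) \<sigma> x)
        = face_integral \<sigma> (\<lambda>x. (if \<sigma> \<subseteq> \<Gamma> i then 1 else 0) * normal_jump (fst q) \<sigma> x)"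
        using that by (intro face_integral_cong) (simp add: r_def)
      then show ?thesis unfolding face_integral_scale by simp
    qed
    ultimately have "(\<Sum>\<sigma>\<in>Eh. if \<sigma> \<subseteq> \<Gamma> i then face_integral \<sigma> (normal_jump (fst q) \<sigma>) else 0) = 0" by simp
    then show ?thesis using finite_Eh by (simp add: sum.inter_filter)
  qed
  \<comment> \<open>By the divergence theorem on all cells, the total flux is the integral of a
    vanishing divergence.\<close>
  have "(\<Sum>T\<in>Th. LINT x:T|lebesgue. divg (\<lambda>x. E T *v fst q T x) x)
      = (\<Sum>T\<in>Th. \<Sum>\<sigma>\<in>F T. face_integral \<sigma> (\<lambda>x. 1 * ((E T *v fst q T x) \<bullet> normal_of T \<sigma>)))"
    using divergence_theorem[OF _ vpoly_space_C1[OF matrix_vpoly_space[OF w]]] by simp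
  also have "\<dots> = (\<Sum>\<sigma>\<in>Eh. face_integral \<sigma> (\<lambda>x. 1 * normal_jump (fst q) \<sigma> x))"
    by (rule normal_jump_face_sum[of "fst q" k "\<lambda>_ _. 1"]) (auto intro: w)
  finally have "(\<Sum>\<sigma>\<in>Eh. face_integral \<sigma> (normal_jump (fst q) \<sigma>)) = 0" using div by simp
  moreover have "face_integral \<sigma> (normal_jump (fst q) \<sigma>) = 0" if "\<sigma> \<in> Eh" "\<not> \<sigma> \<subseteq> frontier \<Omega>" for \<sigma>
    using face_integral_cong[of \<sigma> "normal_jump (fst q) \<sigma>" "\<lambda>x. 0"] J0 that by simp
  ultimately have tot: "(\<Sum>i\<in>{0..L}. \<Sum>\<sigma>\<in>faces_on i. face_integral \<sigma> (normal_jump (fst q) \<sigma>)) = 0"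
    using boundary_sum[of "\<lambda>\<sigma>. face_integral \<sigma> (normal_jump (fst q) \<sigma>)"] by simp
  have "(\<Sum>i\<in>{0..L}. \<Sum>\<sigma>\<in>faces_on i. face_integral \<sigma> (normal_jump (fst q) \<sigma>))
      = (\<Sum>\<sigma>\<in>{\<sigma>\<in>Eh. \<sigma> \<subseteq> \<Gamma> 0}. face_integral \<sigma> (normal_jump (fst q) \<sigma>))"
    by (subst sum.remove[of _ 0]) (auto intro!: sum.neutral i1)
  then show "(\<Sum>\<sigma>\<in>faces_on i. face_integral \<sigma> (normal_jump (fst q) \<sigma>)) = 0" if "i \<in> {0..L}" for i
    using tot i1[of i] that by (cases "i = 0") auto
qed

text \<open>On an interior face the cells share the tangential value in \<open>snd q\<close> and
  their normals cancel; on a boundary face that value is zero.\<close>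

lemma multiplier_tangential_jump:
  assumes q: "q \<in> W_h \<Omega> Th Eh k" "tangentially_conforming q" and s: "\<sigma> \<in> Eh" "x \<in> \<sigma>"
  shows "tangential_jump (fst q) \<sigma> x = 0"
proof -
  have "tangential_jump (fst q) \<sigma> x = (\<Sum>T\<in>cells_at \<sigma>. cross3 (normal_of T \<sigma>) (snd q \<sigma> x))"
    unfolding tangential_jump_def
  proof (intro sum.cong refl)
    fix T assume "T \<in> cells_at \<sigma>"
    then have "cross3 (snd q \<sigma> x) (normal_of T \<sigma>) = cross3 (fst q T x) (normal_of T \<sigma>)"
      using q(2) s(2) unfolding tangentially_conforming_def by blast
    then show "cross3 (normal_of T \<sigma>) (fst q T x) = cross3 (normal_of T \<sigma>) (snd q \<sigma> x)"
      by (metis cross_skew)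
  qed
  also have "\<dots> = cross3 (\<Sum>T\<in>cells_at \<sigma>. normal_of T \<sigma>) (snd q \<sigma> x)"
    by (simp add: linear_sum[OF linear_cross3(1)])
  finally show ?thesis
    using interior_face_normals[OF s(1)] q(1) s unfolding W_h_iff by (cases "\<sigma> \<subseteq> frontier \<Omega>") auto
qed

text \<open>On boundary faces the normal jump is included, as it expresses that the normal component
  of \<open>\<epsilon>\<close> times the field vanishes there. The tangential jump is taken on
  interior faces only: a normal harmonic field satisfies no tangential boundary condition.\<close>

definition broken_harmonic :: "(real^3) pw \<Rightarrow> bool" where
  "broken_harmonic u \<longleftrightarrow> (\<forall>T\<in>Th. divg (\<lambda>x. E T *v u T x) = (\<lambda>x. 0) \<and> curl (u T) = (\<lambda>x. 0))
    \<and> (\<forall>\<sigma>\<in>Eh. \<forall>x\<in>\<sigma>. normal_jump u \<sigma> x = 0)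
    \<and> (\<forall>\<sigma>\<in>Eh. \<not> \<sigma> \<subseteq> frontier \<Omega> \<longrightarrow> (\<forall>x\<in>\<sigma>. tangential_jump u \<sigma> x = 0))"

text \<open>The factor \<open>c T\<close> is the sign of the normal of \<open>T\<close> relative to
  \<open>n\<close>. In this form the jump is itself an admissible face part of a test
  function.\<close>

lemma tangential_jump_tangential:
  assumes w0: "\<forall>T\<in>Th. w T \<in> vpoly_space k" and s: "\<sigma> \<in> Eh" and n: "unit_normal \<sigma> n"
  obtains p where "p \<in> vpoly_space k" "\<And>x. tangential_jump w \<sigma> x = cross3 (p x) n"
proof
  note w = w0[rule_format]
  define c where "c T = (if normal_of T \<sigma> = n then 1 else - 1 :: real)" for T
  have norm: "normal_of T \<sigma> = c T *\<^sub>R n" if "T \<in> cells_at \<sigma>" for T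
    using unit_normal_unique[OF face[OF s] n unit_normal_of] that by (auto simp: c_def)
  show "(\<lambda>x. \<Sum>T\<in>cells_at \<sigma>. (- c T) *\<^sub>R w T x) \<in> vpoly_space k"
  proof -
    have "(\<Sum>T\<in>cells_at \<sigma>. (- c T) *\<^sub>R w T) \<in> vpoly_space k"
      using w by (intro subspace_sum subspace_scale vpoly_space_subspace) auto
    also have "(\<Sum>T\<in>cells_at \<sigma>. (- c T) *\<^sub>R w T) = (\<lambda>x. \<Sum>T\<in>cells_at \<sigma>. (- c T) *\<^sub>R w T x)"
      by (rule ext) (simp only: sum_fun_apply scaleR_fun_apply)
    finally show ?thesis .
  qed
  fix x
  have "tangential_jump w \<sigma> x = (\<Sum>T\<in>cells_at \<sigma>. cross3 ((- c T) *\<^sub>R w T x) n)"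
    unfolding tangential_jump_def
  proof (intro sum.cong refl)
    fix T assume "T \<in> cells_at \<sigma>"
    from norm[OF this] show "cross3 (normal_of T \<sigma>) (w T x) = cross3 ((- c T) *\<^sub>R w T x) n"
      by (simp add: cross_mult_left cross_skew[of n])
  qed
  then show "tangential_jump w \<sigma> x = cross3 (\<Sum>T\<in>cells_at \<sigma>. (- c T) *\<^sub>R w T x) n"
    by (simp only: linear_sum[OF linear_cross3(1)])
qed

text \<open>After integration by parts the cell and face parts of the test functions act
  independently, so each broken quantity can be tested with itself.\<close>

lemma broken_harmonic_iff:
  assumes u: "u \<in> V_h Th k"
  shows "(\<forall>\<phi>\<in>M_h \<Omega> Th Eh k. \<forall>\<psi>\<in>W_h \<Omega> Th Eh k. div_form u \<phi> + curl_form u \<psi> = 0) \<longleftrightarrow> broken_harmonic u"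
proof
  note w = V_h_cell[OF u]
  have w0: "\<forall>T\<in>Th. u T \<in> vpoly_space k" using w by blast
  assume bh: "broken_harmonic u"
  show "\<forall>\<phi>\<in>M_h \<Omega> Th Eh k. \<forall>\<psi>\<in>W_h \<Omega> Th Eh k. div_form u \<phi> + curl_form u \<psi> = 0"
  proof (intro ballI)
    fix \<phi> \<psi> assume p: "\<phi> \<in> M_h \<Omega> Th Eh k" "\<psi> \<in> W_h \<Omega> Th Eh k"
    have P: "\<phi> \<in> PW k" "\<psi> \<in> VW k" using p M_h_PW W_h_VW by blast+
    have "face_integral \<sigma> (\<lambda>x. snd \<phi> \<sigma> x * normal_jump u \<sigma> x) = 0" if "\<sigma> \<in> Eh" for \<sigma>
      using bh that face_integral_cong[of \<sigma> "\<lambda>x. snd \<phi> \<sigma> x * normal_jump u \<sigma> x" "\<lambda>x. 0"]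
      unfolding broken_harmonic_def by simp
    moreover have "face_integral \<sigma> (\<lambda>x. snd \<psi> \<sigma> x \<bullet> tangential_jump u \<sigma> x) = 0" if "\<sigma> \<in> Eh" for \<sigma>
    proof -
      have "snd \<psi> \<sigma> x \<bullet> tangential_jump u \<sigma> x = 0" if "x \<in> \<sigma>" for x
        using bh p(2) that \<open>\<sigma> \<in> Eh\<close> unfolding broken_harmonic_def W_h_iff by (cases "\<sigma> \<subseteq> frontier \<Omega>") auto
      then show ?thesis using face_integral_cong[of \<sigma> "\<lambda>x. snd \<psi> \<sigma> x \<bullet> tangential_jump u \<sigma> x" "\<lambda>x. 0"] by simp
    qed
    ultimately show "div_form u \<phi> + curl_form u \<psi> = 0"
      unfolding div_form_eq[of u, OF w0 P(1)] curl_form_eq[of u, OF w0 P(2)]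
      using bh unfolding broken_harmonic_def by simp
  qed
next
  note w = V_h_cell[OF u]
  have w0: "\<forall>T\<in>Th. u T \<in> vpoly_space k" using w by blast
  assume eq: "\<forall>\<phi>\<in>M_h \<Omega> Th Eh k. \<forall>\<psi>\<in>W_h \<Omega> Th Eh k. div_form u \<phi> + curl_form u \<psi> = 0"
  have d0: "div_form u 0 = 0" using div_form_lin_right[of u, OF w0 subspace_0[OF PW_subspace] subspace_0[OF PW_subspace], of 1] by simp
  have c0: "curl_form u 0 = 0" using curl_form_lin_right[of u, OF w0 subspace_0[OF VW_subspace] subspace_0[OF VW_subspace], of 1] by simp
  have curl: "curl_form u \<psi> = 0" if "\<psi> \<in> W_h \<Omega> Th Eh k" for \<psi>
    using eq[rule_format, OF subspace_0[OF M_h_subspace] that] d0 by simp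
  have divM: "div_form u \<phi> = 0" if "\<phi> \<in> M_h \<Omega> Th Eh k" for \<phi>
    using eq[rule_format, OF that subspace_0[OF W_h_subspace]] c0 by simp
  have div: "div_form u \<phi> = 0" if p: "\<phi> \<in> PW k" for \<phi>
  proof -
    define e where "e = (on_cells (\<lambda>_ _. 1 :: real), on_faces (\<lambda>_ _. 1 :: real))"
    have e: "e \<in> PW k" unfolding e_def by (intro PW_pairI poly_space_const)
    have "conforming e" unfolding conforming_def e_def using faces_in_Eh by auto
    then have de: "div_form u e = 0"
      unfolding div_form_conforming[OF e \<open>conforming e\<close>] by (simp add: e_def grad_def zero_vec_def[symmetric])
    define m where "m \<phi> = (LINT x:\<Omega>|lebesgue. glue Th (fst \<phi>) x)" for \<phi> :: "real weak"
    have "m e = (LINT x:\<Omega>|lebesgue. 1)"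
      unfolding m_def mean_eq[OF e] inner_L2_def
      by (subst domain_integral(2)[OF _ negligible_empty, where h = "\<lambda>_ _. 1"]) (auto simp: e_def)
    then have me: "m e \<noteq> 0" using measure_domain_pos by (simp add: domain_integral_const)
    have "m (\<phi> - (m \<phi> / m e) *\<^sub>R e) = 0"
      using lin_on_diff[OF mean_lin p e, of "m \<phi> / m e"] me by (simp add: m_def)
    then have "\<phi> - (m \<phi> / m e) *\<^sub>R e \<in> M_h \<Omega> Th Eh k"
      unfolding M_h_iff m_def[symmetric] using p e by (auto intro!: subspace_diff subspace_scale PW_subspace)
    from divM[OF this] show ?thesis
      using div_form_lin_right[of u, OF w0 p e, of "- (m \<phi> / m e)"] de by simp
  qed
  show "broken_harmonic u"
    unfolding broken_harmonic_def
  proof (intro conjI ballI impI)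
    fix T assume T: "T \<in> Th"
    have "(on_cells (\<lambda>T. divg (\<lambda>x. E T *v u T x)), on_faces (\<lambda>_ _. 0)) \<in> PW k"
      using divg_in_poly_space[OF matrix_vpoly_space[OF w]] by (intro PW_pairI poly_space_const)
    then show "divg (\<lambda>x. E T *v u T x) = (\<lambda>x. 0)" using div by (intro div_form_cells[of u, OF w0 _ T]) auto
    define \<psi> where "\<psi> = (on_cells (\<lambda>T. curl (u T)), on_faces (\<lambda>_ _. 0 :: real^3))"
    have z: "snd \<psi> \<sigma> = (\<lambda>x. 0)" for \<sigma> by (auto simp: \<psi>_def on_faces_def)
    have "snd \<psi> = 0" using z by (simp add: zero_fun_def fun_eq_iff)
    have V: "\<psi> \<in> VW k"
      unfolding VW_def
    proof (rule mem_Times_iff[THEN iffD2], intro conjI)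
      show "fst \<psi> \<in> piecewise Th (\<lambda>_. vpoly_space k)"
        unfolding \<psi>_def using curl_in_vpoly_space[OF w] by (auto intro!: on_cells_piecewise)
      show "snd \<psi> \<in> piecewise Eh (face_tangential k)"
        unfolding \<open>snd \<psi> = 0\<close> by (rule subspace_0[OF piecewise_subspace[OF face_tangential_subspace]])
    qed
    then have "\<psi> \<in> W_h \<Omega> Th Eh k" unfolding W_h_iff by (simp add: z)
    from curl[OF this] have "(\<Sum>T\<in>Th. inner_L2 T (curl (u T)) (curl (u T))) = 0"
      unfolding curl_form_eq[of u, OF w0 V] z by (simp add: \<psi>_def)
    then have "inner_L2 T (curl (u T)) (curl (u T)) = 0"
      by (rule sum_nonneg_zero[of Th "\<lambda>T. inner_L2 T (curl (u T)) (curl (u T))", OF finite_Th inner_L2_self_nonneg _ T])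
    then show "curl (u T) = (\<lambda>x. 0)" by (rule inner_L2_vpoly_zero[OF T curl_in_vpoly_space[OF w[OF T]]])
  next
    fix \<sigma> x assume s: "\<sigma> \<in> Eh" "x \<in> \<sigma>"
    have "(on_cells (\<lambda>_ _. 0), on_faces (\<lambda>\<sigma>. if True then normal_jump u \<sigma> else (\<lambda>_. 0))) \<in> PW k"
      using normal_jump_poly[of u, OF w0] poly_space_const by (intro PW_pairI) auto
    then show "normal_jump u \<sigma> x = 0" using div by (intro div_form_faces[where w = u, OF w0 _ s(1) _ s(2), where P = "\<lambda>_. True"]) auto
  next
    fix \<sigma>0 x assume s: "\<sigma>0 \<in> Eh" "\<not> \<sigma>0 \<subseteq> frontier \<Omega>" "x \<in> \<sigma>0"
    obtain n where n: "unit_normal \<sigma>0 n" using face_has_unit_normal[OF face[OF s(1)]] .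
    obtain p where p: "p \<in> vpoly_space k" "\<And>x. tangential_jump u \<sigma>0 x = cross3 (p x) n"
      by (rule tangential_jump_tangential[of u, OF w0 s(1) n]) blast
    \<comment> \<open>The support is one interior face, so the boundary condition of
      \<open>W_h\<close> holds automatically.\<close>
    define b where "b \<sigma> = (if \<sigma> = \<sigma>0 then (\<lambda>x. if x \<in> \<sigma>0 then tangential_jump u \<sigma>0 x else 0) else (\<lambda>_. 0))" for \<sigma>
    define \<psi> where "\<psi> = (0 :: (real^3) pw, b)"
    have b: "b \<in> piecewise Eh (face_tangential k)"
      unfolding piecewise_def
    proof (intro CollectI conjI ballI allI impI)
      fix \<sigma> assume sE: "\<sigma> \<in> Eh"
      show "b \<sigma> \<in> face_tangential k \<sigma>"
      proof (cases "\<sigma> = \<sigma>0")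
        case True
        have "b \<sigma> = (\<lambda>x. if x \<in> \<sigma>0 then cross3 (p x) n else 0)" using True by (auto simp: b_def p(2) fun_eq_iff)
        then show ?thesis unfolding face_tangential_def using p(1) n True by blast
      next
        case False
        then have "b \<sigma> = 0" by (auto simp: b_def)
        then show ?thesis using subspace_0[OF face_tangential_subspace[OF sE]] by simp
      qed
    qed (use s(1) in \<open>auto simp: b_def\<close>)
    have V: "\<psi> \<in> VW k"
      unfolding VW_def \<psi>_def
      using b subspace_0[OF piecewise_subspace[of Th "\<lambda>_. vpoly_space k", OF vpoly_space_subspace]] by simp
    have "\<psi> \<in> W_h \<Omega> Th Eh k" unfolding W_h_iff using V s(2) by (auto simp: \<psi>_def b_def)
    from curl[OF this] have sum0: "(\<Sum>\<sigma>\<in>Eh. face_integral \<sigma> (\<lambda>x. b \<sigma> x \<bullet> tangential_jump u \<sigma> x)) = 0"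
      unfolding curl_form_eq[of u, OF w0 V] by (simp add: \<psi>_def zero_fun_def)
    have "(\<Sum>\<sigma>\<in>Eh. face_integral \<sigma> (\<lambda>x. b \<sigma> x \<bullet> tangential_jump u \<sigma> x))
        = (\<Sum>\<sigma>\<in>Eh. if \<sigma> = \<sigma>0 then face_integral \<sigma>0 (\<lambda>x. tangential_jump u \<sigma>0 x \<bullet> tangential_jump u \<sigma>0 x) else 0)"
      by (intro sum.cong refl) (auto simp: b_def intro!: face_integral_cong)
    then have "face_integral \<sigma>0 (\<lambda>x. tangential_jump u \<sigma>0 x \<bullet> tangential_jump u \<sigma>0 x) = 0"
      using sum0 s(1) finite_Eh by simp
    moreover have "continuous_on \<sigma>0 (tangential_jump u \<sigma>0)"
      unfolding p(2)[abs_def] by (intro continuous_on_cross3 vpoly_continuous_on[OF p(1)])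
    ultimately have "tangential_jump u \<sigma>0 x \<bullet> tangential_jump u \<sigma>0 x = 0"
      by (intro face_integral_zero_imp_zero[OF face[OF s(1)], of "\<lambda>x. tangential_jump u \<sigma>0 x \<bullet> tangential_jump u \<sigma>0 x"])
        (auto intro: continuous_on_inner s)
    then show "tangential_jump u \<sigma>0 x = 0" by simp
  qed
qed

end

subsection \<open>Convolution with a \<open>C\<^sup>1\<close> kernel\<close>

lemma dominated_convergence_compact:
  fixes F :: "nat \<Rightarrow> 'a::euclidean_space \<Rightarrow> real"
  assumes S: "compact S" and F: "\<And>n. continuous_on S (F n)" and G: "continuous_on S G"
    and B: "\<And>n x. x \<in> S \<Longrightarrow> \<bar>F n x\<bar> \<le> B" and N: "negligible N"
    and lim: "\<And>x. x \<in> S \<Longrightarrow> x \<notin> N \<Longrightarrow> (\<lambda>n. F n x) \<longlonglongrightarrow> G x"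
  shows "(\<lambda>n. LINT x:S|lebesgue. F n x) \<longlonglongrightarrow> (LINT x:S|lebesgue. G x)"
  unfolding set_lebesgue_integral_def
proof (rule integral_dominated_convergence[where w = "\<lambda>x. indicator S x *\<^sub>R B"])
  show "(\<lambda>x. indicator S x *\<^sub>R G x) \<in> borel_measurable lebesgue"
    using borel_measurable_integrable[OF integrable_on_compact[OF S G, unfolded set_integrable_def]] .
  show "(\<lambda>x. indicator S x *\<^sub>R F n x) \<in> borel_measurable lebesgue" for n
    using borel_measurable_integrable[OF integrable_on_compact[OF S F, unfolded set_integrable_def]] .
  show "integrable lebesgue (\<lambda>x. indicator S x *\<^sub>R B)"
    using integrable_on_compact[OF S continuous_on_const, of B] unfolding set_integrable_def .
  have "AE x in lebesgue. x \<notin> N" using N by (simp add: AE_not_in negligible_iff_null_sets)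
  then show "AE x in lebesgue. (\<lambda>n. indicator S x *\<^sub>R F n x) \<longlonglongrightarrow> indicator S x *\<^sub>R G x"
  proof (rule eventually_mono)
    fix x assume "x \<notin> N"
    then show "(\<lambda>n. indicator S x *\<^sub>R F n x) \<longlonglongrightarrow> indicator S x *\<^sub>R G x"
      using lim[of x] by (cases "x \<in> S") auto
  qed
  show "AE x in lebesgue. norm (indicator S x *\<^sub>R F n x) \<le> indicator S x *\<^sub>R B" for n
    using B by (intro AE_I2) (auto simp: indicator_def)
qed

lemma C1_Lipschitz_on:
  fixes \<zeta> :: "pt \<Rightarrow> real"
  assumes "C1 \<zeta>" "convex S" "\<And>x. x \<in> S \<Longrightarrow> norm (grad \<zeta> x) \<le> C" "u \<in> S" "v \<in> S"
  shows "\<bar>\<zeta> u - \<zeta> v\<bar> \<le> C * norm (u - v)"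
proof -
  have "norm (\<zeta> u - \<zeta> v) \<le> C * norm (u - v)"
  proof (rule differentiable_bound[OF assms(2) _ _ assms(4,5)])
    show "(\<zeta> has_derivative (\<lambda>h. grad \<zeta> z \<bullet> h)) (at z within S)" for z
      using C1_has_grad[OF assms(1)] by (rule has_derivative_at_withinI)
    show "onorm (\<lambda>h. grad \<zeta> z \<bullet> h) \<le> C" if "z \<in> S" for z
    proof (rule onorm_le)
      fix h
      have "norm (grad \<zeta> z \<bullet> h) \<le> norm (grad \<zeta> z) * norm h" by (simp add: Cauchy_Schwarz_ineq2)
      also have "\<dots> \<le> C * norm h" using assms(3)[OF that] by (intro mult_right_mono) auto
      finally show "norm (grad \<zeta> z \<bullet> h) \<le> C * norm h" .
    qed
  qed
  then show ?thesis by simp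
qed

lemma C1_Lipschitz:
  fixes \<zeta> :: "pt \<Rightarrow> real"
  assumes "C1 \<zeta>" "\<And>x. norm (grad \<zeta> x) \<le> C"
  shows "\<bar>\<zeta> u - \<zeta> v\<bar> \<le> C * norm (u - v)"
  using assms by (intro C1_Lipschitz_on[OF assms(1) convex_UNIV]) auto

lemma C1_local_bounds:
  fixes \<kappa> :: "pt \<Rightarrow> real"
  assumes "C1 \<kappa>"
  obtains C where "0 \<le> C" "\<And>u. u \<in> cball 0 R \<Longrightarrow> norm (grad \<kappa> u) \<le> C"
    "\<And>u v. u \<in> cball 0 R \<Longrightarrow> v \<in> cball 0 R \<Longrightarrow> \<bar>\<kappa> u - \<kappa> v\<bar> \<le> C * norm (u - v)"
proof -
  obtain C where C: "0 \<le> C" "\<And>u. u \<in> cball 0 R \<Longrightarrow> norm (grad \<kappa> u) \<le> C"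
    using continuous_on_compact_bound[OF compact_cball[of 0 R] continuous_on_grad[OF assms]] by metis
  have "\<bar>\<kappa> u - \<kappa> v\<bar> \<le> C * norm (u - v)" if "u \<in> cball 0 R" "v \<in> cball 0 R" for u v
    by (rule C1_Lipschitz_on[OF assms convex_cball C(2) that])
  then show ?thesis using that C by blast
qed

lemma continuous_on_shift:
  assumes "continuous_on UNIV \<mu>"
  shows "continuous_on S (\<lambda>y. \<mu> (x - y :: pt))"
  by (rule continuous_on_compose2[OF assms]) (auto intro!: continuous_intros)

text \<open>Along a convergent sequence of centres all shifted and reflected copies of
  \<open>T\<close> stay in one ball, on which bounds for the kernel are uniform.\<close>

lemma shift_bounded:
  assumes "compact T" "X \<longlonglongrightarrow> (x :: pt)"
  obtains R where "\<And>n y. y \<in> T \<Longrightarrow> X n - y \<in> cball 0 R" "\<And>y. y \<in> T \<Longrightarrow> x - y \<in> cball 0 R"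
proof -
  obtain B where B: "\<And>y. y \<in> T \<Longrightarrow> norm y \<le> B" using compact_imp_bounded[OF assms(1)] by (auto simp: bounded_iff)
  have "Bseq X" using assms(2) convergentI convergent_imp_Bseq by blast
  then obtain K where K: "\<And>n. norm (X n) \<le> K" by (auto simp: Bseq_def)
  have "norm x \<le> K" using LIMSEQ_le_const2[OF tendsto_norm[OF assms(2)], of K] K by auto
  then have "norm (X n - y) \<le> K + B" "norm (x - y) \<le> K + B" if "y \<in> T" for n y
    using K[of n] B[OF that] norm_triangle_ineq4[of "X n" y] norm_triangle_ineq4[of x y] by linarith+
  then show ?thesis using that[of "K + B"] by simp
qed

lemma continuous_on_convolution:
  fixes g \<mu> :: "pt \<Rightarrow> real"
  assumes T: "compact T" and g: "continuous_on T g" and \<mu>: "continuous_on UNIV \<mu>"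
  shows "continuous_on UNIV (\<lambda>x. inner_L2 T g (\<lambda>y. \<mu> (x - y)))"
  unfolding continuous_on_sequentially
proof (intro allI ballI impI, elim conjE)
  fix X :: "nat \<Rightarrow> pt" and x assume X: "X \<longlonglongrightarrow> x"
  obtain R where R: "\<And>n y. y \<in> T \<Longrightarrow> X n - y \<in> cball 0 R" "\<And>y. y \<in> T \<Longrightarrow> x - y \<in> cball 0 R"
    using shift_bounded[OF T X] by metis
  obtain M where M: "\<And>u. u \<in> cball 0 R \<Longrightarrow> \<bar>\<mu> u\<bar> \<le> M"
    by (rule continuous_on_compact_bound[OF compact_cball[of 0 R] continuous_on_subset[OF \<mu> subset_UNIV]]) auto
  obtain G where G: "\<And>y. y \<in> T \<Longrightarrow> \<bar>g y\<bar> \<le> G" by (rule continuous_on_compact_bound[OF T g]) auto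
  have "(\<lambda>n. LINT y:T|lebesgue. g y * \<mu> (X n - y)) \<longlonglongrightarrow> (LINT y:T|lebesgue. g y * \<mu> (x - y))"
  proof (rule dominated_convergence_compact[OF T _ _ _ negligible_empty, where B = "G * M"])
    show "continuous_on T (\<lambda>y. g y * \<mu> (X n - y))" for n by (intro continuous_on_mult g continuous_on_shift \<mu>)
    show "continuous_on T (\<lambda>y. g y * \<mu> (x - y))" by (intro continuous_on_mult g continuous_on_shift \<mu>)
    show "\<bar>g y * \<mu> (X n - y)\<bar> \<le> G * M" if "y \<in> T" for n y
      unfolding abs_mult using G[OF that] M[OF R(1)[OF that]] by (intro mult_mono) auto
    show "(\<lambda>n. g y * \<mu> (X n - y)) \<longlonglongrightarrow> g y * \<mu> (x - y)" for y
      using X by (intro tendsto_mult tendsto_const continuous_on_tendsto_compose[OF \<mu>] tendsto_diff) auto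
  qed
  then show "((\<lambda>x. inner_L2 T g (\<lambda>y. \<mu> (x - y))) \<circ> X) \<longlonglongrightarrow> inner_L2 T g (\<lambda>y. \<mu> (x - y))"
    by (simp add: inner_L2_def o_def)
qed

text \<open>The first-order remainder divided by the size of the increment is bounded by
  \<open>2 * C\<close> on the relevant compact set and tends to zero pointwise, so dominated
  convergence applies.\<close>

lemma convolution_has_derivative:
  fixes g \<kappa> :: "pt \<Rightarrow> real"
  assumes T: "compact T" and g: "continuous_on T g" and \<kappa>: "C1 \<kappa>"
  shows "((\<lambda>x. inner_L2 T g (\<lambda>y. \<kappa> (x - y))) has_derivative
    (\<lambda>h. \<Sum>j\<in>UNIV. h $ j * inner_L2 T g (\<lambda>y. partial j \<kappa> (x - y)))) (at x)"
  unfolding has_derivative_at2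
proof (intro conjI)
  have \<kappa>c: "continuous_on UNIV \<kappa>" by (rule C1_continuous_on[OF \<kappa>])
  have pc: "continuous_on UNIV (partial j \<kappa>)" for j by (rule C1_continuous_partial[OF \<kappa>])
  show "bounded_linear (\<lambda>h. \<Sum>j\<in>UNIV. h $ j * inner_L2 T g (\<lambda>y. partial j \<kappa> (x - y)))"
    by (intro bounded_linear_sum bounded_linear_mult_const bounded_linear_vec_nth)
  show "((\<lambda>z. (1 / norm (z - x)) *\<^sub>R (inner_L2 T g (\<lambda>y. \<kappa> (z - y)) - (inner_L2 T g (\<lambda>y. \<kappa> (x - y))
      + (\<Sum>j\<in>UNIV. (z - x) $ j * inner_L2 T g (\<lambda>y. partial j \<kappa> (x - y)))))) \<longlongrightarrow> 0) (at x)"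
    unfolding tendsto_at_iff_sequentially o_def
  proof (intro allI impI)
    fix X assume ne: "\<forall>n. X n \<in> UNIV - {x}" and X: "X \<longlonglongrightarrow> x"
    obtain R where R: "\<And>n y. y \<in> T \<Longrightarrow> X n - y \<in> cball 0 R" "\<And>y. y \<in> T \<Longrightarrow> x - y \<in> cball 0 R"
      using shift_bounded[OF T X] by metis
    obtain C where C: "0 \<le> C" "\<And>u. u \<in> cball 0 R \<Longrightarrow> norm (grad \<kappa> u) \<le> C"
      "\<And>u v. u \<in> cball 0 R \<Longrightarrow> v \<in> cball 0 R \<Longrightarrow> \<bar>\<kappa> u - \<kappa> v\<bar> \<le> C * norm (u - v)"
      by (rule C1_local_bounds[OF \<kappa>]) blast
    obtain G where G: "\<And>y. y \<in> T \<Longrightarrow> \<bar>g y\<bar> \<le> G" by (rule continuous_on_compact_bound[OF T g]) auto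
    define r where "r n y = (\<kappa> (X n - y) - \<kappa> (x - y) - (\<Sum>j\<in>UNIV. (X n - x) $ j * partial j \<kappa> (x - y))) / norm (X n - x)" for n y
    have sumgrad: "(\<Sum>j\<in>UNIV. h $ j * partial j \<kappa> z) = grad \<kappa> z \<bullet> h" for h z
      by (simp add: inner_vec_def grad_def mult.commute)
    have rc: "continuous_on T (r n)" for n
      unfolding r_def using ne
      by (intro continuous_intros continuous_on_shift \<kappa>c pc) auto
    have rb: "\<bar>r n y\<bar> \<le> 2 * C" if y: "y \<in> T" for n y
    proof -
      have n0: "norm (X n - x) > 0" using ne by simp
      have "\<bar>\<kappa> (X n - y) - \<kappa> (x - y)\<bar> \<le> C * norm (X n - x)"
        using C(3)[OF R(1)[OF y, of n] R(2)[OF y]] by simp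
      moreover have "\<bar>grad \<kappa> (x - y) \<bullet> (X n - x)\<bar> \<le> C * norm (X n - x)"
        using Cauchy_Schwarz_ineq2[of "grad \<kappa> (x - y)" "X n - x"] C(2)[OF R(2)[OF y]]
        by (meson mult_right_mono norm_ge_zero order_trans)
      ultimately have "\<bar>\<kappa> (X n - y) - \<kappa> (x - y) - grad \<kappa> (x - y) \<bullet> (X n - x)\<bar> \<le> 2 * C * norm (X n - x)" by linarith
      then show ?thesis using n0 by (simp add: r_def sumgrad divide_le_eq del: vector_minus_component)
    qed
    have r0: "(\<lambda>n. r n y) \<longlonglongrightarrow> 0" for y
    proof -
      have "(\<kappa> has_derivative (\<lambda>h. grad \<kappa> (x - y) \<bullet> h)) (at (x - y))" by (rule C1_has_grad[OF \<kappa>])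
      then have "((\<lambda>z. (\<kappa> z - \<kappa> (x - y) - grad \<kappa> (x - y) \<bullet> (z - (x - y))) / norm (z - (x - y))) \<longlongrightarrow> 0) (at (x - y))"
        unfolding has_derivative_at2 by (simp add: divide_inverse mult.commute diff_diff_eq)
      moreover have "filterlim (\<lambda>n. X n - y) (at (x - y)) sequentially"
        using X ne by (intro filterlim_atI tendsto_diff) auto
      ultimately have "(\<lambda>n. (\<kappa> (X n - y) - \<kappa> (x - y) - grad \<kappa> (x - y) \<bullet> (X n - y - (x - y))) / norm (X n - y - (x - y))) \<longlonglongrightarrow> 0"
        by (rule filterlim_compose)
      then show ?thesis by (simp add: r_def sumgrad del: vector_minus_component)
    qed
    have "(\<lambda>n. LINT y:T|lebesgue. g y * r n y) \<longlonglongrightarrow> (LINT y:T|lebesgue. 0)"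
    proof (rule dominated_convergence_compact[OF T _ continuous_on_const _ negligible_empty, where B = "G * (2 * C)"])
      show "continuous_on T (\<lambda>y. g y * r n y)" for n by (intro continuous_on_mult g rc)
      show "\<bar>g y * r n y\<bar> \<le> G * (2 * C)" if "y \<in> T" for n y
        unfolding abs_mult using G[OF that] rb[OF that] by (intro mult_mono) auto
      show "(\<lambda>n. g y * r n y) \<longlonglongrightarrow> 0" for y using tendsto_mult_right_zero[OF r0] .
    qed
    then have lim: "(\<lambda>n. inner_L2 T g (r n)) \<longlonglongrightarrow> 0" by (simp add: inner_L2_def)
    have "inner_L2 T g (r n) = (1 / norm (X n - x)) *\<^sub>R (inner_L2 T g (\<lambda>y. \<kappa> (X n - y)) - (inner_L2 T g (\<lambda>y. \<kappa> (x - y))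
        + (\<Sum>j\<in>UNIV. (X n - x) $ j * inner_L2 T g (\<lambda>y. partial j \<kappa> (x - y)))))" for n
    proof -
      have c: "continuous_on T (\<lambda>y. \<kappa> (X n - y))" "continuous_on T (\<lambda>y. \<kappa> (x - y))"
        "continuous_on T (\<lambda>y. (X n - x) $ j * partial j \<kappa> (x - y))" for j
        by (intro continuous_intros continuous_on_shift \<kappa>c pc)+
      have "inner_L2 T g (r n) = (1 / norm (X n - x)) * inner_L2 T g (\<lambda>y. \<kappa> (X n - y) - \<kappa> (x - y)
          - (\<Sum>j\<in>UNIV. (X n - x) $ j * partial j \<kappa> (x - y)))"
        using inner_L2_scale[of T g "1 / norm (X n - x)" "\<lambda>y. \<kappa> (X n - y) - \<kappa> (x - y)
          - (\<Sum>j\<in>UNIV. (X n - x) $ j * partial j \<kappa> (x - y))"] by (simp add: r_def[abs_def])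
      moreover have "inner_L2 T g (\<lambda>y. \<kappa> (X n - y) - \<kappa> (x - y) - (\<Sum>j\<in>UNIV. (X n - x) $ j * partial j \<kappa> (x - y)))
        = inner_L2 T g (\<lambda>y. \<kappa> (X n - y)) - inner_L2 T g (\<lambda>y. \<kappa> (x - y))
          - (\<Sum>j\<in>UNIV. inner_L2 T g (\<lambda>y. (X n - x) $ j * partial j \<kappa> (x - y)))"
        using c by (simp add: inner_L2_diff[OF T g] inner_L2_sum[OF T g] continuous_on_diff continuous_on_sum)
      moreover have "(\<Sum>j\<in>UNIV. inner_L2 T g (\<lambda>y. (X n - x) $ j * partial j \<kappa> (x - y)))
        = (\<Sum>j\<in>UNIV. (X n - x) $ j * inner_L2 T g (\<lambda>y. partial j \<kappa> (x - y)))"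
        by (intro sum.cong refl) (rule inner_L2_scale[of T g, unfolded real_scaleR_def])
      ultimately show ?thesis by (simp only: real_scaleR_def diff_diff_eq)
    qed
    from lim[unfolded this] show "(\<lambda>n. (1 / norm (X n - x)) *\<^sub>R (inner_L2 T g (\<lambda>y. \<kappa> (X n - y)) - (inner_L2 T g (\<lambda>y. \<kappa> (x - y))
        + (\<Sum>j\<in>UNIV. (X n - x) $ j * inner_L2 T g (\<lambda>y. partial j \<kappa> (x - y)))))) \<longlonglongrightarrow> 0"
      .
  qed
qed

lemma convolution_C1:
  fixes g \<kappa> :: "pt \<Rightarrow> real"
  assumes T: "compact T" and g: "continuous_on T g" and \<kappa>: "C1 \<kappa>"
  shows "partial i (\<lambda>x. inner_L2 T g (\<lambda>y. \<kappa> (x - y))) x = inner_L2 T g (\<lambda>y. partial i \<kappa> (x - y))"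
    and "C1 (\<lambda>x. inner_L2 T g (\<lambda>y. \<kappa> (x - y)))"
proof -
  have a: "(\<Sum>j\<in>UNIV. axis i 1 $ j * a j) = a i" for i :: 3 and a :: "3 \<Rightarrow> real"
    using exhaust_3[of i] by (auto simp: axis_def sum_3)
  have p: "partial i (\<lambda>x. inner_L2 T g (\<lambda>y. \<kappa> (x - y))) x = inner_L2 T g (\<lambda>y. partial i \<kappa> (x - y))" for i x
    unfolding partial_eqI[OF convolution_has_derivative[OF T g \<kappa>]]
    by (rule a)
  then show "partial i (\<lambda>x. inner_L2 T g (\<lambda>y. \<kappa> (x - y))) x = inner_L2 T g (\<lambda>y. partial i \<kappa> (x - y))" .
  show "C1 (\<lambda>x. inner_L2 T g (\<lambda>y. \<kappa> (x - y)))"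
    unfolding C1_def
  proof (intro conjI allI)
    show "(\<lambda>x. inner_L2 T g (\<lambda>y. \<kappa> (x - y))) differentiable at x" for x
      using convolution_has_derivative[OF T g \<kappa>] differentiable_def by blast
    show "continuous_on UNIV (partial i (\<lambda>x. inner_L2 T g (\<lambda>y. \<kappa> (x - y))))" for i
      unfolding p[abs_def] by (rule continuous_on_convolution[OF T g C1_continuous_partial[OF \<kappa>]])
  qed
qed

subsection \<open>A spline kernel\<close>

definition ramp :: "nat \<Rightarrow> real \<Rightarrow> real" where
  "ramp n t = (max 0 t) ^ n"

lemma ramp_deriv: "(ramp (Suc (Suc n)) has_real_derivative real (Suc (Suc n)) * ramp (Suc n) t) (at t)"
proof -
  consider "t > 0" | "t < 0" | "t = 0" by linarith
  then show ?thesis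
  proof cases
    case 1
    have "((\<lambda>t. t ^ Suc (Suc n)) has_real_derivative real (Suc (Suc n)) * ramp (Suc n) t) (at t)"
      using 1 DERIV_pow[of "Suc (Suc n)" t UNIV] by (simp add: ramp_def)
    then show ?thesis
      by (rule DERIV_cong_ev[THEN iffD1, rotated 3])
        (use 1 eventually_nhds_in_open[of "{0<..}" t] in \<open>auto simp: ramp_def elim!: eventually_mono\<close>)
  next
    case 2
    have "((\<lambda>t. 0) has_real_derivative real (Suc (Suc n)) * ramp (Suc n) t) (at t)"
      using 2 by (simp add: ramp_def)
    then show ?thesis
      by (rule DERIV_cong_ev[THEN iffD1, rotated 3])
        (use 2 eventually_nhds_in_open[of "{..<0}" t] in \<open>auto simp: ramp_def elim!: eventually_mono\<close>)
  next
    case 3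
    have "((\<lambda>h. ramp (Suc (Suc n)) h / h) \<longlongrightarrow> 0) (at 0)"
    proof (rule Lim_null_comparison)
      have "norm (ramp (Suc (Suc n)) h / h) \<le> \<bar>h\<bar> ^ Suc n" for h
        by (cases "0 \<le> h") (auto simp: ramp_def max_def abs_if intro!: mult_nonpos_nonneg)
      then show "\<forall>\<^sub>F h in at 0. norm (ramp (Suc (Suc n)) h / h) \<le> \<bar>h\<bar> ^ Suc n"
        by (intro always_eventually allI)
      show "((\<lambda>h::real. \<bar>h\<bar> ^ Suc n) \<longlongrightarrow> 0) (at 0)" by (auto intro!: tendsto_eq_intros)
    qed
    then show ?thesis using 3 by (simp add: DERIV_def ramp_def)
  qed
qed

lemma continuous_on_ramp: "continuous_on S (ramp n)"
  unfolding ramp_def by (intro continuous_intros)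

text \<open>The third backward difference annihilates quadratic polynomials, which is why the
  difference of \<open>ramp 2\<close> vanishes beyond \<open>3\<close>.\<close>

definition third_difference :: "(real \<Rightarrow> real) \<Rightarrow> real \<Rightarrow> real" where
  "third_difference f t = f t - 3 * f (t - 1) + 3 * f (t - 2) - f (t - 3)"

text \<open>Up to a factor the uniform quadratic B-spline on the interval from \<open>0\<close> to
  \<open>3\<close>. It is continuously differentiable and has the explicit antiderivative
  \<open>spline_int\<close>.\<close>

abbreviation spline :: "real \<Rightarrow> real" where "spline \<equiv> third_difference (ramp 2)"
abbreviation spline_int :: "real \<Rightarrow> real" where "spline_int t \<equiv> third_difference (ramp 3) t / 3"

lemma third_difference_deriv:
  assumes "\<And>t. (f has_real_derivative f' t) (at t)"
  shows "(third_difference f has_real_derivative third_difference f' t) (at t)"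
proof -
  have "((\<lambda>t. f (t - a)) has_real_derivative f' (t - a)) (at t)" for a
    using DERIV_shift[of f "f' (t - a)" t "- a"] assms by simp
  from this[of 0] this[of 1] this[of 2] this[of 3] show ?thesis
    unfolding third_difference_def by (auto intro!: derivative_eq_intros)
qed

lemma continuous_on_third_difference: "continuous_on UNIV f \<Longrightarrow> continuous_on S (third_difference f)"
proof -
  assume f: "continuous_on UNIV f"
  have s: "continuous_on S (\<lambda>t. f (t - a))" for a
    by (rule continuous_on_compose2[OF f]) (auto intro!: continuous_on_diff continuous_on_id continuous_on_const)
  have "continuous_on S f" by (rule continuous_on_subset[OF f]) simp
  then show "continuous_on S (third_difference f)"
    unfolding third_difference_def
    by (intro continuous_on_add continuous_on_diff continuous_on_mult continuous_on_const s)
qed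

lemma spline_deriv:
  "(spline has_real_derivative 2 * third_difference (ramp 1) t) (at t)"
  "(spline_int has_real_derivative spline t) (at t)"
proof -
  have r: "(ramp 2 has_real_derivative 2 * ramp 1 t) (at t)" "(ramp 3 has_real_derivative 3 * ramp 2 t) (at t)" for t
    using ramp_deriv[of 0 t] ramp_deriv[of 1 t] by (simp_all add: numeral_2_eq_2 numeral_3_eq_3)
  have m: "third_difference (\<lambda>t. c * f t) t = c * third_difference f t" for c f t
    by (simp add: third_difference_def algebra_simps)
  show "(spline has_real_derivative 2 * third_difference (ramp 1) t) (at t)"
    using third_difference_deriv[of "ramp 2" "\<lambda>t. 2 * ramp 1 t" t] r by (simp add: m)
  have "(third_difference (ramp 3) has_real_derivative 3 * spline t) (at t)"
    using third_difference_deriv[of "ramp 3" "\<lambda>t. 3 * ramp 2 t" t] r by (simp add: m)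
  from DERIV_cdivide[OF this, of 3] show "(spline_int has_real_derivative spline t) (at t)" by simp
qed

lemma spline_support: "t \<notin> {0..3} \<Longrightarrow> spline t = 0"
  by (auto simp: third_difference_def ramp_def max_def power2_eq_square algebra_simps)

lemma spline_nonneg: "0 \<le> spline t"
proof -
  consider "t \<le> 1" | "1 \<le> t" "t \<le> 2" | "2 \<le> t" "t \<le> 3" | "3 \<le> t" by linarith
  then show ?thesis
  proof cases
    case 1 then show ?thesis by (simp add: third_difference_def ramp_def)
  next
    case 2
    have "spline t = t\<^sup>2 - 3 * (t - 1)\<^sup>2" using 2 by (simp add: third_difference_def ramp_def)
    \<comment> \<open>In this form the sign on the middle interval is visible.\<close>
    also have "\<dots> = 1 + 2 * ((t - 1) * (2 - t))" by (simp add: power2_eq_square algebra_simps)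
    also have "\<dots> \<ge> 0" using mult_nonneg_nonneg[of "t - 1" "2 - t"] 2 by linarith
    finally show ?thesis .
  next
    case 3
    have "spline t = t\<^sup>2 - 3 * (t - 1)\<^sup>2 + 3 * (t - 2)\<^sup>2" using 3 by (simp add: third_difference_def ramp_def)
    also have "\<dots> = (3 - t)\<^sup>2" by (simp add: power2_eq_square algebra_simps)
    finally show ?thesis by simp
  next
    case 4
    then show ?thesis by (simp add: third_difference_def ramp_def power2_eq_square algebra_simps)
  qed
qed

lemma spline_pos: "0 < spline 1"
  by (simp add: third_difference_def ramp_def)

lemma continuous_on_spline: "continuous_on S spline"
  by (rule continuous_on_third_difference[OF continuous_on_ramp])

lemma C1_compose:
  assumes f: "\<And>t. (f has_real_derivative f' t) (at t)" "continuous_on UNIV f'" and u: "C1 u"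
  shows "C1 (\<lambda>x. f (u x))" "partial i (\<lambda>x. f (u x)) x = f' (u x) * partial i u x"
proof -
  have p: "partial i (\<lambda>x. f (u x)) x = f' (u x) * partial i u x" for i x
    by (rule partial_compose(1)[OF C1_differentiable[OF u] f(1)])
  then show "partial i (\<lambda>x. f (u x)) x = f' (u x) * partial i u x" .
  show "C1 (\<lambda>x. f (u x))"
    unfolding C1_def
  proof (intro conjI allI)
    show "(\<lambda>x. f (u x)) differentiable at x" for x by (rule partial_compose(2)[OF C1_differentiable[OF u] f(1)])
    show "continuous_on UNIV (partial i (\<lambda>x. f (u x)))" for i
      unfolding p[abs_def]
      by (intro continuous_on_mult continuous_on_compose2[OF f(2) C1_continuous_on[OF u]] C1_continuous_partial[OF u]) auto
  qed
qed

definition kernel :: "pt \<Rightarrow> real" where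
  "kernel x = spline (x $ 1) * spline (x $ 2) * spline (x $ 3)"

text \<open>An antiderivative in the first coordinate of the kernel scaled to width
  \<open>d\<close>. The integration contributes one factor \<open>d\<close>, which leaves
  \<open>d\<^sup>2\<close> of the scaling factor \<open>d ^ 3\<close>.\<close>

definition kernel_potential :: "real \<Rightarrow> pt \<Rightarrow> real" where
  "kernel_potential d x = spline_int (x $ 1 / d) * (spline (x $ 2 / d) * spline (x $ 3 / d)) / d\<^sup>2"

lemma kernel_potential_C1:
  assumes d: "d \<noteq> 0"
  shows "C1 (kernel_potential d)" "partial 1 (kernel_potential d) x = kernel (x /\<^sub>R d) / d ^ 3"
proof -
  have idC: "C1 (\<lambda>x::pt. x $ i)" for i
    unfolding C1_def partial_coord[abs_def]
    by (auto intro!: bounded_linear_imp_differentiable[OF bounded_linear_vec_nth])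
  have uC: "C1 (\<lambda>x::pt. x $ i / d)" for i
    using C1_linear[OF bounded_linear_mult_left[of "inverse d"] idC[of i]] by (simp add: divide_inverse mult.commute)
  have up: "partial j (\<lambda>x::pt. x $ i / d) x = (if j = i then 1 / d else 0)" for i j x
    using partial_linear[OF bounded_linear_mult_left[of "inverse d"] C1_differentiable[OF idC[of i]], of j x]
    by (simp add: partial_coord divide_inverse mult.commute)
  have c1: "continuous_on UNIV (\<lambda>t. 2 * third_difference (ramp 1) t)"
    by (intro continuous_intros continuous_on_third_difference continuous_on_ramp)
  note S = C1_compose[OF spline_deriv(1) c1 uC]
  note I = C1_compose[OF spline_deriv(2) continuous_on_spline uC]
  have eq: "kernel_potential d = (\<lambda>x. (1 / d\<^sup>2) * (spline_int (x $ 1 / d) * (spline (x $ 2 / d) * spline (x $ 3 / d))))"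
    by (simp add: kernel_potential_def[abs_def] mult.commute[of 3])
  show "C1 (kernel_potential d)"
    unfolding eq by (intro C1_mult C1_const S(1) I(1))
  show "partial 1 (kernel_potential d) x = kernel (x /\<^sub>R d) / d ^ 3"
  proof -
    have product: "partial i (\<lambda>x. a * (f x * (g x * h x))) x
        = a * (f x * (g x * partial i h x + partial i g x * h x) + partial i f x * (g x * h x))"
      if "C1 f" "C1 g" "C1 h" for i a x and f g h :: "pt \<Rightarrow> real"
      using that C1_mult[OF that(2,3)] C1_mult[OF that(1) C1_mult[OF that(2,3)]]
      by (simp add: partial_mult C1_differentiable C1_const)
    have "partial 1 (kernel_potential d) x
      = (1 / d\<^sup>2) * (spline_int (x $ 1 / d) * (spline (x $ 2 / d) * partial 1 (\<lambda>x. spline (x $ 3 / d)) x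
          + partial 1 (\<lambda>x. spline (x $ 2 / d)) x * spline (x $ 3 / d))
        + partial 1 (\<lambda>x. spline_int (x $ 1 / d)) x * (spline (x $ 2 / d) * spline (x $ 3 / d)))"
      unfolding eq by (rule product[OF I(1) S(1) S(1)])
    also have "\<dots> = (1 / d\<^sup>2) * ((spline (x $ 1 / d) * (1 / d)) * (spline (x $ 2 / d) * spline (x $ 3 / d)))"
      unfolding S(2) I(2) up by simp
    also have "\<dots> = kernel (x /\<^sub>R d) / d ^ 3"
      by (simp add: kernel_def divide_inverse power2_eq_square power3_eq_cube mult.commute)
    finally show ?thesis .
  qed
qed

lemma continuous_on_kernel: "continuous_on S kernel"
  unfolding kernel_def
  by (intro continuous_intros continuous_on_compose2[OF continuous_on_spline[of UNIV]]) auto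

lemma kernel_nonneg: "0 \<le> kernel x"
  by (simp add: kernel_def spline_nonneg)

lemma kernel_support: "x \<notin> cbox 0 (vec 3) \<Longrightarrow> kernel x = 0"
  using spline_support by (auto simp: kernel_def mem_box_cart forall_3)

lemma kernel_integrable: "integrable lborel kernel"
proof -
  have "integrable lborel (\<lambda>x. indicator (cbox 0 (vec 3)) x *\<^sub>R kernel x)"
    by (rule borel_integrable_compact[OF compact_cbox continuous_on_kernel])
  moreover have "(\<lambda>x. indicator (cbox 0 (vec 3)) x *\<^sub>R kernel x) = kernel"
    using kernel_support by (auto simp: indicator_def fun_eq_iff)
  ultimately show ?thesis by simp
qed

text \<open>The kernel is not normalised; its mass appears as the constant \<open>c\<close> in the
  limit of the gradients.\<close>

lemma kernel_integral_pos: "0 < integral\<^sup>L lborel kernel"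
proof -
  have "0 \<le> integral\<^sup>L lborel kernel" by (intro integral_nonneg_AE AE_I2 kernel_nonneg)
  moreover have "integral\<^sup>L lborel kernel \<noteq> 0"
  proof
    assume "integral\<^sup>L lborel kernel = 0"
    moreover have "integral\<^sup>L lborel kernel = integral\<^sup>L lebesgue kernel"
      using kernel_integrable by (intro integral_completion[symmetric]) auto
    moreover have "integral\<^sup>L lebesgue kernel = (LINT x:cbox 0 (vec 3)|lebesgue. kernel x)"
      unfolding set_lebesgue_integral_def using kernel_support
      by (intro Bochner_Integration.integral_cong) (auto simp: indicator_def)
    ultimately have z: "(LINT x:cbox 0 (vec 3)|lebesgue. kernel x) = 0" by simp
    have "(vec 1 :: pt) \<in> interior (cbox 0 (vec 3))"
      unfolding interior_cbox by (simp add: mem_box_cart)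
    from set_integral_zero_imp_zero[OF compact_cbox continuous_on_kernel kernel_nonneg z this]
    show False using spline_pos by (simp add: kernel_def)
  qed
  ultimately show ?thesis by linarith
qed

lemma lborel_integral_scale:
  fixes f :: "pt \<Rightarrow> real"
  assumes "f \<in> borel_measurable borel" "d > 0"
  shows "integral\<^sup>L lborel f = d ^ 3 * integral\<^sup>L lborel (\<lambda>w. f (x - d *\<^sub>R w))"
proof -
  have "lborel = density (distr lborel borel (\<lambda>w. x + (- d) *\<^sub>R w)) (\<lambda>_. ennreal (d ^ 3))"
    using lborel_affine[of "- d" x] assms(2) by (simp add: ennreal_power)
  then have "integral\<^sup>L lborel f = integral\<^sup>L (density (distr lborel borel (\<lambda>w. x + (- d) *\<^sub>R w)) (\<lambda>_. ennreal (d ^ 3))) f"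
    by simp
  also have "\<dots> = integral\<^sup>L (distr lborel borel (\<lambda>w. x + (- d) *\<^sub>R w)) (\<lambda>w. d ^ 3 *\<^sub>R f w)"
    using assms by (intro integral_density) auto
  also have "\<dots> = integral\<^sup>L lborel (\<lambda>w. d ^ 3 *\<^sub>R f (x + (- d) *\<^sub>R w))"
    using assms by (intro integral_distr) auto
  finally show ?thesis by simp
qed

subsection \<open>Approximate potentials of curl-free fields\<close>

context polyhedral_mesh
begin

text \<open>The potential is the convolution of \<open>q\<^sub>1\<close> with an antiderivative in \<open>x\<^sub>1\<close> of the rescaled kernel. Since \<open>q\<close>
  is curl free on the whole space, its \<open>j\<close>-th derivative is the convolution of \<open>q\<^sub>j\<close> with the kernel. The support of the
  kernel need not contain the origin.\<close>

lemma mollified_potential: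
  assumes q0: "\<forall>T\<in>Th. q T \<in> vpoly_space k"
    and curl_free: "\<And>\<phi>. C1 \<phi> \<Longrightarrow> (\<Sum>T\<in>Th. inner_L2 T (q T) (curl \<phi>)) = 0"
  obtains \<zeta> :: "nat \<Rightarrow> pt \<Rightarrow> real" and c C where "c > 0" "\<And>m. C1 (\<zeta> m)"
    "\<And>m x. norm (grad (\<zeta> m) x) \<le> C"
    "\<And>T x. T \<in> Th \<Longrightarrow> x \<in> interior T \<Longrightarrow> (\<lambda>m. grad (\<zeta> m) x) \<longlonglongrightarrow> c *\<^sub>R q T x"
    "\<And>x. x \<notin> closure \<Omega> \<Longrightarrow> (\<lambda>m. grad (\<zeta> m) x) \<longlonglongrightarrow> 0"
proof -
  note q = q0[rule_format]
  define \<delta> where "\<delta> m = 1 / real (Suc m)" for m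
  have \<delta>: "\<delta> m > 0" for m by (simp add: \<delta>_def)
  have \<delta>0: "\<delta> \<longlonglongrightarrow> 0" unfolding \<delta>_def by (rule LIMSEQ_inverse_real_of_nat[unfolded inverse_eq_divide])
  define \<Theta> where "\<Theta> m = kernel_potential (\<delta> m)" for m
  have \<Theta>C: "C1 (\<Theta> m)" and \<Theta>1: "partial 1 (\<Theta> m) z = kernel (z /\<^sub>R \<delta> m) / \<delta> m ^ 3" for m z
    using kernel_potential_C1[of "\<delta> m"] \<delta>[of m] by (auto simp: \<Theta>_def)
  have qc: "continuous_on S (\<lambda>y. q T y $ j)" if "T \<in> Th" for T j S
    using vpoly_continuous_on[OF q[OF that]] by (intro continuous_intros)
  have qb: "(\<lambda>y. q T y $ j) \<in> borel_measurable borel" if "T \<in> Th" for T j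
    using qc[OF that] by (intro borel_measurable_continuous_onI)
  have pc: "continuous_on S (\<lambda>y. partial i (\<Theta> m) (x - y))" for S i m x
    by (rule continuous_on_shift[OF C1_continuous_partial[OF \<Theta>C]])
  define \<zeta> where "\<zeta> m x = (\<Sum>T\<in>Th. inner_L2 T (\<lambda>y. q T y $ 1) (\<lambda>y. \<Theta> m (x - y)))" for m x
  have \<zeta>C: "C1 (\<zeta> m)" for m
    unfolding \<zeta>_def by (intro C1_sum convolution_C1(2) cell_compact qc \<Theta>C)
  have \<zeta>p: "partial i (\<zeta> m) x = (\<Sum>T\<in>Th. inner_L2 T (\<lambda>y. q T y $ 1) (\<lambda>y. partial i (\<Theta> m) (x - y)))" for i m x
  proof -
    have "partial i (\<zeta> m) x = (\<Sum>T\<in>Th. partial i (\<lambda>x. inner_L2 T (\<lambda>y. q T y $ 1) (\<lambda>y. \<Theta> m (x - y))) x)"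
      unfolding \<zeta>_def[abs_def]
      by (intro partial_sum C1_differentiable convolution_C1(2) cell_compact qc \<Theta>C)
    then show ?thesis by (simp add: convolution_C1(1)[OF cell_compact qc \<Theta>C])
  qed
  \<comment> \<open>The \<open>j\<close>-th component of the field, extended by zero to the whole
    space.\<close>
  define Q where "Q j y = glue Th q y $ j" for j y
  have Qeq: "Q j y = (\<Sum>T\<in>Th. indicator (interior T) y * q T y $ j)" for j y
    by (simp add: Q_def glue_def)
  have Qm: "Q j \<in> borel_measurable borel" for j
    unfolding Qeq[abs_def] using qb by (intro borel_measurable_sum borel_measurable_times) auto
  have "\<exists>b. \<forall>y\<in>T. \<bar>q T y $ j\<bar> \<le> b" if "T \<in> Th" for T j
    using compact_imp_bounded[OF compact_continuous_image[OF qc[OF that, of T j] cell_compact[OF that]]]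
    by (auto simp: bounded_iff)
  then obtain b where b: "\<And>T j y. T \<in> Th \<Longrightarrow> y \<in> T \<Longrightarrow> \<bar>q T y $ j\<bar> \<le> b T j" by metis
  define M where "M j = (\<Sum>T\<in>Th. \<bar>b T j\<bar>)" for j
  have QM: "\<bar>Q j y\<bar> \<le> M j" for j y
  proof -
    have "\<bar>Q j y\<bar> \<le> (\<Sum>T\<in>Th. \<bar>indicator (interior T) y * q T y $ j\<bar>)" unfolding Qeq by (rule sum_abs)
    also have "\<dots> \<le> M j" unfolding M_def
    proof (rule sum_mono)
      fix T assume "T \<in> Th"
      then show "\<bar>indicator (interior T) y * q T y $ j\<bar> \<le> \<bar>b T j\<bar>"
        using b[of T y j] subsetD[OF interior_subset, of y T] by (force simp: indicator_def)
    qed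
    finally show ?thesis .
  qed
  define conv where "conv j m x = integral\<^sup>L lborel (\<lambda>w. Q j (x - \<delta> m *\<^sub>R w) * kernel w)" for j m x
  have convint: "(\<Sum>T\<in>Th. inner_L2 T (\<lambda>y. q T y $ j) (\<lambda>y. partial 1 (\<Theta> m) (x - y))) = conv j m x" for j m x
  proof -
    let ?f = "\<lambda>y. Q j y * partial 1 (\<Theta> m) (x - y)"
    have fm: "?f \<in> borel_measurable borel"
      by (rule borel_measurable_times[OF Qm borel_measurable_continuous_onI[OF pc]])
    have hc: "continuous_on T (\<lambda>y. q T y $ j * partial 1 (\<Theta> m) (x - y))" if "T \<in> Th" for T
      by (intro continuous_on_mult qc that pc)
    have "(LINT y:\<Omega>|lebesgue. ?f y) = (\<Sum>T\<in>Th. LINT y:T|lebesgue. q T y $ j * partial 1 (\<Theta> m) (x - y))"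
      using hc by (intro domain_integral(2)[OF _ negligible_empty]) (auto simp: Q_def glue_interior)
    moreover have "(LINT y:\<Omega>|lebesgue. ?f y) = integral\<^sup>L lebesgue ?f"
      unfolding set_lebesgue_integral_def
    proof (intro Bochner_Integration.integral_cong refl)
      fix y
      have "Q j y = 0" if "y \<notin> \<Omega>"
        unfolding Qeq using interior_cell_subset that by (intro sum.neutral) (auto simp: indicator_def)
      then show "indicator \<Omega> y *\<^sub>R ?f y = ?f y" by (cases "y \<in> \<Omega>") auto
    qed
    moreover have "integral\<^sup>L lebesgue ?f = integral\<^sup>L lborel ?f" using fm by (intro integral_completion) auto
    moreover have "integral\<^sup>L lborel ?f = \<delta> m ^ 3 * integral\<^sup>L lborel (\<lambda>w. ?f (x - \<delta> m *\<^sub>R w))"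
      by (rule lborel_integral_scale[OF fm \<delta>])
    moreover have "\<delta> m ^ 3 * integral\<^sup>L lborel (\<lambda>w. ?f (x - \<delta> m *\<^sub>R w)) = conv j m x"
      unfolding conv_def integral_mult_right_zero[symmetric]
    proof (intro Bochner_Integration.integral_cong refl)
      fix w :: pt
      show "\<delta> m ^ 3 * (Q j (x - \<delta> m *\<^sub>R w) * partial 1 (\<Theta> m) (x - (x - \<delta> m *\<^sub>R w))) = Q j (x - \<delta> m *\<^sub>R w) * kernel w"
        using \<delta>[of m] by (simp add: \<Theta>1)
    qed
    ultimately show ?thesis by (simp add: inner_L2_def)
  qed
  \<comment> \<open>The curl-free condition, tested with the reflected and translated kernel
    potential times \<open>axis 3 1\<close> and \<open>axis 2 1\<close>, exchanges the index
    \<open>j\<close> with the index \<open>1\<close>.\<close>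
  have swap: "(\<Sum>T\<in>Th. inner_L2 T (\<lambda>y. q T y $ 1) (\<lambda>y. partial j (\<Theta> m) (x - y)))
    = (\<Sum>T\<in>Th. inner_L2 T (\<lambda>y. q T y $ j) (\<lambda>y. partial 1 (\<Theta> m) (x - y)))" for j m x
  proof -
    define f where "f y = \<Theta> m (x - y)" for y
    have D: "(f has_derivative (\<lambda>h. grad (\<Theta> m) (x - y) \<bullet> (- h))) (at y)" for y
      unfolding f_def
      by (rule has_derivative_compose[of "\<lambda>y. x - y" uminus y UNIV "\<Theta> m", OF _ C1_has_grad[OF \<Theta>C]])
        (auto intro!: derivative_eq_intros)
    have fp: "partial i f y = - partial i (\<Theta> m) (x - y)" for i y
      unfolding partial_eqI[OF D] by (simp add: grad_def inner_axis)
    have fC: "C1 f"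
      unfolding C1_def fp[abs_def]
      using D pc by (auto simp: differentiable_def intro!: continuous_on_minus)
    have fd: "f differentiable (at y)" for y by (rule C1_differentiable[OF fC])
    have lin: "bounded_linear (\<lambda>r::real. r *\<^sub>R axis i (1::real) :: real^3)" for i by (rule bounded_linear_scaleR_left)
    have test: "(\<Sum>T\<in>Th. inner_L2 T (q T) (curl (\<lambda>y. f y *\<^sub>R axis i 1))) = 0" for i
      by (rule curl_free[OF C1_linear[OF lin fC]])
    have pv: "partial l (\<lambda>y. f y *\<^sub>R axis i 1) y = partial l f y *\<^sub>R (axis i 1 :: real^3)" for l i y
      by (rule partial_linear[OF lin fd])
    have A: "inner_L2 T (q T) (curl (\<lambda>y. f y *\<^sub>R axis 3 1))
      = - inner_L2 T (\<lambda>y. q T y $ 1) (\<lambda>y. partial 2 (\<Theta> m) (x - y)) + inner_L2 T (\<lambda>y. q T y $ 2) (\<lambda>y. partial 1 (\<Theta> m) (x - y))"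
      "inner_L2 T (q T) (curl (\<lambda>y. f y *\<^sub>R axis 2 1))
      = inner_L2 T (\<lambda>y. q T y $ 1) (\<lambda>y. partial 3 (\<Theta> m) (x - y)) - inner_L2 T (\<lambda>y. q T y $ 3) (\<lambda>y. partial 1 (\<Theta> m) (x - y))"
      if T: "T \<in> Th" for T
    proof -
      have i: "set_integrable lebesgue T (\<lambda>y. q T y $ a * partial b (\<Theta> m) (x - y))" for a b
        by (intro integrable_on_compact cell_compact[OF T] continuous_on_mult qc[OF T] pc)
      have "inner_L2 T (q T) (curl (\<lambda>y. f y *\<^sub>R axis 3 1))
        = (LINT y:T|lebesgue. q T y $ 2 * partial 1 (\<Theta> m) (x - y) - q T y $ 1 * partial 2 (\<Theta> m) (x - y))"
        unfolding inner_L2_def curl_def pv fp by (simp add: inner_vec_def sum_3 axis_def algebra_simps)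
      then show "inner_L2 T (q T) (curl (\<lambda>y. f y *\<^sub>R axis 3 1))
        = - inner_L2 T (\<lambda>y. q T y $ 1) (\<lambda>y. partial 2 (\<Theta> m) (x - y)) + inner_L2 T (\<lambda>y. q T y $ 2) (\<lambda>y. partial 1 (\<Theta> m) (x - y))"
        using set_integral_diff(2)[OF i i] by (simp add: inner_L2_def)
      have "inner_L2 T (q T) (curl (\<lambda>y. f y *\<^sub>R axis 2 1))
        = (LINT y:T|lebesgue. q T y $ 1 * partial 3 (\<Theta> m) (x - y) - q T y $ 3 * partial 1 (\<Theta> m) (x - y))"
        unfolding inner_L2_def curl_def pv fp by (simp add: inner_vec_def sum_3 axis_def algebra_simps)
      then show "inner_L2 T (q T) (curl (\<lambda>y. f y *\<^sub>R axis 2 1))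
        = inner_L2 T (\<lambda>y. q T y $ 1) (\<lambda>y. partial 3 (\<Theta> m) (x - y)) - inner_L2 T (\<lambda>y. q T y $ 3) (\<lambda>y. partial 1 (\<Theta> m) (x - y))"
        using set_integral_diff(2)[OF i i] by (simp add: inner_L2_def)
    qed
    show ?thesis
      using test[of 3] test[of 2] exhaust_3[of j] by (auto simp: A sum.distrib sum_negf sum_subtractf)
  qed
  have gz: "grad (\<zeta> m) x $ j = conv j m x" for j m x
    using \<zeta>p[of j m x] swap[of j m x] convint[of j m x] by (simp add: grad_def)
  define c where "c = integral\<^sup>L lborel kernel"
  have cm: "(\<lambda>w. Q j (x - \<delta> m *\<^sub>R w) * kernel w) \<in> borel_measurable lborel" for j x m
    using borel_measurable_integrable[OF kernel_integrable] Qm[of j] by measurable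
  have cb: "norm (Q j (x - \<delta> m *\<^sub>R w) * kernel w) \<le> M j * kernel w" for j x m w
    using QM[of j "x - \<delta> m *\<^sub>R w"] kernel_nonneg[of w] by (simp add: abs_mult mult_right_mono)
  have ci: "integrable lborel (\<lambda>w. M j * kernel w)" for j using kernel_integrable by simp
  have conv_bound: "\<bar>conv j m x\<bar> \<le> M j * c" for j m x
  proof -
    have "norm (conv j m x) \<le> integral\<^sup>L lborel (\<lambda>w. M j * kernel w)"
      unfolding conv_def
    proof (rule Bochner_Integration.integral_norm_bound_integral[OF _ ci cb])
      show "integrable lborel (\<lambda>w. Q j (x - \<delta> m *\<^sub>R w) * kernel w)"
        by (rule Bochner_Integration.integrable_bound[OF ci[of j] cm])
          (intro AE_I2 order_trans[OF cb], simp)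
    qed
    then show ?thesis by (simp add: c_def)
  qed
  \<comment> \<open>The function \<open>h\<close> is continuous at \<open>x\<close> and agrees with
    \<open>Q j\<close> near \<open>x\<close>: the polynomial of the cell at its interior points, and
    zero outside \<open>closure \<Omega>\<close>.\<close>
  have conv_lim: "(\<lambda>m. conv j m x) \<longlonglongrightarrow> a * c" if a: "eventually (\<lambda>y. Q j y = h y) (nhds x)" "isCont h x" "h x = a" for j x a h
  proof -
    have "(\<lambda>m. conv j m x) \<longlonglongrightarrow> integral\<^sup>L lborel (\<lambda>w. a * kernel w)"
      unfolding conv_def
    proof (rule integral_dominated_convergence[OF _ cm ci])
      show "(\<lambda>w. a * kernel w) \<in> borel_measurable lborel" using borel_measurable_integrable[OF kernel_integrable] by measurable
      show "AE w in lborel. (\<lambda>m. Q j (x - \<delta> m *\<^sub>R w) * kernel w) \<longlonglongrightarrow> a * kernel w"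
      proof (intro AE_I2 tendsto_mult tendsto_const)
        fix w :: pt
        have t: "(\<lambda>m. x - \<delta> m *\<^sub>R w) \<longlonglongrightarrow> x" using \<delta>0 by (auto intro!: tendsto_eq_intros)
        have "(\<lambda>m. h (x - \<delta> m *\<^sub>R w)) \<longlonglongrightarrow> h x" by (rule isCont_tendsto_compose[OF a(2) t])
        moreover have "eventually (\<lambda>m. h (x - \<delta> m *\<^sub>R w) = Q j (x - \<delta> m *\<^sub>R w)) sequentially"
          using filterlim_iff[THEN iffD1, OF t, rule_format, OF a(1)] by (rule eventually_mono) (rule sym)
        ultimately show "(\<lambda>m. Q j (x - \<delta> m *\<^sub>R w)) \<longlonglongrightarrow> a"
          unfolding a(3)[symmetric] by (rule Lim_transform_eventually)
      qed
      show "AE w in lborel. norm (Q j (x - \<delta> m *\<^sub>R w) * kernel w) \<le> M j * kernel w" for m using cb by (intro AE_I2)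
    qed
    then show ?thesis by (simp add: c_def)
  qed
  show ?thesis
  proof (rule that[of c \<zeta> "\<Sum>j\<in>UNIV. M j * c"])
    show "c > 0" unfolding c_def by (rule kernel_integral_pos)
    show "C1 (\<zeta> m)" for m by (rule \<zeta>C)
    show "norm (grad (\<zeta> m) x) \<le> (\<Sum>j\<in>UNIV. M j * c)" for m x
    proof (rule order_trans[OF norm_le_l1_cart])
      show "(\<Sum>j\<in>UNIV. \<bar>grad (\<zeta> m) x $ j\<bar>) \<le> (\<Sum>j\<in>UNIV. M j * c)"
        unfolding gz by (intro sum_mono conv_bound)
    qed
    show "(\<lambda>m. grad (\<zeta> m) x) \<longlonglongrightarrow> c *\<^sub>R q T x" if T: "T \<in> Th" "x \<in> interior T" for T x
    proof (rule vec_tendstoI)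
      fix j
      have "eventually (\<lambda>y. y \<in> interior T) (nhds x)" using T by (simp add: eventually_nhds_in_open)
      then have "eventually (\<lambda>y. Q j y = q T y $ j) (nhds x)"
        by (rule eventually_mono) (use T in \<open>simp add: Q_def glue_interior\<close>)
      moreover have "isCont (\<lambda>y. q T y $ j) x"
        using qc[OF T(1), of UNIV j] by (simp add: continuous_on_eq_continuous_at)
      ultimately show "(\<lambda>m. grad (\<zeta> m) x $ j) \<longlonglongrightarrow> (c *\<^sub>R q T x) $ j"
        using conv_lim[of j "\<lambda>y. q T y $ j" x "q T x $ j"] by (simp add: gz mult.commute)
    qed
    show "(\<lambda>m. grad (\<zeta> m) x) \<longlonglongrightarrow> 0" if x: "x \<notin> closure \<Omega>" for x
    proof (rule vec_tendstoI)
      fix j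
      have "eventually (\<lambda>y. y \<in> - closure \<Omega>) (nhds x)" using x by (intro eventually_nhds_in_open) auto
      then have "eventually (\<lambda>y. Q j y = 0) (nhds x)"
      proof (rule eventually_mono)
        fix y assume "y \<in> - closure \<Omega>"
        then show "Q j y = 0"
          unfolding Qeq using interior_cell_subset closure_subset[of \<Omega>]
          by (intro sum.neutral) (auto simp: indicator_def)
      qed
      then show "(\<lambda>m. grad (\<zeta> m) x $ j) \<longlonglongrightarrow> 0 $ j"
        using conv_lim[of j "\<lambda>_. 0" x 0] by (simp add: gz)
    qed
  qed
qed

end

context polyhedral_mesh
begin

text \<open>The domain is locally conic, so near a boundary point there are exterior segments ending
  in it. Along them the gradients tend to zero boundedly, so differences of values tend to zero.
  This relation between nearby boundary points spreads over the connected set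
  \<open>K\<close>.\<close>

lemma potential_oscillation:
  fixes \<zeta> :: "nat \<Rightarrow> pt \<Rightarrow> real"
  assumes \<zeta>: "\<And>m. C1 (\<zeta> m)" and C: "\<And>m x. norm (grad (\<zeta> m) x) \<le> C"
    and out: "\<And>x. x \<notin> closure \<Omega> \<Longrightarrow> (\<lambda>m. grad (\<zeta> m) x) \<longlonglongrightarrow> 0"
    and K: "connected K" "K \<subseteq> frontier \<Omega>" "x \<in> K" "y \<in> K"
  shows "(\<lambda>m. \<zeta> m x - \<zeta> m y) \<longlonglongrightarrow> 0"
proof -
  have C0: "0 \<le> C" using order_trans[OF norm_ge_zero C] .
  have lip: "\<bar>\<zeta> m u - \<zeta> m v\<bar> \<le> C * norm (u - v)" for m u v
    by (rule C1_Lipschitz[OF \<zeta> C])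
  \<comment> \<open>The end \<open>a\<close> may lie on the boundary, where the gradients are not
    known to converge; the parameter \<open>0\<close> is discarded as a null set.\<close>
  have ray: "(\<lambda>m. \<zeta> m y - \<zeta> m a) \<longlonglongrightarrow> 0"
    if seg: "\<And>t. 0 < t \<Longrightarrow> t \<le> 1 \<Longrightarrow> a + t *\<^sub>R (y - a) \<notin> closure \<Omega>" for a y
  proof -
    define F where "F m t = grad (\<zeta> m) (a + t *\<^sub>R (y - a)) \<bullet> (y - a)" for m t
    have Fc: "continuous_on {0..1} (F m)" for m
      unfolding F_def
      by (intro continuous_on_inner continuous_on_const continuous_on_compose2[OF continuous_on_grad[OF \<zeta>, of UNIV]])
        (auto intro!: continuous_intros)
    have eq: "\<zeta> m y - \<zeta> m a = (LINT t:{0..1}|lebesgue. F m t)" for m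
    proof -
      have D: "((\<lambda>t. \<zeta> m (a + t *\<^sub>R (y - a))) has_derivative (\<lambda>h. grad (\<zeta> m) (a + t *\<^sub>R (y - a)) \<bullet> (h *\<^sub>R (y - a)))) (at t within {0..1})" for t
        by (rule has_derivative_compose[of "\<lambda>t. a + t *\<^sub>R (y - a)" "\<lambda>h. h *\<^sub>R (y - a)" t "{0..1}", OF _ C1_has_grad[OF \<zeta>]])
          (auto intro!: derivative_eq_intros)
      have "(F m has_integral (\<zeta> m (a + 1 *\<^sub>R (y - a)) - \<zeta> m (a + 0 *\<^sub>R (y - a)))) {0..1}"
      proof (rule fundamental_theorem_of_calculus)
        show "((\<lambda>t. \<zeta> m (a + t *\<^sub>R (y - a))) has_vector_derivative F m t) (at t within {0..1})" for t
          using D[of t] by (simp add: has_vector_derivative_def F_def)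
      qed simp
      then have "integral {0..1} (F m) = \<zeta> m y - \<zeta> m a" by (simp add: integral_unique)
      moreover have "(LINT t:{0..1}|lebesgue. F m t) = integral {0..1} (F m)"
        by (intro set_lebesgue_integral_eq_integral(2) integrable_on_compact compact_Icc Fc)
      ultimately show ?thesis by simp
    qed
    have "(\<lambda>m. LINT t:{0..1}|lebesgue. F m t) \<longlonglongrightarrow> (LINT t:{0..1::real}|lebesgue. (0::real))"
    proof (rule dominated_convergence_compact[where F = F and G = "\<lambda>_. 0" and B = "C * norm (y - a)", OF compact_Icc Fc continuous_on_const])
      show "\<bar>F m t\<bar> \<le> C * norm (y - a)" for m t
        unfolding F_def by (rule order_trans[OF Cauchy_Schwarz_ineq2]) (intro mult_right_mono C norm_ge_zero)
      show "negligible {0::real}" by simp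
      show "(\<lambda>m. F m t) \<longlonglongrightarrow> 0" if "t \<in> {0..1}" "t \<notin> {0}" for t
        using tendsto_inner[OF out[OF seg] tendsto_const, of t "y - a"] that by (simp add: F_def)
    qed
    then show ?thesis by (simp add: eq)
  qed
  show ?thesis
  proof (rule connected_equivalence_relation[OF K(1,3,4), where R = "\<lambda>x y. (\<lambda>m. \<zeta> m x - \<zeta> m y) \<longlonglongrightarrow> 0"])
    show "(\<lambda>m. \<zeta> m y - \<zeta> m x) \<longlonglongrightarrow> 0" if "(\<lambda>m. \<zeta> m x - \<zeta> m y) \<longlonglongrightarrow> 0" for x y
      using tendsto_minus[OF that] by simp
    show "(\<lambda>m. \<zeta> m x - \<zeta> m z) \<longlonglongrightarrow> 0"
      if "(\<lambda>m. \<zeta> m x - \<zeta> m y) \<longlonglongrightarrow> 0" "(\<lambda>m. \<zeta> m y - \<zeta> m z) \<longlonglongrightarrow> 0" for x y z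
      using tendsto_add[OF that] by simp
    fix a assume a: "a \<in> K"
    obtain e where e: "e > 0"
      and conic: "\<And>y t. y \<in> ball a e \<Longrightarrow> 0 < t \<Longrightarrow> t \<le> 1 \<Longrightarrow> a + t *\<^sub>R (y - a) \<in> closure \<Omega> \<longleftrightarrow> y \<in> closure \<Omega>"
      using locally_conic_polytope_union[OF polytope_union_closure, of a] unfolding locally_conic_def by blast
    have "(\<lambda>m. \<zeta> m a - \<zeta> m x) \<longlonglongrightarrow> 0" if x: "x \<in> K" "x \<in> ball a e" for x
    proof (rule LIMSEQ_I)
      fix \<eta> :: real assume \<eta>: "\<eta> > 0"
      have "x \<notin> interior (closure \<Omega>)"
        using x(1) K(2) open_domain by (auto simp: interior_closure_domain frontier_def interior_open)
      then have "x \<in> closure (- closure \<Omega>)" by (simp add: closure_complement)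
      \<comment> \<open>The segment from \<open>a\<close> to \<open>x\<close> may run in the
        boundary, so \<open>x\<close> is replaced by an exterior point \<open>y\<close> so close
        that the Lipschitz bound costs at most \<open>\<eta> / 2\<close>. The summand
        \<open>1\<close> covers \<open>C = 0\<close>.\<close>
      moreover have "open (ball x (\<eta> / (2 * (C + 1))) \<inter> ball a e)" "x \<in> ball x (\<eta> / (2 * (C + 1))) \<inter> ball a e"
        using x(2) \<eta> C0 by auto
      ultimately obtain y where y: "y \<notin> closure \<Omega>" "dist x y < \<eta> / (2 * (C + 1))" "y \<in> ball a e"
        using open_Int_closure_eq_empty[of "ball x (\<eta> / (2 * (C + 1))) \<inter> ball a e" "- closure \<Omega>"] by force
      have "(\<lambda>m. \<zeta> m y - \<zeta> m a) \<longlonglongrightarrow> 0" by (rule ray) (use conic[OF y(3)] y(1) in blast)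
      from LIMSEQ_D[OF this half_gt_zero[OF \<eta>]] obtain M where M: "\<And>m. m \<ge> M \<Longrightarrow> \<bar>\<zeta> m y - \<zeta> m a\<bar> < \<eta> / 2"
        by auto
      have "\<bar>\<zeta> m x - \<zeta> m y\<bar> \<le> \<eta> / 2" for m
      proof -
        have "C * dist x y \<le> (C + 1) * (\<eta> / (2 * (C + 1)))" using y(2) C0 \<eta> by (intro mult_mono) auto
        also have "\<dots> = \<eta> / 2" using C0 by (simp add: field_simps)
        finally show ?thesis using lip[of m x y] by (simp add: dist_norm)
      qed
      then have "norm (\<zeta> m a - \<zeta> m x - 0) < \<eta>" if "m \<ge> M" for m
        using M[OF that] \<open>\<And>m. \<bar>\<zeta> m x - \<zeta> m y\<bar> \<le> \<eta> / 2\<close>[of m] unfolding real_norm_def by linarith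
      then show "\<exists>M. \<forall>m\<ge>M. norm (\<zeta> m a - \<zeta> m x - 0) < \<eta>" by blast
    qed
    then show "\<exists>T. openin (top_of_set K) T \<and> a \<in> T \<and> (\<forall>x\<in>T. (\<lambda>m. \<zeta> m a - \<zeta> m x) \<longlonglongrightarrow> 0)"
      using a e by (intro exI[of _ "K \<inter> ball a e"]) auto
  qed
qed

text \<open>On the face the convergence is pointwise and bounded, and the surface integral is a
  volume integral over a compact slab.\<close>

lemma potential_boundary_integral:
  fixes \<zeta> :: "nat \<Rightarrow> pt \<Rightarrow> real"
  assumes \<zeta>: "\<And>m. C1 (\<zeta> m)" and s: "\<sigma> \<in> Eh" and J: "continuous_on \<sigma> J" and p: "\<And>x m. x \<in> \<sigma> \<Longrightarrow> \<bar>\<zeta> m x - \<zeta> m p\<bar> \<le> B"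
    and lim: "\<And>x. x \<in> \<sigma> \<Longrightarrow> (\<lambda>m. \<zeta> m x - \<zeta> m p) \<longlonglongrightarrow> 0"
  shows "(\<lambda>m. face_integral \<sigma> (\<lambda>x. (\<zeta> m x - \<zeta> m p) * J x)) \<longlonglongrightarrow> 0"
proof -
  obtain D where D: "\<And>x. x \<in> \<sigma> \<Longrightarrow> \<bar>J x\<bar> \<le> D"
    by (rule continuous_on_compact_bound[OF face_compact[OF face[OF s]] J]) auto
  have in\<sigma>: "closest_point (affine hull \<sigma>) x \<in> \<sigma>" if "x \<in> slab \<sigma>" for x using that by (simp add: slab_def)
  have "(\<lambda>m. LINT x:slab \<sigma>|lebesgue. (\<zeta> m (closest_point (affine hull \<sigma>) x) - \<zeta> m p) * J (closest_point (affine hull \<sigma>) x))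
    \<longlonglongrightarrow> (LINT x:slab \<sigma>|lebesgue. (0::real))"
  proof (rule dominated_convergence_compact[OF slab_compact[OF face[OF s]] _ continuous_on_const _ negligible_empty])
    show "continuous_on (slab \<sigma>) (\<lambda>x. (\<zeta> m (closest_point (affine hull \<sigma>) x) - \<zeta> m p) * J (closest_point (affine hull \<sigma>) x))" for m
      by (rule continuous_on_slab[OF face[OF s], of "\<lambda>x. (\<zeta> m x - \<zeta> m p) * J x"])
        (intro continuous_on_mult continuous_on_diff continuous_on_const C1_continuous_on \<zeta> J)
    show "\<bar>(\<zeta> m (closest_point (affine hull \<sigma>) x) - \<zeta> m p) * J (closest_point (affine hull \<sigma>) x)\<bar> \<le> B * D"
      if "x \<in> slab \<sigma>" for m x
      unfolding abs_mult by (intro mult_mono' p D in\<sigma> that abs_ge_zero)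
    show "(\<lambda>m. (\<zeta> m (closest_point (affine hull \<sigma>) x) - \<zeta> m p) * J (closest_point (affine hull \<sigma>) x)) \<longlonglongrightarrow> 0"
      if "x \<in> slab \<sigma>" for x
      by (rule tendsto_mult_left_zero[OF lim[OF in\<sigma>[OF that]]])
  qed
  then show ?thesis by (simp add: face_integral_def)
qed

end

context pdwg_setting
begin

text \<open>The pairing \<open>A m\<close> of \<open>\<epsilon> q\<close> with the gradient of the
  approximate potential is evaluated twice: in the limit it is \<open>c\<close> times the energy of
  \<open>q\<close>, and by parts it is a sum of boundary terms that tend to zero.\<close>

lemma multiplier_field_zero:
  assumes q: "q \<in> W_h \<Omega> Th Eh k" "tangentially_conforming q"
    and curl0: "\<And>T. T \<in> Th \<Longrightarrow> curl (fst q T) = (\<lambda>x. 0)"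
    and eq: "\<And>r. r \<in> S_h Th Eh k \<Gamma> L \<Longrightarrow> div_form (fst q) r = 0"
  shows "q = 0"
proof -
  have qV: "q \<in> VW k" using q W_h_VW by blast
  define w where "w = fst q"
  have w0: "\<forall>T\<in>Th. w T \<in> vpoly_space k" using VW_cell[OF qV] by (simp add: w_def)
  define J where "J = normal_jump w"
  have Jc: "continuous_on S (J \<sigma>)" for S \<sigma>
    unfolding J_def by (rule poly_continuous_on[OF normal_jump_poly[OF w0]])
  have md: "\<And>T. T \<in> Th \<Longrightarrow> divg (\<lambda>x. E T *v w T x) = (\<lambda>x. 0)"
    "\<And>\<sigma> x. \<sigma> \<in> Eh \<Longrightarrow> \<not> \<sigma> \<subseteq> frontier \<Omega> \<Longrightarrow> x \<in> \<sigma> \<Longrightarrow> J \<sigma> x = 0"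
    "\<And>i. i \<in> {0..L} \<Longrightarrow> (\<Sum>\<sigma>\<in>faces_on i. face_integral \<sigma> (J \<sigma>)) = 0"
    unfolding w_def J_def by (rule multiplier_divergence_free[OF qV]; simp add: eq)+
  \<comment> \<open>No boundary condition on \<open>\<phi>\<close> is imposed, since the tangential
    jump of \<open>q\<close> vanishes on boundary faces too. This is the statement that the zero
    extension is curl free on the whole space.\<close>
  have "(\<Sum>T\<in>Th. inner_L2 T (w T) (curl \<phi>)) = 0" if p: "C1 \<phi>" for \<phi>
  proof -
    have "face_integral \<sigma> (\<lambda>x. \<phi> x \<bullet> tangential_jump w \<sigma> x) = face_integral \<sigma> (\<lambda>x. 0)" if "\<sigma> \<in> Eh" for \<sigma>
      using multiplier_tangential_jump[OF q that] by (intro face_integral_cong) (simp add: w_def)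
    then show ?thesis unfolding sum_green_curl[OF w0 p] using curl0 by (simp add: w_def)
  qed
  from mollified_potential[OF w0 this] obtain \<zeta> c C where c: "c > 0" and \<zeta>: "\<And>m. C1 (\<zeta> m)"
    and C: "\<And>m x. norm (grad (\<zeta> m) x) \<le> C"
    and lim: "\<And>T x. T \<in> Th \<Longrightarrow> x \<in> interior T \<Longrightarrow> (\<lambda>m. grad (\<zeta> m) x) \<longlonglongrightarrow> c *\<^sub>R w T x"
    and out: "\<And>x. x \<notin> closure \<Omega> \<Longrightarrow> (\<lambda>m. grad (\<zeta> m) x) \<longlonglongrightarrow> 0" by metis
  define A where "A m = (\<Sum>T\<in>Th. inner_L2 T (\<lambda>x. E T *v w T x) (grad (\<zeta> m)))" for m
  have wc: "continuous_on S (\<lambda>x. E T *v w T x)" "continuous_on S (w T)" if "T \<in> Th" for T S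
    using vpoly_continuous_on[OF bspec[OF w0 that]] by (auto intro!: continuous_on_matrix)
  have "A \<longlonglongrightarrow> (\<Sum>T\<in>Th. inner_L2 T (\<lambda>x. E T *v w T x) (\<lambda>x. c *\<^sub>R w T x))"
    unfolding A_def
  proof (rule tendsto_sum)
    fix T assume T: "T \<in> Th"
    obtain D where D: "\<And>x. x \<in> T \<Longrightarrow> norm (E T *v w T x) \<le> D"
      by (rule continuous_on_compact_bound[OF cell_compact[OF T] wc(1)[OF T]]) auto
    show "(\<lambda>m. inner_L2 T (\<lambda>x. E T *v w T x) (grad (\<zeta> m))) \<longlonglongrightarrow> inner_L2 T (\<lambda>x. E T *v w T x) (\<lambda>x. c *\<^sub>R w T x)"
      unfolding inner_L2_def
    proof (rule dominated_convergence_compact[OF cell_compact[OF T] _ _ _ negligible_cell_frontier[OF T]])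
      show "continuous_on T (\<lambda>x. (E T *v w T x) \<bullet> grad (\<zeta> m) x)" for m
        by (intro continuous_on_inner wc T continuous_on_grad \<zeta>)
      show "continuous_on T (\<lambda>x. (E T *v w T x) \<bullet> (c *\<^sub>R w T x))"
        by (intro continuous_on_inner continuous_on_scaleR continuous_on_const wc T)
      show "\<bar>(E T *v w T x) \<bullet> grad (\<zeta> m) x\<bar> \<le> D * C" if "x \<in> T" for m x
        by (rule order_trans[OF Cauchy_Schwarz_ineq2]) (intro mult_mono' D[OF that] C norm_ge_zero)
      show "(\<lambda>m. (E T *v w T x) \<bullet> grad (\<zeta> m) x) \<longlonglongrightarrow> (E T *v w T x) \<bullet> (c *\<^sub>R w T x)"
        if "x \<in> T" "x \<notin> frontier T" for x
      proof (intro tendsto_inner tendsto_const lim T)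
        show "x \<in> interior T" using that cell_closed[OF T] by (auto simp: frontier_def)
      qed
    qed
  qed
  moreover have "A \<longlonglongrightarrow> 0"
  proof -
    have "\<forall>i\<in>{0..L}. \<exists>p. p \<in> \<Gamma> i" using component_of in_components_nonempty by (metis all_not_in_conv)
    then obtain p where p: "\<And>i. i \<in> {0..L} \<Longrightarrow> p i \<in> \<Gamma> i" by metis
    \<comment> \<open>On each component the value at a reference point \<open>p i\<close> may be
      subtracted, because the flux through the component is zero.\<close>
    have Am: "A m = (\<Sum>i\<in>{0..L}. \<Sum>\<sigma>\<in>faces_on i. face_integral \<sigma> (\<lambda>x. (\<zeta> m x - \<zeta> m (p i)) * J \<sigma> x))" for m
    proof -
      have "A m = (\<Sum>\<sigma>\<in>Eh. face_integral \<sigma> (\<lambda>x. \<zeta> m x * J \<sigma> x))"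
        unfolding A_def sum_green_grad[OF w0 \<zeta>] using md(1) by (simp add: J_def)
      also have "\<dots> = (\<Sum>i\<in>{0..L}. \<Sum>\<sigma>\<in>faces_on i. face_integral \<sigma> (\<lambda>x. \<zeta> m x * J \<sigma> x))"
      proof (rule boundary_sum)
        fix \<sigma> assume "\<sigma> \<in> Eh" "\<not> \<sigma> \<subseteq> frontier \<Omega>"
        then have "face_integral \<sigma> (\<lambda>x. \<zeta> m x * J \<sigma> x) = face_integral \<sigma> (\<lambda>x. 0)"
          using md(2) by (intro face_integral_cong) simp
        then show "face_integral \<sigma> (\<lambda>x. \<zeta> m x * J \<sigma> x) = 0" by simp
      qed
      also have "\<dots> = (\<Sum>i\<in>{0..L}. \<Sum>\<sigma>\<in>faces_on i. face_integral \<sigma> (\<lambda>x. (\<zeta> m x - \<zeta> m (p i)) * J \<sigma> x))"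
      proof (rule sum.cong[OF refl])
        fix i assume i: "i \<in> {0..L}"
        have "face_integral \<sigma> (\<lambda>x. (\<zeta> m x - \<zeta> m (p i)) * J \<sigma> x)
          = face_integral \<sigma> (\<lambda>x. \<zeta> m x * J \<sigma> x) + (- \<zeta> m (p i)) * face_integral \<sigma> (J \<sigma>)" if "\<sigma> \<in> Eh" for \<sigma>
        proof -
          have "face_integrable \<sigma> (\<lambda>x. \<zeta> m x * J \<sigma> x)" "face_integrable \<sigma> (J \<sigma>)"
            by (intro continuous_face_integrable face[OF that] continuous_on_mult C1_continuous_on \<zeta> Jc)+
          from face_integral_lin[OF this, of "- \<zeta> m (p i)"] show ?thesis by (simp add: algebra_simps)
        qed
        then have "(\<Sum>\<sigma>\<in>faces_on i. face_integral \<sigma> (\<lambda>x. (\<zeta> m x - \<zeta> m (p i)) * J \<sigma> x))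
          = (\<Sum>\<sigma>\<in>faces_on i. face_integral \<sigma> (\<lambda>x. \<zeta> m x * J \<sigma> x))
            + (- \<zeta> m (p i)) * (\<Sum>\<sigma>\<in>faces_on i. face_integral \<sigma> (J \<sigma>))"
          by (simp only: sum_distrib_left sum.distrib[symmetric]) (rule sum.cong, auto)
        then show "(\<Sum>\<sigma>\<in>faces_on i. face_integral \<sigma> (\<lambda>x. \<zeta> m x * J \<sigma> x))
          = (\<Sum>\<sigma>\<in>faces_on i. face_integral \<sigma> (\<lambda>x. (\<zeta> m x - \<zeta> m (p i)) * J \<sigma> x))"
          using md(3)[OF i] by simp
      qed
      finally show ?thesis .
    qed
    have "bounded (frontier \<Omega>)" unfolding frontier_def using bounded_closure[OF bounded_domain] by (rule bounded_diff)
    then obtain R where R': "\<forall>x\<in>frontier \<Omega>. \<forall>y\<in>frontier \<Omega>. dist x y \<le> R"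
      unfolding bounded_two_points ..
    then have R: "\<And>x y. x \<in> frontier \<Omega> \<Longrightarrow> y \<in> frontier \<Omega> \<Longrightarrow> dist x y \<le> R" by simp
    have C0: "0 \<le> C" using order_trans[OF norm_ge_zero C] .
    have lip: "\<bar>\<zeta> m x - \<zeta> m y\<bar> \<le> C * norm (x - y)" for m x y
      by (rule C1_Lipschitz[OF \<zeta> C])
    have "(\<lambda>m. \<Sum>i\<in>{0..L}. \<Sum>\<sigma>\<in>faces_on i. face_integral \<sigma> (\<lambda>x. (\<zeta> m x - \<zeta> m (p i)) * J \<sigma> x))
      \<longlonglongrightarrow> (\<Sum>i\<in>{0..L}. \<Sum>\<sigma>\<in>faces_on i. 0)"
    proof (intro tendsto_sum)
      fix i \<sigma> assume i: "i \<in> {0..L}" and "\<sigma> \<in> faces_on i"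
      then have s: "\<sigma> \<in> Eh" "\<sigma> \<subseteq> \<Gamma> i" by auto
      have G: "\<Gamma> i \<subseteq> frontier \<Omega>" "connected (\<Gamma> i)"
        using component_subset_frontier[OF i] in_components_connected[OF component_of[OF i]] by auto
      show "(\<lambda>m. face_integral \<sigma> (\<lambda>x. (\<zeta> m x - \<zeta> m (p i)) * J \<sigma> x)) \<longlonglongrightarrow> 0"
      proof (rule potential_boundary_integral[OF \<zeta> s(1) Jc, where B = "C * R"])
        show "\<bar>\<zeta> m x - \<zeta> m (p i)\<bar> \<le> C * R" if "x \<in> \<sigma>" for x m
        proof -
          have "dist x (p i) \<le> R" using that s(2) G(1) p[OF i] by (intro R) auto
          then show ?thesis using lip[of m x "p i"] mult_left_mono[OF _ C0, of "dist x (p i)" R] by (simp add: dist_norm)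
        qed
        show "(\<lambda>m. \<zeta> m x - \<zeta> m (p i)) \<longlonglongrightarrow> 0" if "x \<in> \<sigma>" for x
          using that s(2) p[OF i] by (intro potential_oscillation[OF \<zeta> C out G(2,1)]) auto
      qed
    qed
    then show ?thesis unfolding Am[abs_def] by simp
  qed
  ultimately have "(\<Sum>T\<in>Th. inner_L2 T (\<lambda>x. E T *v w T x) (\<lambda>x. c *\<^sub>R w T x)) = 0" by (rule LIMSEQ_unique)
  then have "c * (\<Sum>T\<in>Th. inner_L2 T (w T) (\<lambda>x. E T *v w T x)) = 0"
    by (simp add: inner_L2_scale sum_distrib_left inner_L2_commute[of _ "w _"])
  then have z: "(\<Sum>T\<in>Th. inner_L2 T (w T) (\<lambda>x. E T *v w T x)) = 0" using c by simp
  have "fst q T = (\<lambda>x. 0)" if T: "T \<in> Th" for T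
    unfolding w_def[symmetric]
  proof (rule E_form_zero[OF T bspec[OF w0 T]])
    show "inner_L2 T (w T) (\<lambda>x. E T *v w T x) = 0"
      by (rule sum_nonneg_zero[of Th "\<lambda>T. inner_L2 T (w T) (\<lambda>x. E T *v w T x)", OF finite_Th E_form_nonneg z T])
  qed
  then show ?thesis by (rule VW_zeroI[OF qV _ q(2)])
qed

end

subsection \<open>Localisation by smooth test functions\<close>

lemma smooth_gen_sum: "(\<And>j. j \<in> I \<Longrightarrow> smooth_gen (f j)) \<Longrightarrow> smooth_gen (\<lambda>x. \<Sum>j\<in>I. f j x)"
  by (induction I rule: infinite_finite_induct) (auto intro: smooth_gen.intros)

lemma smooth_gen_prod: "(\<And>j. j \<in> I \<Longrightarrow> smooth_gen (f j)) \<Longrightarrow> smooth_gen (\<lambda>x. \<Prod>j\<in>I. f j x)"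
  by (induction I rule: infinite_finite_induct) (auto intro: smooth_gen.intros)

lemma smooth_gen_power: "smooth_gen f \<Longrightarrow> smooth_gen (\<lambda>x. f x ^ n)"
  by (induction n) (auto intro: smooth_gen.intros)

lemma poly_space_smooth_gen: "p \<in> poly_space k \<Longrightarrow> smooth_gen p"
  unfolding poly_space_def
  by (auto intro!: smooth_gen_sum smooth_gen.mult smooth_gen.const smooth_gen_prod smooth_gen_power smooth_gen.coord)

lemma test_function_localized:
  assumes "0 < r" "cball p r \<subseteq> \<Omega>" "smooth_gen g"
  shows "test_function \<Omega> (\<lambda>x. (bump p r x * g x) *\<^sub>R v)"
proof -
  let ?S = "{x. (bump p r x * g x) *\<^sub>R v \<noteq> 0}"
  have "x \<in> cball p r" if "x \<in> ?S" for x
    using that bump_zero_iff[OF assms(1), of p x] by force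
  then have cl: "closure ?S \<subseteq> cball p r" by (intro closure_minimal closed_cball subsetI)
  then have "compact (closure ?S)" using bounded_subset bounded_cball by (auto simp: compact_eq_bounded_closed)
  moreover have "smooth (\<lambda>x. (bump p r x * g x) *\<^sub>R v)"
    by (intro smooth_gen_scaleR smooth_gen.mult smooth_gen_bump assms(3))
  ultimately show ?thesis unfolding test_function_def using assms(2) cl by blast
qed

lemma continuous_on_bump_mult: "smooth_gen g \<Longrightarrow> continuous_on S (\<lambda>x. bump p r x * g x)"
  by (intro C1_continuous_on smooth_C1 smooth_gen_smooth smooth_gen.mult smooth_gen_bump)

context polyhedral_mesh
begin

text \<open>An open set that meets a face contains a point of that face off the skeleton.\<close>

lemma zero_off_skeleton:
  fixes J :: "pt \<Rightarrow> real"
  assumes s: "\<sigma> \<in> Eh" and J: "continuous_on UNIV J" and z: "\<And>p. p \<in> \<sigma> \<Longrightarrow> p \<notin> skel \<Longrightarrow> J p = 0" and x: "x \<in> \<sigma>"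
  shows "J x = 0"
proof (rule ccontr)
  assume "J x \<noteq> 0"
  moreover have "open {y. J y \<noteq> 0}" by (rule open_Collect_neq[OF J continuous_on_const])
  ultimately show False using generic_point[OF s, of "{y. J y \<noteq> 0}"] x z by blast
qed

text \<open>The integrand is a square times a nonnegative weight that is positive at
  \<open>p\<close>.\<close>

lemma bump_face_zero:
  assumes s: "\<sigma> \<in> Eh" "p \<in> \<sigma>" and J: "J \<in> poly_space m" and r: "r > 0"
    and z: "face_integral \<sigma> (\<lambda>x. J x * (bump p r x * J x)) = 0"
  shows "J p = 0"
proof -
  have c: "continuous_on \<sigma> (\<lambda>x. J x * (bump p r x * J x))"
    by (intro continuous_on_mult[OF poly_continuous_on[OF J] continuous_on_bump_mult] poly_space_smooth_gen[OF J])
  have nn: "0 \<le> J x * (bump p r x * J x)" for x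
    using mult_nonneg_nonneg[OF bump_nonneg zero_le_square, of p r x "J x"] by (simp add: ac_simps)
  have "J p * (bump p r p * J p) = 0" by (rule face_integral_zero_imp_zero[OF face[OF s(1)] c nn z s(2)])
  moreover have "bump p r p > 0" using r by (simp add: bump_pos_iff)
  ultimately show ?thesis by simp
qed

text \<open>A fundamental lemma of the calculus of variations for polynomial pieces: balls inside
  one cell isolate \<open>D T\<close>, and then balls at generic points of an interior face isolate
  \<open>J \<sigma>\<close>. The free factor \<open>g\<close> lets the polynomial itself be tested
  with.\<close>

lemma localized_zero:
  assumes D: "\<And>T. T \<in> Th \<Longrightarrow> D T \<in> poly_space m" and J: "\<And>\<sigma>. \<sigma> \<in> Eh \<Longrightarrow> J \<sigma> \<in> poly_space m"
    and eq: "\<And>p r g. 0 < r \<Longrightarrow> cball p r \<subseteq> \<Omega> \<Longrightarrow> smooth_gen g \<Longrightarrow>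
      (\<Sum>T\<in>Th. LINT x:T|lebesgue. D T x * (bump p r x * g x)) = (\<Sum>\<sigma>\<in>Eh. face_integral \<sigma> (\<lambda>x. J \<sigma> x * (bump p r x * g x)))"
  shows "\<And>T. T \<in> Th \<Longrightarrow> D T = (\<lambda>x. 0)"
    and "\<And>\<sigma> x. \<sigma> \<in> Eh \<Longrightarrow> \<not> \<sigma> \<subseteq> frontier \<Omega> \<Longrightarrow> x \<in> \<sigma> \<Longrightarrow> J \<sigma> x = 0"
proof -
  show D0: "D T = (\<lambda>x. 0)" if T: "T \<in> Th" for T
  proof (rule poly_space_zero_on_open[OF D[OF T] open_interior cell_closure_interior(2)[OF T]])
    fix p assume p: "p \<in> interior T"
    then obtain r where r: "r > 0" "cball p r \<subseteq> interior T" using open_contains_cball[of "interior T"] by auto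
    have out: "bump p r x = 0" if "x \<notin> interior T" for x
      using that r bump_zero_iff[OF r(1), of p x] ball_subset_cball[of p r] by blast
    note sep = interior_avoids_cells[OF T]
    have "(\<Sum>T'\<in>Th. LINT x:T'|lebesgue. D T' x * (bump p r x * D T x))
      = (\<Sum>T'\<in>Th. if T' = T then LINT x:T|lebesgue. D T x * (bump p r x * D T x) else 0)"
    proof (intro sum.cong refl)
      fix T' assume T': "T' \<in> Th"
      have "(LINT x:T'|lebesgue. D T' x * (bump p r x * D T x)) = 0" if "T' \<noteq> T"
      proof -
        have "indicator T' x *\<^sub>R (D T' x * (bump p r x * D T x)) = 0" for x
          using sep[OF T' that, of x] out by (auto simp: indicator_def)
        then show ?thesis by (simp only: set_lebesgue_integral_def) simp
      qed
      then show "(LINT x:T'|lebesgue. D T' x * (bump p r x * D T x))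
        = (if T' = T then LINT x:T|lebesgue. D T x * (bump p r x * D T x) else 0)" by auto
    qed
    moreover have "face_integral \<sigma> (\<lambda>x. J \<sigma> x * (bump p r x * D T x)) = 0" if s: "\<sigma> \<in> Eh" for \<sigma>
    proof -
      obtain T' where T': "T' \<in> Th" "\<sigma> \<in> F T'" using face_has_cell[OF s] by blast
      have "x \<notin> interior T" if "x \<in> \<sigma>" for x
        using sep[OF T'(1)] faces_in_frontier[OF T'(2)] cell_closed[OF T'(1)] that
        by (cases "T' = T") (auto simp: frontier_def)
      then have "face_integral \<sigma> (\<lambda>x. J \<sigma> x * (bump p r x * D T x)) = face_integral \<sigma> (\<lambda>x. 0)"
        using out by (intro face_integral_cong) auto
      then show ?thesis by simp
    qed
    moreover have "cball p r \<subseteq> \<Omega>" using r(2) interior_cell_subset[OF T] by blast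
    ultimately have "(LINT x:T|lebesgue. D T x * (bump p r x * D T x)) = 0"
      using eq[OF r(1), of p "D T"] poly_space_smooth_gen[OF D[OF T]] T finite_Th by simp
    moreover have "continuous_on T (\<lambda>x. D T x * (bump p r x * D T x))"
      by (intro continuous_on_mult[OF poly_continuous_on[OF D[OF T]] continuous_on_bump_mult] poly_space_smooth_gen[OF D[OF T]])
    moreover have "0 \<le> D T x * (bump p r x * D T x)" for x
      using mult_nonneg_nonneg[OF bump_nonneg zero_le_square, of p r x "D T x"] by (simp add: ac_simps)
    ultimately have "D T p * (bump p r p * D T p) = 0"
      using set_integral_zero_imp_zero[OF cell_compact[OF T], of "\<lambda>x. D T x * (bump p r x * D T x)" p] p by simp
    moreover have "bump p r p > 0" using r by (simp add: bump_pos_iff)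
    ultimately show "D T p = 0" by simp
  qed
  fix \<sigma> x assume s: "\<sigma> \<in> Eh" "\<not> \<sigma> \<subseteq> frontier \<Omega>" and x: "x \<in> \<sigma>"
  show "J \<sigma> x = 0"
  proof (rule zero_off_skeleton[OF s(1) poly_continuous_on[OF J[OF s(1)]] _ x])
    fix p assume p: "p \<in> \<sigma>" "p \<notin> skel"
    obtain r1 where r1: "r1 > 0" "\<And>\<sigma>' x. \<sigma>' \<in> Eh \<Longrightarrow> \<sigma>' \<noteq> \<sigma> \<Longrightarrow> x \<in> \<sigma>' \<Longrightarrow> x \<notin> ball p r1"
      by (rule isolated_face_point[OF s(1) p]) blast
    obtain r2 where r2: "r2 > 0" "cball p r2 \<subseteq> \<Omega>"
      using open_contains_cball[of \<Omega>] open_domain interior_face_generic[OF s p] by auto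
    define r where "r = min r1 r2"
    have r: "r > 0" "cball p r \<subseteq> \<Omega>" using r1(1) r2 by (auto simp: r_def)
    have "bump p r x = 0" if "\<sigma>' \<in> Eh" "\<sigma>' \<noteq> \<sigma>" "x \<in> \<sigma>'" for \<sigma>' x
      unfolding bump_zero_iff[OF r(1)] using r1(2)[OF that] by (simp add: r_def)
    then have "(\<Sum>\<sigma>'\<in>Eh. face_integral \<sigma>' (\<lambda>x. J \<sigma>' x * (bump p r x * J \<sigma> x)))
      = (\<Sum>\<sigma>'\<in>Eh. if \<sigma>' = \<sigma> then face_integral \<sigma> (\<lambda>x. J \<sigma> x * (bump p r x * J \<sigma> x)) else 0)"
      using face_integral_cong[of _ _ "\<lambda>x. 0"] by (intro sum.cong refl) auto
    then have "face_integral \<sigma> (\<lambda>x. J \<sigma> x * (bump p r x * J \<sigma> x)) = 0"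
      using eq[OF r poly_space_smooth_gen[OF J[OF s(1)]]] D0 s(1) finite_Eh by simp
    then show "J \<sigma> p = 0" by (rule bump_face_zero[OF s(1) p(1) J[OF s(1)] r(1)])
  qed
qed

lemma square_integrable_glue:
  fixes v :: "(real^3) pw"
  assumes v: "\<And>T. T \<in> Th \<Longrightarrow> continuous_on UNIV (v T)"
  shows "square_integrable \<Omega> (glue Th v)"
  unfolding square_integrable_def
proof
  have "glue Th v \<in> borel_measurable borel"
    unfolding glue_def[abs_def]
    using v by (intro borel_measurable_sum borel_measurable_scaleR borel_measurable_indicator
        borel_measurable_continuous_onI[of "v _"]) auto
  then show "glue Th v \<in> borel_measurable (lebesgue_on \<Omega>)"
    by (intro measurable_restrict_space1 measurable_completion) simp
  have "set_integrable lebesgue \<Omega> (\<lambda>x. (norm (glue Th v x))\<^sup>2)"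
    using continuous_on_subset[OF v]
    by (intro domain_integral(1)[OF _ negligible_empty, of "\<lambda>T x. (norm (v T x))\<^sup>2"] continuous_intros) (auto simp: glue_interior)
  then show "integrable (lebesgue_on \<Omega>) (\<lambda>x. (norm (glue Th v x))\<^sup>2)"
    using open_domain by (subst integrable_restrict_space) (auto simp: set_integrable_def borel_open)
qed

text \<open>The factor \<open>exp (- m (n \<bullet> (x - p))\<^sup>2)\<close> is \<open>1\<close> on the plane through \<open>p\<close> with normal \<open>n\<close> and tends
  to \<open>0\<close> off it, so that a test function keeps its values on a face while its integral over \<open>\<Omega>\<close> vanishes in the limit.\<close>

lemma concentrated_integral:
  fixes d \<phi> :: "pt \<Rightarrow> real"
  assumes d: "square_integrable \<Omega> d" and \<phi>: "continuous_on UNIV \<phi>" and n: "n \<noteq> 0"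
  shows "(\<lambda>m. inner_L2 \<Omega> d (\<lambda>x. \<phi> x * exp (- real m * (n \<bullet> (x - p))\<^sup>2))) \<longlonglongrightarrow> 0"
proof -
  let ?M = "lebesgue_on \<Omega>"
  have S: "\<Omega> \<in> sets lebesgue" using open_domain by (simp add: borel_open)
  have dm: "d \<in> borel_measurable ?M" and d2: "integrable ?M (\<lambda>x. (norm (d x))\<^sup>2)"
    using d by (auto simp: square_integrable_def)
  have fm: "\<phi> \<in> borel_measurable ?M" "(\<lambda>x. exp (- real m * (n \<bullet> (x - p))\<^sup>2)) \<in> borel_measurable ?M" for m
    using S by (intro continuous_imp_measurable_on_sets_lebesgue continuous_on_subset[OF \<phi>] continuous_intros; simp)+
  have "compact (closure \<Omega>)" using bounded_domain by (simp add: compact_closure)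
  then obtain K where K: "\<And>x. x \<in> closure \<Omega> \<Longrightarrow> \<bar>\<phi> x\<bar> \<le> K"
    using continuous_on_compact_bound[OF _ continuous_on_subset[OF \<phi> subset_UNIV]] by (metis real_norm_def)
  have one: "integrable ?M (\<lambda>x. 1 :: real)"
  proof -
    from lmeasurable_domain show ?thesis using S by (subst integrable_restrict_space) (auto simp: fmeasurable_def)
  qed
  have eq: "inner_L2 \<Omega> d f = integral\<^sup>L ?M (\<lambda>x. d x * f x)" for f
    unfolding inner_L2_def set_lebesgue_integral_def using S by (subst integral_restrict_space) auto
  have "(\<lambda>m. integral\<^sup>L ?M (\<lambda>x. d x * (\<phi> x * exp (- real m * (n \<bullet> (x - p))\<^sup>2)))) \<longlonglongrightarrow> integral\<^sup>L ?M (\<lambda>x. 0)"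
  proof (rule integral_dominated_convergence[where w = "\<lambda>x. (1 + (norm (d x))\<^sup>2) * K"])
    show "(\<lambda>x. d x * (\<phi> x * exp (- real m * (n \<bullet> (x - p))\<^sup>2))) \<in> borel_measurable ?M" for m
      using dm fm by (intro borel_measurable_times)
    show "integrable ?M (\<lambda>x. (1 + (norm (d x))\<^sup>2) * K)" using one d2 by simp
    have "negligible {x. n \<bullet> x = n \<bullet> p}" using n by (simp add: negligible_hyperplane)
    then have "AE x in lebesgue. x \<notin> {x. n \<bullet> x = n \<bullet> p}" by (simp only: AE_not_in negligible_iff_null_sets)
    then have "AE x in ?M. x \<notin> {x. n \<bullet> x = n \<bullet> p}" using S by (subst AE_restrict_space_iff) auto
    then show "AE x in ?M. (\<lambda>m. d x * (\<phi> x * exp (- real m * (n \<bullet> (x - p))\<^sup>2))) \<longlonglongrightarrow> 0"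
    proof (rule eventually_mono)
      fix x assume "x \<notin> {x. n \<bullet> x = n \<bullet> p}"
      then have "0 < (n \<bullet> (x - p))\<^sup>2" by (simp add: inner_simps)
      then have "exp (- (n \<bullet> (x - p))\<^sup>2) < 1" by simp
      then have "(\<lambda>m. exp (- (n \<bullet> (x - p))\<^sup>2) ^ m) \<longlonglongrightarrow> 0" by (intro LIMSEQ_realpow_zero) auto
      then have "(\<lambda>m. exp (- real m * (n \<bullet> (x - p))\<^sup>2)) \<longlonglongrightarrow> 0" by (simp add: exp_of_nat_mult[symmetric])
      then show "(\<lambda>m. d x * (\<phi> x * exp (- real m * (n \<bullet> (x - p))\<^sup>2))) \<longlonglongrightarrow> 0"
        by (intro tendsto_mult_right_zero)
    qed
    show "AE x in ?M. norm (d x * (\<phi> x * exp (- real m * (n \<bullet> (x - p))\<^sup>2))) \<le> (1 + (norm (d x))\<^sup>2) * K" for m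
    proof (rule AE_I2)
      fix x assume "x \<in> space ?M"
      then have x: "x \<in> closure \<Omega>" using closure_subset by (auto simp: space_restrict_space)
      \<comment> \<open>On a set of finite measure \<open>1 + (norm (d x))\<^sup>2\<close> is
        integrable, and it dominates \<open>\<bar>d x\<bar>\<close>.\<close>
      have "0 \<le> (\<bar>d x\<bar> - 1)\<^sup>2" by simp
      then have "\<bar>d x\<bar> \<le> 1 + (norm (d x))\<^sup>2" using sum_power2_ge_zero[of "d x" 1] by (simp add: power2_diff)
      moreover have "\<bar>\<phi> x * exp (- real m * (n \<bullet> (x - p))\<^sup>2)\<bar> \<le> K * 1"
        unfolding abs_mult using K[OF x] by (intro mult_mono) auto
      ultimately show "norm (d x * (\<phi> x * exp (- real m * (n \<bullet> (x - p))\<^sup>2))) \<le> (1 + (norm (d x))\<^sup>2) * K"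
        unfolding real_norm_def abs_mult[of "d x"] by (intro mult_mono) auto
    qed
  qed auto
  then show ?thesis by (simp add: eq)
qed

end

context pdwg_setting
begin

lemma glue_inner:
  assumes u: "u \<in> V_h Th k" and g: "continuous_on UNIV g"
  shows "inner_L2 \<Omega> (glue Th u) g = (\<Sum>T\<in>Th. inner_L2 T (u T) g)"
    and "inner_L2 \<Omega> (\<lambda>x. \<epsilon> x *v glue Th u x) g = (\<Sum>T\<in>Th. inner_L2 T (\<lambda>x. E T *v u T x) g)"
proof -
  have c: "continuous_on T (u T)" "continuous_on T (\<lambda>x. E T *v u T x)" "continuous_on T g" if "T \<in> Th" for T
    using vpoly_continuous_on[OF V_h_cell[OF u that]] continuous_on_subset[OF g] by (auto intro: continuous_on_matrix)
  show "inner_L2 \<Omega> (glue Th u) g = (\<Sum>T\<in>Th. inner_L2 T (u T) g)"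
    using c by (intro inner_L2_domain[OF _ _ negligible_empty]) (auto simp: glue_interior)
  obtain N where N: "negligible N" "\<And>T x. T \<in> Th \<Longrightarrow> x \<in> interior T \<Longrightarrow> x \<notin> N \<Longrightarrow> \<epsilon> x = E T" by (rule E_ae) blast
  show "inner_L2 \<Omega> (\<lambda>x. \<epsilon> x *v glue Th u x) g = (\<Sum>T\<in>Th. inner_L2 T (\<lambda>x. E T *v u T x) g)"
    using c N(2) by (intro inner_L2_domain[OF _ _ N(1)]) (auto simp: glue_interior)
qed

text \<open>Green's formulas on the cells leave only jumps. The zero function serves as divergence
  in the normal trace condition, and boundary faces do not contribute to the weak curl because test
  functions vanish on them.\<close>

lemma broken_harmonic_imp_normal_harmonic:
  assumes u: "u \<in> V_h Th k" and bh: "broken_harmonic u"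
  shows "glue Th u \<in> normal_harmonic \<Omega> \<epsilon>"
proof -
  have w0: "\<forall>T\<in>Th. u T \<in> vpoly_space k" using V_h_cell[OF u] by blast
  have div0: "divg (\<lambda>x. E T *v u T x) = (\<lambda>x. 0)" and curl0: "curl (u T) = (\<lambda>x. 0)" if "T \<in> Th" for T
    using bh that unfolding broken_harmonic_def by auto
  have J: "normal_jump u \<sigma> x = 0" if "\<sigma> \<in> Eh" "x \<in> \<sigma>" for \<sigma> x using bh that unfolding broken_harmonic_def by auto
  have K: "tangential_jump u \<sigma> x = 0" if "\<sigma> \<in> Eh" "\<not> \<sigma> \<subseteq> frontier \<Omega>" "x \<in> \<sigma>" for \<sigma> x
    using bh that unfolding broken_harmonic_def by auto
  have D: "inner_L2 \<Omega> (\<lambda>x. \<epsilon> x *v glue Th u x) (grad \<phi>) = 0" if "smooth \<phi>" for \<phi>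
  proof -
    have p: "C1 \<phi>" using that by (rule smooth_C1)
    have "face_integral \<sigma> (\<lambda>x. \<phi> x * normal_jump u \<sigma> x) = face_integral \<sigma> (\<lambda>x. 0)" if "\<sigma> \<in> Eh" for \<sigma>
      using J[OF that] by (intro face_integral_cong) simp
    then show ?thesis
      unfolding glue_inner(2)[OF u continuous_on_grad[OF p]] sum_green_grad[of u, OF w0 p] using div0 by simp
  qed
  have C: "inner_L2 \<Omega> (glue Th u) (curl \<phi>) = 0" if t: "test_function \<Omega> \<phi>" for \<phi>
  proof -
    have p: "C1 \<phi>" by (rule smooth_C1) (use t in \<open>simp add: test_function_def\<close>)
    have z: "\<phi> x = 0" if "x \<in> frontier \<Omega>" for x
    proof (rule ccontr)
      assume "\<phi> x \<noteq> 0"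
      then have "x \<in> closure {x. \<phi> x \<noteq> 0}" using closure_subset[of "{x. \<phi> x \<noteq> 0}"] by auto
      then have "x \<in> \<Omega>" using t unfolding test_function_def by blast
      then show False using that open_domain by (simp add: frontier_def interior_open)
    qed
    have "face_integral \<sigma> (\<lambda>x. \<phi> x \<bullet> tangential_jump u \<sigma> x) = face_integral \<sigma> (\<lambda>x. 0)" if "\<sigma> \<in> Eh" for \<sigma>
    proof (rule face_integral_cong)
      fix x assume x: "x \<in> \<sigma>"
      show "\<phi> x \<bullet> tangential_jump u \<sigma> x = 0"
        using K[OF that _ x] z[of x] x by (cases "\<sigma> \<subseteq> frontier \<Omega>") auto
    qed
    then show ?thesis
      unfolding glue_inner(1)[OF u continuous_on_curl[OF p]] sum_green_curl[of u, OF w0 p] using curl0 by simp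
  qed
  have sq: "square_integrable \<Omega> (\<lambda>x. 0 :: real)" by (simp add: square_integrable_def)
  have wd: "has_weak_div \<Omega> (\<lambda>x. \<epsilon> x *v glue Th u x) (\<lambda>_. 0)"
    using D by (simp add: has_weak_div_def test_function_def)
  show ?thesis
    unfolding normal_harmonic_def zero_normal_trace_def
    using square_integrable_glue[OF vpoly_continuous_on[OF V_h_cell[OF u]]] C D sq wd
    by (auto simp: has_weak_curl_def intro!: exI[of _ "\<lambda>_. 0"])
qed

text \<open>Localisation treats cells and interior faces. For the normal jump up to the boundary,
  the trace condition involves some square integrable \<open>d\<close>. Test functions concentrated
  at the plane of a face make its contribution tend to zero while the face term stays fixed.\<close>

lemma normal_harmonic_imp_broken_harmonic:
  assumes u: "u \<in> V_h Th k" and h: "glue Th u \<in> normal_harmonic \<Omega> \<epsilon>"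
  shows "broken_harmonic u"
proof -
  have w0: "\<forall>T\<in>Th. u T \<in> vpoly_space k" using V_h_cell[OF u] by blast
  have bC: "C1 (\<lambda>x. (bump p r x * g x) *\<^sub>R v)" if "smooth_gen g" for p r g and v :: "'c::real_normed_vector"
    by (intro smooth_C1 smooth_gen_scaleR smooth_gen.mult smooth_gen_bump that)
  have Jp: "normal_jump u \<sigma> \<in> poly_space k" for \<sigma> by (rule normal_jump_poly[of u, OF w0])
  have div: "(\<Sum>T\<in>Th. LINT x:T|lebesgue. divg (\<lambda>x. E T *v u T x) x * (bump p r x * g x))
      = (\<Sum>\<sigma>\<in>Eh. face_integral \<sigma> (\<lambda>x. normal_jump u \<sigma> x * (bump p r x * g x)))"
    if r: "0 < r" "cball p r \<subseteq> \<Omega>" "smooth_gen g" for p r g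
  proof -
    let ?f = "\<lambda>x. bump p r x * g x"
    have p: "C1 ?f" and t: "test_function \<Omega> ?f"
      using bC[OF r(3), of p r "1::real"] test_function_localized[OF r, of "1::real"] by simp_all
    have "inner_L2 \<Omega> (\<lambda>x. \<epsilon> x *v glue Th u x) (grad ?f) = 0"
      using h t unfolding normal_harmonic_def has_weak_div_def by auto
    then show ?thesis
      unfolding glue_inner(2)[OF u continuous_on_grad[OF p]] sum_green_grad[of u, OF w0 p]
      by (simp add: inner_L2_def mult.commute)
  qed
  have dz: "divg (\<lambda>x. E T *v u T x) = (\<lambda>x. 0)" if "T \<in> Th" for T
    by (rule localized_zero(1)[where D = "\<lambda>T. divg (\<lambda>x. E T *v u T x)" and J = "normal_jump u" and m = k, OF _ _ _ that];
      (rule divg_in_poly_space[OF matrix_vpoly_space[OF V_h_cell[OF u]]] Jp div; assumption)+)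
  have curlj: "(\<Sum>T\<in>Th. LINT x:T|lebesgue. curl (u T) x $ j * (bump p r x * g x))
      = (\<Sum>\<sigma>\<in>Eh. face_integral \<sigma> (\<lambda>x. tangential_jump u \<sigma> x $ j * (bump p r x * g x)))"
    if r: "0 < r" "cball p r \<subseteq> \<Omega>" "smooth_gen g" for p r g j
  proof -
    let ?f = "\<lambda>x. (bump p r x * g x) *\<^sub>R (axis j 1 :: real^3)"
    have "inner_L2 \<Omega> (glue Th u) (curl ?f) = 0"
      using h test_function_localized[OF r] unfolding normal_harmonic_def has_weak_curl_def by auto
    then show ?thesis
      unfolding glue_inner(1)[OF u continuous_on_curl[OF bC[OF r(3)]]] sum_green_curl[of u, OF w0 bC[OF r(3)]]
      by (simp add: inner_L2_def inner_axis inner_axis' mult.commute)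
  qed
  have tp: "(\<lambda>x. tangential_jump u \<sigma> x $ j) \<in> poly_space k" if s: "\<sigma> \<in> Eh" for \<sigma> j
    unfolding tangential_jump_def sum_component
    by (intro poly_space_sum vpoly_space_component linear_vpoly_space[OF _ linear_cross3(2)]) (use w0 in auto)
  note lz = localized_zero[where D = "\<lambda>T x. curl (u T) x $ j" and J = "\<lambda>\<sigma> x. tangential_jump u \<sigma> x $ j" and m = k for j]
  have cz1: "(\<lambda>x. curl (u T) x $ j) = (\<lambda>x. 0)" if "T \<in> Th" for T j
    by (rule lz(1)[OF _ _ _ that]; (rule vpoly_space_component[OF curl_in_vpoly_space[OF V_h_cell[OF u]]] tp curlj; assumption)+)
  have cz2: "tangential_jump u \<sigma> x $ j = 0" if "\<sigma> \<in> Eh" "\<not> \<sigma> \<subseteq> frontier \<Omega>" "x \<in> \<sigma>" for \<sigma> x j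
    by (rule lz(2)[OF _ _ _ that]; (rule vpoly_space_component[OF curl_in_vpoly_space[OF V_h_cell[OF u]]] tp curlj; assumption)+)
  have "normal_jump u \<sigma> x = 0" if s: "\<sigma> \<in> Eh" "x \<in> \<sigma>" for \<sigma> x
  proof (rule zero_off_skeleton[OF s(1) poly_continuous_on[OF Jp] _ s(2)])
    fix p assume p: "p \<in> \<sigma>" "p \<notin> skel"
    obtain n where n: "unit_normal \<sigma> n" using face_has_unit_normal[OF face[OF s(1)]] .
    obtain r where r: "r > 0" "\<And>\<sigma>' x. \<sigma>' \<in> Eh \<Longrightarrow> \<sigma>' \<noteq> \<sigma> \<Longrightarrow> x \<in> \<sigma>' \<Longrightarrow> x \<notin> ball p r"
      by (rule isolated_face_point[OF s(1) p]) blast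
    obtain d where d: "square_integrable \<Omega> d"
      and tr: "\<And>\<phi>. smooth \<phi> \<Longrightarrow> inner_L2 \<Omega> (\<lambda>x. \<epsilon> x *v glue Th u x) (grad \<phi>) + inner_L2 \<Omega> d \<phi> = 0"
      using h unfolding normal_harmonic_def zero_normal_trace_def by blast
    define J where "J = normal_jump u \<sigma>"
    \<comment> \<open>On the face the exponential equals one for every \<open>m\<close>. The bump
      separates the face from all others, and the factor \<open>J\<close> makes the face term a
      weighted square.\<close>
    define \<phi> where "\<phi> m x = bump p r x * J x * exp (- real m * (n \<bullet> (x - p))\<^sup>2)" for m x
    have sg: "smooth_gen (\<lambda>x. bump p r x * J x)"
      unfolding J_def by (intro smooth_gen.mult smooth_gen_bump poly_space_smooth_gen[OF Jp])
    have \<phi>: "smooth_gen (\<phi> m)" for m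
      unfolding \<phi>_def power2_eq_square by (intro smooth_gen.mult smooth_gen.exp sg smooth_gen.const smooth_gen_inner)
    have on: "\<phi> m x = bump p r x * J x" if "x \<in> \<sigma>" for m x
      using n p(1) that by (simp add: \<phi>_def unit_normal_def)
    have "inner_L2 \<Omega> d (\<phi> m) = - face_integral \<sigma> (\<lambda>x. J x * (bump p r x * J x))" for m
    proof -
      have sm: "smooth (\<phi> m)" by (rule smooth_gen_smooth[OF \<phi>])
      note C = smooth_C1[OF sm]
      have "(\<Sum>\<sigma>'\<in>Eh. face_integral \<sigma>' (\<lambda>x. \<phi> m x * normal_jump u \<sigma>' x))
        = (\<Sum>\<sigma>'\<in>Eh. if \<sigma>' = \<sigma> then face_integral \<sigma> (\<lambda>x. J x * (bump p r x * J x)) else 0)"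
      proof (intro sum.cong refl)
        fix \<sigma>' assume s': "\<sigma>' \<in> Eh"
        show "face_integral \<sigma>' (\<lambda>x. \<phi> m x * normal_jump u \<sigma>' x)
          = (if \<sigma>' = \<sigma> then face_integral \<sigma> (\<lambda>x. J x * (bump p r x * J x)) else 0)"
        proof (cases "\<sigma>' = \<sigma>")
          case True
          then show ?thesis using on by (simp add: J_def[symmetric]) (intro face_integral_cong, simp)
        next
          case False
          then have "\<phi> m x = 0" if "x \<in> \<sigma>'" for x
            using r(2)[OF s' False that] by (simp add: \<phi>_def bump_zero_iff[OF r(1)])
          then show ?thesis using False face_integral_cong[of \<sigma>' _ "\<lambda>x. 0"] by simp
        qed
      qed
      then show ?thesis
        using tr[OF sm] dz s(1) finite_Eh
        unfolding glue_inner(2)[OF u continuous_on_grad[OF C]] sum_green_grad[of u, OF w0 C] by simp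
    qed
    moreover have "(\<lambda>m. inner_L2 \<Omega> d (\<phi> m)) \<longlonglongrightarrow> 0"
      unfolding \<phi>_def
      by (rule concentrated_integral[OF d]) (use n C1_continuous_on[OF smooth_C1[OF smooth_gen_smooth[OF sg]]] in \<open>auto simp: unit_normal_def\<close>)
    ultimately have "face_integral \<sigma> (\<lambda>x. J x * (bump p r x * J x)) = 0" by (simp add: LIMSEQ_const_iff)
    then show "normal_jump u \<sigma> p = 0"
      unfolding J_def by (rule bump_face_zero[OF s(1) p(1) Jp r(1)])
  qed
  moreover have "curl (u T) = (\<lambda>x. 0)" if "T \<in> Th" for T
    using cz1[OF that] by (auto simp: fun_eq_iff vec_eq_iff)
  ultimately show ?thesis
    unfolding broken_harmonic_def using dz cz2 by (auto simp: vec_eq_iff)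
qed

end

subsection \<open>The stabilisation forms\<close>

context polyhedral_mesh
begin

text \<open>A cell contains a ball. This makes the weights of the stabilisers positive.\<close>

lemma diameter_pos: "T \<in> Th \<Longrightarrow> 0 < diameter T"
proof -
  assume T: "T \<in> Th"
  obtain x e where e: "e > 0" "ball x e \<subseteq> T"
    using cell_closure_interior(2)[OF T] by (metis all_not_in_conv mem_interior)
  have "dist x (x + (e / 2) *\<^sub>R axis 1 1) \<le> diameter T"
    using e by (intro diameter_bounded_bound compact_imp_bounded cell_compact[OF T]) (auto intro!: subsetD[OF e(2)] simp: dist_norm)
  then show ?thesis using e(1) by (simp add: dist_norm)
qed

text \<open>One form with cell weights for both scalar stabilisers: the weight is
  \<open>inverse (diameter T)\<close> in \<open>s_1\<close> and a power of the diameter in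
  \<open>s_2\<close>.\<close>

definition jump_form :: "(pt set \<Rightarrow> real) \<Rightarrow> real weak \<Rightarrow> real weak \<Rightarrow> real" where
  "jump_form \<omega> l \<phi> = (\<Sum>T\<in>Th. \<omega> T * (\<Sum>\<sigma>\<in>F T.
     face_integral \<sigma> (\<lambda>x. (fst l T x - snd l \<sigma> x) * (fst \<phi> T x - snd \<phi> \<sigma> x))))"

abbreviation tangential_gap :: "(real^3) weak \<Rightarrow> pt set \<Rightarrow> pt set \<Rightarrow> pt \<Rightarrow> real^3" where
  "tangential_gap \<psi> T \<sigma> x \<equiv> cross3 (fst \<psi> T x) (normal_of T \<sigma>) - cross3 (snd \<psi> \<sigma> x) (normal_of T \<sigma>)"

definition tangential_jump_form :: "(pt set \<Rightarrow> real) \<Rightarrow> (real^3) weak \<Rightarrow> (real^3) weak \<Rightarrow> real" where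
  "tangential_jump_form \<omega> q \<psi> = (\<Sum>T\<in>Th. \<omega> T * (\<Sum>\<sigma>\<in>F T. face_integral \<sigma> (\<lambda>x.
     tangential_gap q T \<sigma> x \<bullet> tangential_gap \<psi> T \<sigma> x)))"

lemma s_1_eq: "s_1 Th Eh \<rho>1 \<rho>2 l q \<phi> \<psi>
    = \<rho>1 * jump_form (\<lambda>T. inverse (diameter T)) l \<phi> + \<rho>2 * tangential_jump_form (\<lambda>T. inverse (diameter T)) q \<psi>"
  by (simp add: s_1_def jump_form_def tangential_jump_form_def)

lemma s_2_eq: "s_2 Th Eh \<rho>3 \<gamma> s r = \<rho>3 * jump_form (\<lambda>T. diameter T powr (- \<gamma>)) s r"
  by (simp add: s_2_def jump_form_def)

lemma jump_form_sym: "jump_form \<omega> l \<phi> = jump_form \<omega> \<phi> l"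
  by (simp add: jump_form_def mult.commute)

lemma tangential_jump_form_sym: "tangential_jump_form \<omega> q \<psi> = tangential_jump_form \<omega> \<psi> q"
  by (simp add: tangential_jump_form_def inner_commute)

lemma weighted_face_sum_lin:
  assumes "\<And>T \<sigma>. T \<in> Th \<Longrightarrow> \<sigma> \<in> F T \<Longrightarrow> continuous_on \<sigma> (f T \<sigma>) \<and> continuous_on \<sigma> (g T \<sigma>)"
    and "\<And>T \<sigma> x. T \<in> Th \<Longrightarrow> \<sigma> \<in> F T \<Longrightarrow> h T \<sigma> x = f T \<sigma> x + c * g T \<sigma> x"
  shows "(\<Sum>T\<in>Th. \<omega> T * (\<Sum>\<sigma>\<in>F T. face_integral \<sigma> (h T \<sigma>)))
    = (\<Sum>T\<in>Th. \<omega> T * (\<Sum>\<sigma>\<in>F T. face_integral \<sigma> (f T \<sigma>))) + c * (\<Sum>T\<in>Th. \<omega> T * (\<Sum>\<sigma>\<in>F T. face_integral \<sigma> (g T \<sigma>)))"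
proof -
  have "face_integral \<sigma> (h T \<sigma>) = face_integral \<sigma> (f T \<sigma>) + c * face_integral \<sigma> (g T \<sigma>)" if "T \<in> Th" "\<sigma> \<in> F T" for T \<sigma>
  proof -
    have "face_integral \<sigma> (h T \<sigma>) = face_integral \<sigma> (\<lambda>x. f T \<sigma> x + c * g T \<sigma> x)"
      using assms(2)[OF that] by (intro face_integral_cong) simp
    then show ?thesis using assms(1)[OF that] continuous_face_integrable[OF face_of_cell[OF that(2)]] by (simp add: face_integral_lin)
  qed
  then show ?thesis by (simp add: sum.distrib sum_distrib_left algebra_simps)
qed

lemma weighted_face_sum_zero:
  assumes \<omega>: "\<And>T. T \<in> Th \<Longrightarrow> 0 < \<omega> T"
    and f: "\<And>T \<sigma>. T \<in> Th \<Longrightarrow> \<sigma> \<in> F T \<Longrightarrow> continuous_on \<sigma> (f T \<sigma>)" "\<And>T \<sigma> x. 0 \<le> f T \<sigma> x"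
  shows "0 \<le> (\<Sum>T\<in>Th. \<omega> T * (\<Sum>\<sigma>\<in>F T. face_integral \<sigma> (f T \<sigma>)))"
    and "(\<Sum>T\<in>Th. \<omega> T * (\<Sum>\<sigma>\<in>F T. face_integral \<sigma> (f T \<sigma>))) = 0 \<Longrightarrow> T \<in> Th \<Longrightarrow> \<sigma> \<in> F T \<Longrightarrow> x \<in> \<sigma> \<Longrightarrow> f T \<sigma> x = 0"
proof -
  have nn: "0 \<le> face_integral \<sigma> (f T \<sigma>)" for T \<sigma> by (rule face_integral_nonneg[OF f(2)])
  then have nt: "0 \<le> \<omega> T * (\<Sum>\<sigma>\<in>F T. face_integral \<sigma> (f T \<sigma>))" if "T \<in> Th" for T
    using \<omega>[OF that] by (intro mult_nonneg_nonneg sum_nonneg) auto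
  then show "0 \<le> (\<Sum>T\<in>Th. \<omega> T * (\<Sum>\<sigma>\<in>F T. face_integral \<sigma> (f T \<sigma>)))" by (rule sum_nonneg)
  assume z: "(\<Sum>T\<in>Th. \<omega> T * (\<Sum>\<sigma>\<in>F T. face_integral \<sigma> (f T \<sigma>))) = 0" and T: "T \<in> Th" and s: "\<sigma> \<in> F T" and x: "x \<in> \<sigma>"
  have "\<omega> T * (\<Sum>\<sigma>\<in>F T. face_integral \<sigma> (f T \<sigma>)) = 0"
    by (rule sum_nonneg_zero[of Th "\<lambda>T. \<omega> T * (\<Sum>\<sigma>\<in>F T. face_integral \<sigma> (f T \<sigma>))", OF finite_Th nt z T])
  then have "(\<Sum>\<sigma>\<in>F T. face_integral \<sigma> (f T \<sigma>)) = 0" using \<omega>[OF T] by simp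
  then have "face_integral \<sigma> (f T \<sigma>) = 0"
    by (rule sum_nonneg_zero[of "F T" "\<lambda>\<sigma>. face_integral \<sigma> (f T \<sigma>)", OF finite_faces nn _ s])
  then show "f T \<sigma> x = 0" by (rule face_integral_zero_imp_zero[OF face_of_cell[OF s] f(1)[OF T s] f(2) _ x])
qed

lemma PW_jump_continuous:
  assumes "l \<in> PW k" "T \<in> Th" "\<sigma> \<in> F T"
  shows "continuous_on \<sigma> (\<lambda>x. fst l T x - snd l \<sigma> x)"
  by (intro continuous_on_diff poly_continuous_on[OF PW_cell[OF assms(1,2)]] PW_face_continuous[OF assms(1) faces_in_Eh[OF assms(3)]])

lemma VW_jump_continuous:
  assumes "q \<in> VW k" "T \<in> Th" "\<sigma> \<in> F T"
  shows "continuous_on \<sigma> (\<lambda>x. cross3 (fst q T x) n - cross3 (snd q \<sigma> x) n)"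
  by (intro continuous_on_diff continuous_on_cross3 continuous_on_const vpoly_continuous_on[OF VW_cell[OF assms(1,2)]]
      VW_face_continuous[OF assms(1) faces_in_Eh[OF assms(3)]])

lemma jump_form_lin:
  assumes "l \<in> PW k" "\<phi> \<in> PW k" "\<phi>' \<in> PW k"
  shows "jump_form \<omega> l (\<phi> + c *\<^sub>R \<phi>') = jump_form \<omega> l \<phi> + c * jump_form \<omega> l \<phi>'"
  unfolding jump_form_def
  by (rule weighted_face_sum_lin, (intro conjI continuous_on_mult PW_jump_continuous[OF assms(1)]
        PW_jump_continuous[OF assms(2)] PW_jump_continuous[OF assms(3)]; assumption), simp add: algebra_simps)

lemma tangential_jump_form_lin:
  assumes "q \<in> VW k" "\<psi> \<in> VW k" "\<psi>' \<in> VW k"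
  shows "tangential_jump_form \<omega> q (\<psi> + c *\<^sub>R \<psi>') = tangential_jump_form \<omega> q \<psi> + c * tangential_jump_form \<omega> q \<psi>'"
  unfolding tangential_jump_form_def
proof (rule weighted_face_sum_lin)
  fix T \<sigma> x
  define n where "n = normal_of T \<sigma>"
  have "cross3 (fst (\<psi> + c *\<^sub>R \<psi>') T x) n - cross3 (snd (\<psi> + c *\<^sub>R \<psi>') \<sigma> x) n
    = (cross3 (fst \<psi> T x) n - cross3 (snd \<psi> \<sigma> x) n) + c *\<^sub>R (cross3 (fst \<psi>' T x) n - cross3 (snd \<psi>' \<sigma> x) n)"
    by (simp add: linear_add[OF linear_cross3(1)] linear_scale[OF linear_cross3(1)] algebra_simps)
  then show "tangential_gap q T \<sigma> x \<bullet> tangential_gap (\<psi> + c *\<^sub>R \<psi>') T \<sigma> x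
    = tangential_gap q T \<sigma> x \<bullet> tangential_gap \<psi> T \<sigma> x
    + c * (tangential_gap q T \<sigma> x \<bullet> tangential_gap \<psi>' T \<sigma> x)"
    unfolding n_def[symmetric] by (simp only: inner_add_right inner_scaleR_right)
qed (intro conjI continuous_on_inner VW_jump_continuous[OF assms(1)] VW_jump_continuous[OF assms(2)] VW_jump_continuous[OF assms(3)])

lemma jump_form_zero:
  assumes \<omega>: "\<And>T. T \<in> Th \<Longrightarrow> 0 < \<omega> T" and l: "l \<in> PW k"
  shows "0 \<le> jump_form \<omega> l l" "jump_form \<omega> l l = 0 \<Longrightarrow> conforming l"
proof -
  have c: "continuous_on \<sigma> (\<lambda>x. (fst l T x - snd l \<sigma> x) * (fst l T x - snd l \<sigma> x))" if "T \<in> Th" "\<sigma> \<in> F T" for T \<sigma>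
    by (intro continuous_on_mult PW_jump_continuous[OF l that])
  show "0 \<le> jump_form \<omega> l l"
    unfolding jump_form_def by (rule weighted_face_sum_zero(1)[OF \<omega> c]) auto
  show "conforming l" if z: "jump_form \<omega> l l = 0"
    unfolding conforming_def
  proof (intro ballI)
    fix T \<sigma> x assume a: "T \<in> Th" "\<sigma> \<in> F T" "x \<in> \<sigma>"
    have "(fst l T x - snd l \<sigma> x) * (fst l T x - snd l \<sigma> x) = 0"
      by (rule weighted_face_sum_zero(2)[OF \<omega> c _ z[unfolded jump_form_def] a]) auto
    then show "snd l \<sigma> x = fst l T x" by simp
  qed
qed

lemma tangential_jump_form_zero:
  assumes \<omega>: "\<And>T. T \<in> Th \<Longrightarrow> 0 < \<omega> T" and q: "q \<in> VW k"
  shows "0 \<le> tangential_jump_form \<omega> q q" "tangential_jump_form \<omega> q q = 0 \<Longrightarrow> tangentially_conforming q"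
proof -
  have c: "continuous_on \<sigma> (\<lambda>x. tangential_gap q T \<sigma> x \<bullet> tangential_gap q T \<sigma> x)" if "T \<in> Th" "\<sigma> \<in> F T" for T \<sigma>
    by (intro continuous_on_inner VW_jump_continuous[OF q that])
  show "0 \<le> tangential_jump_form \<omega> q q"
    unfolding tangential_jump_form_def by (rule weighted_face_sum_zero(1)[OF \<omega> c]) auto
  show "tangentially_conforming q" if z: "tangential_jump_form \<omega> q q = 0"
    unfolding tangentially_conforming_def
  proof (intro ballI)
    fix T \<sigma> x assume a: "T \<in> Th" "\<sigma> \<in> F T" "x \<in> \<sigma>"
    have "tangential_gap q T \<sigma> x \<bullet> tangential_gap q T \<sigma> x = 0"
      by (rule weighted_face_sum_zero(2)[OF \<omega> c _ z[unfolded tangential_jump_form_def] a]) auto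
    then show "cross3 (snd q \<sigma> x) (normal_of T \<sigma>) = cross3 (fst q T x) (normal_of T \<sigma>)" by simp
  qed
qed

lemma jump_form_conforming: "conforming l \<Longrightarrow> jump_form \<omega> l \<phi> = 0"
proof -
  assume l: "conforming l"
  have "face_integral \<sigma> (\<lambda>x. (fst l T x - snd l \<sigma> x) * (fst \<phi> T x - snd \<phi> \<sigma> x)) = face_integral \<sigma> (\<lambda>x. 0)"
    if "T \<in> Th" "\<sigma> \<in> F T" for T \<sigma>
    using l that by (intro face_integral_cong) (simp add: conforming_def)
  then show ?thesis by (simp add: jump_form_def)
qed

lemma tangential_jump_form_conforming: "tangentially_conforming q \<Longrightarrow> tangential_jump_form \<omega> q \<psi> = 0"
proof -
  assume q: "tangentially_conforming q"
  have "face_integral \<sigma> (\<lambda>x. tangential_gap q T \<sigma> x \<bullet> tangential_gap \<psi> T \<sigma> x) = face_integral \<sigma> (\<lambda>x. 0)"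
    if "T \<in> Th" "\<sigma> \<in> F T" for T \<sigma>
    using q that by (intro face_integral_cong) (simp add: tangentially_conforming_def)
  then show ?thesis by (simp add: tangential_jump_form_def)
qed

text \<open>Additivity rests on the integrability of every load term: a non-integrable function is
  assigned a default integral, for which sums would not split.\<close>

lemma F_load_lin:
  assumes wd: "F_well_defined \<Omega> Th Eh k f g \<phi>1"
    and p: "\<phi> \<in> M_h \<Omega> Th Eh k" "\<phi>' \<in> M_h \<Omega> Th Eh k" and q: "\<psi> \<in> W_h \<Omega> Th Eh k" "\<psi>' \<in> W_h \<Omega> Th Eh k"
  shows "F_load \<Omega> Th Eh f g \<phi>1 (\<phi> + c *\<^sub>R \<phi>') (\<psi> + c *\<^sub>R \<psi>')
    = F_load \<Omega> Th Eh f g \<phi>1 \<phi> \<psi> + c * F_load \<Omega> Th Eh f g \<phi>1 \<phi>' \<psi>'"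
proof -
  have glue: "glue Th (v + c *\<^sub>R w) x = glue Th v x + c *\<^sub>R glue Th w x" for v w :: "'c::real_vector pw" and x
    by (simp add: glue_def sum.distrib scaleR_sum_right algebra_simps)
  note I = wd[unfolded F_well_defined_def, rule_format]
  have 1: "inner_L2 \<Omega> g (glue Th (fst (\<psi> + c *\<^sub>R \<psi>'))) = inner_L2 \<Omega> g (glue Th (fst \<psi>)) + c * inner_L2 \<Omega> g (glue Th (fst \<psi>'))"
    using set_integral_add(2)[OF I[OF p(1) q(1), THEN conjunct1] set_integrable_mult_right[OF I[OF p(1) q(2), THEN conjunct1], of c]]
    by (simp add: inner_L2_def glue inner_add_right)
  have 2: "inner_L2 \<Omega> f (glue Th (fst (\<phi> + c *\<^sub>R \<phi>'))) = inner_L2 \<Omega> f (glue Th (fst \<phi>)) + c * inner_L2 \<Omega> f (glue Th (fst \<phi>'))"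
    using set_integral_add(2)[OF I[OF p(1) q(1), THEN conjunct2, THEN conjunct1]
        set_integrable_mult_right[OF I[OF p(2) q(1), THEN conjunct2, THEN conjunct1], of c]]
    by (simp add: inner_L2_def glue algebra_simps)
  have 3: "face_integral \<sigma> (\<lambda>x. \<phi>1 x * snd (\<phi> + c *\<^sub>R \<phi>') \<sigma> x)
    = face_integral \<sigma> (\<lambda>x. \<phi>1 x * snd \<phi> \<sigma> x) + c * face_integral \<sigma> (\<lambda>x. \<phi>1 x * snd \<phi>' \<sigma> x)" if "\<sigma> \<in> boundary_faces \<Omega> Eh" for \<sigma>
    using face_integral_lin[of \<sigma> "\<lambda>x. \<phi>1 x * snd \<phi> \<sigma> x" "\<lambda>x. \<phi>1 x * snd \<phi>' \<sigma> x" c]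
      I[OF p(1) q(1), THEN conjunct2, THEN conjunct2] I[OF p(2) q(1), THEN conjunct2, THEN conjunct2] that
    by (simp add: algebra_simps)
  have 4: "(\<Sum>\<sigma>\<in>boundary_faces \<Omega> Eh. face_integral \<sigma> (\<lambda>x. \<phi>1 x * snd (\<phi> + c *\<^sub>R \<phi>') \<sigma> x))
    = (\<Sum>\<sigma>\<in>boundary_faces \<Omega> Eh. face_integral \<sigma> (\<lambda>x. \<phi>1 x * snd \<phi> \<sigma> x))
      + c * (\<Sum>\<sigma>\<in>boundary_faces \<Omega> Eh. face_integral \<sigma> (\<lambda>x. \<phi>1 x * snd \<phi>' \<sigma> x))"
    unfolding sum_distrib_left sum.distrib[symmetric] by (rule sum.cong[OF refl 3])
  show ?thesis unfolding F_load_def 1 2 4 by (simp add: algebra_simps)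
qed

end

subsection \<open>The scheme as a symmetric linear system\<close>

locale pdwg_scheme = pdwg_setting +
  fixes \<rho>1 \<rho>2 \<rho>3 \<gamma> :: real and f :: "pt \<Rightarrow> real" and g :: "pt \<Rightarrow> real^3" and \<phi>1 :: "pt \<Rightarrow> real"
  assumes parameters: "\<rho>1 > 0" "\<rho>2 > 0" "\<rho>3 > 0" and load: "F_well_defined \<Omega> Th Eh k f g \<phi>1"
begin

abbreviation "V \<equiv> V_h Th k"
abbreviation "S \<equiv> S_h Th Eh k \<Gamma> L"
abbreviation "M \<equiv> M_h \<Omega> Th Eh k"
abbreviation "W \<equiv> W_h \<Omega> Th Eh k"
abbreviation "X \<equiv> V \<times> S \<times> M \<times> W"

abbreviation "J1 \<equiv> jump_form (\<lambda>T. inverse (diameter T))"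
abbreviation "J2 \<equiv> jump_form (\<lambda>T. diameter T powr (- \<gamma>))"
abbreviation "K \<equiv> tangential_jump_form (\<lambda>T. inverse (diameter T))"

text \<open>On the discrete spaces this is \<open>B_h\<close>, expressed by sums over cells and
  without the glued functions.\<close>

definition coupling :: "(real^3) pw \<Rightarrow> real weak \<Rightarrow> real weak \<Rightarrow> (real^3) weak \<Rightarrow> real" where
  "coupling v r \<phi> \<psi> = div_form v \<phi> + curl_form v \<psi> + div_form (fst \<psi>) r"

text \<open>The two equations added, each with its own sign. The two couplings are mirror images of
  each other and the stabilisers are symmetric, so the whole saddle-point form is symmetric.\<close>

definition system :: "(real^3) pw \<times> real weak \<times> real weak \<times> (real^3) weak \<Rightarrow>
    (real^3) pw \<times> real weak \<times> real weak \<times> (real^3) weak \<Rightarrow> real" where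
  "system = (\<lambda>(u, s, l, q) (v, r, \<phi>, \<psi>).
     \<rho>1 * J1 l \<phi> + \<rho>2 * K q \<psi> + coupling u s \<phi> \<psi> + (- (\<rho>3 * J2 s r) + coupling v r l q))"

definition rhs :: "(real^3) pw \<times> real weak \<times> real weak \<times> (real^3) weak \<Rightarrow> real" where
  "rhs = (\<lambda>(v, r, \<phi>, \<psi>). F_load \<Omega> Th Eh f g \<phi>1 \<phi> \<psi>)"

lemma X_subspace: "subspace X"
  by (intro subspace_Times V_h_subspace S_h_subspace M_h_subspace W_h_subspace)

lemma fin_span_X: "fin_span X"
  using fin_span_subset[OF fin_span_PW S_h_PW] fin_span_subset[OF fin_span_PW M_h_PW] fin_span_subset[OF fin_span_VW W_h_VW]
  by (intro fin_span_Times fin_span_V_h)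

lemma weights: "T \<in> Th \<Longrightarrow> 0 < inverse (diameter T)" "T \<in> Th \<Longrightarrow> 0 < diameter T powr (- \<gamma>)"
  using diameter_pos[of T] by auto

lemma system_sym: "system x y = system y x"
  by (cases x, cases y) (simp add: system_def jump_form_sym tangential_jump_form_sym)

lemma forms_zero:
  assumes "v \<in> V" "\<phi> \<in> PW k" "\<psi> \<in> VW k"
  shows "div_form v 0 = 0" "curl_form v 0 = 0" "div_form 0 \<phi> = 0" "curl_form 0 \<psi> = 0"
proof -
  have v: "\<forall>T\<in>Th. v T \<in> vpoly_space k" using V_h_cell[OF assms(1)] by blast
  note Z = subspace_0[OF PW_subspace] subspace_0[OF VW_subspace]
  show "div_form v 0 = 0" "curl_form v 0 = 0"
    using div_form_lin_right[of v, OF v Z(1) Z(1), of 1] curl_form_lin_right[of v, OF v Z(2) Z(2), of 1] by simp_all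
  show "div_form 0 \<phi> = 0" "curl_form 0 \<psi> = 0"
    by (simp_all add: div_form_def curl_form_def inner_L2_def zero_fun_def)
qed

lemma system_lin: "x \<in> X \<Longrightarrow> lin_on X (system x)"
proof (rule lin_onI)
  fix x y y' c assume "x \<in> X" "y \<in> X" "y' \<in> X"
  then obtain u s l q v r \<phi> \<psi> v' r' \<phi>' \<psi>' where e: "x = (u, s, l, q)" "y = (v, r, \<phi>, \<psi>)" "y' = (v', r', \<phi>', \<psi>')"
    and m: "u \<in> V" "s \<in> S" "l \<in> M" "q \<in> W" "v \<in> V" "r \<in> S" "\<phi> \<in> M" "\<psi> \<in> W" "v' \<in> V" "r' \<in> S" "\<phi>' \<in> M" "\<psi>' \<in> W"
    by (cases x, cases y, cases y') auto
  have p: "s \<in> PW k" "r \<in> PW k" "r' \<in> PW k" "l \<in> PW k" "\<phi> \<in> PW k" "\<phi>' \<in> PW k" "q \<in> VW k" "\<psi> \<in> VW k" "\<psi>' \<in> VW k"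
    using m S_h_PW M_h_PW W_h_VW by blast+
  have c: "\<forall>T\<in>Th. u T \<in> vpoly_space k" "\<forall>T\<in>Th. v T \<in> vpoly_space k" "\<forall>T\<in>Th. v' T \<in> vpoly_space k"
    "\<forall>T\<in>Th. fst q T \<in> vpoly_space k" "\<forall>T\<in>Th. fst \<psi> T \<in> vpoly_space k" "\<forall>T\<in>Th. fst \<psi>' T \<in> vpoly_space k"
    using V_h_cell m VW_cell p by blast+
  have b1: "coupling u s (\<phi> + c *\<^sub>R \<phi>') (\<psi> + c *\<^sub>R \<psi>') = coupling u s \<phi> \<psi> + c * coupling u s \<phi>' \<psi>'"
    using div_form_lin_right[of u, OF c(1) p(5,6)] curl_form_lin_right[of u, OF c(1) p(8,9)]
      div_form_lin_left[of "fst \<psi>" "fst \<psi>'", OF c(5,6) p(1)]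
    by (simp add: coupling_def algebra_simps)
  have b2: "coupling (v + c *\<^sub>R v') (r + c *\<^sub>R r') l q = coupling v r l q + c * coupling v' r' l q"
    using div_form_lin_left[of v v', OF c(2,3) p(4)] curl_form_lin_left[of v v', OF c(2,3) p(7)]
      div_form_lin_right[of "fst q", OF c(4) p(2,3)]
    by (simp add: coupling_def algebra_simps)
  show "system x (y + c *\<^sub>R y') = system x y + c * system x y'"
    unfolding e system_def
    by (simp add: b1 b2 jump_form_lin[OF p(4,5,6)] jump_form_lin[OF p(1,2,3)] tangential_jump_form_lin[OF p(7,8,9)] algebra_simps)
qed

lemma rhs_lin: "lin_on X rhs"
proof (rule lin_onI)
  fix y y' c assume "y \<in> X" "y' \<in> X"
  then obtain v r \<phi> \<psi> v' r' \<phi>' \<psi>' where "y = (v, r, \<phi>, \<psi>)" "y' = (v', r', \<phi>', \<psi>')"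
    "\<phi> \<in> M" "\<psi> \<in> W" "\<phi>' \<in> M" "\<psi>' \<in> W" by (cases y, cases y') auto
  then show "rhs (y + c *\<^sub>R y') = rhs y + c * rhs y'" by (simp add: rhs_def F_load_lin[OF load])
qed

text \<open>The sum of the equations is equivalent to the pair: setting the test functions of one
  equation to zero leaves the other, because every form vanishes with its test argument.\<close>

lemma solution_iff: "pdwg_solution \<Omega> \<Gamma> L \<epsilon> Th Eh k \<rho>1 \<rho>2 \<rho>3 \<gamma> f g \<phi>1 u s l q
    \<longleftrightarrow> (u, s, l, q) \<in> X \<and> (\<forall>y\<in>X. system (u, s, l, q) y = rhs y)"
proof (cases "(u, s, l, q) \<in> X")
  case True
  then have m: "u \<in> V" "s \<in> S" "l \<in> M" "q \<in> W" by auto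
  have p: "s \<in> PW k" "l \<in> PW k" "q \<in> VW k" using m S_h_PW M_h_PW W_h_VW by blast+
  have B: "B_h \<Omega> \<epsilon> Th Eh k v r \<phi> \<psi> = coupling v r \<phi> \<psi>" if "v \<in> V" "r \<in> S" "\<phi> \<in> M" "\<psi> \<in> W" for v r \<phi> \<psi>
    unfolding coupling_def by (rule B_h_forms) (use that S_h_PW M_h_PW W_h_VW in blast)+
  have "pdwg_solution \<Omega> \<Gamma> L \<epsilon> Th Eh k \<rho>1 \<rho>2 \<rho>3 \<gamma> f g \<phi>1 u s l q \<longleftrightarrow>
      (\<forall>\<phi>\<in>M. \<forall>\<psi>\<in>W. \<rho>1 * J1 l \<phi> + \<rho>2 * K q \<psi> + coupling u s \<phi> \<psi> = F_load \<Omega> Th Eh f g \<phi>1 \<phi> \<psi>)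
      \<and> (\<forall>v\<in>V. \<forall>r\<in>S. - (\<rho>3 * J2 s r) + coupling v r l q = 0)" (is "_ \<longleftrightarrow> ?P \<and> ?Q")
    unfolding pdwg_solution_def s_1_eq s_2_eq using m by (simp add: B)
  also have "\<dots> \<longleftrightarrow> (\<forall>y\<in>X. system (u, s, l, q) y = rhs y)"
  proof
    assume *: "?P \<and> ?Q"
    show "\<forall>y\<in>X. system (u, s, l, q) y = rhs y"
    proof
      fix y assume "y \<in> X"
      then obtain v r \<phi> \<psi> where y: "y = (v, r, \<phi>, \<psi>)" "v \<in> V" "r \<in> S" "\<phi> \<in> M" "\<psi> \<in> W" by (cases y) auto
      have "\<rho>1 * J1 l \<phi> + \<rho>2 * K q \<psi> + coupling u s \<phi> \<psi> = F_load \<Omega> Th Eh f g \<phi>1 \<phi> \<psi>"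
        "- (\<rho>3 * J2 s r) + coupling v r l q = 0" using * y by simp_all
      then show "system (u, s, l, q) y = rhs y" by (simp only: y(1) system_def rhs_def prod.case)
    qed
  next
    assume *: "\<forall>y\<in>X. system (u, s, l, q) y = rhs y"
    have z: "0 \<in> V" "0 \<in> S" "0 \<in> M" "0 \<in> W"
      using V_h_subspace S_h_subspace M_h_subspace W_h_subspace by (simp_all add: subspace_0)
    have j: "J1 l 0 = 0" "J2 s 0 = 0" "K q 0 = 0"
      using jump_form_lin[OF p(2) subspace_0[OF PW_subspace] subspace_0[OF PW_subspace], of _ 1]
        jump_form_lin[OF p(1) subspace_0[OF PW_subspace] subspace_0[OF PW_subspace], of _ 1]
        tangential_jump_form_lin[OF p(3) subspace_0[OF VW_subspace] subspace_0[OF VW_subspace], of _ 1] by simp_all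
    have qV: "fst q \<in> V" using p(3) by (auto simp: VW_def V_h_def)
    have c0: "coupling 0 0 l q = 0" "coupling u s 0 0 = 0"
      using forms_zero[OF m(1) p(2,3)] forms_zero[OF qV p(2,3)] forms_zero[OF m(1) p(1,3)] by (simp_all add: coupling_def)
    have F0: "F_load \<Omega> Th Eh f g \<phi>1 0 0 = 0"
      by (simp add: F_load_def glue_def inner_L2_def)
    have ?P
    proof (intro ballI)
      fix \<phi> \<psi> assume "\<phi> \<in> M" "\<psi> \<in> W"
      then show "\<rho>1 * J1 l \<phi> + \<rho>2 * K q \<psi> + coupling u s \<phi> \<psi> = F_load \<Omega> Th Eh f g \<phi>1 \<phi> \<psi>"
        using bspec[OF *, of "(0, 0, \<phi>, \<psi>)"] z by (simp add: system_def rhs_def j c0)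
    qed
    moreover have ?Q
    proof (intro ballI)
      fix v r assume "v \<in> V" "r \<in> S"
      then show "- (\<rho>3 * J2 s r) + coupling v r l q = 0"
        using bspec[OF *, of "(v, r, 0, 0)"] z by (simp add: system_def rhs_def j c0 F0)
    qed
    ultimately show "?P \<and> ?Q" ..
  qed
  finally show ?thesis using True by simp
qed (auto simp: pdwg_solution_def)

text \<open>The form is indefinite. Testing with \<open>(- u, - s, l, q)\<close> cancels the two
  couplings and gives all three stabilisers the same sign.\<close>

lemma kernel_iff:
  assumes x: "(u, s, l, q) \<in> X"
  shows "(\<forall>y\<in>X. system (u, s, l, q) y = 0) \<longleftrightarrow> s = 0 \<and> l = 0 \<and> q = 0 \<and> broken_harmonic u"
proof
  have m: "u \<in> V" "s \<in> S" "l \<in> M" "q \<in> W" using x by auto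
  have p: "s \<in> PW k" "l \<in> PW k" "q \<in> VW k" using m S_h_PW M_h_PW W_h_VW by blast+
  have z: "0 \<in> V" "0 \<in> S" "0 \<in> M" "0 \<in> W" and Z: "0 \<in> PW k" "0 \<in> VW k"
    using V_h_subspace S_h_subspace M_h_subspace W_h_subspace PW_subspace VW_subspace by (simp_all add: subspace_0)
  have fstV: "fst \<psi> \<in> V" if "\<psi> \<in> W" for \<psi> using subsetD[OF W_h_VW that] by (auto simp: VW_def V_h_def)
  assume "\<forall>y\<in>X. system (u, s, l, q) y = 0"
  then have eq: "\<rho>1 * J1 l \<phi> + \<rho>2 * K q \<psi> + coupling u s \<phi> \<psi> + (- (\<rho>3 * J2 s r) + coupling v r l q) = 0"
    if "v \<in> V" "r \<in> S" "\<phi> \<in> M" "\<psi> \<in> W" for v r \<phi> \<psi> using that by (auto simp: system_def)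
  have neg: "- u \<in> V" "- s \<in> S" using subspace_neg[OF V_h_subspace m(1)] subspace_neg[OF S_h_subspace m(2)] .
  have n: "coupling (- u) (- s) l q = - coupling u s l q" "J2 s (- s) = - J2 s s"
  proof -
    have c: "\<forall>T\<in>Th. u T \<in> vpoly_space k" "\<forall>T\<in>Th. (0 :: (real^3) pw) T \<in> vpoly_space k" "\<forall>T\<in>Th. fst q T \<in> vpoly_space k"
      using V_h_cell[OF m(1)] V_h_cell[OF z(1)] VW_cell[OF p(3)] by blast+
    show "coupling (- u) (- s) l q = - coupling u s l q"
      using div_form_lin_left[of 0 u, OF c(2,1) p(2), of "-1"] curl_form_lin_left[of 0 u, OF c(2,1) p(3), of "-1"]
        div_form_lin_right[of "fst q", OF c(3) Z(1) p(1), of "-1"]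
        forms_zero[OF m(1) p(2,3)] forms_zero[OF fstV[OF m(4)] p(2,3)]
      by (simp add: coupling_def)
    show "J2 s (- s) = - J2 s s"
      using jump_form_lin[OF p(1) p(1) p(1), of _ "-2"] scaleR_add_left[of 1 "-2" s] by simp
  qed
  have "\<rho>1 * J1 l l + \<rho>2 * K q q + \<rho>3 * J2 s s = 0" using eq[OF neg m(3,4)] by (simp add: n)
  moreover have nn: "0 \<le> J1 l l" "0 \<le> K q q" "0 \<le> J2 s s"
    by (rule jump_form_zero(1)[OF weights(1) p(2)] tangential_jump_form_zero(1)[OF weights(1) p(3)]
        jump_form_zero(1)[OF weights(2) p(1)]; assumption)+
  ultimately have "J1 l l = 0" "K q q = 0" "J2 s s = 0"
    using parameters mult_nonneg_nonneg[of \<rho>1 "J1 l l"] mult_nonneg_nonneg[of \<rho>2 "K q q"] mult_nonneg_nonneg[of \<rho>3 "J2 s s"]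
    by (simp_all add: add_nonneg_eq_0_iff)
  then have cl: "conforming l" and cq: "tangentially_conforming q" and cs: "conforming s"
    by (auto intro: jump_form_zero(2)[OF weights(1) p(2)] tangential_jump_form_zero(2)[OF weights(1) p(3)]
        jump_form_zero(2)[OF weights(2) p(1)])
  have eq': "coupling u s \<phi> \<psi> + coupling v r l q = 0"
    if "v \<in> V" "r \<in> S" "\<phi> \<in> M" "\<psi> \<in> W" for v r \<phi> \<psi>
    using eq[OF that] by (simp add: jump_form_conforming[OF cl] jump_form_conforming[OF cs] tangential_jump_form_conforming[OF cq])
  have c0: "coupling u s 0 0 = 0"
    using forms_zero[OF m(1) p(1,3)] by (simp add: coupling_def)
  \<comment> \<open>With the stabilisers gone, zero as test function separates the two
    equations.\<close>
  have e2: "coupling v r l q = 0" if "v \<in> V" "r \<in> S" for v r using eq'[OF that z(3,4)] c0 by simp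
  have e1: "coupling u s \<phi> \<psi> = 0" if "\<phi> \<in> M" "\<psi> \<in> W" for \<phi> \<psi> using eq'[OF m(1,2) that] e2[OF m(1,2)] by simp
  have lq: "div_form v l + curl_form v q = 0" if "v \<in> V" for v
    using e2[OF that z(2)] forms_zero(1)[OF fstV[OF m(4)] p(2,3)] by (simp add: coupling_def)
  have l0: "l = 0" and curl0: "\<And>T. T \<in> Th \<Longrightarrow> curl (fst q T) = (\<lambda>x. 0)"
    using multiplier_zero[OF m(3) cl m(4) cq lq] by auto
  have q0: "q = 0"
  proof (rule multiplier_field_zero[OF m(4) cq curl0])
    show "div_form (fst q) r = 0" if "r \<in> S" for r
      using e2[OF z(1) that] forms_zero(3,4)[OF m(1) p(2,3)] by (simp add: coupling_def)
  qed
  have s0: "s = 0"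
  proof (rule potential_zero[OF m(2) cs m(1)])
    show "curl_form u \<psi> + div_form (fst \<psi>) s = 0" if "\<psi> \<in> W" for \<psi>
      using e1[OF z(3) that] forms_zero(1)[OF m(1) p(2,3)] by (simp add: coupling_def)
  qed
  have "\<forall>\<phi>\<in>M. \<forall>\<psi>\<in>W. div_form u \<phi> + curl_form u \<psi> = 0"
    using e1 forms_zero(1)[OF fstV p(2,3)] by (simp add: coupling_def s0)
  then show "s = 0 \<and> l = 0 \<and> q = 0 \<and> broken_harmonic u"
    using s0 l0 q0 broken_harmonic_iff[OF m(1)] by simp
next
  have m: "u \<in> V" using x by auto
  assume h: "s = 0 \<and> l = 0 \<and> q = 0 \<and> broken_harmonic u"
  then have bh: "\<forall>\<phi>\<in>M. \<forall>\<psi>\<in>W. div_form u \<phi> + curl_form u \<psi> = 0" using broken_harmonic_iff[OF m] by simp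
  have c: "conforming 0" "tangentially_conforming 0" by (simp_all add: conforming_def tangentially_conforming_def)
  show "\<forall>y\<in>X. system (u, s, l, q) y = 0"
  proof
    fix y assume "y \<in> X"
    then obtain v r \<phi> \<psi> where y: "y = (v, r, \<phi>, \<psi>)" "v \<in> V" "r \<in> S" "\<phi> \<in> M" "\<psi> \<in> W" by (cases y) auto
    have P: "r \<in> PW k" "\<phi> \<in> PW k" "\<psi> \<in> VW k" "fst \<psi> \<in> V" using subsetD[OF S_h_PW y(3)] subsetD[OF M_h_PW y(4)] subsetD[OF W_h_VW y(5)]
      by (auto simp: VW_def V_h_def)
    have "coupling u 0 \<phi> \<psi> = 0" "coupling v r 0 0 = 0"
      using bh y(4,5) forms_zero[OF P(4) P(2,3)] forms_zero[OF y(2) P(1,3)] by (simp_all add: coupling_def)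
    then show "system (u, s, l, q) y = 0"
      using h y(1) by (simp add: system_def jump_form_conforming[OF c(1)] tangential_jump_form_conforming[OF c(2)])
  qed
qed

text \<open>The load sees only \<open>\<phi>\<close> and \<open>\<psi>\<close>, both of which vanish
  on the kernel, so it is compatible for all admissible data.\<close>

lemma solution_exists: "\<exists>x\<in>X. \<forall>y\<in>X. system x y = rhs y"
proof (rule symmetric_form_representation[OF X_subspace fin_span_X system_sym system_lin rhs_lin])
  fix y assume y: "y \<in> X" and z: "\<And>x. x \<in> X \<Longrightarrow> system x y = 0"
  obtain v r \<phi> \<psi> where e: "y = (v, r, \<phi>, \<psi>)" by (cases y)
  have "\<phi> = 0" "\<psi> = 0" using kernel_iff[of v r \<phi> \<psi>] y z system_sym unfolding e by (metis, metis)
  then show "rhs y = 0" by (simp add: e rhs_def F_load_def glue_def inner_L2_def)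
qed

text \<open>The solution set is a translate of the kernel, in which only the first component is
  free.\<close>

lemma solution_unique:
  assumes x: "(u, s, l, q) \<in> X" "\<forall>y\<in>X. system (u, s, l, q) y = rhs y"
  shows "(u', s', l', q') \<in> X \<and> (\<forall>y\<in>X. system (u', s', l', q') y = rhs y)
    \<longleftrightarrow> s' = s \<and> l' = l \<and> q' = q \<and> (\<exists>\<eta>\<in>V. broken_harmonic \<eta> \<and> u' = u + \<eta>)"
    (is "?L \<longleftrightarrow> ?R")
proof -
  define \<eta> where "\<eta> = u' - u"
  have diff: "system ((u', s', l', q') - (u, s, l, q)) y = system (u', s', l', q') y - system (u, s, l, q) y"
    if "(u', s', l', q') \<in> X" "y \<in> X" for y
    using lin_on_diff[OF system_lin[OF that(2)] that(1) x(1), of 1] by (simp add: system_sym[of y])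
  show ?thesis
  proof
    assume L: ?L
    have m: "(\<eta>, s' - s, l' - l, q' - q) \<in> X"
      using subspace_diff[OF X_subspace conjunct1[OF L] x(1)] by (simp add: \<eta>_def)
    have "\<forall>y\<in>X. system (\<eta>, s' - s, l' - l, q' - q) y = 0"
      using diff[OF conjunct1[OF L]] L x(2) by (simp add: \<eta>_def)
    then show ?R using kernel_iff[OF m] m by (auto simp: \<eta>_def intro!: bexI[of _ \<eta>])
  next
    assume R: ?R
    then obtain \<eta>' where e: "\<eta>' \<in> V" "broken_harmonic \<eta>'" "u' = u + \<eta>'" "s' = s" "l' = l" "q' = q" by blast
    have k: "(\<eta>', 0, 0, 0) \<in> X"
      using e(1) S_h_subspace M_h_subspace W_h_subspace by (simp add: subspace_0)
    have "(u', s', l', q') = (u, s, l, q) + (\<eta>', 0, 0, 0)" using e by simp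
    then have X': "(u', s', l', q') \<in> X" using subspace_add[OF X_subspace x(1) k] by simp
    have "(u', s', l', q') - (u, s, l, q) = (\<eta>', 0, 0, 0)" using e by (simp add: zero_prod_def)
    moreover have "\<forall>y\<in>X. system (\<eta>', 0, 0, 0) y = 0" using kernel_iff[OF k] e(2) by simp
    ultimately have "system (u', s', l', q') y - system (u, s, l, q) y = 0" if "y \<in> X" for y
      using diff[OF X' that] that by metis
    then have "system (u', s', l', q') y = rhs y" if "y \<in> X" for y
      using bspec[OF x(2) that] that by force
    then show ?L using X' by blast
  qed
qed

end

theorem theorem5p3:
  fixes \<Omega> :: "(real^3) set" and \<Gamma> :: "nat \<Rightarrow> (real^3) set" and L :: nat
    and \<epsilon> :: "real^3 \<Rightarrow> real^3^3"
    and Th Eh :: "(real^3) set set" and \<kappa> :: real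
    and k :: nat and \<rho>1 \<rho>2 \<rho>3 \<gamma> :: real
    and f :: "real^3 \<Rightarrow> real" and g :: "real^3 \<Rightarrow> real^3" and \<phi>1 :: "real^3 \<Rightarrow> real"
  assumes "polyhedral_domain \<Omega>"
    and "components (frontier \<Omega>) = \<Gamma> ` {0..L}" and "inj_on \<Gamma> {0..L}"
    and "frontier (outside \<Omega>) \<subseteq> \<Gamma> 0"
    and "polyhedral_partition \<Omega> Th Eh"
    and "\<kappa> > 0" and "shape_regular \<kappa> Th Eh"
    and "coefficient \<Omega> Th \<epsilon>"
    and "\<rho>1 > 0" and "\<rho>2 > 0" and "\<rho>3 > 0" and "\<gamma> \<ge> -1"
    and "F_well_defined \<Omega> Th Eh k f g \<phi>1"
  shows "\<exists>u s l q.
    pdwg_solution \<Omega> \<Gamma> L \<epsilon> Th Eh k \<rho>1 \<rho>2 \<rho>3 \<gamma> f g \<phi>1 u s l q \<and>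
    (\<forall>u' s' l' q'.
       pdwg_solution \<Omega> \<Gamma> L \<epsilon> Th Eh k \<rho>1 \<rho>2 \<rho>3 \<gamma> f g \<phi>1 u' s' l' q' \<longleftrightarrow>
       s' = s \<and> l' = l \<and> q' = q \<and>
       (\<exists>\<eta>\<in>V_h Th k. glue Th \<eta> \<in> normal_harmonic \<Omega> \<epsilon> \<and> u' = (\<lambda>T x. u T x + \<eta> T x)))"
proof -
  interpret pdwg_scheme \<Omega> Th Eh \<Gamma> L \<epsilon> k \<rho>1 \<rho>2 \<rho>3 \<gamma> f g \<phi>1
    using assms by unfold_locales auto
  obtain u s l q where x: "(u, s, l, q) \<in> X" "\<forall>y\<in>X. system (u, s, l, q) y = rhs y"
    using solution_exists by (metis prod_cases4)
  \<comment> \<open>Passes from the conditions on cells and faces to the distributional definition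
    of harmonic fields.\<close>
  have h: "(\<exists>\<eta>\<in>V. broken_harmonic \<eta> \<and> u' = u + \<eta>)
    \<longleftrightarrow> (\<exists>\<eta>\<in>V. glue Th \<eta> \<in> normal_harmonic \<Omega> \<epsilon> \<and> u' = (\<lambda>T x. u T x + \<eta> T x))" for u'
    using broken_harmonic_imp_normal_harmonic normal_harmonic_imp_broken_harmonic
    by (auto simp: plus_fun_def)
  have "pdwg_solution \<Omega> \<Gamma> L \<epsilon> Th Eh k \<rho>1 \<rho>2 \<rho>3 \<gamma> f g \<phi>1 u s l q" using x solution_iff by simp
  moreover have "pdwg_solution \<Omega> \<Gamma> L \<epsilon> Th Eh k \<rho>1 \<rho>2 \<rho>3 \<gamma> f g \<phi>1 u' s' l' q' \<longleftrightarrow>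
       s' = s \<and> l' = l \<and> q' = q \<and>
       (\<exists>\<eta>\<in>V. glue Th \<eta> \<in> normal_harmonic \<Omega> \<epsilon> \<and> u' = (\<lambda>T x. u T x + \<eta> T x))" for u' s' l' q'
    unfolding solution_iff solution_unique[OF x] h ..
  ultimately show ?thesis by blast
qed

end
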